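(* Let $q\in(0,1)$ and $t\in[0,1]$, and let $\lambda$ be a random partition of law $\mathbb{P}_{n,q,t}$, with conjugate partition $\lambda'$. Then, as $n\to\infty$, $$\lambda_i=n\,t(1-q)q^{i-1}+n^{1/2}X_i+o(n^{1/2}),\qquad \lambda'_j=n\,(1-t)(1-q)q^{j-1}+n^{1/2}Y_j+o(n^{1/2}),$$ in the sense that the variables $n^{-1/2}(\lambda_i-n\,t(1-q)q^{i-1})$ and $n^{-1/2}(\lambda'_j-n(1-t)(1-q)q^{j-1})$, $i,j\ge1$, converge jointly in law (finite-dimensional distributions) to $(X_i,Y_j)_{i\ge1,j\ge1}$, where $(X_i,Y_j)_{i,j\ge1}$ is a centered Gaussian vector with covariances $$\mathrm{Cov}(X_i,X_j)=\delta_{ij}\,t(1-q)q^{i-1}-t^2(1-q)^2q^{i+j-2},$$ $$\mathrm{Cov}(Y_i,Y_j)=\delta_{ij}\,(1-t)(1-q)q^{i-1}-(1-t)^2(1-q)^2q^{i+j-2},$$ $$\mathrm{Cov}(X_i,Y_j)=-t(1-t)(1-q)^2q^{i+j-2}.$$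
   Context: The $(q,t)$-Plancherel measure on partitions of $n$ is $\mathbb{P}_{n,q,t}=\mathbb{P}_{n,\omega_{q,t}}$, where $\omega_{q,t}=(\alpha,\beta)$ with $\alpha_i=t(1-q)q^{i-1}$, $\beta_i=(1-t)(1-q)q^{i-1}$ for $i\ge1$, and $\mathbb{P}_{n,\omega}[\lambda]=(\dim\lambda)\,s_\lambda(\omega)$. Here $\dim\lambda$ is the number of standard Young tableaux of shape $\lambda$ and $s_\lambda(\omega)$ is the image of the Schur function $s_\lambda$ under the algebra morphism from symmetric functions to $\mathbb{C}$ sending the power sums to $p_1(\omega)=1$ and $p_k(\omega)=\sum_i\alpha_i^k+(-1)^{k-1}\sum_i\beta_i^k$ for $k\ge2$; explicitly $p_k(\omega_{q,t})=\frac{(t^k-(t-1)^k)(1-q)^k}{1-q^k}$. *)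

theory Defs
  imports "HOL-Probability.Probability" "HOL-Library.Multiset"
begin

section \<open>Partitions and tableaux\<close>

text \<open>A partition is the list of its positive parts in weakly decreasing order. Rows, columns and
  all sequences below are indexed from 0: index \<open>i\<close> here is index \<open>i + 1\<close> in the usual notation
  \<open>\<lambda>\<^sub>1 \<ge> \<lambda>\<^sub>2 \<ge> \<dots>\<close>.\<close>

definition partitions_of :: "nat \<Rightarrow> nat list set" where
  "partitions_of n = {lam. sorted_wrt (\<ge>) lam \<and> 0 \<notin> set lam \<and> sum_list lam = n}"

definition row_part :: "nat list \<Rightarrow> nat \<Rightarrow> nat" where
  "row_part lam i = (if i < length lam then lam ! i else 0)"

definition conj_part :: "nat list \<Rightarrow> nat \<Rightarrow> nat" where
  "conj_part lam j = card {i. i < length lam \<and> j < lam ! i}"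

definition cells :: "nat list \<Rightarrow> (nat \<times> nat) set" where
  "cells lam = {(i, j). i < length lam \<and> j < lam ! i}"

definition standard_tableaux :: "nat list \<Rightarrow> (nat \<times> nat \<Rightarrow> nat) set" where
  "standard_tableaux lam =
     {T \<in> extensional (cells lam). bij_betw T (cells lam) {1..sum_list lam} \<and>
        (\<forall>i j j'. (i, j) \<in> cells lam \<and> (i, j') \<in> cells lam \<and> j < j' \<longrightarrow> T (i, j) < T (i, j')) \<and>
        (\<forall>i i' j. (i, j) \<in> cells lam \<and> (i', j) \<in> cells lam \<and> i < i' \<longrightarrow> T (i, j) < T (i', j))}"

definition dim_partition :: "nat list \<Rightarrow> nat" where
  "dim_partition lam = card (standard_tableaux lam)"

definition semistandard_tableaux :: "nat list \<Rightarrow> (nat \<times> nat \<Rightarrow> nat) set" where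
  "semistandard_tableaux lam =
     {T \<in> extensional (cells lam).
        (\<forall>i j j'. (i, j) \<in> cells lam \<and> (i, j') \<in> cells lam \<and> j < j' \<longrightarrow> T (i, j) \<le> T (i, j')) \<and>
        (\<forall>i i' j. (i, j) \<in> cells lam \<and> (i', j) \<in> cells lam \<and> i < i' \<longrightarrow> T (i, j) < T (i', j))}"


section \<open>Symmetric functions\<close>

text \<open>Formal power series over the complex numbers in the variables \<open>x\<^sub>0, x\<^sub>1, \<dots>\<close>. A monomial is the
  multiset of the indices of its variables, so that the product of monomials is the sum of
  multisets; a series maps each monomial to its coefficient.\<close>

type_synonym series = "nat multiset \<Rightarrow> complex"

definition series_one :: series where
  "series_one m = (if m = {#} then 1 else 0)"

definition series_mult :: "series \<Rightarrow> series \<Rightarrow> series" where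
  "series_mult f g m = (\<Sum>a | a \<subseteq># m. f a * g (m - a))"

definition symmetric_functions :: "series set" where
  "symmetric_functions =
     {f. (\<forall>\<pi> m. bij \<pi> \<longrightarrow> f (image_mset \<pi> m) = f m) \<and> (\<exists>d. \<forall>m. f m \<noteq> 0 \<longrightarrow> size m \<le> d)}"

definition power_sum :: "nat \<Rightarrow> series" where
  "power_sum k m = (if \<exists>i. m = replicate_mset k i then 1 else 0)"

definition schur :: "nat list \<Rightarrow> series" where
  "schur lam m =
     of_nat (card {T \<in> semistandard_tableaux lam. image_mset T (mset_set (cells lam)) = m})"

definition symfun_morphism :: "(series \<Rightarrow> complex) \<Rightarrow> bool" where
  "symfun_morphism \<phi> \<longleftrightarrow>
     \<phi> series_one = 1 \<and>
     (\<forall>f\<in>symmetric_functions. \<forall>g\<in>symmetric_functions.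
        \<phi> (\<lambda>m. f m + g m) = \<phi> f + \<phi> g \<and> \<phi> (series_mult f g) = \<phi> f * \<phi> g) \<and>
     (\<forall>f\<in>symmetric_functions. \<forall>c. \<phi> (\<lambda>m. c * f m) = c * \<phi> f)"

text \<open>The power sums \<open>p\<^sub>1, p\<^sub>2, \<dots>\<close> are algebraically independent generators of the algebra of
  symmetric functions, so there is exactly one such morphism; \<open>extensional\<close> only fixes its
  irrelevant values on series that are not symmetric functions.\<close>

definition specialization :: "(nat \<Rightarrow> complex) \<Rightarrow> series \<Rightarrow> complex" where
  "specialization p =
     (THE \<phi>. \<phi> \<in> extensional symmetric_functions \<and> symfun_morphism \<phi> \<and>
        (\<forall>k\<ge>1. \<phi> (power_sum k) = p k))"


section \<open>Central measures and the \<open>(q,t)\<close>-Plancherel measure\<close>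

definition thoma_power_sum :: "(nat \<Rightarrow> real) \<Rightarrow> (nat \<Rightarrow> real) \<Rightarrow> nat \<Rightarrow> real" where
  "thoma_power_sum \<alpha> \<beta> k =
     (if k = 1 then 1 else (\<Sum>i. \<alpha> i ^ k) + (- 1) ^ (k - 1) * (\<Sum>i. \<beta> i ^ k))"

definition schur_at :: "(nat \<Rightarrow> real) \<Rightarrow> (nat \<Rightarrow> real) \<Rightarrow> nat list \<Rightarrow> complex" where
  "schur_at \<alpha> \<beta> lam = specialization (\<lambda>k. of_real (thoma_power_sum \<alpha> \<beta> k)) (schur lam)"

definition central_weight :: "(nat \<Rightarrow> real) \<Rightarrow> (nat \<Rightarrow> real) \<Rightarrow> nat list \<Rightarrow> complex" where
  "central_weight \<alpha> \<beta> lam = of_nat (dim_partition lam) * schur_at \<alpha> \<beta> lam"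

definition alpha_qt :: "real \<Rightarrow> real \<Rightarrow> nat \<Rightarrow> real" where
  "alpha_qt q t i = t * (1 - q) * q ^ i"

definition beta_qt :: "real \<Rightarrow> real \<Rightarrow> nat \<Rightarrow> real" where
  "beta_qt q t i = (1 - t) * (1 - q) * q ^ i"

lemma thoma_power_sum_qt:
  assumes q: "0 < q" "q < 1" and k: "k \<ge> 1"
  shows "thoma_power_sum (alpha_qt q t) (beta_qt q t) k =
    (t ^ k - (t - 1) ^ k) * (1 - q) ^ k / (1 - q ^ k)"
proof (cases "k = 1")
  case True
  then show ?thesis using q by (simp add: thoma_power_sum_def)
next
  case False
  have qk: "norm (q ^ k) < 1" using q k by (simp add: power_less_one_iff abs_if)
  have geo: "(\<Sum>i. (c * (1 - q) * q ^ i) ^ k) = c ^ k * (1 - q) ^ k / (1 - q ^ k)" for c :: real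
  proof -
    have "(\<Sum>i. (c * (1 - q) * q ^ i) ^ k) = (\<Sum>i. (c ^ k * (1 - q) ^ k) * (q ^ k) ^ i)"
      by (simp add: power_mult_distrib mult.commute flip: power_mult)
    also have "\<dots> = (c ^ k * (1 - q) ^ k) * (\<Sum>i. (q ^ k) ^ i)"
      by (rule suminf_mult) (rule summable_geometric[OF qk])
    finally show ?thesis by (simp add: suminf_geometric[OF qk])
  qed
  have "(- 1) ^ (k - 1) * (1 - t) ^ k = - ((- 1) ^ k * (1 - t) ^ k)"
    using k by (cases k) auto
  also have "(- 1) ^ k * (1 - t) ^ k = (t - 1) ^ k"
    by (simp flip: power_mult_distrib)
  finally have sgn: "(- 1) ^ (k - 1) * (1 - t) ^ k = - ((t - 1) ^ k)" .
  have "thoma_power_sum (alpha_qt q t) (beta_qt q t) k =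
      t ^ k * (1 - q) ^ k / (1 - q ^ k)
      + ((- 1) ^ (k - 1) * (1 - t) ^ k) * (1 - q) ^ k / (1 - q ^ k)"
    using False by (simp add: thoma_power_sum_def alpha_qt_def beta_qt_def geo)
  then show ?thesis unfolding sgn by (simp add: diff_divide_distrib left_diff_distrib)
qed

text \<open>\<open>L\<close> is a random partition of \<open>n\<close> on the probability space \<open>M\<close> whose law is
  the \<open>(q,t)\<close>-Plancherel measure.\<close>

definition qt_plancherel_random :: "real \<Rightarrow> real \<Rightarrow> nat \<Rightarrow> 'a measure \<Rightarrow> ('a \<Rightarrow> nat list) \<Rightarrow> bool" where
  "qt_plancherel_random q t n M L \<longleftrightarrow>
     prob_space M \<and> L \<in> measurable M (count_space (partitions_of n)) \<and>
     (\<forall>lam\<in>partitions_of n.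
        complex_of_real (measure M {\<omega> \<in> space M. L \<omega> = lam})
          = central_weight (alpha_qt q t) (beta_qt q t) lam)"


section \<open>Gaussian families and convergence in law\<close>

text \<open>Degenerate (almost surely constant) variables count as Gaussian; they occur
  as limits when \<open>t = 0\<close> or \<open>t = 1\<close>.\<close>

definition gaussian_variable :: "'b measure \<Rightarrow> ('b \<Rightarrow> real) \<Rightarrow> bool" where
  "gaussian_variable N X \<longleftrightarrow>
     X \<in> borel_measurable N \<and>
     ((\<exists>\<mu>. AE \<omega> in N. X \<omega> = \<mu>) \<or>
      (\<exists>\<mu> \<sigma>. \<sigma> > 0 \<and> distributed N lborel X (\<lambda>x. ennreal (normal_density \<mu> \<sigma> x))))"

definition gaussian_family :: "'b measure \<Rightarrow> ('k \<Rightarrow> 'b \<Rightarrow> real) \<Rightarrow> bool" where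
  "gaussian_family N Z \<longleftrightarrow>
     (\<forall>K c. finite K \<longrightarrow> gaussian_variable N (\<lambda>\<omega>. \<Sum>k\<in>K. c k * Z k \<omega>))"

definition mean :: "'b measure \<Rightarrow> ('b \<Rightarrow> real) \<Rightarrow> real" where
  "mean N X = (\<integral>\<omega>. X \<omega> \<partial>N)"

definition covariance :: "'b measure \<Rightarrow> ('b \<Rightarrow> real) \<Rightarrow> ('b \<Rightarrow> real) \<Rightarrow> real" where
  "covariance N X Y = (\<integral>\<omega>. (X \<omega> - mean N X) * (Y \<omega> - mean N Y) \<partial>N)"

text \<open>Convergence in law of all finite-dimensional marginals: for every finite \<open>K\<close>, the expectations
  of every bounded continuous function on \<open>\<real>\<^sup>K\<close> (functions on \<open>K\<close> with the product topology)
  converge.\<close>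

definition converges_in_law_fdd ::
  "(nat \<Rightarrow> 'a measure) \<Rightarrow> (nat \<Rightarrow> 'k \<Rightarrow> 'a \<Rightarrow> real) \<Rightarrow> 'b measure \<Rightarrow> ('k \<Rightarrow> 'b \<Rightarrow> real) \<Rightarrow> bool"
where
  "converges_in_law_fdd M Z N W \<longleftrightarrow>
     (\<forall>K f. finite K \<and>
        continuous_map (product_topology (\<lambda>_. euclideanreal) K) euclideanreal f \<and>
        bounded (f ` (\<Pi>\<^sub>E k\<in>K. UNIV)) \<longrightarrow>
        (\<lambda>n. \<integral>\<omega>. f (\<lambda>k\<in>K. Z n k \<omega>) \<partial>M n) \<longlonglongrightarrow> (\<integral>\<omega>. f (\<lambda>k\<in>K. W k \<omega>) \<partial>N))"

end

theory Submission
  imports Defs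
begin

text \<open>
  A partition of \<open>n\<close> under the \<open>(q,t)\<close>-Plancherel measure behaves like the sorted list of counts of
  \<open>n\<close> independent random letters. The letters have two signs; the \<open>i\<close>-th positive letter has probability
  \<open>alpha_qt q t i\<close> and the \<open>j\<close>-th negative letter has probability \<open>beta_qt q t j\<close>. Up to an error that is
  bounded in expectation, row \<open>i\<close> has as many cells as the word has copies of the \<open>i\<close>-th positive letter, and
  column \<open>j\<close> as many cells as the word has copies of the \<open>j\<close>-th negative letter. The counts are multinomial,
  and the covariance matrix of the theorem is that of the multinomial central limit theorem. No insertion
  algorithm is needed to see this: the comparison follows from branching and Pieri rules alone.

  \<^bold>\<open>Values of Schur functions.\<close> Adjoining a letter \<open>x\<close> of positive sign to a specialization replaces the
  values \<open>s\<close> of the Schur functions by \<open>add_pos x s\<close>, a sum over horizontal strips; a negative letter acts by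
  \<open>add_neg y s\<close>, the same sum over vertical strips. The first operator comes from extracting one variable
  from a symmetric series (\<open>adjoin_schurf\<close>, which rests on the symmetry of the Schur function), and the second
  one is the inverse of the first at \<open>- y\<close> (\<open>add_neg_add_pos_inverse\<close>). Since power sums generate the symmetric
  functions (\<open>Sym_induct\<close>), a specialization is determined by them, and pointwise limits of specializations are
  specializations; this identifies the one defined by infinitely many letters (\<open>specializes_limit\<close>).

  \<^bold>\<open>Random letters.\<close> The operator \<open>up_strip 1\<close> that adds a box commutes with \<open>add_pos x\<close> up to the
  extra term \<open>x * add_pos x\<close> (\<open>up_strip_add_pos\<close>), and likewise with \<open>add_neg\<close>. Hence the sum of \<open>dim \<lambda> * s \<lambda>\<close> over the partitions of \<open>n\<close> is
  the \<open>n\<close>-th power of the total weight of the letters (\<open>dim_sum_harmonic\<close>). Applied to letters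
  multiplied by phases \<open>cis \<theta>\<close>, this is the characteristic function of the letter counts.

  \<^bold>\<open>Rows are counts.\<close> Let \<open>x\<close> be the largest positive letter and let \<open>s\<close> be the Schur values of all others. The
  value \<open>add_pos x s \<lambda>\<close> is a sum over \<open>\<mu>\<close> interlacing with \<open>\<lambda>\<close>, and the number of letters \<open>x\<close> falls short of the
  first row exactly by \<open>k = |\<mu>| - |\<lambda> without its first row|\<close>. The Pieri rule bounds the total mass of the
  \<open>\<mu>\<close> with given \<open>k\<close> by the complete homogeneous value \<open>h\<^sub>k\<close> at the smaller letters times \<open>x ^ - k\<close>, which
  decays geometrically (\<open>pieri_bound\<close>, \<open>first_row_defect\<close>). So row one agrees with its letter up
  to a bounded mean error for each single \<open>\<lambda>\<close>, and \<open>\<mu>\<close> differs from the remaining rows by at most \<open>k\<close> while no column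
  changes by more than one. Peeling off one letter after another, then conjugating for the negative letters,
  gives \<open>characteristic_estimate\<close>. Letters with strictly decreasing weights are essential here, and they
  are available when \<open>0 < t < 1\<close>. If \<open>t = 0\<close> all positive letters vanish; then the first row has at most
  \<open>b\<close> cells unless a letter beyond the \<open>b\<close>-th one occurs, which is rare already for slowly growing \<open>b\<close>
  (\<open>few_cols\<close>). The case \<open>t = 1\<close> is symmetric.

  \<^bold>\<open>Convergence in law.\<close> Characteristic functions in several variables are reduced to the one-dimensional
  continuity theorem by tilting the measure with a bounded factor, one coordinate at a time; the
  Stone--Weierstrass theorem then passes from products to all bounded continuous functions
  (\<open>converges_in_law_fddI\<close>). The limit is realized by finite linear combinations of
  independent normal variables, as for the increments of a Brownian bridge (\<open>gaussian_exists\<close>).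
\<close>

section \<open>Partitions, conjugation and strips\<close>

type_synonym shape = "nat \<Rightarrow> nat"

text \<open>A partition is a function of the row index: its number of parts needs no bookkeeping, and strips and
  conjugation become pointwise inequalities.\<close>
definition is_part :: "shape \<Rightarrow> bool" where
  "is_part p \<longleftrightarrow> antimono p \<and> (\<exists>N. \<forall>i\<ge>N. p i = 0)"

definition cellset :: "shape \<Rightarrow> (nat \<times> nat) set" where
  "cellset p = {(i, j). j < p i}"

definition part_size :: "shape \<Rightarrow> nat" where
  "part_size p = card (cellset p)"

definition conjugate :: "shape \<Rightarrow> nat \<Rightarrow> nat" where
  "conjugate p j = card {i. j < p i}"

text \<open>The pair is interlacing, that is, the difference is a horizontal strip. The condition forces either argument to be
  a partition as soon as the other one is (\<open>hstrip_part_lower\<close>, \<open>hstrip_part_upper\<close>).\<close>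
definition hstrip :: "shape \<Rightarrow> shape \<Rightarrow> bool" where
  "hstrip la mu \<longleftrightarrow> (\<forall>i. la (Suc i) \<le> mu i \<and> mu i \<le> la i)"

lemma nat_le_if: "(\<And>k. k < a \<Longrightarrow> k < b) \<Longrightarrow> a \<le> (b::nat)"
  by (meson less_irrefl linorder_not_less)

lemma nat_less_iff_eqI: "(\<And>k. k < a \<longleftrightarrow> k < b) \<Longrightarrow> a = (b::nat)"
  by (meson less_irrefl linorder_neqE_nat)

lemma is_partI: "(\<And>i. p (Suc i) \<le> p i) \<Longrightarrow> (\<And>i. i \<ge> N \<Longrightarrow> p i = 0) \<Longrightarrow> is_part p"
  unfolding is_part_def by (auto simp: antimono_iff_le_Suc)

lemma is_part_Suc: "is_part p \<Longrightarrow> p (Suc i) \<le> p i"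
  unfolding is_part_def by (auto simp: antimono_iff_le_Suc)

lemma is_part_antimono: "is_part p \<Longrightarrow> i \<le> j \<Longrightarrow> p j \<le> p i"
  unfolding is_part_def antimono_def by auto

lemma is_part_bound: "is_part p \<Longrightarrow> \<exists>N. \<forall>i\<ge>N. p i = 0"
  unfolding is_part_def by auto

lemma is_part_0 [simp]: "is_part (\<lambda>_. 0)"
  by (rule is_partI[where N=0]) auto

lemma cellset_eq: assumes "\<And>i. i \<ge> N \<Longrightarrow> p i = 0"
  shows "cellset p = Sigma {..<N} (\<lambda>i. {..<p i})"
proof -
  have "i < N" if "j < p i" for i j using assms[of i] that by (cases "i < N") auto
  then show ?thesis unfolding cellset_def by auto
qed

lemma finite_cellset: "is_part p \<Longrightarrow> finite (cellset p)"
  using is_part_bound[of p] cellset_eq[of _ p] by fastforce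

lemma part_size_eq: assumes "\<And>i. i \<ge> N \<Longrightarrow> p i = 0" shows "part_size p = (\<Sum>i<N. p i)"
  unfolding part_size_def by (subst cellset_eq[OF assms]) (auto simp: card_SigmaI)

lemma part_size_0 [simp]: "part_size (\<lambda>_. 0) = 0"
  using part_size_eq[of 0 "\<lambda>_. 0"] by simp

lemma common_bound: assumes "is_part p" "is_part q"
  obtains N where "N > 0" "\<And>i. i \<ge> N \<Longrightarrow> p i = 0" "\<And>i. i \<ge> N \<Longrightarrow> q i = 0"
proof -
  obtain a where a: "\<And>i. i \<ge> a \<Longrightarrow> p i = 0" using is_part_bound[OF assms(1)] by auto
  obtain b where b: "\<And>i. i \<ge> b \<Longrightarrow> q i = 0" using is_part_bound[OF assms(2)] by auto
  show thesis by (rule that[of "max (Suc a) b"]) (use a b in auto)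
qed

lemma part_size_mono: assumes "is_part p" "\<And>i. q i \<le> p i" shows "part_size q \<le> part_size p"
proof -
  have "cellset q \<subseteq> cellset p" unfolding cellset_def using assms(2) by (auto intro: less_le_trans)
  then show ?thesis unfolding part_size_def by (intro card_mono finite_cellset assms)
qed

lemma part_size_mono_eq: assumes "is_part p" "\<And>i. q i \<le> p i" "part_size q = part_size p" shows "q = p"
proof -
  have s: "cellset q \<subseteq> cellset p" unfolding cellset_def using assms(2) by (auto intro: less_le_trans)
  have c: "cellset q = cellset p"
    using card_subset_eq[OF finite_cellset[OF assms(1)] s] assms(3) unfolding part_size_def by simp
  have "\<And>i. {j. j < q i} = {j. j < p i}" using c unfolding cellset_def by (auto simp: set_eq_iff)
  then show ?thesis by (intro ext nat_less_iff_eqI) (auto simp: set_eq_iff)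
qed

lemma part_size_eq_0: "is_part p \<Longrightarrow> part_size p = 0 \<longleftrightarrow> p = (\<lambda>_. 0)"
  using part_size_mono_eq[of p "\<lambda>_. 0"] by auto

lemma le_part_size: assumes "is_part p" shows "p i \<le> part_size p"
proof -
  have "card (Pair i ` {..<p i}) \<le> card (cellset p)"
    by (rule card_mono[OF finite_cellset[OF assms(1)]]) (auto simp: cellset_def)
  then show ?thesis by (simp add: part_size_def card_image inj_on_def)
qed

lemma add_pos_letters_le_part_size: assumes "is_part p" "i \<ge> part_size p" shows "p i = 0"
proof (rule ccontr)
  assume "p i \<noteq> 0"
  then have *: "\<And>k. k \<le> i \<Longrightarrow> 0 < p k" using is_part_antimono[OF assms(1)] by (metis gr0I le_zero_eq)
  have "card ((\<lambda>k. (k, 0::nat)) ` {..i}) \<le> card (cellset p)"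
    by (rule card_mono[OF finite_cellset[OF assms(1)]]) (auto simp: cellset_def *)
  then show False using assms(2) by (simp add: part_size_def card_image inj_on_def)
qed

lemma finite_parts: "finite {p. is_part p \<and> part_size p \<le> n}"
proof (rule finite_subset)
  show "{p. is_part p \<and> part_size p \<le> n} \<subseteq> {p. \<forall>i. (i \<in> {..<n} \<longrightarrow> p i \<in> {..n}) \<and> (i \<notin> {..<n} \<longrightarrow> p i = 0)}"
  proof
    fix p assume "p \<in> {p. is_part p \<and> part_size p \<le> n}"
    then have "is_part p" "part_size p \<le> n" by auto
    then have "p i \<le> n" "\<not> i < n \<Longrightarrow> p i = 0" for i
      using le_part_size[of p i] add_pos_letters_le_part_size[of p i] by auto
    then show "p \<in> {p. \<forall>i. (i \<in> {..<n} \<longrightarrow> p i \<in> {..n}) \<and> (i \<notin> {..<n} \<longrightarrow> p i = 0)}" by simp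
  qed
qed (rule finite_set_of_finite_funs; simp)

lemma set_less_conjugate: assumes "is_part p" shows "{i. j < p i} = {..<conjugate p j}"
proof -
  obtain N where N: "\<And>i. i \<ge> N \<Longrightarrow> p i = 0" using is_part_bound[OF assms] by auto
  have sub: "{i. j < p i} \<subseteq> {..<N}" using N by (auto simp: not_le[symmetric])
  then have fin: "finite {i. j < p i}" by (rule finite_subset) simp
  have down: "k \<in> {i. j < p i}" if "i \<in> {i. j < p i}" "k \<le> i" for i k
    using that is_part_antimono[OF assms that(2)] by auto
  have eq: "\<exists>m. {i. j < p i} = {..<m}"
  proof (cases "{i. j < p i} = {}")
    case False
    have "{i. j < p i} = {..Max {i. j < p i}}"
      using Max_in[OF fin False] Max_ge[OF fin] down by blast
    then show ?thesis by (metis lessThan_Suc_atMost)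
  qed auto
  then obtain m where m: "{i. j < p i} = {..<m}" by blast
  then have "conjugate p j = m" unfolding conjugate_def by simp
  with m show ?thesis by simp
qed

text \<open>All facts about conjugation follow from this adjunction, since a natural number is determined by the
  numbers below it.\<close>
lemma less_conjugate_iff: assumes "is_part p" shows "i < conjugate p j \<longleftrightarrow> j < p i"
  using set_less_conjugate[OF assms, of j] by auto

lemma conjugate_is_part: assumes "is_part p" shows "is_part (conjugate p)"
proof (rule is_partI)
  fix j show "conjugate p (Suc j) \<le> conjugate p j"
  proof (rule nat_le_if)
    fix k assume "k < conjugate p (Suc j)"
    then show "k < conjugate p j" using less_conjugate_iff[OF assms] by (simp add: Suc_lessD)
  qed
  fix j assume "j \<ge> p 0"
  then show "conjugate p j = 0" using less_conjugate_iff[OF assms, of 0 j] by auto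
qed

lemma conjugate_conjugate: assumes "is_part p" shows "conjugate (conjugate p) = p"
proof
  fix i show "conjugate (conjugate p) i = p i"
    by (rule nat_less_iff_eqI) (simp add: less_conjugate_iff conjugate_is_part assms)
qed

lemma part_size_conjugate: assumes "is_part p" shows "part_size (conjugate p) = part_size p"
proof -
  have "cellset (conjugate p) = prod.swap ` cellset p"
    unfolding cellset_def by (auto simp: less_conjugate_iff[OF assms] image_iff)
  then show ?thesis unfolding part_size_def by (simp add: card_image)
qed

lemma hstripD: "hstrip la mu \<Longrightarrow> la (Suc i) \<le> mu i" "hstrip la mu \<Longrightarrow> mu i \<le> la i"
  unfolding hstrip_def by auto

lemma hstrip_part_lower: assumes "hstrip la mu" "is_part la" shows "is_part mu"
proof -
  obtain N where N: "\<And>i. i \<ge> N \<Longrightarrow> la i = 0" using is_part_bound[OF assms(2)] by auto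
  show ?thesis
  proof (rule is_partI)
    show "mu (Suc i) \<le> mu i" for i using hstripD[OF assms(1), of i] hstripD[OF assms(1), of "Suc i"] by simp
    show "mu i = 0" if "i \<ge> N" for i using hstripD(2)[OF assms(1), of i] N[OF that] by simp
  qed
qed

lemma hstrip_part_upper: assumes "hstrip la mu" "is_part mu" shows "is_part la"
proof -
  obtain N where N: "\<And>i. i \<ge> N \<Longrightarrow> mu i = 0" using is_part_bound[OF assms(2)] by auto
  show ?thesis
  proof (rule is_partI)
    show "la (Suc i) \<le> la i" for i using hstripD[OF assms(1), of i] by simp
    show "la i = 0" if "i \<ge> Suc N" for i
      using hstripD(1)[OF assms(1), of "i - 1"] N[of "i - 1"] that by simp
  qed
qed

lemma hstrip_part_size: "hstrip la mu \<Longrightarrow> is_part la \<Longrightarrow> part_size mu \<le> part_size la"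
  by (rule part_size_mono) (auto dest: hstripD)

lemma finite_hstrip: assumes "is_part la" shows "finite {mu. hstrip la mu}"
  by (rule finite_subset[OF _ finite_parts[of "part_size la"]])
     (auto simp: hstrip_part_lower[OF _ assms] hstrip_part_size[OF _ assms])

lemma finite_hstrip_upper: assumes "is_part nu" shows "finite {mu. hstrip mu nu \<and> part_size mu = n}"
  by (rule finite_subset[OF _ finite_parts[of n]]) (auto simp: hstrip_part_upper[OF _ assms])

lemma hstrip_refl: "is_part la \<Longrightarrow> hstrip la la"
  unfolding hstrip_def by (auto simp: is_part_Suc)

lemma hstrip_shift: "is_part la \<Longrightarrow> hstrip la (\<lambda>i. la (Suc i))"
  unfolding hstrip_def by (auto simp: is_part_Suc)

lemma hstrip_0_iff: "hstrip (\<lambda>_. 0) mu \<longleftrightarrow> mu = (\<lambda>_. 0)"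
  unfolding hstrip_def by (auto simp: fun_eq_iff)

text \<open>Vertical strips. Unlike interlacing, the pointwise inequalities do not make the smaller function a partition, so
  this is required.\<close>
definition vstrip :: "shape \<Rightarrow> shape \<Rightarrow> bool" where
  "vstrip la mu \<longleftrightarrow> is_part mu \<and> (\<forall>i. mu i \<le> la i \<and> la i \<le> Suc (mu i))"

text \<open>Both conditions are translated by the adjunction \<open>less_conjugate_iff\<close>; the shift by one row in the definition of
  interlacing becomes the slack of one column.\<close>
lemma hstrip_conjugate_iff: assumes "is_part la" "is_part mu" shows "hstrip (conjugate la) (conjugate mu) \<longleftrightarrow> vstrip la mu"
proof -
  note c = less_conjugate_iff[OF assms(1)] less_conjugate_iff[OF assms(2)]
  have le_iff: "(a::nat) \<le> b \<longleftrightarrow> (\<forall>k. k < a \<longrightarrow> k < b)" for a b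
    by (meson less_le_trans linorder_not_less less_irrefl)
  have "(\<forall>j. conjugate mu j \<le> conjugate la j) \<longleftrightarrow> (\<forall>i. mu i \<le> la i)"
    unfolding le_iff c by blast
  moreover have "(\<forall>j. conjugate la (Suc j) \<le> conjugate mu j) \<longleftrightarrow> (\<forall>i. la i \<le> Suc (mu i))"
  proof -
    have "(\<forall>j. conjugate la (Suc j) \<le> conjugate mu j) \<longleftrightarrow> (\<forall>i j. Suc j < la i \<longrightarrow> j < mu i)"
      unfolding le_iff c by blast
    also have "\<dots> \<longleftrightarrow> (\<forall>i. la i \<le> Suc (mu i))"
    proof -
      have "(\<forall>j. Suc j < l \<longrightarrow> j < m) \<longleftrightarrow> l \<le> Suc m" for l m :: nat
      proof
        assume *: "\<forall>j. Suc j < l \<longrightarrow> j < m"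
        show "l \<le> Suc m"
        proof (rule ccontr)
          assume "\<not> l \<le> Suc m"
          then have "Suc m < l" by simp
          then show False using * by blast
        qed
      qed auto
      then show ?thesis by simp
    qed
    finally show ?thesis .
  qed
  ultimately show ?thesis unfolding hstrip_def vstrip_def using assms by blast
qed

lemma hstrip_conjugate_iff': assumes "is_part la" "is_part mu" shows "hstrip la mu \<longleftrightarrow> vstrip (conjugate la) (conjugate mu)"
  using hstrip_conjugate_iff[OF conjugate_is_part[OF assms(1)] conjugate_is_part[OF assms(2)]] by (simp add: conjugate_conjugate assms)

lemma hstrip_conjugate_bounds: assumes "is_part la" "hstrip la mu"
  shows "conjugate mu j \<le> conjugate la j" "conjugate la j \<le> Suc (conjugate mu j)"
  using hstrip_conjugate_iff'[OF assms(1) hstrip_part_lower[OF assms(2,1)]] assms(2) unfolding vstrip_def by auto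

section \<open>Transfer operators on functions of partitions\<close>

text \<open>If \<open>s\<close> lists the values of the Schur functions at a specialization, then \<open>add_pos x s\<close> lists them after the
  letter \<open>x\<close> has been adjoined, by the branching rule.\<close>
definition add_pos :: "'a::real_normed_field \<Rightarrow> (shape \<Rightarrow> 'a) \<Rightarrow> shape \<Rightarrow> 'a" where
  "add_pos x s la = (\<Sum>mu | hstrip la mu. x ^ (part_size la - part_size mu) * s mu)"

text \<open>The same for a letter of negative sign, which fills vertical strips; it is \<open>add_pos\<close> conjugated by transposition.\<close>
definition add_neg :: "'a::real_normed_field \<Rightarrow> (shape \<Rightarrow> 'a) \<Rightarrow> shape \<Rightarrow> 'a" where
  "add_neg y s la = add_pos y (\<lambda>p. s (conjugate p)) (conjugate la)"

text \<open>On Schur values this is multiplication by the complete homogeneous function \<open>h\<^sub>k\<close>, by the Pieri rule; the case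
  \<open>k = 1\<close> adds one box.\<close>
definition up_strip :: "nat \<Rightarrow> (shape \<Rightarrow> 'a::real_normed_field) \<Rightarrow> shape \<Rightarrow> 'a" where
  "up_strip k s nu = (\<Sum>mu | hstrip mu nu \<and> part_size mu = part_size nu + k. s mu)"

definition down_strip :: "nat \<Rightarrow> (shape \<Rightarrow> 'a::comm_monoid_add) \<Rightarrow> shape \<Rightarrow> 'a" where
  "down_strip k g la = (\<Sum>mu | hstrip la mu \<and> part_size la = part_size mu + k. g mu)"

lemma add_pos_cong: "(\<And>p. is_part p \<Longrightarrow> s p = t p) \<Longrightarrow> is_part la \<Longrightarrow> add_pos x s la = add_pos x t la"
  unfolding add_pos_def by (intro sum.cong) (auto dest: hstrip_part_lower)

lemma add_neg_cong: "(\<And>p. is_part p \<Longrightarrow> s p = t p) \<Longrightarrow> is_part la \<Longrightarrow> add_neg x s la = add_neg x t la"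
  unfolding add_neg_def by (intro add_pos_cong conjugate_is_part) (auto intro: conjugate_is_part)

lemma up_strip_cong: "(\<And>p. is_part p \<Longrightarrow> s p = t p) \<Longrightarrow> is_part la \<Longrightarrow> up_strip k s la = up_strip k t la"
  unfolding up_strip_def by (intro sum.cong) (auto dest: hstrip_part_upper)

lemma add_pos_sum: "add_pos x (\<lambda>p. \<Sum>i\<in>I. c i * s i p) la = (\<Sum>i\<in>I. c i * add_pos x (s i) la)"
  unfolding add_pos_def sum_distrib_left by (subst sum.swap) (simp add: ac_simps)

lemma add_pos_lin: "add_pos x (\<lambda>p. a * s p + b * t p) la = a * add_pos x s la + b * add_pos x t la"
  unfolding add_pos_def by (simp add: sum_distrib_left sum.distrib algebra_simps)

lemma add_neg_lin: "add_neg x (\<lambda>p. a * s p + b * t p) la = a * add_neg x s la + b * add_neg x t la"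
  unfolding add_neg_def by (rule add_pos_lin)

lemma up_strip_0: assumes "is_part nu" shows "up_strip 0 s nu = s nu"
proof -
  have "mu = nu" if "hstrip mu nu" "part_size mu = part_size nu" for mu
    using part_size_mono_eq[OF hstrip_part_upper[OF that(1) assms], of nu] hstripD(2)[OF that(1)] that(2) by auto
  then have "{mu. hstrip mu nu \<and> part_size mu = part_size nu + 0} = {nu}"
    by (auto simp: hstrip_refl assms)
  then show ?thesis unfolding up_strip_def by simp
qed

lemma part_size_split: assumes "\<And>i. i \<ge> Suc N \<Longrightarrow> p i = 0" shows "part_size p = p 0 + (\<Sum>j<N. p (Suc j))"
  using part_size_eq[of "Suc N" p] assms by (simp only: sum.lessThan_Suc_shift)

lemma cauchy_size:
  assumes nu: "is_part nu" and ka: "is_part ka"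
    and h: "hstrip mu nu" "hstrip nu rho"
    and r: "mu 0 = i + max (nu 0) (ka 0)"
      "\<And>j. mu (Suc j) + rho j = max (nu (Suc j)) (ka (Suc j)) + min (nu j) (ka j)"
  shows "part_size mu + part_size rho = i + part_size nu + part_size ka"
proof -
  obtain N where N: "N > 0" "\<And>i. i \<ge> N \<Longrightarrow> nu i = 0" "\<And>i. i \<ge> N \<Longrightarrow> ka i = 0"
    using common_bound[OF nu ka] by blast
  have mu0: "mu i = 0" if "i \<ge> Suc N" for i
    using hstripD(1)[OF h(1), of "i - 1"] N(2)[of "i - 1"] that by simp
  have rho0: "rho i = 0" if "i \<ge> N" for i using hstripD(2)[OF h(2), of i] N(2)[OF that] by simp
  have "part_size mu + part_size rho = mu 0 + (\<Sum>j<N. mu (Suc j) + rho j)"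
    using part_size_split[of N mu] mu0 part_size_eq[of N rho] rho0 by (simp add: sum.distrib)
  also have "\<dots> = i + (max (nu 0) (ka 0) + (\<Sum>j<N. max (nu (Suc j)) (ka (Suc j)))) + (\<Sum>j<N. min (nu j) (ka j))"
    unfolding r by (simp add: sum.distrib)
  also have "max (nu 0) (ka 0) + (\<Sum>j<N. max (nu (Suc j)) (ka (Suc j))) = (\<Sum>j<Suc N. max (nu j) (ka j))"
    by (rule sum.lessThan_Suc_shift[symmetric])
  also have "\<dots> = (\<Sum>j<N. max (nu j) (ka j))" using N by simp
  also have "i + (\<Sum>j<N. max (nu j) (ka j)) + (\<Sum>j<N. min (nu j) (ka j)) = i + (\<Sum>j<N. nu j + ka j)"
    by (simp add: sum.distrib[symmetric] max_def min_def add.assoc) (rule sum.cong; auto)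
  also have "\<dots> = i + part_size nu + part_size ka"
    using part_size_eq[of N nu] N(2) part_size_eq[of N ka] N(3) by (simp add: sum.distrib)
  finally show ?thesis .
qed

text \<open>The two maps below are mutually inverse bijections behind the commutation of \<open>up_strip\<close> and \<open>add_pos\<close>. Given \<open>\<nu>\<close> and
  \<open>\<kappa>\<close>, a common upper neighbour \<open>\<mu>\<close> has row \<open>j + 1\<close> confined to an interval with ends
  \<open>max (\<nu> (j + 1)) (\<kappa> (j + 1))\<close> and \<open>min (\<nu> j) (\<kappa> j)\<close>; row \<open>j\<close> of a common lower neighbour is confined to the
  same interval. Reflecting the interval matches the two, and the free first row of \<open>\<mu>\<close> becomes the extra number \<open>i\<close>.\<close>
definition cauchy_down :: "shape \<Rightarrow> shape \<Rightarrow> shape \<Rightarrow> nat \<Rightarrow> nat" where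
  "cauchy_down nu ka mu = (\<lambda>j. max (nu (Suc j)) (ka (Suc j)) + min (nu j) (ka j) - mu (Suc j))"
definition cauchy_up :: "shape \<Rightarrow> shape \<Rightarrow> nat \<Rightarrow> shape \<Rightarrow> nat \<Rightarrow> nat" where
  "cauchy_up nu ka i rho = (\<lambda>j. case j of 0 \<Rightarrow> i + max (nu 0) (ka 0)
      | Suc j \<Rightarrow> max (nu (Suc j)) (ka (Suc j)) + min (nu j) (ka j) - rho j)"

lemma cauchy_down_props: assumes "hstrip mu nu" "hstrip mu ka"
  shows "hstrip nu (cauchy_down nu ka mu)" "hstrip ka (cauchy_down nu ka mu)"
    "mu (Suc j) + cauchy_down nu ka mu j = max (nu (Suc j)) (ka (Suc j)) + min (nu j) (ka j)"
    "mu 0 = (mu 0 - max (nu 0) (ka 0)) + max (nu 0) (ka 0)"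
    "cauchy_up nu ka (mu 0 - max (nu 0) (ka 0)) (cauchy_down nu ka mu) = mu"
proof -
  have b: "mu (Suc j) \<le> nu j" "nu j \<le> mu j" "mu (Suc j) \<le> ka j" "ka j \<le> mu j" for j
    using hstripD[OF assms(1)] hstripD[OF assms(2)] by auto
  have c: "max (nu (Suc j)) (ka (Suc j)) \<le> mu (Suc j)" "mu (Suc j) \<le> min (nu j) (ka j)" for j
    using b by auto
  show "hstrip nu (cauchy_down nu ka mu)" unfolding hstrip_def cauchy_down_def
  proof (intro allI conjI)
    fix i show "nu (Suc i) \<le> max (nu (Suc i)) (ka (Suc i)) + min (nu i) (ka i) - mu (Suc i)"
      "max (nu (Suc i)) (ka (Suc i)) + min (nu i) (ka i) - mu (Suc i) \<le> nu i"
      using c[of i] by linarith+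
  qed
  show "hstrip ka (cauchy_down nu ka mu)" unfolding hstrip_def cauchy_down_def
  proof (intro allI conjI)
    fix i show "ka (Suc i) \<le> max (nu (Suc i)) (ka (Suc i)) + min (nu i) (ka i) - mu (Suc i)"
      "max (nu (Suc i)) (ka (Suc i)) + min (nu i) (ka i) - mu (Suc i) \<le> ka i"
      using c[of i] by linarith+
  qed
  show "mu (Suc j) + cauchy_down nu ka mu j = max (nu (Suc j)) (ka (Suc j)) + min (nu j) (ka j)"
    unfolding cauchy_down_def using c[of j] by linarith
  show *: "mu 0 = (mu 0 - max (nu 0) (ka 0)) + max (nu 0) (ka 0)" using b(2,4)[of 0] by linarith
  show "cauchy_up nu ka (mu 0 - max (nu 0) (ka 0)) (cauchy_down nu ka mu) = mu"
  proof
    fix j show "cauchy_up nu ka (mu 0 - max (nu 0) (ka 0)) (cauchy_down nu ka mu) j = mu j"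
    proof (cases j)
      case 0 then show ?thesis unfolding cauchy_up_def using * by simp
    next
      case (Suc m) then show ?thesis unfolding cauchy_up_def cauchy_down_def using c[of m] by (simp del: max.bounded_iff min.bounded_iff)
    qed
  qed
qed

lemma cauchy_up_props: assumes "hstrip nu rho" "hstrip ka rho"
  shows "hstrip (cauchy_up nu ka i rho) nu" "hstrip (cauchy_up nu ka i rho) ka"
    "cauchy_up nu ka i rho (Suc j) + rho j = max (nu (Suc j)) (ka (Suc j)) + min (nu j) (ka j)"
    "cauchy_up nu ka i rho 0 = i + max (nu 0) (ka 0)"
    "cauchy_down nu ka (cauchy_up nu ka i rho) = rho"
proof -
  have b: "nu (Suc j) \<le> rho j" "rho j \<le> nu j" "ka (Suc j) \<le> rho j" "rho j \<le> ka j" for j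
    using hstripD[OF assms(1)] hstripD[OF assms(2)] by auto
  have c: "max (nu (Suc j)) (ka (Suc j)) \<le> rho j" "rho j \<le> min (nu j) (ka j)" for j
    using b by auto
  have S: "cauchy_up nu ka i rho (Suc j) = max (nu (Suc j)) (ka (Suc j)) + min (nu j) (ka j) - rho j" for j
    unfolding cauchy_up_def by simp
  show Z: "cauchy_up nu ka i rho 0 = i + max (nu 0) (ka 0)" unfolding cauchy_up_def by simp
  have le1: "nu j \<le> cauchy_up nu ka i rho j" "ka j \<le> cauchy_up nu ka i rho j" for j
  proof -
    have "nu j \<le> cauchy_up nu ka i rho j \<and> ka j \<le> cauchy_up nu ka i rho j"
    proof (cases j)
      case 0 show ?thesis unfolding 0 Z by linarith
    next
      case (Suc m) show ?thesis unfolding Suc S using c[of m] by linarith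
    qed
    then show "nu j \<le> cauchy_up nu ka i rho j" "ka j \<le> cauchy_up nu ka i rho j" by auto
  qed
  have le2: "cauchy_up nu ka i rho (Suc j) \<le> nu j" "cauchy_up nu ka i rho (Suc j) \<le> ka j" for j
    unfolding S using c[of j] by linarith+
  show "hstrip (cauchy_up nu ka i rho) nu" "hstrip (cauchy_up nu ka i rho) ka" unfolding hstrip_def using le1 le2 by auto
  show "cauchy_up nu ka i rho (Suc j) + rho j = max (nu (Suc j)) (ka (Suc j)) + min (nu j) (ka j)"
    unfolding S using c[of j] by linarith
  show "cauchy_down nu ka (cauchy_up nu ka i rho) = rho"
  proof
    fix j show "cauchy_down nu ka (cauchy_up nu ka i rho) j = rho j"
      unfolding cauchy_down_def S using c[of j] by linarith
  qed
qed

text \<open>The skew Cauchy identity: strips added on top and strips removed below commute, up to a geometric factor whose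
  coefficients are the powers \<open>x ^ i\<close>.\<close>
lemma up_strip_add_pos: assumes nu: "is_part nu"
  shows "up_strip k (add_pos x s) nu = (\<Sum>i\<le>k. x ^ i * add_pos x (up_strip (k - i) s) nu)"
proof -
  let ?A = "{mu. hstrip mu nu \<and> part_size mu = part_size nu + k}"
  let ?R = "{rho. hstrip nu rho}"
  let ?K = "\<lambda>i rho. {ka. hstrip ka rho \<and> part_size ka = part_size rho + (k - i)}"
  have "up_strip k (add_pos x s) nu = (\<Sum>mu\<in>?A. \<Sum>ka | hstrip mu ka. x ^ (part_size mu - part_size ka) * s ka)"
    unfolding up_strip_def add_pos_def ..
  also have "\<dots> = (\<Sum>(mu, ka)\<in>Sigma ?A (\<lambda>mu. {ka. hstrip mu ka}). x ^ (part_size mu - part_size ka) * s ka)"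
    by (rule sum.Sigma) (auto intro!: finite_hstrip_upper finite_hstrip nu intro: hstrip_part_upper[OF _ nu])
  also have "\<dots> = (\<Sum>(i, rho, ka)\<in>Sigma {..k} (\<lambda>i. Sigma ?R (\<lambda>rho. ?K i rho)).
      x ^ i * (x ^ (part_size nu - part_size rho) * s ka))"
  proof (rule sum.reindex_bij_witness[where
      j="\<lambda>(mu, ka). (mu 0 - max (nu 0) (ka 0), cauchy_down nu ka mu, ka)" and
      i="\<lambda>(i, rho, ka). (cauchy_up nu ka i rho, ka)"], goal_cases)
    case (1 a)
    obtain mu ka where a: "a = (mu, ka)" by (cases a)
    show ?case using 1 cauchy_down_props(5)[of mu nu ka] unfolding a by simp
  next
    case (2 a)
    obtain mu ka where a: "a = (mu, ka)" by (cases a)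
    have h: "hstrip mu nu" "hstrip mu ka" and k: "part_size mu = part_size nu + k" using 2 a by auto
    note mu = hstrip_part_upper[OF h(1) nu] note ka = hstrip_part_lower[OF h(2) mu]
    note p = cauchy_down_props[OF h]
    have sz: "part_size mu + part_size (cauchy_down nu ka mu) = (mu 0 - max (nu 0) (ka 0)) + part_size nu + part_size ka"
      by (rule cauchy_size[OF nu ka h(1) p(1) p(4) p(3)])
    have "part_size (cauchy_down nu ka mu) \<le> part_size ka" by (rule hstrip_part_size[OF p(2) ka])
    then show ?case using p(1,2) sz k unfolding a by auto
  next
    case (3 b)
    obtain i rho ka where b: "b = (i, rho, ka)" by (cases b)
    show ?case using 3 cauchy_up_props(4,5)[of nu rho ka] unfolding b by simp
  next
    case (4 b)
    obtain i rho ka where b: "b = (i, rho, ka)" by (cases b)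
    have h: "hstrip nu rho" "hstrip ka rho" and k: "i \<le> k" "part_size ka = part_size rho + (k - i)" using 4 b by auto
    have ka: "is_part ka" by (rule hstrip_part_upper[OF h(2) hstrip_part_lower[OF h(1) nu]])
    note p = cauchy_up_props[OF h]
    have "part_size (cauchy_up nu ka i rho) + part_size rho = i + part_size nu + part_size ka"
      by (rule cauchy_size[OF nu ka p(1) h(1) p(4) p(3)])
    then show ?case using p(1,2) k unfolding b by auto
  next
    case (5 a)
    obtain mu ka where a: "a = (mu, ka)" by (cases a)
    have h: "hstrip mu nu" "hstrip mu ka" and k: "part_size mu = part_size nu + k" using 5 a by auto
    note mu = hstrip_part_upper[OF h(1) nu] note ka = hstrip_part_lower[OF h(2) mu]
    note p = cauchy_down_props[OF h]
    have sz: "part_size mu + part_size (cauchy_down nu ka mu) = (mu 0 - max (nu 0) (ka 0)) + part_size nu + part_size ka"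
      by (rule cauchy_size[OF nu ka h(1) p(1) p(4) p(3)])
    have "part_size mu - part_size ka = (mu 0 - max (nu 0) (ka 0)) + (part_size nu - part_size (cauchy_down nu ka mu))"
      using sz hstrip_part_size[OF p(1) nu] hstrip_part_size[OF h(2) mu] by linarith
    then show ?case unfolding a by (simp add: power_add mult.assoc)
  qed
  also have "\<dots> = (\<Sum>i\<le>k. \<Sum>rho\<in>?R. \<Sum>ka\<in>?K i rho. x ^ i * (x ^ (part_size nu - part_size rho) * s ka))"
    by (subst sum.Sigma; (subst sum.Sigma)?)
       (auto intro!: finite_SigmaI finite_hstrip nu finite_hstrip_upper intro: hstrip_part_lower[OF _ nu] simp: split_def)
  also have "\<dots> = (\<Sum>i\<le>k. x ^ i * add_pos x (up_strip (k - i) s) nu)"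
    unfolding add_pos_def up_strip_def by (simp add: sum_distrib_left)
  finally show ?thesis .
qed

text \<open>Row \<open>i\<close> of a partition between \<open>\<nu>\<close> and \<open>\<lambda>\<close> ranges over an interval; reflecting all these intervals is the
  Bender--Knuth involution. The topmost row has upper end \<open>\<lambda> 0\<close>.\<close>
definition bender_knuth :: "shape \<Rightarrow> shape \<Rightarrow> shape \<Rightarrow> nat \<Rightarrow> nat" where
  "bender_knuth la nu mu = (\<lambda>i. max (nu i) (la (Suc i)) + (case i of 0 \<Rightarrow> la 0 | Suc j \<Rightarrow> min (la i) (nu j)) - mu i)"

lemma bender_knuth_props: assumes la: "is_part la" and h: "hstrip la mu" "hstrip mu nu"
  shows "hstrip la (bender_knuth la nu mu)" "hstrip (bender_knuth la nu mu) nu" "bender_knuth la nu (bender_knuth la nu mu) = mu"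
    "part_size mu + part_size (bender_knuth la nu mu) = part_size la + part_size nu"
proof -
  define u where "u = (\<lambda>i. case i of 0 \<Rightarrow> la 0 | Suc j \<Rightarrow> min (la i) (nu j))"
  define l where "l = (\<lambda>i. max (nu i) (la (Suc i)))"
  note b = hstripD[OF h(1)] hstripD[OF h(2)]
  have bender_knuth: "bender_knuth la nu m i = l i + u i - m i" for m i unfolding bender_knuth_def u_def l_def by simp
  have lb: "l i \<le> mu i" for i unfolding l_def using b[of i] by auto
  have ub: "mu i \<le> u i" for i unfolding u_def using b(2)[of i] b(3)[of "i - 1"] by (cases i) auto
  have u1: "u i \<le> la i" "u (Suc i) \<le> nu i" for i unfolding u_def by (auto split: nat.splits)
  have l1: "la (Suc i) \<le> l i" "nu i \<le> l i" for i unfolding l_def by auto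
  have bender_knuth_lb: "l i \<le> bender_knuth la nu mu i" and bender_knuth_ub: "bender_knuth la nu mu i \<le> u i" for i
    unfolding bender_knuth using lb[of i] ub[of i] by linarith+
  show "hstrip la (bender_knuth la nu mu)" "hstrip (bender_knuth la nu mu) nu" unfolding hstrip_def
    using bender_knuth_lb bender_knuth_ub u1 l1 by (meson order_trans)+
  show "bender_knuth la nu (bender_knuth la nu mu) = mu"
  proof
    fix i show "bender_knuth la nu (bender_knuth la nu mu) i = mu i"
      unfolding bender_knuth using lb[of i] ub[of i] by linarith
  qed
  have mu: "is_part mu" by (rule hstrip_part_lower[OF h(1) la])
  have nu: "is_part nu" by (rule hstrip_part_lower[OF h(2) mu])
  obtain N where N: "N > 0" "\<And>i. i \<ge> N \<Longrightarrow> la i = 0" "\<And>i. i \<ge> N \<Longrightarrow> nu i = 0"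
    using common_bound[OF la nu] by blast
  have mu0: "mu i = 0" if "i \<ge> Suc N" for i using b(2)[of i] N(2)[of i] that by simp
  have bk0: "bender_knuth la nu mu i = 0" if "i \<ge> Suc N" for i
    using bender_knuth_ub[of i] u1(1)[of i] N(2)[of i] that by simp
  have "part_size mu + part_size (bender_knuth la nu mu) = (\<Sum>i<Suc N. mu i + bender_knuth la nu mu i)"
    using part_size_eq[of "Suc N" mu] mu0 part_size_eq[of "Suc N" "bender_knuth la nu mu"] bk0 by (simp only: sum.distrib)
  also have "\<dots> = (\<Sum>i<Suc N. l i + u i)"
    unfolding bender_knuth using lb ub by (intro sum.cong refl) (metis add.commute le_add_diff_inverse2 trans_le_add2)
  also have "\<dots> = (\<Sum>i<Suc N. l i) + (\<Sum>i<Suc N. u i)" by (rule sum.distrib)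
  also have "(\<Sum>i<Suc N. l i) = (\<Sum>i<N. l i)" unfolding l_def using N by simp
  also have "(\<Sum>i<Suc N. u i) = la 0 + (\<Sum>i<N. min (la (Suc i)) (nu i))"
    unfolding sum.lessThan_Suc_shift u_def by simp
  also have "(\<Sum>i<N. l i) + (la 0 + (\<Sum>i<N. min (la (Suc i)) (nu i)))
      = la 0 + (\<Sum>i<N. l i + min (la (Suc i)) (nu i))" by (simp add: sum.distrib)
  also have "\<dots> = la 0 + (\<Sum>i<N. la (Suc i) + nu i)"
    unfolding l_def by (intro arg_cong[where f="(+) (la 0)"] sum.cong refl) auto
  also have "\<dots> = (la 0 + (\<Sum>i<N. la (Suc i))) + (\<Sum>i<N. nu i)" by (simp add: sum.distrib)
  also have "la 0 + (\<Sum>i<N. la (Suc i)) = part_size la"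
    by (rule part_size_split[symmetric]) (use N in auto)
  also have "(\<Sum>i<N. nu i) = part_size nu" by (rule part_size_eq[symmetric]) (use N in auto)
  finally show "part_size mu + part_size (bender_knuth la nu mu) = part_size la + part_size nu" .
qed

text \<open>The reflection exchanges the sizes of the two strips. This is the symmetry of Schur functions under adjacent
  transpositions of the variables.\<close>
lemma down_strip_commute: assumes la: "is_part la" shows "down_strip j (down_strip k g) la = down_strip k (down_strip j g) la"
proof -
  have *: "down_strip j (down_strip k g) la = (\<Sum>(mu, nu)\<in>Sigma {mu. hstrip la mu \<and> part_size la = part_size mu + j}
      (\<lambda>mu. {nu. hstrip mu nu \<and> part_size mu = part_size nu + k}). g nu)" for j k
    unfolding down_strip_def by (rule sum.Sigma)
      (auto intro!: finite_subset[OF _ finite_hstrip] la intro: hstrip_part_lower[OF _ la])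
  show ?thesis unfolding *
  proof (rule sum.reindex_bij_witness[where i="\<lambda>(mu, nu). (bender_knuth la nu mu, nu)" and j="\<lambda>(mu, nu). (bender_knuth la nu mu, nu)"], goal_cases)
    case (1 a) then show ?case using bender_knuth_props(3)[OF la] by auto
  next
    case (2 a)
    obtain mu nu where a: "a = (mu, nu)" by (cases a)
    show ?case using 2 bender_knuth_props[OF la, of mu nu] unfolding a by auto
  next
    case (3 a) then show ?case using bender_knuth_props(3)[OF la] by auto
  next
    case (4 a)
    obtain mu nu where a: "a = (mu, nu)" by (cases a)
    show ?case using 4 bender_knuth_props[OF la, of mu nu] unfolding a by auto
  qed auto
qed

lemma vstrip_part_size: "vstrip la mu \<Longrightarrow> is_part la \<Longrightarrow> part_size mu \<le> part_size la"
  unfolding vstrip_def by (intro part_size_mono) auto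

lemma finite_vstrip: assumes "is_part la" shows "finite {mu. vstrip la mu}"
  by (rule finite_subset[OF _ finite_parts[of "part_size la"]]) (auto simp: vstrip_part_size[OF _ assms] vstrip_def)

lemma add_neg_vstrip: assumes la: "is_part la"
  shows "add_neg y s la = (\<Sum>mu | vstrip la mu. y ^ (part_size la - part_size mu) * s mu)"
  unfolding add_neg_def add_pos_def
proof (rule sum.reindex_bij_witness[where i=conjugate and j=conjugate], goal_cases)
  case (1 a) then show ?case using hstrip_part_lower[OF _ conjugate_is_part[OF la]] by (auto simp: conjugate_conjugate)
next
  case (2 a)
  then have "is_part a" using hstrip_part_lower[OF _ conjugate_is_part[OF la]] by auto
  then show ?case using 2 hstrip_conjugate_iff[OF la conjugate_is_part[of a]] by (simp add: conjugate_conjugate)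
next
  case (3 b) then show ?case by (auto simp: vstrip_def conjugate_conjugate)
next
  case (4 b) then show ?case using hstrip_conjugate_iff[OF la] by (auto simp: vstrip_def)
next
  case (5 a)
  then have "is_part a" using hstrip_part_lower[OF _ conjugate_is_part[OF la]] by auto
  then show ?case by (simp add: part_size_conjugate la)
qed

lemma part_size_upd: assumes "is_part p" shows "part_size (p(i := v)) + p i = part_size p + v"
proof -
  obtain N where N: "\<And>i. i \<ge> N \<Longrightarrow> p i = 0" using is_part_bound[OF assms] by auto
  let ?M = "max N (Suc i)"
  have 1: "part_size p = (\<Sum>k<?M. p k)" by (rule part_size_eq) (use N in auto)
  have 2: "part_size (p(i := v)) = (\<Sum>k<?M. (p(i := v)) k)" by (rule part_size_eq) (use N in auto)
  have i: "i \<in> {..<?M}" by auto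
  have "(\<Sum>k<?M. (p(i := v)) k) = v + (\<Sum>k\<in>{..<?M} - {i}. p k)"
    by (subst sum.remove[OF _ i]) (auto intro!: sum.cong)
  moreover have "(\<Sum>k<?M. p k) = p i + (\<Sum>k\<in>{..<?M} - {i}. p k)"
    by (subst sum.remove[OF _ i]) auto
  ultimately show ?thesis using 1 2 by simp
qed

text \<open>Let row \<open>i\<^sub>0\<close> be the first one in which \<open>\<nu>\<close> and \<open>\<lambda>\<close> differ. In that row both \<open>\<lambda> i\<^sub>0\<close> and
  \<open>\<lambda> i\<^sub>0 - 1\<close> are admissible for \<open>\<mu>\<close> (the row above imposes nothing, as \<open>\<nu>\<close> and \<open>\<lambda>\<close> agree there), and switching
  between them is a sign-reversing involution.\<close>
lemma strip_cancel:
  assumes la: "is_part la" and nu: "is_part nu" and ne: "nu \<noteq> la"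
  shows "(\<Sum>mu | vstrip la mu \<and> hstrip mu nu. (- 1) ^ part_size mu) = (0::'a::real_normed_field)"
proof -
  let ?M = "{mu. vstrip la mu \<and> hstrip mu nu}"
  define i0 where "i0 = (LEAST i. nu i \<noteq> la i)"
  have ex: "\<exists>i. nu i \<noteq> la i" using ne by auto
  have i0: "nu i0 \<noteq> la i0" unfolding i0_def using LeastI_ex[OF ex] .
  have below: "nu i = la i" if "i < i0" for i using not_less_Least[of i "\<lambda>i. nu i \<noteq> la i"] that unfolding i0_def by auto
  define T where "T = (\<lambda>mu::nat\<Rightarrow>nat. mu(i0 := la i0 + (la i0 - 1) - mu i0))"
  have T: "T mu \<in> ?M \<and> T (T mu) = mu \<and> (- 1) ^ part_size (T mu) = - ((- 1 :: 'a) ^ part_size mu)" if "mu \<in> ?M" for mu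
  proof -
    have v: "mu i \<le> la i" "la i \<le> Suc (mu i)" and h: "mu (Suc i) \<le> nu i" "nu i \<le> mu i" for i
      
      using that unfolding vstrip_def hstrip_def by auto
    have mup: "is_part mu" using that unfolding vstrip_def by auto
    have lt: "nu i0 < la i0" using i0 v(1)[of i0] h(2)[of i0] by simp
    have c: "mu i0 = la i0 \<and> T mu i0 = la i0 - 1 \<or> mu i0 = la i0 - 1 \<and> T mu i0 = la i0"
      using v[of i0] lt unfolding T_def by auto
    have o: "i \<noteq> i0 \<Longrightarrow> T mu i = mu i" for i unfolding T_def by simp
    have hT: "hstrip (T mu) nu" unfolding hstrip_def
    proof (intro allI conjI)
      fix i
      show "nu i \<le> T mu i" using h(2)[of i] o[of i] c lt by (cases "i = i0") auto
      show "T mu (Suc i) \<le> nu i"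
      proof (cases "Suc i = i0")
        case True
        have "T mu i0 \<le> la i0" using c by auto
        also have "\<dots> \<le> la i" using is_part_Suc[OF la, of i] True by simp
        also have "\<dots> = nu i" using below[of i] True by simp
        finally show ?thesis using True by simp
      qed (use o h(1)[of i] in auto)
    qed
    have "vstrip la (T mu)" unfolding vstrip_def
    proof (intro conjI allI)
      show "is_part (T mu)" by (rule hstrip_part_upper[OF hT nu])
      fix i show "T mu i \<le> la i" "la i \<le> Suc (T mu i)"
        using v[of i] o[of i] c lt by (cases "i = i0"; auto)+
    qed
    moreover have "T (T mu) = mu" using v[of i0] lt unfolding T_def by (auto simp: fun_eq_iff)
    moreover have "odd (part_size (T mu) + part_size mu)"
    proof -
      have "part_size (T mu) + mu i0 = part_size mu + T mu i0"
        using part_size_upd[OF mup, of i0 "T mu i0"] unfolding T_def by simp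
      then have "part_size (T mu) = Suc (part_size mu) \<or> Suc (part_size (T mu)) = part_size mu"
        using c lt by auto
      then show ?thesis by presburger
    qed
    ultimately show ?thesis using hT by (auto simp: minus_one_power_iff)
  qed
  have "(\<Sum>mu\<in>?M. (- 1) ^ part_size mu) = (\<Sum>mu\<in>?M. (- 1 :: 'a) ^ part_size (T mu))"
    by (rule sum.reindex_bij_witness[where i=T and j=T]) (use T in auto)
  also have "\<dots> = - (\<Sum>mu\<in>?M. (- 1) ^ part_size mu)"
    unfolding sum_negf[symmetric] by (rule sum.cong) (use T in auto)
  finally show ?thesis by simp
qed

text \<open>The identity \<open>E (y) * H (- y) = 1\<close> between the generating functions of elementary and complete symmetric functions,
  on the level of strips: all terms cancel by \<open>strip_cancel\<close> except the one without any strip.\<close>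
lemma add_neg_add_pos_inverse: assumes la: "is_part la"
  shows "add_neg y (add_pos (- y) s) la = s la"
proof -
  let ?A = "{mu. vstrip la mu}" and ?B = "{nu. is_part nu \<and> part_size nu \<le> part_size la}"
  have "add_neg y (add_pos (- y) s) la = (\<Sum>mu\<in>?A. \<Sum>nu | nu \<in> ?B \<and> hstrip mu nu.
      y ^ (part_size la - part_size mu) * ((- y) ^ (part_size mu - part_size nu) * s nu))"
    unfolding add_neg_vstrip[OF la] add_pos_def sum_distrib_left
  proof (intro sum.cong refl)
    fix mu assume "mu \<in> ?A"
    then have "is_part mu" "part_size mu \<le> part_size la" using vstrip_part_size[OF _ la] by (auto simp: vstrip_def)
    then show "{nu. hstrip mu nu} = {nu. nu \<in> ?B \<and> hstrip mu nu}"
      using hstrip_part_size hstrip_part_lower by fastforce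
  qed
  also have "\<dots> = (\<Sum>nu\<in>?B. \<Sum>mu | mu \<in> ?A \<and> hstrip mu nu.
      y ^ (part_size la - part_size mu) * ((- y) ^ (part_size mu - part_size nu) * s nu))"
    by (rule sum.swap_restrict) (auto intro: finite_vstrip la finite_parts)
  also have "\<dots> = (\<Sum>nu\<in>?B. if nu = la then s la else 0)"
  proof (rule sum.cong[OF refl])
    fix nu assume nu: "nu \<in> ?B"
    have eq: "{mu. mu \<in> ?A \<and> hstrip mu nu} = {mu. vstrip la mu \<and> hstrip mu nu}" by auto
    show "(\<Sum>mu | mu \<in> ?A \<and> hstrip mu nu. y ^ (part_size la - part_size mu) * ((- y) ^ (part_size mu - part_size nu) * s nu))
       = (if nu = la then s la else 0)"
    proof (cases "nu = la")
      case True
      have "{mu. vstrip la mu \<and> hstrip mu nu} = {la}"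
        unfolding True using la by (auto simp: vstrip_def hstrip_refl is_part_Suc intro!: ext antisym dest: hstripD)
      then show ?thesis unfolding eq using True by simp
    next
      case False
      have "(\<Sum>mu | vstrip la mu \<and> hstrip mu nu. y ^ (part_size la - part_size mu) * ((- y) ^ (part_size mu - part_size nu) * s nu))
        = (\<Sum>mu | vstrip la mu \<and> hstrip mu nu. (- 1) ^ part_size mu * ((- 1) ^ part_size nu * y ^ (part_size la - part_size nu) * s nu))"
      proof (rule sum.cong[OF refl])
        fix mu assume mu: "mu \<in> {mu. vstrip la mu \<and> hstrip mu nu}"
        have le: "part_size nu \<le> part_size mu" "part_size mu \<le> part_size la"
          using mu vstrip_part_size[OF _ la] hstrip_part_size[of mu nu] by (auto simp: vstrip_def)
        have e: "part_size la - part_size nu = (part_size la - part_size mu) + (part_size mu - part_size nu)" using le by simp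
        have m: "(- 1 :: 'a) ^ (part_size mu - part_size nu) = (- 1) ^ part_size mu * (- 1) ^ part_size nu"
          using le(1) by (auto simp: minus_one_power_iff even_diff_nat)
        show "y ^ (part_size la - part_size mu) * ((- y) ^ (part_size mu - part_size nu) * s nu)
          = (- 1) ^ part_size mu * ((- 1) ^ part_size nu * y ^ (part_size la - part_size nu) * s nu)"
          unfolding e power_minus[of y] power_add m by (simp add: ac_simps)
      qed
      also have "\<dots> = 0"
        unfolding sum_distrib_right[symmetric] using strip_cancel[OF la _ False, where 'a='a] nu by simp
      finally show ?thesis unfolding eq using False by simp
    qed
  qed
  also have "\<dots> = s la" using la by (simp add: finite_parts)
  finally show ?thesis .
qed

lemma add_pos_add_neg_inverse: assumes la: "is_part la"
  shows "add_pos (- y) (add_neg y s) la = s la"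
proof -
  have "add_pos (- y) (add_neg y s) la = add_neg (- y) (add_pos (- (- y)) (\<lambda>p. s (conjugate p))) (conjugate la)"
    unfolding add_neg_def using la by (auto simp: conjugate_conjugate intro!: add_pos_cong)
  also have "\<dots> = s la" by (subst add_neg_add_pos_inverse) (auto simp: conjugate_is_part conjugate_conjugate la)
  finally show ?thesis .
qed

text \<open>Because \<open>add_neg y\<close> inverts \<open>add_pos (- y)\<close>, the dual commutation rule is the skew Cauchy identity read
  backwards.\<close>
lemma up_strip_add_neg: assumes nu: "is_part nu"
  shows "up_strip (Suc k) (add_neg y s) nu = add_neg y (\<lambda>p. up_strip (Suc k) s p + y * up_strip k s p) nu"
proof -
  define r where "r = add_neg y s"
  have Hr: "is_part p \<Longrightarrow> add_pos (- y) r p = s p" for p unfolding r_def by (rule add_pos_add_neg_inverse)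
  have key: "up_strip (Suc k) s p + y * up_strip k s p = add_pos (- y) (up_strip (Suc k) r) p" if p: "is_part p" for p
  proof -
    have 1: "up_strip (Suc k) s p = (\<Sum>i\<le>Suc k. (- y) ^ i * add_pos (- y) (up_strip (Suc k - i) r) p)"
      unfolding up_strip_add_pos[OF p, symmetric] by (rule up_strip_cong) (simp_all add: Hr p)
    have 2: "up_strip k s p = (\<Sum>i\<le>k. (- y) ^ i * add_pos (- y) (up_strip (k - i) r) p)"
      unfolding up_strip_add_pos[OF p, symmetric] by (rule up_strip_cong) (simp_all add: Hr p)
    show ?thesis unfolding 1 2 sum.atMost_Suc_shift by (simp add: sum_distrib_left sum_negf mult.assoc)
  qed
  have "add_neg y (\<lambda>p. up_strip (Suc k) s p + y * up_strip k s p) nu = add_neg y (add_pos (- y) (up_strip (Suc k) r)) nu"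
    by (rule add_neg_cong) (simp_all add: key nu)
  also have "\<dots> = up_strip (Suc k) r nu" by (rule add_neg_add_pos_inverse[OF nu])
  finally show ?thesis unfolding r_def by simp
qed

section \<open>Tableaux and Kostka numbers\<close>

definition ssyt :: "shape \<Rightarrow> (nat \<times> nat \<Rightarrow> nat) set" where
  "ssyt p = {T \<in> extensional (cellset p).
     (\<forall>i j j'. (i, j) \<in> cellset p \<and> (i, j') \<in> cellset p \<and> j < j' \<longrightarrow> T (i, j) \<le> T (i, j')) \<and>
     (\<forall>i i' j. (i, j) \<in> cellset p \<and> (i', j) \<in> cellset p \<and> i < i' \<longrightarrow> T (i, j) < T (i', j))}"

lemma ssyt_ext: "T \<in> ssyt p \<Longrightarrow> c \<notin> cellset p \<Longrightarrow> T c = undefined"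
  unfolding ssyt_def by (auto intro: extensional_arb)

definition tabs :: "shape \<Rightarrow> nat multiset \<Rightarrow> (nat \<times> nat \<Rightarrow> nat) set" where
  "tabs p m = {T \<in> ssyt p. image_mset T (mset_set (cellset p)) = m}"

definition kostka :: "shape \<Rightarrow> nat multiset \<Rightarrow> nat" where
  "kostka p m = card (tabs p m)"

lemma cells_eq: "cells lam = cellset (row_part lam)"
  unfolding cells_def cellset_def row_part_def by (auto split: if_splits)

lemma schur_kostka: "schur lam m = of_nat (kostka (row_part lam) m)"
  unfolding schur_def kostka_def tabs_def ssyt_def semistandard_tableaux_def cells_eq by simp

lemma tabs_mem: assumes "is_part p" "T \<in> tabs p m" "c \<in> cellset p" shows "T c \<in># m"
  using assms finite_cellset[OF assms(1)] unfolding tabs_def by auto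

lemma finite_tabs: assumes "is_part p" shows "finite (tabs p m)"
proof (rule finite_subset)
  show "tabs p m \<subseteq> (\<Pi>\<^sub>E c\<in>cellset p. set_mset m)"
    using tabs_mem[OF assms] by (auto simp: PiE_def tabs_def ssyt_def)
  show "finite (\<Pi>\<^sub>E c\<in>cellset p. set_mset m)" by (intro finite_PiE finite_cellset assms) auto
qed

lemma mset_split_top: assumes "set_mset m \<subseteq> {..N::nat}"
  shows "m = filter_mset (\<lambda>x. x < N) m + replicate_mset (count m N) N"
proof (rule multiset_eqI)
  fix x show "count m x = count (filter_mset (\<lambda>x. x < N) m + replicate_mset (count m N) N) x"
    using assms by (cases "x < N"; cases "x = N") (auto simp: not_in_iff)
qed

text \<open>The cells of a tableau with entries below \<open>N\<close> form the diagram of this function.\<close>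
definition shape_below :: "shape \<Rightarrow> nat \<Rightarrow> (nat \<times> nat \<Rightarrow> nat) \<Rightarrow> nat \<Rightarrow> nat" where
  "shape_below p N T = (\<lambda>i. card {j. j < p i \<and> T (i, j) < N})"

lemma shape_below_iff: assumes "T \<in> ssyt p" shows "j < shape_below p N T i \<longleftrightarrow> j < p i \<and> T (i, j) < N"
proof -
  let ?S = "{j. j < p i \<and> T (i, j) < N}"
  have down: "k \<in> ?S" if "j \<in> ?S" "k < j" for j k
  proof -
    have "T (i, k) \<le> T (i, j)" using assms that unfolding ssyt_def cellset_def by auto
    then show ?thesis using that by auto
  qed
  have fin: "finite ?S" by simp
  have "\<exists>m. ?S = {..<m}"
  proof (cases "?S = {}")
    case False
    have "?S = {..Max ?S}"
    proof
      show "?S \<subseteq> {..Max ?S}" using Max_ge[OF fin] by auto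
      show "{..Max ?S} \<subseteq> ?S"
      proof
        fix k assume "k \<in> {..Max ?S}"
        then have "k = Max ?S \<or> k < Max ?S" by auto
        then show "k \<in> ?S"
        proof
          assume "k = Max ?S" then show ?thesis using Max_in[OF fin False] by simp
        next
          assume "k < Max ?S" then show ?thesis by (rule down[OF Max_in[OF fin False]])
        qed
      qed
    qed
    then show ?thesis by (metis lessThan_Suc_atMost)
  qed auto
  then obtain m where m: "?S = {..<m}" by blast
  then have "shape_below p N T i = m" unfolding shape_below_def by simp
  then show ?thesis using m by blast
qed

lemma cellset_mono: "(\<And>i. mu i \<le> p i) \<Longrightarrow> cellset mu \<subseteq> cellset p"
  unfolding cellset_def by (auto intro: less_le_trans)

lemma content_split:
  assumes p: "is_part p" and sub: "cellset mu \<subseteq> cellset p"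
    and top: "\<And>c. c \<in> cellset p - cellset mu \<Longrightarrow> T c = N"
  shows "image_mset T (mset_set (cellset p)) =
    image_mset T (mset_set (cellset mu)) + replicate_mset (part_size p - part_size mu) N"
proof -
  have fp: "finite (cellset p)" by (rule finite_cellset[OF p])
  have fm: "finite (cellset mu)" using sub fp finite_subset by blast
  have "mset_set (cellset p) = mset_set (cellset mu) + mset_set (cellset p - cellset mu)"
    using mset_set_Union[of "cellset mu" "cellset p - cellset mu"] sub fp fm by (auto simp: Un_absorb1)
  moreover have "image_mset T (mset_set (cellset p - cellset mu)) = image_mset (\<lambda>_. N) (mset_set (cellset p - cellset mu))"
    by (rule image_mset_cong) (use top fp in auto)
  moreover have "size (mset_set (cellset p - cellset mu)) = part_size p - part_size mu"
    using sub fm by (simp add: part_size_def card_Diff_subset)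
  ultimately show ?thesis by (simp add: image_mset_const_eq)
qed

lemma image_restrict: "finite A \<Longrightarrow> image_mset (restrict T A) (mset_set A) = image_mset T (mset_set A)"
  by (rule image_mset_cong) auto

lemma shape_below_hstrip: assumes p: "is_part p" and m: "set_mset m \<subseteq> {..N}" and T: "T \<in> tabs p m"
  shows "hstrip p (shape_below p N T)" "restrict T (cellset (shape_below p N T)) \<in> tabs (shape_below p N T) (filter_mset (\<lambda>x. x < N) m)"
    "part_size p = part_size (shape_below p N T) + count m N"
proof -
  let ?mu = "shape_below p N T"
  have Ts: "T \<in> ssyt p" using T unfolding tabs_def by auto
  note li = shape_below_iff[OF Ts]
  have T_le: "T c \<le> N" if "c \<in> cellset p" for c using tabs_mem[OF p T that] m by auto
  have le: "?mu i \<le> p i" for i by (rule nat_le_if) (simp add: li)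
  show hstrip: "hstrip p ?mu" unfolding hstrip_def
  proof (intro allI conjI le)
    fix i show "p (Suc i) \<le> ?mu i"
    proof (rule nat_le_if)
      fix j assume j: "j < p (Suc i)"
      have j': "j < p i" using j is_part_Suc[OF p, of i] by simp
      have "T (i, j) < T (Suc i, j)" using Ts j j' unfolding ssyt_def cellset_def by auto
      also have "\<dots> \<le> N" using T_le[of "(Suc i, j)"] j unfolding cellset_def by auto
      finally show "j < ?mu i" using j' li by auto
    qed
  qed
  have sub: "cellset ?mu \<subseteq> cellset p" by (rule cellset_mono[OF le])
  have fm: "finite (cellset ?mu)" by (rule finite_subset[OF sub finite_cellset[OF p]])
  have top: "T c = N" if "c \<in> cellset p - cellset ?mu" for c
  proof -
    obtain i j where c: "c = (i, j)" by (cases c)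
    have "\<not> T c < N" using that li[of j N i] unfolding c cellset_def by simp
    then show ?thesis using T_le[of c] that by simp
  qed
  have lowT: "T c < N" if "c \<in> cellset ?mu" for c
    using that li[of "snd c" N "fst c"] unfolding cellset_def by (simp add: split_def)
  have eq: "m = image_mset T (mset_set (cellset ?mu)) + replicate_mset (part_size p - part_size ?mu) N"
    using content_split[OF p sub top] T unfolding tabs_def by auto
  have cN: "count (image_mset T (mset_set (cellset ?mu))) N = 0"
    using lowT fm by (intro not_in_iff[THEN iffD1]) auto
  have "count m N = part_size p - part_size ?mu" by (subst eq) (simp add: cN)
  then show "part_size p = part_size ?mu + count m N" using hstrip_part_size[OF hstrip p] by simp
  have "filter_mset (\<lambda>x. x < N) (image_mset T (mset_set (cellset ?mu))) = image_mset T (mset_set (cellset ?mu))"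
    using lowT fm by (auto simp: filter_mset_eq_conv)
  then have fe: "filter_mset (\<lambda>x. x < N) m = image_mset T (mset_set (cellset ?mu))"
    by (subst eq) auto
  have "restrict T (cellset ?mu) \<in> ssyt ?mu" using Ts subsetD[OF sub] unfolding ssyt_def by auto
  then show "restrict T (cellset ?mu) \<in> tabs ?mu (filter_mset (\<lambda>x. x < N) m)"
    unfolding tabs_def using fe image_restrict[OF fm] by auto
qed

definition fill_top :: "shape \<Rightarrow> nat \<Rightarrow> shape \<Rightarrow> (nat \<times> nat \<Rightarrow> nat) \<Rightarrow> nat \<times> nat \<Rightarrow> nat" where
  "fill_top p N mu T = restrict (\<lambda>c. if c \<in> cellset mu then T c else N) (cellset p)"

lemma fill_top_props: assumes p: "is_part p" and m: "set_mset m \<subseteq> {..N}" and hstrip: "hstrip p mu"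
    and sz: "part_size p = part_size mu + count m N" and T: "T \<in> tabs mu (filter_mset (\<lambda>x. x < N) m)"
  shows "fill_top p N mu T \<in> tabs p m" "shape_below p N (fill_top p N mu T) = mu"
    "restrict (fill_top p N mu T) (cellset mu) = T"
proof -
  let ?F = "fill_top p N mu T"
  have mu: "is_part mu" by (rule hstrip_part_lower[OF hstrip p])
  have le: "mu i \<le> p i" for i using hstripD(2)[OF hstrip] .
  have sub: "cellset mu \<subseteq> cellset p" by (rule cellset_mono[OF le])
  have fm: "finite (cellset mu)" by (rule finite_cellset[OF mu])
  have Ts: "T \<in> ssyt mu" using T unfolding tabs_def by auto
  have lt: "T c < N" if "c \<in> cellset mu" for c using tabs_mem[OF mu T that] by auto
  have F: "?F c = (if c \<in> cellset mu then T c else N)" if "c \<in> cellset p" for c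
    using that unfolding fill_top_def by auto
  have row: "?F (i, j) \<le> ?F (i, j')" if "(i, j) \<in> cellset p" "(i, j') \<in> cellset p" "j < j'" for i j j'
  proof (cases "(i, j') \<in> cellset mu")
    case True
    then have "(i, j) \<in> cellset mu" using that unfolding cellset_def by auto
    then show ?thesis using True Ts that F unfolding ssyt_def by auto
  next
    case False then show ?thesis using F that lt[of "(i, j)"] by auto
  qed
  have col: "?F (i, j) < ?F (i', j)" if "(i, j) \<in> cellset p" "(i', j) \<in> cellset p" "i < i'" for i i' j
  proof -
    have "j < p i'" using that unfolding cellset_def by auto
    also have "\<dots> \<le> p (Suc i)" using is_part_antimono[OF p, of "Suc i" i'] that by auto
    also have "\<dots> \<le> mu i" using hstripD(1)[OF hstrip] .
    finally have c: "(i, j) \<in> cellset mu" unfolding cellset_def by auto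
    show ?thesis
    proof (cases "(i', j) \<in> cellset mu")
      case True then show ?thesis using c Ts that F unfolding ssyt_def by auto
    next
      case False then show ?thesis using c F that lt by auto
    qed
  qed
  have Fs: "?F \<in> ssyt p" unfolding ssyt_def using row col by (auto simp: fill_top_def)
  show r: "restrict ?F (cellset mu) = T"
  proof
    fix c show "restrict ?F (cellset mu) c = T c"
      using F[of c] sub ssyt_ext[OF Ts, of c] by (cases "c \<in> cellset mu") auto
  qed
  have "image_mset ?F (mset_set (cellset p)) = image_mset ?F (mset_set (cellset mu)) + replicate_mset (part_size p - part_size mu) N"
    by (rule content_split[OF p sub]) (use F in auto)
  also have "image_mset ?F (mset_set (cellset mu)) = image_mset T (mset_set (cellset mu))"
    using image_restrict[OF fm, of ?F] r by simp
  also have "\<dots> = filter_mset (\<lambda>x. x < N) m" using T unfolding tabs_def by auto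
  also have "filter_mset (\<lambda>x. x < N) m + replicate_mset (part_size p - part_size mu) N = m"
    using mset_split_top[OF m] sz by simp
  finally show "?F \<in> tabs p m" unfolding tabs_def using Fs by auto
  show "shape_below p N ?F = mu"
  proof
    fix i show "shape_below p N ?F i = mu i"
    proof (rule nat_less_iff_eqI)
      fix k show "k < shape_below p N ?F i \<longleftrightarrow> k < mu i"
        unfolding shape_below_iff[OF Fs] using F[of "(i, k)"] lt[of "(i, k)"] le[of i] unfolding cellset_def
        by (cases "k < mu i") auto
    qed
  qed
qed

text \<open>The cells holding the largest possible entry form a horizontal strip: rows increase weakly and columns strictly.
  Removing them loses no information.\<close>
lemma kostka_peel: assumes p: "is_part p" and m: "set_mset m \<subseteq> {..N}"
  shows "kostka p m = down_strip (count m N) (\<lambda>mu. kostka mu (filter_mset (\<lambda>x. x < N) m)) p"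
proof -
  let ?D = "{mu. hstrip p mu \<and> part_size p = part_size mu + count m N}"
  let ?m = "filter_mset (\<lambda>x. x < N) m"
  have "bij_betw (\<lambda>T. (shape_below p N T, restrict T (cellset (shape_below p N T)))) (tabs p m) (Sigma ?D (\<lambda>mu. tabs mu ?m))"
  proof (rule bij_betw_byWitness[where f'="\<lambda>(mu, T). fill_top p N mu T"])
    show "\<forall>T\<in>tabs p m. (case (shape_below p N T, restrict T (cellset (shape_below p N T))) of (mu, T) \<Rightarrow> fill_top p N mu T) = T"
    proof
      fix T assume T: "T \<in> tabs p m"
      have Ts: "T \<in> ssyt p" using T unfolding tabs_def by auto
      have "fill_top p N (shape_below p N T) (restrict T (cellset (shape_below p N T))) c = T c" for c
      proof (cases "c \<in> cellset p")
        case True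
        have "T c \<le> N" using tabs_mem[OF p T True] m by auto
        then show ?thesis using True shape_below_iff[OF Ts] unfolding fill_top_def cellset_def
          by (auto simp: le_less)
      next
        case False then show ?thesis using ssyt_ext[OF Ts False] unfolding fill_top_def by simp
      qed
      then show "(case (shape_below p N T, restrict T (cellset (shape_below p N T))) of (mu, T) \<Rightarrow> fill_top p N mu T) = T"
        by auto
    qed
  qed (use shape_below_hstrip[OF p m] fill_top_props[OF p m] in auto)
  then have "card (tabs p m) = card (Sigma ?D (\<lambda>mu. tabs mu ?m))" by (rule bij_betw_same_card)
  also have "\<dots> = (\<Sum>mu\<in>?D. card (tabs mu ?m))"
    by (rule card_SigmaI) (auto intro!: finite_subset[OF _ finite_hstrip[OF p]] finite_tabs intro: hstrip_part_lower[OF _ p])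
  finally show ?thesis unfolding kostka_def down_strip_def .
qed

text \<open>Kostka numbers by iterated removal of strips; the head of the list is the multiplicity of the largest entry. In this
  form the symmetry reads as invariance under permutations of the list (\<open>kostka_comp_perm\<close>).\<close>
fun kostka_comp :: "nat list \<Rightarrow> shape \<Rightarrow> nat" where
  "kostka_comp [] p = (if p = (\<lambda>_. 0) then 1 else 0)"
| "kostka_comp (k # ks) p = down_strip k (kostka_comp ks) p"

text \<open>The number of standard tableaux (\<open>dim_kostka_comp\<close>), as the number of ways to remove \<open>n\<close> boxes one by one.\<close>
abbreviation dim_shape :: "nat \<Rightarrow> shape \<Rightarrow> nat" where
  "dim_shape n \<equiv> kostka_comp (replicate n 1)"

lemma down_strip_cong: "(\<And>q. is_part q \<Longrightarrow> g q = h q) \<Longrightarrow> is_part p \<Longrightarrow> down_strip k g p = down_strip k h p"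
  unfolding down_strip_def by (intro sum.cong) (auto dest: hstrip_part_lower)

lemma cellset_empty_iff: "cellset p = {} \<longleftrightarrow> p = (\<lambda>_. 0)"
  unfolding cellset_def by (auto simp: fun_eq_iff)

lemma kostka_kostka_comp: "is_part p \<Longrightarrow> set_mset m \<subseteq> {..<N} \<Longrightarrow> kostka p m = kostka_comp (map (count m) (rev [0..<N])) p"
proof (induction N arbitrary: p m)
  case 0
  then have m: "m = {#}" by auto
  have "tabs p {#} = (if p = (\<lambda>_. 0) then {\<lambda>_. undefined} else {})"
  proof (cases "p = (\<lambda>_. 0)")
    case True
    have e: "cellset p = {}" using True by (simp add: cellset_empty_iff)
    show ?thesis unfolding tabs_def ssyt_def e using True by auto
  next
    case False
    then have "cellset p \<noteq> {}" by (simp add: cellset_empty_iff)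
    then show ?thesis using tabs_mem[OF 0(1), of _ "{#}"] False by auto
  qed
  then show ?case unfolding m kostka_def by simp
next
  case (Suc N)
  have m: "set_mset m \<subseteq> {..N}" using Suc.prems by auto
  have e: "map (count (filter_mset (\<lambda>x. x < N) m)) (rev [0..<N]) = map (count m) (rev [0..<N])"
    by simp
  have "kostka p m = down_strip (count m N) (\<lambda>mu. kostka mu (filter_mset (\<lambda>x. x < N) m)) p"
    by (rule kostka_peel[OF Suc.prems(1) m])
  also have "\<dots> = down_strip (count m N) (kostka_comp (map (count m) (rev [0..<N]))) p"
  proof (rule down_strip_cong[OF _ Suc.prems(1)])
    fix q assume "is_part q"
    then have "kostka q (filter_mset (\<lambda>x. x < N) m) = kostka_comp (map (count (filter_mset (\<lambda>x. x < N) m)) (rev [0..<N])) q"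
      by (rule Suc.IH) auto
    then show "kostka q (filter_mset (\<lambda>x. x < N) m) = kostka_comp (map (count m) (rev [0..<N])) q" unfolding e .
  qed
  finally show ?case by simp
qed

lemma kostka_comp_move: "is_part p \<Longrightarrow> kostka_comp (xs @ k # ys) p = kostka_comp (k # xs @ ys) p"
proof (induction xs arbitrary: p)
  case (Cons a xs)
  have kcs: "kostka_comp (j # ks) = down_strip j (kostka_comp ks)" for j ks by (rule ext) simp
  have "kostka_comp ((a # xs) @ k # ys) p = down_strip a (kostka_comp (k # xs @ ys)) p"
    unfolding append_Cons kcs(1)[of a] by (rule down_strip_cong[OF Cons.IH Cons.prems])
  also have "\<dots> = kostka_comp (k # (a # xs) @ ys) p"
    using down_strip_commute[OF Cons.prems, of a k "kostka_comp (xs @ ys)"]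
    unfolding append_Cons kcs .
  finally show ?case .
qed simp

lemma kostka_comp_perm: "mset xs = mset ys \<Longrightarrow> is_part p \<Longrightarrow> kostka_comp xs p = kostka_comp ys p"
proof (induction xs arbitrary: ys p)
  case (Cons a xs)
  have "a \<in> set ys" using Cons.prems(1) by (metis list.set_intros(1) set_mset_mset)
  then obtain us ws where ys: "ys = us @ a # ws" by (auto dest: split_list)
  have "mset xs = mset (us @ ws)" using Cons.prems(1) ys by auto
  then have "kostka_comp (a # xs) p = kostka_comp (a # us @ ws) p"
    unfolding kostka_comp.simps by (intro down_strip_cong Cons.IH Cons.prems(2))
  then show ?case unfolding ys kostka_comp_move[OF Cons.prems(2)] .
qed simp

lemma down_strip_0: assumes "is_part p" shows "down_strip 0 g p = g p"
proof -
  have "mu = p" if "hstrip p mu" "part_size p = part_size mu" for mu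
    using part_size_mono_eq[OF assms, of mu] hstripD(2)[OF that(1)] that(2) by auto
  then have "{mu. hstrip p mu \<and> part_size p = part_size mu + 0} = {p}" by (auto simp: hstrip_refl assms)
  then show ?thesis unfolding down_strip_def by simp
qed

lemma kostka_comp_zeros: "is_part p \<Longrightarrow> kostka_comp (filter (\<lambda>k. k \<noteq> 0) ks) p = kostka_comp ks p"
  by (induction ks arbitrary: p) (auto simp: down_strip_0 cong: down_strip_cong intro!: down_strip_cong)

text \<open>The orbit of a monomial under permutation of the variables is recorded by the multiset of its exponents.\<close>
definition multiplicities :: "nat multiset \<Rightarrow> nat multiset" where
  "multiplicities m = image_mset (count m) (mset_set (set_mset m))"

lemma multiplicities_eq: assumes "set_mset m \<subseteq> {..<N}"
  shows "mset (filter (\<lambda>k. k \<noteq> 0) (map (count m) (rev [0..<N]))) = multiplicities m"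
proof -
  have e: "{x \<in> {0..<N}. count m x \<noteq> 0} = set_mset m" using assms by (auto simp: not_in_iff)
  have "mset (filter (\<lambda>k. k \<noteq> 0) (map (count m) (rev [0..<N])))
      = image_mset (count m) (filter_mset (\<lambda>x. count m x \<noteq> 0) (mset_set {0..<N}))"
    by (simp add: filter_map o_def)
  also have "\<dots> = multiplicities m" unfolding multiplicities_def by (subst filter_mset_mset_set) (simp_all only: e finite_atLeastLessThan)
  finally show ?thesis .
qed

lemma mset_bound: obtains N where "set_mset m \<subseteq> {..<N::nat}"
proof
  show "set_mset m \<subseteq> {..<Suc (Max (set_mset m))}"
    using Max_ge[of "set_mset m"] by (auto simp: less_Suc_eq_le)
qed

lemma kostka_multiplicities: assumes "is_part p" "multiplicities m = multiplicities m'" shows "kostka p m = kostka p m'"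
proof -
  have *: "\<exists>ks. kostka p m = kostka_comp ks p \<and> mset ks = multiplicities m" for m
  proof -
    obtain N where "set_mset m \<subseteq> {..<N}" by (rule mset_bound)
    then show ?thesis using kostka_kostka_comp[OF assms(1)] multiplicities_eq kostka_comp_zeros[OF assms(1)] by metis
  qed
  show ?thesis using *[of m] *[of m'] assms kostka_comp_perm by metis
qed

lemma count_image_inj: "inj f \<Longrightarrow> count (image_mset f m) (f x) = count m x"
  by (induction m) (auto dest: injD)

lemma multiplicities_image: assumes "inj f" shows "multiplicities (image_mset f m) = multiplicities m"
proof -
  have "multiplicities (image_mset f m) = image_mset (count (image_mset f m)) (image_mset f (mset_set (set_mset m)))"
    unfolding multiplicities_def using assms by (simp add: image_mset_mset_set inj_on_subset)
  then show ?thesis by (simp add: multiplicities_def image_mset.compositionality o_def count_image_inj[OF assms])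
qed

lemma kostka_size: assumes "kostka p m \<noteq> 0" shows "size m = part_size p"
proof -
  have "tabs p m \<noteq> {}" using assms unfolding kostka_def by auto
  then obtain T where "image_mset T (mset_set (cellset p)) = m" unfolding tabs_def by auto
  then have "size (mset_set (cellset p)) = size m" by (metis size_image_mset)
  then show ?thesis unfolding part_size_def by simp
qed

text \<open>A standard tableau is, after lowering all entries by one, a semistandard tableau in which each of the entries
  \<open>0, \<dots>, n - 1\<close> occurs once.\<close>
lemma dim_kostka_comp: assumes lam: "lam \<in> partitions_of n"
  shows "dim_partition lam = dim_shape n (row_part lam)" "is_part (row_part lam)" "part_size (row_part lam) = n"
proof -
  let ?p = "row_part lam"
  have srt: "sorted_wrt (\<ge>) lam" and z: "0 \<notin> set lam" and sm: "sum_list lam = n"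
    using lam unfolding partitions_of_def by auto
  show p: "is_part ?p"
  proof (rule is_partI)
    show "?p (Suc i) \<le> ?p i" for i
      using srt unfolding row_part_def by (auto simp: sorted_wrt_iff_nth_less)
    show "?p i = 0" if "i \<ge> length lam" for i using that unfolding row_part_def by auto
  qed
  have "part_size ?p = (\<Sum>i<length lam. ?p i)" by (rule part_size_eq) (auto simp: row_part_def)
  also have "\<dots> = sum_list lam" by (simp add: row_part_def sum_list_sum_nth atLeast0LessThan)
  finally show sz: "part_size ?p = n" using sm by simp
  let ?m = "mset_set {..<n}"
  let ?C = "cellset ?p"
  have fC: "finite ?C" by (rule finite_cellset[OF p])
  have "bij_betw (\<lambda>T. restrict (\<lambda>c. T c - 1) ?C) (standard_tableaux lam) (tabs ?p ?m)"
  proof (rule bij_betw_byWitness[where f'="\<lambda>T. restrict (\<lambda>c. Suc (T c)) ?C"])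
    show "\<forall>T\<in>standard_tableaux lam. restrict (\<lambda>c. Suc (restrict (\<lambda>c. T c - 1) ?C c)) ?C = T"
    proof
      fix T assume T: "T \<in> standard_tableaux lam"
      show "restrict (\<lambda>c. Suc (restrict (\<lambda>c. T c - 1) ?C c)) ?C = T"
      proof
        fix c
        have "1 \<le> T c" if "c \<in> ?C"
          using T that unfolding standard_tableaux_def cells_eq bij_betw_def by auto
        then show "restrict (\<lambda>c. Suc (restrict (\<lambda>c. T c - 1) ?C c)) ?C c = T c"
          using T extensional_arb[of T ?C c] unfolding standard_tableaux_def cells_eq by auto
      qed
    qed
    show "\<forall>T\<in>tabs ?p ?m. restrict (\<lambda>c. restrict (\<lambda>c. Suc (T c)) ?C c - 1) ?C = T"
      unfolding tabs_def ssyt_def extensional_def by (auto simp: fun_eq_iff)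
    show "(\<lambda>T. restrict (\<lambda>c. T c - 1) ?C) ` standard_tableaux lam \<subseteq> tabs ?p ?m"
    proof safe
      fix T assume T: "T \<in> standard_tableaux lam"
      have bij: "bij_betw T ?C {1..n}" using T sm unfolding standard_tableaux_def cells_eq by auto
      have ge: "1 \<le> T c" if "c \<in> ?C" for c using bij that unfolding bij_betw_def by auto
      have bij': "bij_betw (\<lambda>c. T c - 1) ?C {..<n}"
      proof -
        have "bij_betw (\<lambda>k. k - 1) {1..n} {..<n}"
          by (rule bij_betw_byWitness[where f'=Suc]) auto
        from bij_betw_trans[OF bij this] show ?thesis by (simp add: o_def)
      qed
      have "image_mset (restrict (\<lambda>c. T c - 1) ?C) (mset_set ?C) = ?m"
        unfolding image_restrict[OF fC] using bij' by (simp add: image_mset_mset_set bij_betw_def)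
      moreover have "restrict (\<lambda>c. T c - 1) ?C \<in> ssyt ?p"
      proof -
        have "T (i, j) - 1 < T (i', j) - 1" if "(i, j) \<in> ?C" "(i', j) \<in> ?C" "i < i'" for i i' j
        proof -
          have "T (i, j) < T (i', j)" using T that unfolding standard_tableaux_def cells_eq by auto
          then show ?thesis using ge[OF that(1)] by simp
        qed
        moreover have "T (i, j) - 1 \<le> T (i, j') - 1" if "(i, j) \<in> ?C" "(i, j') \<in> ?C" "j < j'" for i j j'
        proof -
          have "T (i, j) < T (i, j')" using T that unfolding standard_tableaux_def cells_eq by auto
          then show ?thesis by simp
        qed
        ultimately show ?thesis unfolding ssyt_def by auto
      qed
      ultimately show "restrict (\<lambda>c. T c - 1) ?C \<in> tabs ?p ?m" unfolding tabs_def by auto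
    qed
    show "(\<lambda>T. restrict (\<lambda>c. Suc (T c)) ?C) ` tabs ?p ?m \<subseteq> standard_tableaux lam"
    proof safe
      fix T assume T: "T \<in> tabs ?p ?m"
      have im: "T ` ?C = {..<n}"
      proof -
        have "set_mset (image_mset T (mset_set ?C)) = set_mset ?m" using T unfolding tabs_def by auto
        then show ?thesis using fC by simp
      qed
      have inj: "inj_on T ?C"
        by (rule eq_card_imp_inj_on[OF fC]) (use im sz in \<open>simp add: part_size_def\<close>)
      have bij: "bij_betw (restrict (\<lambda>c. Suc (T c)) ?C) ?C {1..n}"
        unfolding bij_betw_def
      proof
        show "inj_on (restrict (\<lambda>c. Suc (T c)) ?C) ?C" using inj by (auto simp: inj_on_def)
        have "restrict (\<lambda>c. Suc (T c)) ?C ` ?C = Suc ` (T ` ?C)" by (auto simp: image_image)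
        then show "restrict (\<lambda>c. Suc (T c)) ?C ` ?C = {1..n}" unfolding im
          by (simp add: lessThan_atLeast0 image_Suc_atLeastLessThan atLeastLessThanSuc_atLeastAtMost)
      qed
      have row: "T (i, j) < T (i, j')" if "(i, j) \<in> ?C" "(i, j') \<in> ?C" "j < j'" for i j j'
      proof -
        have "T (i, j) \<le> T (i, j')" using T that unfolding tabs_def ssyt_def by auto
        moreover have "T (i, j) \<noteq> T (i, j')" using inj that by (auto dest: inj_onD)
        ultimately show ?thesis by simp
      qed
      show "restrict (\<lambda>c. Suc (T c)) ?C \<in> standard_tableaux lam"
        unfolding standard_tableaux_def cells_eq sm using bij row T unfolding tabs_def ssyt_def by auto
    qed
  qed
  then have "dim_partition lam = kostka ?p ?m"
    unfolding dim_partition_def kostka_def by (rule bij_betw_same_card)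
  also have "\<dots> = kostka_comp (map (count ?m) (rev [0..<n])) ?p" by (rule kostka_kostka_comp[OF p]) auto
  also have "map (count ?m) (rev [0..<n]) = replicate n 1"
    by (rule replicate_eqI[symmetric, THEN sym]) auto
  finally show "dim_partition lam = dim_shape n ?p" .
qed

section \<open>Symmetric functions\<close>

abbreviation Sym :: "series set" where "Sym \<equiv> symmetric_functions"

definition degree_le :: "nat \<Rightarrow> series \<Rightarrow> bool" where
  "degree_le d f \<longleftrightarrow> (\<forall>m. f m \<noteq> 0 \<longrightarrow> size m \<le> d)"

lemma Sym_iff: "f \<in> Sym \<longleftrightarrow> (\<forall>\<pi> m. bij \<pi> \<longrightarrow> f (image_mset \<pi> m) = f m) \<and> (\<exists>d. degree_le d f)"
  unfolding symmetric_functions_def degree_le_def by auto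

lemma Sym_bij: "f \<in> Sym \<Longrightarrow> bij \<pi> \<Longrightarrow> f (image_mset \<pi> m) = f m"
  unfolding Sym_iff by auto

lemma Sym_deg: "f \<in> Sym \<Longrightarrow> \<exists>d. degree_le d f" unfolding Sym_iff by auto

lemma SymI: "(\<And>\<pi> m. bij \<pi> \<Longrightarrow> f (image_mset \<pi> m) = f m) \<Longrightarrow> degree_le d f \<Longrightarrow> f \<in> Sym"
  unfolding Sym_iff by auto

lemma deg_leD: "degree_le d f \<Longrightarrow> size m > d \<Longrightarrow> f m = 0"
  unfolding degree_le_def by (meson not_le)

lemma degree_le_mono: "degree_le d f \<Longrightarrow> d \<le> e \<Longrightarrow> degree_le e f"
  unfolding degree_le_def by (meson order_trans)

text \<open>Symmetry is only assumed for permutations of all variables; this upgrades it to injections of the finitely many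
  variables of a monomial.\<close>
lemma extend_bij: fixes h :: "'a \<Rightarrow> 'a" assumes "finite A" "inj_on h A"
  shows "\<exists>\<pi>. bij \<pi> \<and> (\<forall>a\<in>A. \<pi> a = h a)"
  using assms
proof (induction A)
  case empty show ?case using bij_id by auto
next
  case (insert a A)
  then obtain \<pi> where \<pi>: "bij \<pi>" "\<And>b. b \<in> A \<Longrightarrow> \<pi> b = h b" by auto
  let ?r = "Transposition.transpose (\<pi> a) (h a) \<circ> \<pi>"
  have "bij ?r" using \<pi>(1) by (intro bij_comp) auto
  moreover have "?r b = h b" if b: "b \<in> insert a A" for b
  proof (cases "b = a")
    case False
    then have "b \<in> A" using b by auto
    moreover have "\<pi> b \<noteq> \<pi> a" using False \<pi>(1) by (auto simp: bij_def inj_eq)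
    moreover have "h b \<noteq> h a" using insert.prems insert.hyps False b by (auto simp: inj_on_def)
    ultimately show ?thesis using \<pi>(2) by (simp add: transpose_apply_other)
  qed simp
  ultimately show ?case by blast
qed

lemma card_bij_image: "bij \<pi> \<Longrightarrow> card (\<pi> ` A) = card A"
  by (rule card_image) (rule inj_on_subset[OF bij_is_inj]; simp)

lemma Sym_inj: assumes "f \<in> Sym" "inj_on h (set_mset m)" shows "f (image_mset h m) = f m"
proof -
  obtain \<pi> where \<pi>: "bij \<pi>" "\<forall>a\<in>set_mset m. \<pi> a = h a"
    using extend_bij[OF finite_set_mset assms(2)] by blast
  have "image_mset h m = image_mset \<pi> m" by (rule image_mset_cong) (use \<pi> in auto)
  then show ?thesis using Sym_bij[OF assms(1) \<pi>(1)] by simp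
qed

lemma degree_le_one: "degree_le 0 series_one" unfolding degree_le_def series_one_def by auto

lemma Sym_one: "series_one \<in> Sym"
  by (rule SymI[OF _ degree_le_one]) (simp add: series_one_def)

lemma degree_le_add: "degree_le d f \<Longrightarrow> degree_le d g \<Longrightarrow> degree_le d (\<lambda>m. f m + g m)"
  unfolding degree_le_def by (metis add.right_neutral)

lemma degree_le_scale: "degree_le d f \<Longrightarrow> degree_le d (\<lambda>m. c * f m)"
  unfolding degree_le_def by auto

lemma Sym_scale: "f \<in> Sym \<Longrightarrow> (\<lambda>m. c * f m) \<in> Sym"
  unfolding Sym_iff using degree_le_scale by fastforce

lemma Sym_add: assumes "f \<in> Sym" "g \<in> Sym" shows "(\<lambda>m. f m + g m) \<in> Sym"
proof -
  obtain d e where "degree_le d f" "degree_le e g" using assms Sym_deg by blast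
  then have "degree_le (max d e) (\<lambda>m. f m + g m)" by (intro degree_le_add) (auto elim: degree_le_mono)
  then show ?thesis by (rule SymI[rotated]) (simp add: Sym_bij assms)
qed

lemma Sym_diff: assumes "f \<in> Sym" "g \<in> Sym" shows "(\<lambda>m. f m - g m) \<in> Sym"
  using Sym_add[OF assms(1) Sym_scale[OF assms(2), of "-1"]] by simp

lemma degree_le_power_sum: "degree_le k (power_sum k)" unfolding degree_le_def power_sum_def by auto

lemma Sym_power_sum: "power_sum k \<in> Sym"
proof (rule SymI[OF _ degree_le_power_sum])
  fix \<pi> :: "nat \<Rightarrow> nat" and m assume b: "bij \<pi>"
  have "(\<exists>i. image_mset \<pi> m = replicate_mset k i) \<longleftrightarrow> (\<exists>i. m = replicate_mset k i)"
  proof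
    assume "\<exists>i. image_mset \<pi> m = replicate_mset k i"
    then obtain i where "image_mset \<pi> m = replicate_mset k i" by auto
    then have "image_mset (inv \<pi>) (image_mset \<pi> m) = image_mset (inv \<pi>) (replicate_mset k i)" by simp
    then show "\<exists>i. m = replicate_mset k i"
      using b by (auto simp: image_mset.compositionality bij_is_inj)
  qed auto
  then show "power_sum k (image_mset \<pi> m) = power_sum k m" unfolding power_sum_def by simp
qed

lemma finite_submsets: "finite {a. a \<subseteq># (m::nat multiset)}"
proof (rule finite_subset)
  show "{a. a \<subseteq># m} \<subseteq> (\<Union>k\<le>size m. multisets_of_size (set_mset m) k)"
    using set_mset_mono by (fastforce simp: multisets_of_size_def size_mset_mono)
qed (intro finite_UN_I finite_multisets_of_size; simp)

lemma degree_le_mult: assumes "degree_le d f" "degree_le e g" shows "degree_le (d + e) (series_mult f g)"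
  unfolding degree_le_def
proof (intro allI impI)
  fix m assume "series_mult f g m \<noteq> 0"
  then obtain a where a: "a \<subseteq># m" "f a \<noteq> 0" "g (m - a) \<noteq> 0"
    unfolding series_mult_def by (auto elim!: sum.not_neutral_contains_not_neutral)
  then have "size a \<le> d" "size (m - a) \<le> e" using assms unfolding degree_le_def by auto
  then show "size m \<le> d + e" using a(1) by (simp add: size_Diff_submset size_mset_mono)
qed

lemma Sym_mult: assumes "f \<in> Sym" "g \<in> Sym" shows "series_mult f g \<in> Sym"
proof -
  obtain d e where "degree_le d f" "degree_le e g" using assms Sym_deg by blast
  from degree_le_mult[OF this] show ?thesis
  proof (rule SymI[rotated])
    fix \<pi> :: "nat \<Rightarrow> nat" and m assume b: "bij \<pi>"
    have i: "image_mset (inv \<pi>) (image_mset \<pi> a) = a" "image_mset \<pi> (image_mset (inv \<pi>) a) = a" for a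
      using b by (simp_all add: image_mset.compositionality bij_is_inj surj_iff[THEN iffD1] bij_is_surj)
    show "series_mult f g (image_mset \<pi> m) = series_mult f g m"
      unfolding series_mult_def
    proof (rule sum.reindex_bij_witness[where i="image_mset \<pi>" and j="image_mset (inv \<pi>)"], goal_cases)
      case (2 a) then show ?case using image_mset_subseteq_mono[of a "image_mset \<pi> m" "inv \<pi>"] i(1) by simp
    next
      case (5 a)
      then have s: "image_mset (inv \<pi>) a \<subseteq># m"
        using image_mset_subseteq_mono[of a "image_mset \<pi> m" "inv \<pi>"] i(1) by simp
      have "f (image_mset (inv \<pi>) a) = f a"
        using Sym_bij[OF assms(1) b, of "image_mset (inv \<pi>) a"] i(2) by simp
      moreover have "g (m - image_mset (inv \<pi>) a) = g (image_mset \<pi> m - a)"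
        using Sym_bij[OF assms(2) b, of "m - image_mset (inv \<pi>) a"] i(2) by (simp add: image_mset_Diff[OF s])
      ultimately show ?case by simp
    qed (auto simp: i image_mset_subseteq_mono)
  qed
qed

definition schurf :: "shape \<Rightarrow> series" where "schurf p = (\<lambda>m. of_nat (kostka p m))"

lemma schur_schurf: "schur lam = schurf (row_part lam)"
  unfolding schurf_def by (rule ext) (rule schur_kostka)

lemma Sym_schurf: assumes "is_part p" shows "schurf p \<in> Sym"
proof (rule SymI)
  show "degree_le (part_size p) (schurf p)" unfolding degree_le_def schurf_def using kostka_size[of p] by auto
  fix \<pi> :: "nat \<Rightarrow> nat" and m assume "bij \<pi>"
  then show "schurf p (image_mset \<pi> m) = schurf p m"
    unfolding schurf_def using kostka_multiplicities[OF assms multiplicities_image] by (metis bij_is_inj)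
qed

lemma schurf_empty: "is_part p \<Longrightarrow> schurf p {#} = (if p = (\<lambda>_. 0) then 1 else 0)"
  unfolding schurf_def using kostka_kostka_comp[of p "{#}" 0] by simp

section \<open>Power sums generate the symmetric functions\<close>

text \<open>Orbits of monomials under permutations of the variables index the basis of orbit sums.\<close>
definition same_orbit :: "nat multiset \<Rightarrow> nat multiset \<Rightarrow> bool" where
  "same_orbit a b \<longleftrightarrow> (\<exists>\<pi>. bij \<pi> \<and> image_mset \<pi> a = b)"

definition orbit_sum :: "nat multiset \<Rightarrow> series" where
  "orbit_sum a m = (if same_orbit a m then 1 else 0)"

lemma same_orbit_refl: "same_orbit a a" unfolding same_orbit_def by (rule exI[of _ id]) auto

lemma same_orbit_image: assumes "bij \<pi>" shows "same_orbit a (image_mset \<pi> b) \<longleftrightarrow> same_orbit a b"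
proof
  assume "same_orbit a b"
  then obtain \<sigma> where "bij \<sigma>" "image_mset \<sigma> a = b" unfolding same_orbit_def by auto
  then show "same_orbit a (image_mset \<pi> b)" unfolding same_orbit_def
    by (intro exI[of _ "\<pi> \<circ> \<sigma>"]) (auto simp: assms bij_comp image_mset.compositionality)
next
  assume "same_orbit a (image_mset \<pi> b)"
  then obtain \<sigma> where \<sigma>: "bij \<sigma>" "image_mset \<sigma> a = image_mset \<pi> b" unfolding same_orbit_def by auto
  have "image_mset (inv \<pi> \<circ> \<sigma>) a = image_mset (inv \<pi>) (image_mset \<pi> b)"
    using \<sigma>(2) by (simp add: image_mset.compositionality[symmetric])
  also have "\<dots> = b" using assms by (simp add: image_mset.compositionality bij_is_inj)
  finally show "same_orbit a b" unfolding same_orbit_def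
    by (intro exI[of _ "inv \<pi> \<circ> \<sigma>"]) (auto simp: assms bij_comp \<sigma>(1) bij_imp_bij_inv)
qed

lemma same_orbit_size: "same_orbit a b \<Longrightarrow> size b = size a" unfolding same_orbit_def by auto

lemma same_orbit_card: "same_orbit a b \<Longrightarrow> card (set_mset b) = card (set_mset a)"
  unfolding same_orbit_def by (auto simp: card_bij_image)

lemma Sym_orbit_sum: "orbit_sum a \<in> Sym"
proof (rule SymI)
  show "degree_le (size a) (orbit_sum a)" unfolding degree_le_def orbit_sum_def by (auto simp: same_orbit_size)
qed (simp add: orbit_sum_def same_orbit_image)

lemma Sym_same_orbit: "f \<in> Sym \<Longrightarrow> same_orbit a b \<Longrightarrow> f b = f a"
  unfolding same_orbit_def using Sym_bij by blast

text \<open>In bounded degree there are finitely many orbits, since each has a member in finitely many fixed variables.\<close>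
lemma small_representative: assumes "size m \<le> d"
  obtains a where "same_orbit a m" "set_mset a \<subseteq> {..<d}"
proof -
  have c: "card (set_mset m) \<le> d" using assms by (metis card_mono finite_set_mset mset_set_set_mset_msubset order_trans size_mset_mono size_mset_set)
  obtain h where h: "h ` set_mset m \<subseteq> {..<d}" "inj_on h (set_mset m)"
    using card_le_inj[of "set_mset m" "{..<d}"] c by auto
  obtain \<pi> where \<pi>: "bij \<pi>" "\<forall>x\<in>set_mset m. \<pi> x = h x" using extend_bij[OF finite_set_mset h(2)] by blast
  have "same_orbit (image_mset \<pi> m) m" unfolding same_orbit_def
    by (intro exI[of _ "inv \<pi>"]) (auto simp: \<pi>(1) bij_imp_bij_inv image_mset.compositionality bij_is_inj)
  moreover have "set_mset (image_mset \<pi> m) \<subseteq> {..<d}" using \<pi>(2) h(1) by auto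
  ultimately show thesis by (rule that)
qed

text \<open>Subtracting a multiple of an orbit sum clears one orbit from the support; the finitely many monomials in
  the first \<open>d\<close> variables measure the progress.\<close>
lemma Sym_orbit_induct:
  assumes P0: "P (\<lambda>_. 0)"
    and P_add: "\<And>f g. f \<in> Sym \<Longrightarrow> g \<in> Sym \<Longrightarrow> P f \<Longrightarrow> P g \<Longrightarrow> P (\<lambda>m. f m + g m)"
    and P_scale: "\<And>f c. f \<in> Sym \<Longrightarrow> P f \<Longrightarrow> P (\<lambda>m. c * f m)"
    and P_mono: "\<And>a. card (set_mset a) = l \<Longrightarrow> P (orbit_sum a)"
    and f: "f \<in> Sym" "\<And>m. f m \<noteq> 0 \<Longrightarrow> card (set_mset m) = l"
  shows "P f"
proof -
  obtain d where d: "degree_le d f" using Sym_deg[OF f(1)] by blast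
  define R where "R = (\<lambda>f::series. {m. set_mset m \<subseteq> {..<d} \<and> size m \<le> d \<and> f m \<noteq> 0})"
  have fin: "finite (R f)" for f
  proof (rule finite_subset)
    show "R f \<subseteq> (\<Union>k\<le>d. multisets_of_size {..<d} k)"
      by (auto simp: R_def multisets_of_size_def)
  qed (intro finite_UN_I finite_multisets_of_size; simp)
  show ?thesis using f d
  proof (induction "card (R f)" arbitrary: f rule: less_induct)
    case less
    show ?case
    proof (cases "f = (\<lambda>_. 0)")
      case True then show ?thesis using P0 by simp
    next
      case False
      then obtain m where m: "f m \<noteq> 0" by auto
      then have "size m \<le> d" using less.prems(3) unfolding degree_le_def by auto
      then obtain a where a: "same_orbit a m" "set_mset a \<subseteq> {..<d}" by (rule small_representative)
      have fa: "f a \<noteq> 0" using m Sym_same_orbit[OF less.prems(1) a(1)] by simp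
      have sa: "size a \<le> d" using fa less.prems(3) unfolding degree_le_def by auto
      define g where "g = (\<lambda>m. f m + (- f a) * orbit_sum a m)"
      have gS: "g \<in> Sym" unfolding g_def by (intro Sym_add Sym_scale Sym_orbit_sum less.prems(1))
      have gz: "g m \<noteq> 0 \<Longrightarrow> f m \<noteq> 0" for m
        unfolding g_def orbit_sum_def using Sym_same_orbit[OF less.prems(1)] by (auto split: if_splits)
      have "g a = 0" unfolding g_def orbit_sum_def by (simp add: same_orbit_refl)
      then have "R g \<subset> R f" using gz fa a(2) sa unfolding R_def by blast
      then have "card (R g) < card (R f)" by (rule psubset_card_mono[OF fin])
      moreover have "degree_le d g" using less.prems(3) gz unfolding degree_le_def by blast
      ultimately have "P g" using less.hyps gS less.prems(2) gz by blast
      moreover have "P (orbit_sum a)" by (rule P_mono) (rule less.prems(2)[OF fa])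
      ultimately have "P (\<lambda>m. g m + f a * orbit_sum a m)"
        by (intro P_add P_scale gS Sym_scale Sym_orbit_sum)
      then show ?thesis unfolding g_def by simp
    qed
  qed
qed

lemma mono_power_mult:
  "series_mult (orbit_sum a) (power_sum k) m = of_nat (card {b. b \<subseteq># m \<and> same_orbit a b \<and> (\<exists>i. m - b = replicate_mset k i)})"
proof -
  have "series_mult (orbit_sum a) (power_sum k) m =
    (\<Sum>b | b \<subseteq># m. if same_orbit a b \<and> (\<exists>i. m - b = replicate_mset k i) then 1 else 0)"
    unfolding series_mult_def orbit_sum_def power_sum_def by (intro sum.cong) auto
  also have "\<dots> = (\<Sum>b | b \<subseteq># m \<and> (same_orbit a b \<and> (\<exists>i. m - b = replicate_mset k i)). 1)"
    by (subst sum.inter_filter[symmetric]) (auto simp: finite_submsets)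
  finally show ?thesis by simp
qed

text \<open>The algebra of symmetric functions is generated by power sums. By induction on the number of variables in a
  monomial: multiplying the orbit sum of \<open>n\<^sub>0\<close> by \<open>power_sum k\<close> either introduces a new variable with exponent \<open>k\<close>, which
  gives a positive multiple of the orbit sum of \<open>n\<^sub>0 + k\<close>, or raises an exponent, which leaves the number of
  variables unchanged and is covered by the induction hypothesis.\<close>
lemma Sym_induct [consumes 1, case_names one power add scale mult]:
  assumes f: "f \<in> Sym"
    and P1: "P series_one"
    and P_power: "\<And>k. k \<ge> 1 \<Longrightarrow> P (power_sum k)"
    and P_add: "\<And>f g. f \<in> Sym \<Longrightarrow> g \<in> Sym \<Longrightarrow> P f \<Longrightarrow> P g \<Longrightarrow> P (\<lambda>m. f m + g m)"
    and P_scale: "\<And>f c. f \<in> Sym \<Longrightarrow> P f \<Longrightarrow> P (\<lambda>m. c * f m)"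
    and P_mult: "\<And>f g. f \<in> Sym \<Longrightarrow> g \<in> Sym \<Longrightarrow> P f \<Longrightarrow> P g \<Longrightarrow> P (series_mult f g)"
  shows "P f"
proof -
  have P0: "P (\<lambda>_. 0)" using P_scale[OF Sym_one P1, of 0] by simp
  have Pm: "P (orbit_sum a)" if "card (set_mset a) = l" for a l
    using that
  proof (induction l arbitrary: a)
    case 0
    then have "a = {#}" by simp
    then have "orbit_sum a = series_one" unfolding orbit_sum_def same_orbit_def series_one_def using bij_id by (intro ext) auto
    then show ?case using P1 by simp
  next
    case (Suc l)
    then obtain i where i: "i \<in># a" by (metis card.empty finite_set_mset multiset_nonemptyE nat.distinct(1) set_mset_empty)
    \<comment> \<open>Splitting off all copies of one variable lowers the number of variables by one.\<close>
    define n0 where "n0 = filter_mset (\<lambda>x. x \<noteq> i) a"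
    define k where "k = count a i"
    have a: "a = n0 + replicate_mset k i" unfolding n0_def k_def
      by (rule multiset_eqI) auto
    have k: "k \<ge> 1" using i unfolding k_def by (simp add: Suc_le_eq)
    have i0: "i \<notin># n0" unfolding n0_def by simp
    have "set_mset a = insert i (set_mset n0)" using a k by auto
    then have c0: "card (set_mset n0) = l" using Suc.prems i0 by simp
    define F where "F = series_mult (orbit_sum n0) (power_sum k)"
    have FS: "F \<in> Sym" unfolding F_def by (intro Sym_mult Sym_orbit_sum Sym_power_sum)
    have PF: "P F" unfolding F_def
      by (intro P_mult Sym_orbit_sum Sym_power_sum Suc.IH c0 P_power k)
    have "n0 \<in> {b. b \<subseteq># a \<and> same_orbit n0 b \<and> (\<exists>i. a - b = replicate_mset k i)}"
      using a same_orbit_refl by auto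
    moreover have "finite {b. b \<subseteq># a \<and> same_orbit n0 b \<and> (\<exists>i. a - b = replicate_mset k i)}"
      by (rule finite_subset[OF _ finite_submsets[of a]]) auto
    ultimately have "card {b. b \<subseteq># a \<and> same_orbit n0 b \<and> (\<exists>i. a - b = replicate_mset k i)} \<noteq> 0"
      by auto
    then have Fa: "F a \<noteq> 0" unfolding F_def mono_power_mult of_nat_eq_0_iff .
    define g where "g = (\<lambda>m. F m + (- F a) * orbit_sum a m)"
    have gS: "g \<in> Sym" unfolding g_def by (intro Sym_add Sym_scale Sym_orbit_sum FS)
    have gl: "card (set_mset m) = l" if gm: "g m \<noteq> 0" for m
    proof -
      have no: "\<not> same_orbit a m"
        using gm Sym_same_orbit[OF FS, of a m] unfolding g_def orbit_sum_def by (auto split: if_splits)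
      then have "F m \<noteq> 0" using gm unfolding g_def orbit_sum_def by simp
      then have "{b. b \<subseteq># m \<and> same_orbit n0 b \<and> (\<exists>i. m - b = replicate_mset k i)} \<noteq> {}"
        unfolding F_def mono_power_mult by (metis card.empty of_nat_0)
      then obtain b j where b: "b \<subseteq># m" "same_orbit n0 b" "m - b = replicate_mset k j" by auto
      have m: "m = b + replicate_mset k j" using b(1,3) by (metis subset_mset.add_diff_inverse)
      have "j \<in># b"
      proof (rule ccontr)
        assume j: "j \<notin># b"
        obtain \<pi> where \<pi>: "bij \<pi>" "image_mset \<pi> n0 = b" using b(2) unfolding same_orbit_def by auto
        have "inj_on (\<pi>(i := j)) (set_mset a)"
        proof (rule inj_onI)
          fix x y assume xy: "x \<in> set_mset a" "y \<in> set_mset a" "(\<pi>(i := j)) x = (\<pi>(i := j)) y"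
          have nj: "\<pi> z \<noteq> j" if "z \<in># a" "z \<noteq> i" for z
          proof -
            have "z \<in># n0" using that unfolding n0_def by simp
            then have "\<pi> z \<in># b" using \<pi>(2) by auto
            then show ?thesis using j by auto
          qed
          show "x = y" using xy nj[of x] nj[of y] \<pi>(1) by (auto simp: bij_def inj_eq split: if_splits)
        qed
        then obtain \<rho> where \<rho>: "bij \<rho>" "\<forall>x\<in>set_mset a. \<rho> x = (\<pi>(i := j)) x"
          using extend_bij[OF finite_set_mset] by blast
        have "image_mset \<rho> a = image_mset (\<pi>(i := j)) a" by (rule image_mset_cong) (use \<rho> in auto)
        also have "\<dots> = image_mset (\<pi>(i := j)) n0 + replicate_mset k j" by (subst a) simp
        also have "image_mset (\<pi>(i := j)) n0 = image_mset \<pi> n0" by (rule image_mset_cong) (use i0 in auto)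
        finally have "image_mset \<rho> a = m" using \<pi>(2) m by simp
        then show False using no \<rho>(1) unfolding same_orbit_def by blast
      qed
      then have "set_mset m = set_mset b" unfolding m by auto
      then show ?thesis using same_orbit_card[OF b(2)] c0 by simp
    qed
    have "P g" by (rule Sym_orbit_induct[OF P0 P_add P_scale Suc.IH gS gl])
    then have "P (\<lambda>m. F m + (- 1) * g m)" by (intro P_add P_scale PF FS gS Sym_scale)
    then have "P (\<lambda>m. (1 / F a) * (F m + (- 1) * g m))"
      by (intro P_scale Sym_add FS Sym_scale gS)
    moreover have "(\<lambda>m. (1 / F a) * (F m + (- 1) * g m)) = orbit_sum a"
      unfolding g_def using Fa by auto
    ultimately show ?case by simp
  qed
  \<comment> \<open>Any symmetric function is the sum of its parts supported on monomials with exactly \<open>l\<close> variables.\<close>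
  obtain d where d: "degree_le d f" using Sym_deg[OF f] by blast
  define h where "h = (\<lambda>l m. if card (set_mset m) = l then f m else 0)"
  have hS: "h l \<in> Sym" for l
  proof (rule SymI)
    show "degree_le d (h l)" using d unfolding degree_le_def h_def by auto
    show "h l (image_mset \<pi> m) = h l m" if "bij \<pi>" for \<pi> m
      using that Sym_bij[OF f that] unfolding h_def by (simp add: card_bij_image)
  qed
  have Ph: "P (h l)" for l
    by (rule Sym_orbit_induct[OF P0 P_add P_scale Pm hS]) (auto simp: h_def split: if_splits)
  have "P (\<lambda>m. \<Sum>l\<in>A. h l m) \<and> (\<lambda>m. \<Sum>l\<in>A. h l m) \<in> Sym" if "finite A" for A
    using that
  proof (induction A)
    case empty
    show ?case using P0 Sym_scale[OF Sym_one, of 0] by simp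
  next
    case (insert l A)
    then show ?case using P_add[OF hS _ Ph, of "\<lambda>m. \<Sum>l\<in>A. h l m" l] Sym_add[OF hS, of _ l] by simp
  qed
  then have "P (\<lambda>m. \<Sum>l\<le>d. h l m)" by simp
  moreover have "(\<lambda>m. \<Sum>l\<le>d. h l m) = f"
  proof
    fix m
    show "(\<Sum>l\<le>d. h l m) = f m"
    proof (cases "f m = 0")
      case False
      then have "size m \<le> d" using d unfolding degree_le_def by auto
      moreover have "card (set_mset m) \<le> size m"
        by (metis mset_set_set_mset_msubset size_mset_mono size_mset_set)
      ultimately show ?thesis unfolding h_def by simp
    qed (simp add: h_def)
  qed
  ultimately show ?thesis by simp
qed

section \<open>Adjoining a variable to a specialization\<close>

text \<open>All variables move up by one, and the new variable \<open>0\<close> gets exponent \<open>j\<close>.\<close>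
definition insert_var :: "nat \<Rightarrow> nat multiset \<Rightarrow> nat multiset" where
  "insert_var j m = image_mset Suc m + replicate_mset j 0"

text \<open>The symmetric series evaluated with one of its variables replaced by the number \<open>x\<close>. For a symmetric function the
  summation range is finite; this way of writing it does not depend on a choice of degree bound.\<close>
definition adjoin :: "complex \<Rightarrow> series \<Rightarrow> series" where
  "adjoin x f m = (\<Sum>j | f (insert_var j m) \<noteq> 0. x ^ j * f (insert_var j m))"

lemma count_insert_var [simp]: "count (insert_var j m) 0 = j" "count (insert_var j m) (Suc i) = count m i"
  unfolding insert_var_def using count_image_inj[of Suc m i] by (auto simp: not_in_iff[symmetric])

lemma insert_var_eqI: "count a 0 = j \<Longrightarrow> (\<And>i. count a (Suc i) = count m i) \<Longrightarrow> a = insert_var j m"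
  by (rule multiset_eqI) (metis count_insert_var not0_implies_Suc)

lemma size_insert_var [simp]: "size (insert_var j m) = size m + j" unfolding insert_var_def by simp

lemma insert_var_diff: "insert_var j m - insert_var i a = insert_var (j - i) (m - a)"
  by (rule insert_var_eqI) auto

lemma insert_var_subset: "insert_var i a \<subseteq># insert_var j m \<longleftrightarrow> i \<le> j \<and> a \<subseteq># m"
proof -
  have "insert_var i a \<subseteq># insert_var j m \<longleftrightarrow> (\<forall>x. count (insert_var i a) x \<le> count (insert_var j m) x)"
    by (simp add: subseteq_mset_def)
  also have "\<dots> \<longleftrightarrow> i \<le> j \<and> (\<forall>x. count a x \<le> count m x)"
    by (metis count_insert_var not0_implies_Suc)
  finally show ?thesis by (simp add: subseteq_mset_def)
qed

lemma insert_var_inj: "insert_var i a = insert_var j b \<longleftrightarrow> i = j \<and> a = b"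
  by (metis count_insert_var multiset_eqI)

lemma insert_var_ex: "\<exists>m. a = insert_var (count a 0) m"
proof -
  have "a = insert_var (count a 0) (image_mset (\<lambda>x. x - 1) (filter_mset (\<lambda>x. x > 0) a))"
  proof -
    have "image_mset Suc (image_mset (\<lambda>x. x - 1) (filter_mset (\<lambda>x. x > 0) a)) = image_mset id (filter_mset (\<lambda>x. x > 0) a)"
      unfolding image_mset.compositionality by (rule image_mset_cong) auto
    then show ?thesis unfolding insert_var_def by (intro multiset_eqI) auto
  qed
  then show ?thesis by blast
qed

text \<open>A divisor of a monomial splits into its part in the new variable and its part in the others.\<close>
lemma series_mult_insert_var:
  "series_mult f g (insert_var j m) = (\<Sum>i\<le>j. \<Sum>a | a \<subseteq># m. f (insert_var i a) * g (insert_var (j - i) (m - a)))"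
proof -
  have "series_mult f g (insert_var j m) = (\<Sum>(i, a)\<in>{..j} \<times> {a. a \<subseteq># m}. f (insert_var i a) * g (insert_var (j - i) (m - a)))"
    unfolding series_mult_def
  proof (rule sum.reindex_bij_betw[symmetric, THEN trans, rotated])
    show "bij_betw (\<lambda>(i, a). insert_var i a) ({..j} \<times> {a. a \<subseteq># m}) {a. a \<subseteq># insert_var j m}"
      unfolding bij_betw_def
    proof
      show "inj_on (\<lambda>(i, a). insert_var i a) ({..j} \<times> {a. a \<subseteq># m})" by (auto simp: inj_on_def insert_var_inj)
      show "(\<lambda>(i, a). insert_var i a) ` ({..j} \<times> {a. a \<subseteq># m}) = {a. a \<subseteq># insert_var j m}"
      proof (intro equalityI subsetI)
        fix a assume a: "a \<in> {a. a \<subseteq># insert_var j m}"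
        obtain b where b: "a = insert_var (count a 0) b" using insert_var_ex by blast
        then have "count a 0 \<le> j \<and> b \<subseteq># m" using a insert_var_subset by (metis mem_Collect_eq)
        then show "a \<in> (\<lambda>(i, a). insert_var i a) ` ({..j} \<times> {a. a \<subseteq># m})" using b
          by (intro image_eqI[of _ _ "(count a 0, b)"]) auto
      qed (auto simp: insert_var_subset)
    qed
  qed (auto intro!: sum.cong simp: insert_var_diff)
  then show ?thesis by (simp add: sum.cartesian_product)
qed

lemma adjoin_eq: assumes "degree_le d f" shows "adjoin x f m = (\<Sum>j\<le>d. x ^ j * f (insert_var j m))"
  unfolding adjoin_def
proof (rule sum.mono_neutral_left)
  show "{j. f (insert_var j m) \<noteq> 0} \<subseteq> {..d}" using assms unfolding degree_le_def by fastforce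
qed auto

lemma degree_le_adjoin: assumes "degree_le d f" shows "degree_le d (adjoin x f)"
  unfolding degree_le_def adjoin_eq[OF assms]
proof (intro allI impI)
  fix m assume "(\<Sum>j\<le>d. x ^ j * f (insert_var j m)) \<noteq> 0"
  then obtain j where "f (insert_var j m) \<noteq> 0" by (auto elim!: sum.not_neutral_contains_not_neutral)
  then show "size m \<le> d" using assms unfolding degree_le_def by fastforce
qed

lemma Sym_adjoin: assumes "f \<in> Sym" shows "adjoin x f \<in> Sym"
proof -
  obtain d where d: "degree_le d f" using Sym_deg[OF assms] by blast
  show ?thesis
  proof (rule SymI[OF _ degree_le_adjoin[OF d]])
    fix \<pi> :: "nat \<Rightarrow> nat" and m assume b: "bij \<pi>"
    define \<rho> where "\<rho> = (\<lambda>i. case i of 0 \<Rightarrow> 0 | Suc i \<Rightarrow> Suc (\<pi> i))"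
    have inj: "inj \<rho>"
    proof (rule injI)
      fix u v assume "\<rho> u = \<rho> v"
      then show "u = v" using injD[OF bij_is_inj[OF b]] by (cases u; cases v) (auto simp: \<rho>_def)
    qed
    have sh: "insert_var j (image_mset \<pi> m) = image_mset \<rho> (insert_var j m)" for j
      unfolding insert_var_def by (simp add: image_mset.compositionality o_def \<rho>_def)
    have "f (insert_var j (image_mset \<pi> m)) = f (insert_var j m)" for j
      unfolding sh by (rule Sym_inj[OF assms]) (rule inj_on_subset[OF inj]; simp)
    then show "adjoin x f (image_mset \<pi> m) = adjoin x f m" unfolding adjoin_def by simp
  qed
qed

lemma adjoin_one: "adjoin x series_one = series_one"
  by (rule ext) (simp add: adjoin_eq[OF degree_le_one], simp add: series_one_def insert_var_def)

lemma adjoin_add: assumes "f \<in> Sym" "g \<in> Sym"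
  shows "adjoin x (\<lambda>m. f m + g m) = (\<lambda>m. adjoin x f m + adjoin x g m)"
proof -
  obtain d e where "degree_le d f" "degree_le e g" using assms Sym_deg by blast
  then have 1: "degree_le (max d e) f" "degree_le (max d e) g" by (auto elim: degree_le_mono)
  show ?thesis
    by (rule ext) (simp add: adjoin_eq[OF 1(1)] adjoin_eq[OF 1(2)] adjoin_eq[OF degree_le_add[OF 1]] sum.distrib algebra_simps)
qed

lemma adjoin_scale: assumes "f \<in> Sym" shows "adjoin x (\<lambda>m. c * f m) = (\<lambda>m. c * adjoin x f m)"
proof -
  obtain d where 1: "degree_le d f" using assms Sym_deg by blast
  show ?thesis
    by (rule ext) (simp add: adjoin_eq[OF 1(1)] adjoin_eq[OF degree_le_scale[OF 1]] sum_distrib_left algebra_simps)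
qed

lemma adjoin_mult: assumes "f \<in> Sym" "g \<in> Sym"
  shows "adjoin x (series_mult f g) = series_mult (adjoin x f) (adjoin x g)"
proof
  fix m
  obtain d e where d: "degree_le d f" and e: "degree_le e g" using assms Sym_deg by blast
  have "adjoin x (series_mult f g) m = (\<Sum>j\<le>d+e. x ^ j * series_mult f g (insert_var j m))"
    by (rule adjoin_eq[OF degree_le_mult[OF d e]])
  also have "\<dots> = (\<Sum>j\<le>d+e. \<Sum>i\<le>j. \<Sum>a | a \<subseteq># m. f (insert_var i a) * g (insert_var (j - i) (m - a)) * x ^ j)"
    unfolding series_mult_insert_var by (simp add: sum_distrib_left mult.commute)
  also have "\<dots> = (\<Sum>a | a \<subseteq># m. \<Sum>j\<le>d+e. (\<Sum>i\<le>j. f (insert_var i a) * g (insert_var (j - i) (m - a))) * x ^ j)"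
  proof -
    have "(\<Sum>j\<le>d+e. \<Sum>i\<le>j. \<Sum>a | a \<subseteq># m. f (insert_var i a) * g (insert_var (j - i) (m - a)) * x ^ j)
      = (\<Sum>j\<le>d+e. \<Sum>a | a \<subseteq># m. \<Sum>i\<le>j. f (insert_var i a) * g (insert_var (j - i) (m - a)) * x ^ j)"
      by (intro sum.cong refl sum.swap)
    also have "\<dots> = (\<Sum>a | a \<subseteq># m. \<Sum>j\<le>d+e. \<Sum>i\<le>j. f (insert_var i a) * g (insert_var (j - i) (m - a)) * x ^ j)"
      by (rule sum.swap)
    finally show ?thesis unfolding sum_distrib_right .
  qed
  also have "\<dots> = (\<Sum>a | a \<subseteq># m. adjoin x f a * adjoin x g (m - a))"
  proof (rule sum.cong[OF refl])
    fix a
    have "(\<Sum>i\<le>d. f (insert_var i a) * x ^ i) * (\<Sum>j\<le>e. g (insert_var j (m - a)) * x ^ j)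
      = (\<Sum>j\<le>d+e. (\<Sum>i\<le>j. f (insert_var i a) * g (insert_var (j - i) (m - a))) * x ^ j)"
      by (rule polynomial_product) (auto intro: deg_leD[OF d] deg_leD[OF e])
    then show "(\<Sum>j\<le>d+e. (\<Sum>i\<le>j. f (insert_var i a) * g (insert_var (j - i) (m - a))) * x ^ j)
      = adjoin x f a * adjoin x g (m - a)"
      unfolding adjoin_eq[OF d] adjoin_eq[OF e] by (simp add: mult.commute)
  qed
  finally show "adjoin x (series_mult f g) m = series_mult (adjoin x f) (adjoin x g) m"
    unfolding series_mult_def .
qed

lemma insert_var_replicate: assumes "k \<ge> 1"
  shows "(\<exists>i. insert_var j m = replicate_mset k i) \<longleftrightarrow> (j = 0 \<and> (\<exists>i. m = replicate_mset k i)) \<or> (j = k \<and> m = {#})"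
proof
  assume "\<exists>i. insert_var j m = replicate_mset k i"
  then obtain i where i: "insert_var j m = replicate_mset k i" by blast
  show "(j = 0 \<and> (\<exists>i. m = replicate_mset k i)) \<or> (j = k \<and> m = {#})"
  proof (cases i)
    case 0
    then have "replicate_mset k i = insert_var k {#}" unfolding insert_var_def by simp
    then show ?thesis using i by (simp add: insert_var_inj)
  next
    case (Suc i')
    then have "replicate_mset k i = insert_var 0 (replicate_mset k i')" unfolding insert_var_def by simp
    then show ?thesis using i by (auto simp: insert_var_inj)
  qed
next
  assume "(j = 0 \<and> (\<exists>i. m = replicate_mset k i)) \<or> (j = k \<and> m = {#})"
  then show "\<exists>i. insert_var j m = replicate_mset k i" unfolding insert_var_def by auto
qed

lemma adjoin_power: assumes k: "k \<ge> 1"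
  shows "adjoin x (power_sum k) = (\<lambda>m. power_sum k m + x ^ k * series_one m)"
proof
  fix m
  have "adjoin x (power_sum k) m = (\<Sum>j\<le>k. x ^ j * power_sum k (insert_var j m))"
    by (rule adjoin_eq[OF degree_le_power_sum])
  also have "\<dots> = (\<Sum>j\<le>k. (if j = 0 then power_sum k m else 0) + (if j = k then x ^ k * series_one m else 0))"
  proof (rule sum.cong[OF refl])
    fix j
    have "m \<noteq> replicate_mset k i" if "m = {#}" for i using that k by auto
    then show "x ^ j * power_sum k (insert_var j m) = (if j = 0 then power_sum k m else 0) + (if j = k then x ^ k * series_one m else 0)"
      unfolding power_sum_def insert_var_replicate[OF k] series_one_def using k by auto
  qed
  also have "\<dots> = power_sum k m + x ^ k * series_one m" by (simp add: sum.distrib)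
  finally show "adjoin x (power_sum k) m = power_sum k m + x ^ k * series_one m" .
qed

text \<open>The new variable is the smallest entry of a tableau and would leave a skew shape behind; by symmetry of the
  Kostka numbers it may be removed as if it were the largest one.\<close>
lemma kostka_insert_var: assumes p: "is_part p"
  shows "kostka p (insert_var j m) = down_strip j (\<lambda>mu. kostka mu m) p"
proof -
  obtain N where N: "set_mset m \<subseteq> {..<N}" by (rule mset_bound)
  have "set_mset (insert_var j m) \<subseteq> {..<Suc N}" using N unfolding insert_var_def by auto
  then have "kostka p (insert_var j m) = kostka_comp (map (count (insert_var j m)) (rev [0..<Suc N])) p"
    by (rule kostka_kostka_comp[OF p])
  also have "[0..<Suc N] = 0 # map Suc [0..<N]" by (simp add: upt_conv_Cons map_Suc_upt del: upt_Suc)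
  also have "map (count (insert_var j m)) (rev (0 # map Suc [0..<N])) = map (count m) (rev [0..<N]) @ [j]"
    by (simp add: rev_map o_def)
  also have "kostka_comp (map (count m) (rev [0..<N]) @ [j]) p = kostka_comp (j # map (count m) (rev [0..<N])) p"
    by (rule kostka_comp_perm[OF _ p]) simp
  also have "\<dots> = down_strip j (\<lambda>mu. kostka mu m) p"
    unfolding kostka_comp.simps by (rule down_strip_cong[OF _ p]) (simp add: kostka_kostka_comp[OF _ N])
  finally show ?thesis .
qed

lemma adjoin_schurf: assumes p: "is_part p"
  shows "adjoin x (schurf p) = (\<lambda>m. \<Sum>mu | hstrip p mu. x ^ (part_size p - part_size mu) * schurf mu m)"
proof
  fix m
  have deg: "degree_le (part_size p) (schurf p)" unfolding degree_le_def schurf_def using kostka_size[of p] by auto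
  have fin: "finite {mu. hstrip p mu}" by (rule finite_hstrip[OF p])
  have "adjoin x (schurf p) m = (\<Sum>j\<le>part_size p. \<Sum>mu | mu \<in> {mu. hstrip p mu} \<and> part_size p = part_size mu + j. x ^ j * schurf mu m)"
    unfolding adjoin_eq[OF deg] unfolding schurf_def kostka_insert_var[OF p] down_strip_def
    by (simp add: sum_distrib_left)
  also have "\<dots> = (\<Sum>mu | hstrip p mu. \<Sum>j | j \<in> {..part_size p} \<and> part_size p = part_size mu + j. x ^ j * schurf mu m)"
    by (rule sum.swap_restrict) (auto simp: fin)
  also have "\<dots> = (\<Sum>mu | hstrip p mu. x ^ (part_size p - part_size mu) * schurf mu m)"
  proof (rule sum.cong[OF refl])
    fix mu assume "mu \<in> {mu. hstrip p mu}"
    then have "part_size mu \<le> part_size p" using hstrip_part_size p by auto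
    then have "{j. j \<in> {..part_size p} \<and> part_size p = part_size mu + j} = {part_size p - part_size mu}" by auto
    then show "(\<Sum>j | j \<in> {..part_size p} \<and> part_size p = part_size mu + j. x ^ j * schurf mu m) = x ^ (part_size p - part_size mu) * schurf mu m"
      by simp
  qed
  finally show "adjoin x (schurf p) m = (\<Sum>mu | hstrip p mu. x ^ (part_size p - part_size mu) * schurf mu m)" .
qed

lemma adjoin_0_deg: assumes "f \<in> Sym" "degree_le 0 f" shows "adjoin x f = f"
proof
  fix m
  have "f (image_mset Suc m) = f m" by (rule Sym_inj[OF assms(1)]) simp
  then show "adjoin x f m = f m" unfolding adjoin_eq[OF assms(2)] by (simp add: insert_var_def)
qed

text \<open>Modulo lower degree, adjoining a variable is the identity. Hence it is an automorphism of the algebra of symmetric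
  functions (\<open>adjoin_surj\<close>, \<open>adjoin_eq_0\<close>), and its inverse removes a variable.\<close>
lemma adjoin_lowers: assumes "f \<in> Sym" "degree_le (Suc d) f" shows "degree_le d (\<lambda>m. f m - adjoin x f m)"
  unfolding degree_le_def
proof (intro allI impI)
  fix m assume ne: "f m - adjoin x f m \<noteq> 0"
  show "size m \<le> d"
  proof (rule ccontr)
    assume "\<not> size m \<le> d"
    then have z: "f (insert_var (Suc j) m) = 0" for j by (intro deg_leD[OF assms(2)]) simp
    have "f (image_mset Suc m) = f m" by (rule Sym_inj[OF assms(1)]) simp
    then have "adjoin x f m = f m"
      unfolding adjoin_eq[OF assms(2)] sum.atMost_Suc_shift z by (simp add: insert_var_def)
    then show False using ne by simp
  qed
qed

lemma adjoin_surj: "f \<in> Sym \<Longrightarrow> \<exists>g\<in>Sym. adjoin x g = f"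
proof -
  have "degree_le d f \<Longrightarrow> f \<in> Sym \<Longrightarrow> \<exists>g\<in>Sym. adjoin x g = f" for d f
  proof (induction d arbitrary: f)
    case 0 then show ?case using adjoin_0_deg by blast
  next
    case (Suc d)
    let ?h = "\<lambda>m. f m - adjoin x f m"
    have "?h \<in> Sym" by (intro Sym_diff Sym_adjoin Suc.prems)
    then obtain g where g: "g \<in> Sym" "adjoin x g = ?h"
      using Suc.IH[OF adjoin_lowers[OF Suc.prems(2,1)]] by blast
    have "adjoin x (\<lambda>m. f m + g m) = f" unfolding adjoin_add[OF Suc.prems(2) g(1)] g(2) by auto
    then show ?case using Sym_add[OF Suc.prems(2) g(1)] by blast
  qed
  then show "f \<in> Sym \<Longrightarrow> \<exists>g\<in>Sym. adjoin x g = f" using Sym_deg by blast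
qed

lemma adjoin_eq_0: "f \<in> Sym \<Longrightarrow> adjoin x f = (\<lambda>_. 0) \<Longrightarrow> f = (\<lambda>_. 0)"
proof -
  have "degree_le d f \<Longrightarrow> f \<in> Sym \<Longrightarrow> adjoin x f = (\<lambda>_. 0) \<Longrightarrow> f = (\<lambda>_. 0)" for d f
  proof (induction d arbitrary: f)
    case 0 then show ?case using adjoin_0_deg by metis
  next
    case (Suc d)
    have "degree_le d f" using adjoin_lowers[OF Suc.prems(2,1), of x] unfolding Suc.prems(3) by simp
    then show ?case using Suc by blast
  qed
  then show "f \<in> Sym \<Longrightarrow> adjoin x f = (\<lambda>_. 0) \<Longrightarrow> f = (\<lambda>_. 0)" using Sym_deg by blast
qed

lemma adjoin_inj: assumes "f \<in> Sym" "g \<in> Sym" "adjoin x f = adjoin x g" shows "f = g"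
proof -
  have "adjoin x (\<lambda>m. f m + (-1) * g m) = (\<lambda>_. 0)"
    unfolding adjoin_add[OF assms(1) Sym_scale[OF assms(2)]] adjoin_scale[OF assms(2)] assms(3) by simp
  then have "(\<lambda>m. f m + (-1) * g m) = (\<lambda>_. 0)"
    by (rule adjoin_eq_0[rotated]) (intro Sym_add Sym_scale assms)
  then show ?thesis by (auto simp: fun_eq_iff)
qed

text \<open>The inverse automorphism on symmetric functions. Removing the variable \<open>- y\<close> changes \<open>p\<^sub>k\<close> by
  \<open>- (- y) ^ k = (- 1) ^ (k - 1) * y ^ k\<close>, which is what a negative letter \<open>y\<close> contributes.\<close>
definition discard :: "complex \<Rightarrow> series \<Rightarrow> series" where
  "discard x f = (SOME g. g \<in> Sym \<and> adjoin x g = f)"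

lemma discard_Sym: assumes "f \<in> Sym" shows "discard x f \<in> Sym" "adjoin x (discard x f) = f"
proof -
  have "\<exists>g. g \<in> Sym \<and> adjoin x g = f" using adjoin_surj[OF assms] by blast
  from someI_ex[OF this] show "discard x f \<in> Sym" "adjoin x (discard x f) = f" unfolding discard_def by auto
qed

lemma discard_eqI: assumes "g \<in> Sym" "adjoin x g = f" shows "discard x f = g"
proof -
  have f: "f \<in> Sym" using Sym_adjoin[OF assms(1), of x] assms(2) by simp
  show ?thesis by (rule adjoin_inj[OF discard_Sym(1)[OF f] assms(1), of x]) (simp add: discard_Sym(2)[OF f] assms(2))
qed

lemma morphD: assumes "symfun_morphism \<phi>"
  shows "\<phi> series_one = 1" "f \<in> Sym \<Longrightarrow> g \<in> Sym \<Longrightarrow> \<phi> (\<lambda>m. f m + g m) = \<phi> f + \<phi> g"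
    "f \<in> Sym \<Longrightarrow> g \<in> Sym \<Longrightarrow> \<phi> (series_mult f g) = \<phi> f * \<phi> g"
    "f \<in> Sym \<Longrightarrow> \<phi> (\<lambda>m. c * f m) = c * \<phi> f"
  using assms unfolding symfun_morphism_def by auto

lemma morphI: assumes "\<phi> series_one = 1"
    "\<And>f g. f \<in> Sym \<Longrightarrow> g \<in> Sym \<Longrightarrow> \<phi> (\<lambda>m. f m + g m) = \<phi> f + \<phi> g"
    "\<And>f g. f \<in> Sym \<Longrightarrow> g \<in> Sym \<Longrightarrow> \<phi> (series_mult f g) = \<phi> f * \<phi> g"
    "\<And>f c. f \<in> Sym \<Longrightarrow> \<phi> (\<lambda>m. c * f m) = c * \<phi> f"
  shows "symfun_morphism \<phi>"
  using assms unfolding symfun_morphism_def by auto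

lemma morph_sum: assumes \<phi>: "symfun_morphism \<phi>" and "finite A" "\<And>a. a \<in> A \<Longrightarrow> F a \<in> Sym"
  shows "\<phi> (\<lambda>m. \<Sum>a\<in>A. c a * F a m) = (\<Sum>a\<in>A. c a * \<phi> (F a)) \<and> (\<lambda>m. \<Sum>a\<in>A. c a * F a m) \<in> Sym"
  using assms(2,3)
proof (induction A)
  case empty
  show ?case using morphD(4)[OF \<phi> Sym_one, of 0] Sym_scale[OF Sym_one, of 0] by simp
next
  case (insert a A)
  then have 1: "F a \<in> Sym" and 2: "(\<lambda>m. \<Sum>a\<in>A. c a * F a m) \<in> Sym"
    and 3: "\<phi> (\<lambda>m. \<Sum>a\<in>A. c a * F a m) = (\<Sum>a\<in>A. c a * \<phi> (F a))" by auto
  show ?case using insert.hyps morphD(2)[OF \<phi> Sym_scale[OF 1] 2, of "c a"] morphD(4)[OF \<phi> 1, of "c a"] 3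
      Sym_add[OF Sym_scale[OF 1] 2] by simp
qed

lemma morph_adjoin: assumes "symfun_morphism \<phi>" shows "symfun_morphism (\<lambda>f. \<phi> (adjoin x f))"
  by (rule morphI) (simp_all add: adjoin_one adjoin_add adjoin_mult adjoin_scale morphD[OF assms] Sym_adjoin)

lemma discard_one: "discard x series_one = series_one"
  by (rule discard_eqI[OF Sym_one adjoin_one])

lemma morph_discard: assumes "symfun_morphism \<phi>" shows "symfun_morphism (\<lambda>f. \<phi> (discard x f))"
proof (rule morphI)
  show "\<phi> (discard x series_one) = 1" unfolding discard_one by (rule morphD(1)[OF assms])
next
  fix f g assume f: "f \<in> Sym" and g: "g \<in> Sym"
  note m = discard_Sym[OF f, of x] discard_Sym[OF g, of x]
  have "discard x (\<lambda>m. f m + g m) = (\<lambda>m. discard x f m + discard x g m)"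
    by (rule discard_eqI) (simp_all add: Sym_add m adjoin_add)
  then show "\<phi> (discard x (\<lambda>m. f m + g m)) = \<phi> (discard x f) + \<phi> (discard x g)"
    using m morphD[OF assms] by simp
  have "discard x (series_mult f g) = series_mult (discard x f) (discard x g)"
    by (rule discard_eqI) (simp_all add: Sym_mult m adjoin_mult)
  then show "\<phi> (discard x (series_mult f g)) = \<phi> (discard x f) * \<phi> (discard x g)"
    using m morphD[OF assms] by simp
next
  fix f c assume f: "f \<in> Sym"
  note m = discard_Sym[OF f, of x]
  have "discard x (\<lambda>m. c * f m) = (\<lambda>m. c * discard x f m)"
    by (rule discard_eqI) (simp_all add: Sym_scale m adjoin_scale)
  then show "\<phi> (discard x (\<lambda>m. c * f m)) = c * \<phi> (discard x f)"
    using m morphD[OF assms] by simp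
qed

lemma morph_unique: assumes "symfun_morphism \<phi>" "symfun_morphism \<psi>"
    "\<And>k. k \<ge> 1 \<Longrightarrow> \<phi> (power_sum k) = \<psi> (power_sum k)" "f \<in> Sym"
  shows "\<phi> f = \<psi> f"
  using assms(4)
  by (induction rule: Sym_induct) (simp_all add: morphD[OF assms(1)] morphD[OF assms(2)] assms(3))

text \<open>There is a morphism with the given values on power sums and on Schur functions. It is unique by
  \<open>morph_unique\<close>, so that such a statement computes \<open>specialization\<close>.\<close>
definition specializes :: "(nat \<Rightarrow> complex) \<Rightarrow> (shape \<Rightarrow> complex) \<Rightarrow> bool" where
  "specializes p s \<longleftrightarrow> (\<exists>\<phi>. symfun_morphism \<phi> \<and> (\<forall>k\<ge>1. \<phi> (power_sum k) = p k)
     \<and> (\<forall>la. is_part la \<longrightarrow> \<phi> (schurf la) = s la))"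

lemma specializes_specialization: assumes "specializes p s" "is_part la"
  shows "specialization p (schurf la) = s la"
proof -
  obtain \<phi> where \<phi>: "symfun_morphism \<phi>" "\<forall>k\<ge>1. \<phi> (power_sum k) = p k" "\<phi> (schurf la) = s la"
    using assms unfolding specializes_def by blast
  define \<psi> where "\<psi> = restrict \<phi> Sym"
  have 1: "symfun_morphism \<psi>"
    unfolding \<psi>_def by (rule morphI) (simp_all add: Sym_one Sym_add Sym_mult Sym_scale morphD[OF \<phi>(1)])
  have "specialization p = \<psi>" unfolding specialization_def
  proof (rule the_equality)
    show "\<psi> \<in> extensional Sym \<and> symfun_morphism \<psi> \<and> (\<forall>k\<ge>1. \<psi> (power_sum k) = p k)"
      using 1 \<phi>(2) by (simp add: \<psi>_def Sym_power_sum)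
    fix \<xi> assume \<xi>: "\<xi> \<in> extensional Sym \<and> symfun_morphism \<xi> \<and> (\<forall>k\<ge>1. \<xi> (power_sum k) = p k)"
    show "\<xi> = \<psi>"
    proof
      fix f show "\<xi> f = \<psi> f"
      proof (cases "f \<in> Sym")
        case True
        then have "\<xi> f = \<phi> f" by (rule morph_unique[rotated -1]) (use \<xi> \<phi> in auto)
        then show ?thesis using True by (simp add: \<psi>_def)
      next
        case False then show ?thesis using \<xi> by (simp add: \<psi>_def extensional_def)
      qed
    qed
  qed
  then show ?thesis using \<phi>(3) by (simp add: \<psi>_def Sym_schurf assms(2))
qed

text \<open>The Schur values at the empty alphabet.\<close>
definition delta :: "shape \<Rightarrow> 'a::zero_neq_one" where
  "delta p = (if p = (\<lambda>_. 0) then 1 else 0)"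

lemma specializes_0: "specializes (\<lambda>_. 0) delta"
  unfolding specializes_def
proof (intro exI conjI allI impI)
  show "symfun_morphism (\<lambda>f. f {#})"
    by (rule morphI) (simp_all add: series_one_def series_mult_def)
qed (auto simp: schurf_empty delta_def power_sum_def)

lemma morph_adjoin_schurf: assumes "symfun_morphism \<phi>" "is_part la"
  shows "\<phi> (adjoin x (schurf la)) = add_pos x (\<lambda>p. \<phi> (schurf p)) la"
  unfolding adjoin_schurf[OF assms(2)] add_pos_def
  using morph_sum[OF assms(1) finite_hstrip[OF assms(2)], of schurf "\<lambda>mu. x ^ (part_size la - part_size mu)"]
  by (auto intro: Sym_schurf hstrip_part_lower[OF _ assms(2)])

lemma specializes_add_pos: assumes "specializes p s" shows "specializes (\<lambda>k. p k + x ^ k) (add_pos x s)"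
proof -
  obtain \<phi> where \<phi>: "symfun_morphism \<phi>" "\<forall>k\<ge>1. \<phi> (power_sum k) = p k" "\<And>la. is_part la \<Longrightarrow> \<phi> (schurf la) = s la"
    using assms unfolding specializes_def by blast
  show ?thesis unfolding specializes_def
  proof (intro exI conjI allI impI)
    show "symfun_morphism (\<lambda>f. \<phi> (adjoin x f))" by (rule morph_adjoin[OF \<phi>(1)])
    show "\<phi> (adjoin x (power_sum k)) = p k + x ^ k" if "k \<ge> 1" for k
      unfolding adjoin_power[OF that] using \<phi>(2) that
      by (simp add: morphD[OF \<phi>(1)] Sym_power_sum Sym_scale Sym_one)
    show "\<phi> (adjoin x (schurf la)) = add_pos x s la" if "is_part la" for la
      unfolding morph_adjoin_schurf[OF \<phi>(1) that] by (rule add_pos_cong) (simp_all add: \<phi>(3) that)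
  qed
qed

text \<open>The values \<open>t\<close> after removal of the variable \<open>- y\<close> satisfy \<open>add_pos (- y) t = s\<close>, because adjoining it again
  restores the old specialization; \<open>add_neg y\<close> solves this equation for \<open>t\<close>.\<close>
lemma specializes_add_neg: assumes "specializes p s" shows "specializes (\<lambda>k. p k - (- y) ^ k) (add_neg y s)"
proof -
  obtain \<phi> where \<phi>: "symfun_morphism \<phi>" "\<forall>k\<ge>1. \<phi> (power_sum k) = p k" "\<And>la. is_part la \<Longrightarrow> \<phi> (schurf la) = s la"
    using assms unfolding specializes_def by blast
  let ?\<psi> = "\<lambda>f. \<phi> (discard (- y) f)"
  have \<psi>: "symfun_morphism ?\<psi>" by (rule morph_discard[OF \<phi>(1)])
  show ?thesis unfolding specializes_def
  proof (intro exI conjI allI impI)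
    show "symfun_morphism ?\<psi>" by (rule \<psi>)
    show "?\<psi> (power_sum k) = p k - (- y) ^ k" if k: "k \<ge> 1" for k
    proof -
      have "?\<psi> (adjoin (- y) (power_sum k)) = \<phi> (power_sum k)"
        using discard_eqI[OF Sym_power_sum refl] by simp
      moreover have "?\<psi> (adjoin (- y) (power_sum k)) = ?\<psi> (power_sum k) + (- y) ^ k * ?\<psi> series_one"
        unfolding adjoin_power[OF k] morphD(2)[OF \<psi> Sym_power_sum Sym_scale[OF Sym_one]]
          morphD(4)[OF \<psi> Sym_one] ..
      ultimately show ?thesis using \<phi>(2) k by (simp add: morphD(1)[OF \<psi>] eq_diff_eq)
    qed
    fix la assume la: "is_part la"
    have s: "s p = add_pos (- y) (\<lambda>p. ?\<psi> (schurf p)) p" if p: "is_part p" for p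
      using morph_adjoin_schurf[OF \<psi> p, of "- y"] discard_eqI[OF Sym_schurf[OF p] refl] \<phi>(3)[OF p] by simp
    have "add_neg y s la = add_neg y (add_pos (- y) (\<lambda>p. ?\<psi> (schurf p))) la"
      by (rule add_neg_cong[OF s la])
    also have "\<dots> = ?\<psi> (schurf la)" by (rule add_neg_add_pos_inverse[OF la])
    finally show "?\<psi> (schurf la) = add_neg y s la" by simp
  qed
qed

text \<open>Convergence on power sums propagates to sums and products, hence to all symmetric functions, and a limit of morphisms
  is a morphism.\<close>
lemma specializes_limit: assumes S: "\<And>n. specializes (P n) (S n)" and P: "\<And>k. k \<ge> 1 \<Longrightarrow> (\<lambda>n. P n k) \<longlonglongrightarrow> p k"
  shows "\<exists>s. specializes p s \<and> (\<forall>la. is_part la \<longrightarrow> (\<lambda>n. S n la) \<longlonglongrightarrow> s la)"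
proof -
  have "\<forall>n. \<exists>\<phi>. symfun_morphism \<phi> \<and> (\<forall>k\<ge>1. \<phi> (power_sum k) = P n k) \<and> (\<forall>la. is_part la \<longrightarrow> \<phi> (schurf la) = S n la)"
    using S unfolding specializes_def by blast
  then obtain \<phi> where \<phi>: "\<And>n. symfun_morphism (\<phi> n)" "\<And>n k. k \<ge> 1 \<Longrightarrow> \<phi> n (power_sum k) = P n k"
    "\<And>n la. is_part la \<Longrightarrow> \<phi> n (schurf la) = S n la" by metis
  have conv: "convergent (\<lambda>n. \<phi> n f)" if "f \<in> Sym" for f
    using that
  proof (induction rule: Sym_induct)
    case one show ?case by (simp add: morphD(1)[OF \<phi>(1)] convergent_const)
  next
    case (power k) then show ?case using P[of k] \<phi>(2)[of k] by (auto simp: convergent_def)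
  next
    case (add f g) then show ?case by (simp add: morphD(2)[OF \<phi>(1)] convergent_add)
  next
    case (scale f c)
    then have "convergent (\<lambda>n. c * \<phi> n f)" by (intro convergent_mult convergent_const)
    then show ?case using scale by (simp add: morphD(4)[OF \<phi>(1)])
  next
    case (mult f g) then show ?case by (simp add: morphD(3)[OF \<phi>(1)] convergent_mult)
  qed
  define \<psi> where "\<psi> = (\<lambda>f. lim (\<lambda>n. \<phi> n f))"
  have \<psi>: "(\<lambda>n. \<phi> n f) \<longlonglongrightarrow> \<psi> f" if "f \<in> Sym" for f
    using conv[OF that] unfolding \<psi>_def by (simp add: convergent_LIMSEQ_iff)
  have "symfun_morphism \<psi>"
  proof (rule morphI)
    show "\<psi> series_one = 1" unfolding \<psi>_def by (simp add: morphD(1)[OF \<phi>(1)])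
    fix f g assume f: "f \<in> Sym" and g: "g \<in> Sym"
    have "(\<lambda>n. \<phi> n (\<lambda>m. f m + g m)) \<longlonglongrightarrow> \<psi> f + \<psi> g"
      unfolding morphD(2)[OF \<phi>(1) f g] by (intro tendsto_add \<psi> f g)
    then show "\<psi> (\<lambda>m. f m + g m) = \<psi> f + \<psi> g" using \<psi>[OF Sym_add[OF f g]] LIMSEQ_unique by blast
    have "(\<lambda>n. \<phi> n (series_mult f g)) \<longlonglongrightarrow> \<psi> f * \<psi> g"
      unfolding morphD(3)[OF \<phi>(1) f g] by (intro tendsto_mult \<psi> f g)
    then show "\<psi> (series_mult f g) = \<psi> f * \<psi> g" using \<psi>[OF Sym_mult[OF f g]] LIMSEQ_unique by blast
  next
    fix f c assume f: "f \<in> Sym"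
    have "(\<lambda>n. \<phi> n (\<lambda>m. c * f m)) \<longlonglongrightarrow> c * \<psi> f"
      unfolding morphD(4)[OF \<phi>(1) f] by (intro tendsto_mult tendsto_const \<psi> f)
    then show "\<psi> (\<lambda>m. c * f m) = c * \<psi> f" using \<psi>[OF Sym_scale[OF f]] LIMSEQ_unique by blast
  qed
  moreover have "\<psi> (power_sum k) = p k" if "k \<ge> 1" for k
    using \<psi>[OF Sym_power_sum, of k] P[OF that] unfolding \<phi>(2)[OF that] by (rule LIMSEQ_unique)
  ultimately have "specializes p (\<lambda>la. \<psi> (schurf la))" unfolding specializes_def by blast
  moreover have "(\<lambda>n. S n la) \<longlonglongrightarrow> \<psi> (schurf la)" if "is_part la" for la
    using \<psi>[OF Sym_schurf[OF that]] unfolding \<phi>(3)[OF that] .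
  ultimately show ?thesis by blast
qed

section \<open>Harmonic functions and Pieri bounds\<close>

lemma add_pos_mono: assumes "x \<ge> (0::real)" "\<And>p. is_part p \<Longrightarrow> s p \<le> t p" "is_part la"
  shows "add_pos x s la \<le> add_pos x t la"
  unfolding add_pos_def using assms by (intro sum_mono mult_left_mono) (auto dest: hstrip_part_lower)

lemma add_neg_mono: assumes "x \<ge> (0::real)" "\<And>p. is_part p \<Longrightarrow> s p \<le> t p" "is_part la"
  shows "add_neg x s la \<le> add_neg x t la"
  unfolding add_neg_def by (intro add_pos_mono) (auto simp: assms conjugate_is_part)

lemma add_pos_const0: "add_pos x (\<lambda>_. 0) la = 0" unfolding add_pos_def by simp
lemma add_neg_const0: "add_neg x (\<lambda>_. 0) la = 0" unfolding add_neg_def add_pos_def by simp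

lemma add_pos_nonneg: "x \<ge> (0::real) \<Longrightarrow> (\<And>p. is_part p \<Longrightarrow> 0 \<le> s p) \<Longrightarrow> is_part la \<Longrightarrow> 0 \<le> add_pos x s la"
  using add_pos_mono[of x "\<lambda>_. 0" s la] by (simp add: add_pos_const0)

lemma add_neg_nonneg: "x \<ge> (0::real) \<Longrightarrow> (\<And>p. is_part p \<Longrightarrow> 0 \<le> s p) \<Longrightarrow> is_part la \<Longrightarrow> 0 \<le> add_neg x s la"
  using add_neg_mono[of x "\<lambda>_. 0" s la] by (simp add: add_neg_const0)

lemma add_pos_cmult: "add_pos x (\<lambda>p. c * s p) la = c * add_pos x s la"
  using add_pos_lin[of x c s 0 s la] by simp

lemma add_neg_cmult: "add_neg x (\<lambda>p. c * s p) la = c * add_neg x s la"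
  using add_neg_lin[of x c s 0 s la] by simp

lemma add_neg_sum: "add_neg x (\<lambda>p. \<Sum>i\<in>I. c i * s i p) la = (\<Sum>i\<in>I. c i * add_neg x (s i) la)"
  unfolding add_neg_def by (rule add_pos_sum)

lemma conjugate_0: "conjugate (\<lambda>_. 0) = (\<lambda>_. 0)" unfolding conjugate_def by auto

lemma conjugate_eq_0_iff: "is_part p \<Longrightarrow> conjugate p = (\<lambda>_. 0) \<longleftrightarrow> p = (\<lambda>_. 0)"
  using conjugate_conjugate conjugate_0 by metis

lemma add_pos_at_0: "add_pos x s (\<lambda>_. 0) = s (\<lambda>_. 0)"
proof -
  have "{mu. hstrip (\<lambda>_. 0) mu} = {\<lambda>_. 0}" by (auto simp: hstrip_0_iff)
  then show ?thesis unfolding add_pos_def by simp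
qed

lemma add_neg_at_0: "add_neg x s (\<lambda>_. 0) = s (\<lambda>_. 0)"
  unfolding add_neg_def by (simp add: conjugate_0 add_pos_at_0)

lemma add_pos_conjugate: "is_part la \<Longrightarrow> add_pos x s (conjugate la) = add_neg x (\<lambda>p. s (conjugate p)) la"
  unfolding add_neg_def by (intro add_pos_cong) (auto simp: conjugate_conjugate conjugate_is_part)

lemma add_neg_conjugate: "is_part la \<Longrightarrow> add_neg x s (conjugate la) = add_pos x (\<lambda>p. s (conjugate p)) la"
  unfolding add_neg_def by (simp add: conjugate_conjugate)

lemma up_strip_nonneg: "(\<And>p. is_part p \<Longrightarrow> 0 \<le> (s p::real)) \<Longrightarrow> is_part nu \<Longrightarrow> 0 \<le> up_strip k s nu"
  unfolding up_strip_def by (intro sum_nonneg) (auto dest: hstrip_part_upper)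

text \<open>The Pieri rule for \<open>p\<^sub>1\<close>, with \<open>c\<close> the value of \<open>p\<^sub>1\<close>. For \<open>c = 1\<close> these are the harmonic functions on the
  graph of partitions.\<close>
definition harmonic :: "'a::real_normed_field \<Rightarrow> (shape \<Rightarrow> 'a) \<Rightarrow> bool" where
  "harmonic c s \<longleftrightarrow> (\<forall>nu. is_part nu \<longrightarrow> up_strip 1 s nu = c * s nu)"

lemma harmonic_add_pos: assumes "harmonic c s" shows "harmonic (c + x) (add_pos x s)"
  unfolding harmonic_def
proof (intro allI impI)
  fix nu :: shape assume nu: "is_part nu"
  have "up_strip 1 (add_pos x s) nu = add_pos x (up_strip 1 s) nu + x * add_pos x (up_strip 0 s) nu"
    unfolding up_strip_add_pos[OF nu] by simp
  also have "add_pos x (up_strip 1 s) nu = add_pos x (\<lambda>p. c * s p) nu"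
    by (rule add_pos_cong) (use assms nu in \<open>auto simp: harmonic_def\<close>)
  also have "add_pos x (up_strip 0 s) nu = add_pos x s nu" by (rule add_pos_cong) (auto simp: up_strip_0 nu)
  finally show "up_strip 1 (add_pos x s) nu = (c + x) * add_pos x s nu"
    unfolding add_pos_cmult by (simp add: algebra_simps)
qed

lemma harmonic_add_neg: assumes "harmonic c s" shows "harmonic (c + y) (add_neg y s)"
  unfolding harmonic_def
proof (intro allI impI)
  fix nu :: shape assume nu: "is_part nu"
  have "up_strip 1 (add_neg y s) nu = add_neg y (\<lambda>p. up_strip (Suc 0) s p + y * up_strip 0 s p) nu"
    using up_strip_add_neg[OF nu, of 0 y s] by simp
  also have "\<dots> = add_neg y (\<lambda>p. (c + y) * s p) nu"
    by (rule add_neg_cong) (use assms nu in \<open>auto simp: harmonic_def up_strip_0 algebra_simps\<close>)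
  finally show "up_strip 1 (add_neg y s) nu = (c + y) * add_neg y s nu" unfolding add_neg_cmult .
qed

lemma up_strip_delta: "is_part nu \<Longrightarrow> up_strip k delta nu = (if k = 0 then delta nu else (0::'a::real_normed_field))"
proof (cases "k = 0")
  case False
  assume nu: "is_part nu"
  have "delta mu = (0::'a)" if "part_size mu = part_size nu + k" for mu
    using that False unfolding delta_def by auto
  then show ?thesis using False unfolding up_strip_def by simp
qed (simp add: up_strip_0)

lemma harmonic_delta: "harmonic 0 delta" unfolding harmonic_def by (simp add: up_strip_delta)

text \<open>The sum of \<open>dim \<lambda> * s \<lambda>\<close> over the partitions of \<open>n\<close>.\<close>
definition dim_sum :: "nat \<Rightarrow> (shape \<Rightarrow> 'a::real_normed_field) \<Rightarrow> 'a" where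
  "dim_sum n s = (\<Sum>la | is_part la \<and> part_size la = n. of_nat (dim_shape n la) * s la)"

lemma finite_parts_eq: "finite {la. is_part la \<and> part_size la = n}"
  by (rule finite_subset[OF _ finite_parts[of n]]) auto

text \<open>The expansion of \<open>p\<^sub>1 ^ n\<close> into Schur functions: the recursion of dimensions by removing a box is
  adjoint to the Pieri rule.\<close>
lemma dim_sum_harmonic: assumes "harmonic c s" shows "dim_sum n s = c ^ n * s (\<lambda>_. 0)"
proof (induction n)
  case 0
  have "{la. is_part la \<and> part_size la = 0} = {\<lambda>_. 0}" using part_size_eq_0 by auto
  then show ?case unfolding dim_sum_def by simp
next
  case (Suc n)
  let ?f = "\<lambda>n la. of_nat (dim_shape n la) :: 'a"
  let ?P = "\<lambda>n. {la. is_part la \<and> part_size la = n}"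
  have "dim_sum (Suc n) s = (\<Sum>la\<in>?P (Suc n). \<Sum>mu | mu \<in> ?P n \<and> hstrip la mu. ?f n mu * s la)"
    unfolding dim_sum_def
  proof (rule sum.cong[OF refl])
    fix la assume la: "la \<in> ?P (Suc n)"
    have e: "{mu. hstrip la mu \<and> part_size la = part_size mu + 1} = {mu. mu \<in> ?P n \<and> hstrip la mu}"
      using la hstrip_part_lower by auto
    have "dim_shape (Suc n) la = (\<Sum>mu | mu \<in> ?P n \<and> hstrip la mu. dim_shape n mu)"
      unfolding replicate_Suc kostka_comp.simps down_strip_def e ..
    then show "?f (Suc n) la * s la = (\<Sum>mu | mu \<in> ?P n \<and> hstrip la mu. ?f n mu * s la)"
      by (simp only: of_nat_sum sum_distrib_right)
  qed
  also have "\<dots> = (\<Sum>mu\<in>?P n. \<Sum>la | la \<in> ?P (Suc n) \<and> hstrip la mu. ?f n mu * s la)"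
    by (rule sum.swap_restrict) (rule finite_parts_eq)+
  also have "\<dots> = (\<Sum>mu\<in>?P n. ?f n mu * (c * s mu))"
  proof (rule sum.cong[OF refl])
    fix mu assume mu: "mu \<in> ?P n"
    have e: "{la. la \<in> ?P (Suc n) \<and> hstrip la mu} = {la. hstrip la mu \<and> part_size la = part_size mu + 1}"
      using mu hstrip_part_upper by auto
    have "(\<Sum>la | la \<in> ?P (Suc n) \<and> hstrip la mu. ?f n mu * s la) = ?f n mu * up_strip 1 s mu"
      unfolding e up_strip_def sum_distrib_left ..
    then show "(\<Sum>la | la \<in> ?P (Suc n) \<and> hstrip la mu. ?f n mu * s la) = ?f n mu * (c * s mu)"
      using assms mu unfolding harmonic_def by simp
  qed
  also have "\<dots> = c * dim_sum n s" unfolding dim_sum_def by (simp add: sum_distrib_left ac_simps)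
  finally show ?case using Suc by simp
qed

text \<open>By the Pieri rule the left-hand side tends to \<open>s \<nu>\<close> times the sum of all \<open>z ^ k * h\<^sub>k\<close>. Only a bound on this
  generating function matters, and partial sums avoid any question of convergence.\<close>
definition pieri_bound :: "real \<Rightarrow> real \<Rightarrow> (shape \<Rightarrow> real) \<Rightarrow> bool" where
  "pieri_bound z K s \<longleftrightarrow> (\<forall>nu B. is_part nu \<longrightarrow> (\<Sum>k\<le>B. z ^ k * up_strip k s nu) \<le> K * s nu)"

lemma pbD: "pieri_bound z K s \<Longrightarrow> is_part nu \<Longrightarrow> (\<Sum>k\<le>B. z ^ k * up_strip k s nu) \<le> K * s nu"
  unfolding pieri_bound_def by auto

lemma pieri_bound_mono: "pieri_bound z K s \<Longrightarrow> K \<le> K' \<Longrightarrow> (\<And>p. is_part p \<Longrightarrow> 0 \<le> s p) \<Longrightarrow> pieri_bound z K' s"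
  unfolding pieri_bound_def by (meson mult_right_mono order_trans)

lemma pieri_bound_cong: assumes "\<And>p. is_part p \<Longrightarrow> s p = t p" "pieri_bound z K s" shows "pieri_bound z K t"
  using assms(2) up_strip_cong[of s t, OF assms(1)] assms(1) unfolding pieri_bound_def by simp

text \<open>A positive letter multiplies the generating function of the \<open>h\<^sub>k\<close> by a geometric series.\<close>
lemma pieri_bound_add_pos:
  assumes x: "0 \<le> x" and z: "0 \<le> z" "x * z < 1" and s: "\<And>p. is_part p \<Longrightarrow> 0 \<le> s p" and pieri_bound: "pieri_bound z K s"
  shows "pieri_bound z (1 / (1 - x * z) * K) (add_pos x s)"
  unfolding pieri_bound_def
proof (intro allI impI)
  fix nu :: shape and B assume nu: "is_part nu"
  define g where "g = (\<lambda>i l. (x * z) ^ i * (z ^ l * add_pos x (up_strip l s) nu))"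
  have un: "0 \<le> add_pos x (up_strip l s) nu" for l
    by (rule add_pos_nonneg[OF x _ nu]) (rule up_strip_nonneg[OF s])
  have g0: "0 \<le> g i l" for i l unfolding g_def using un x z by simp
  have "(\<Sum>k\<le>B. z ^ k * up_strip k (add_pos x s) nu) = (\<Sum>k\<le>B. \<Sum>i\<le>k. g i (k - i))"
    unfolding up_strip_add_pos[OF nu] sum_distrib_left
  proof (intro sum.cong refl)
    fix k i assume "k \<in> {..B}" "i \<in> {..k}"
    then have "z ^ k = z ^ i * z ^ (k - i)" by (simp flip: power_add)
    then show "z ^ k * (x ^ i * add_pos x (up_strip (k - i) s) nu) = g i (k - i)"
      unfolding g_def by (simp add: power_mult_distrib)
  qed
  also have "\<dots> = (\<Sum>(i, l)\<in>{(i, l). i + l \<le> B}. g i l)" by (rule sum.triangle_reindex_eq[symmetric])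
  also have "\<dots> \<le> (\<Sum>(i, l)\<in>{..B} \<times> {..B}. g i l)"
    by (rule sum_mono2) (use g0 in auto)
  also have "\<dots> = (\<Sum>i\<le>B. (x * z) ^ i) * (\<Sum>l\<le>B. z ^ l * add_pos x (up_strip l s) nu)"
    unfolding g_def sum_product sum.cartesian_product ..
  also have "(\<Sum>l\<le>B. z ^ l * add_pos x (up_strip l s) nu) = add_pos x (\<lambda>p. \<Sum>l\<le>B. z ^ l * up_strip l s p) nu"
    by (rule add_pos_sum[symmetric])
  also have "(\<Sum>i\<le>B. (x * z) ^ i) * add_pos x (\<lambda>p. \<Sum>l\<le>B. z ^ l * up_strip l s p) nu
      \<le> 1 / (1 - x * z) * add_pos x (\<lambda>p. K * s p) nu"
  proof (rule mult_mono)
    have "(\<Sum>i\<le>B. (x * z) ^ i) = (1 - (x * z) ^ Suc B) / (1 - x * z)"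
      using sum_gp0[of "x * z" B] z(2) by simp
    also have "\<dots> \<le> 1 / (1 - x * z)" using x z by (intro divide_right_mono) auto
    finally show "(\<Sum>i\<le>B. (x * z) ^ i) \<le> 1 / (1 - x * z)" .
    show "add_pos x (\<lambda>p. \<Sum>l\<le>B. z ^ l * up_strip l s p) nu \<le> add_pos x (\<lambda>p. K * s p) nu"
      by (rule add_pos_mono[OF x _ nu]) (rule pbD[OF pieri_bound])
    show "0 \<le> add_pos x (\<lambda>p. \<Sum>l\<le>B. z ^ l * up_strip l s p) nu"
      by (rule add_pos_nonneg[OF x _ nu]) (use z up_strip_nonneg[OF s] in \<open>auto intro!: sum_nonneg\<close>)
  qed (use z in auto)
  finally show "(\<Sum>k\<le>B. z ^ k * up_strip k (add_pos x s) nu) \<le> 1 / (1 - x * z) * K * add_pos x s nu"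
    unfolding add_pos_cmult by simp
qed

text \<open>A negative letter multiplies the generating function of the \<open>h\<^sub>k\<close> by a linear factor.\<close>
lemma pieri_bound_add_neg:
  assumes y: "0 \<le> y" and z: "0 \<le> z" and s: "\<And>p. is_part p \<Longrightarrow> 0 \<le> s p" and pieri_bound: "pieri_bound z K s"
  shows "pieri_bound z ((1 + y * z) * K) (add_neg y s)"
  unfolding pieri_bound_def
proof (intro allI impI)
  fix nu :: shape and B assume nu: "is_part nu"
  define h where "h = (\<lambda>k p. up_strip k s p + (case k of 0 \<Rightarrow> 0 | Suc j \<Rightarrow> y * up_strip j s p))"
  have h: "up_strip k (add_neg y s) nu = add_neg y (h k) nu" for k
  proof (cases k)
    case 0
    have "add_neg y (h 0) nu = add_neg y s nu" unfolding h_def by (rule add_neg_cong) (simp_all add: up_strip_0 nu)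
    then show ?thesis unfolding 0 up_strip_0[OF nu] by simp
  next
    case (Suc j) then show ?thesis unfolding Suc up_strip_add_neg[OF nu] h_def by simp
  qed
  have "(\<Sum>k\<le>B. z ^ k * up_strip k (add_neg y s) nu) = add_neg y (\<lambda>p. \<Sum>k\<le>B. z ^ k * h k p) nu"
    unfolding h by (rule add_neg_sum[symmetric])
  also have "\<dots> \<le> add_neg y (\<lambda>p. ((1 + y * z) * K) * s p) nu"
  proof (rule add_neg_mono[OF y _ nu])
    fix p :: shape assume p: "is_part p"
    have "(\<Sum>k\<le>B. z ^ k * (case k of 0 \<Rightarrow> 0 | Suc j \<Rightarrow> y * up_strip j s p)) \<le> y * z * (K * s p)"
    proof (cases B)
      case 0
      have "0 \<le> K * s p" using pbD[OF pieri_bound p, of 0] up_strip_0[OF p, of s] s[OF p] by simp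
      then show ?thesis using 0 y z by simp
    next
      case (Suc B')
      have "(\<Sum>k\<le>Suc B'. z ^ k * (case k of 0 \<Rightarrow> 0 | Suc j \<Rightarrow> y * up_strip j s p)) = y * z * (\<Sum>k\<le>B'. z ^ k * up_strip k s p)"
        unfolding sum.atMost_Suc_shift by (simp add: sum_distrib_left ac_simps)
      also have "\<dots> \<le> y * z * (K * s p)" by (intro mult_left_mono pbD[OF pieri_bound p]) (use y z in auto)
      finally show ?thesis unfolding Suc .
    qed
    then have "(\<Sum>k\<le>B. z ^ k * h k p) \<le> K * s p + y * z * (K * s p)"
      unfolding h_def distrib_left sum.distrib by (intro add_mono pbD[OF pieri_bound p])
    then show "(\<Sum>k\<le>B. z ^ k * h k p) \<le> ((1 + y * z) * K) * s p" by (simp add: algebra_simps)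
  qed
  finally show "(\<Sum>k\<le>B. z ^ k * up_strip k (add_neg y s) nu) \<le> (1 + y * z) * K * add_neg y s nu"
    unfolding add_neg_cmult .
qed

lemma pieri_bound_delta: "0 \<le> z \<Longrightarrow> pieri_bound z 1 delta"
  unfolding pieri_bound_def
proof (intro allI impI)
  fix nu :: shape and B assume "is_part nu"
  then have "(\<Sum>k\<le>B. z ^ k * up_strip k delta nu) = (\<Sum>k\<le>B. if k = 0 then delta nu else 0)"
    by (intro sum.cong) (auto simp: up_strip_delta)
  then show "(\<Sum>k\<le>B. z ^ k * up_strip k delta nu) \<le> 1 * delta nu" by simp
qed

section \<open>Infinite alphabets\<close>

fun finite_alphabet :: "(nat \<Rightarrow> real) \<Rightarrow> (nat \<Rightarrow> real) \<Rightarrow> nat \<Rightarrow> shape \<Rightarrow> real" where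
  "finite_alphabet a b 0 = delta"
| "finite_alphabet a b (Suc n) = add_pos (a n) (add_neg (b n) (finite_alphabet a b n))"

lemma add_pos_of_real: "add_pos (of_real x) (\<lambda>p. of_real (s p)) la = of_real (add_pos x s la)"
  unfolding add_pos_def by simp

lemma add_neg_of_real: "add_neg (of_real x) (\<lambda>p. of_real (s p)) la = of_real (add_neg x s la)"
  unfolding add_neg_def by (rule add_pos_of_real)

lemma specializes_cong: "specializes p s \<Longrightarrow> (\<And>k. k \<ge> 1 \<Longrightarrow> p k = p' k) \<Longrightarrow> (\<And>la. is_part la \<Longrightarrow> s la = s' la) \<Longrightarrow> specializes p' s'"
  unfolding specializes_def by auto

text \<open>A negative letter \<open>y\<close> counts as \<open>- (- y) ^ k\<close>.\<close>
definition psums :: "(nat \<Rightarrow> real) \<Rightarrow> (nat \<Rightarrow> real) \<Rightarrow> nat \<Rightarrow> nat \<Rightarrow> complex" where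
  "psums a b n k = of_real ((\<Sum>i<n. a i ^ k) - (\<Sum>i<n. (- b i) ^ k))"

lemma specializes_finite_alphabet: "specializes (psums a b n) (\<lambda>la. of_real (finite_alphabet a b n la))"
proof (induction n)
  case 0
  show ?case by (rule specializes_cong[OF specializes_0]) (auto simp: psums_def delta_def)
next
  case (Suc n)
  show ?case
  proof (rule specializes_cong[OF specializes_add_pos[OF specializes_add_neg[OF Suc, of "of_real (b n)"], of "of_real (a n)"]])
    show "psums a b n k - (- of_real (b n)) ^ k + of_real (a n) ^ k = psums a b (Suc n) k" for k
      unfolding psums_def by simp
    show "add_pos (of_real (a n)) (add_neg (of_real (b n)) (\<lambda>la. of_real (finite_alphabet a b n la))) la = of_real (finite_alphabet a b (Suc n) la)" for la
      unfolding add_neg_of_real[abs_def] add_pos_of_real by simp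
  qed
qed

locale alphabets =
  fixes a b :: "nat \<Rightarrow> real"
  assumes a0: "\<And>i. 0 \<le> a i" and b0: "\<And>i. 0 \<le> b i" and sa: "summable a" and sb: "summable b"
begin

lemma finite_alphabet_nonneg: "is_part p \<Longrightarrow> 0 \<le> finite_alphabet a b n p"
  by (induction n arbitrary: p) (auto simp: delta_def a0 b0 intro!: add_pos_nonneg add_neg_nonneg)

lemma finite_alphabet_at_0: "finite_alphabet a b n (\<lambda>_. 0) = 1"
  by (induction n) (auto simp: delta_def add_pos_at_0 add_neg_at_0)

lemma harmonic_finite_alphabet: "harmonic ((\<Sum>i<n. a i) + (\<Sum>i<n. b i)) (finite_alphabet a b n)"
proof (induction n)
  case 0 show ?case using harmonic_delta by simp
next
  case (Suc n)
  from harmonic_add_pos[OF harmonic_add_neg[OF Suc, of "b n"], of "a n"] show ?case by (simp add: algebra_simps)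
qed

lemma exp_bound: assumes "0 \<le> u" "u \<le> c" "c < 1" shows "1 / (1 - u) \<le> exp (u / (1 - c :: real))"
proof -
  have "1 / (1 - u) = 1 + u / (1 - u)" using assms by (simp add: field_simps)
  also have "\<dots> \<le> 1 + u / (1 - c)" using assms by (intro add_left_mono divide_left_mono) (auto simp: mult_pos_pos)
  also have "\<dots> \<le> exp (u / (1 - c))" by (rule exp_ge_add_one_self)
  finally show ?thesis .
qed

text \<open>The bounds for finite alphabets must be uniform in their size. The factor \<open>1 / (1 - u)\<close> of a positive letter is
  dominated by an exponential, so that the product is controlled by the sum of the letters. The statement is about an arbitrary
  sequence of functions because it serves both for the finite alphabets and for their conjugates, where the two kinds of
  letters trade places.\<close>
lemma pieri_bound_finite_alphabet_gen:
  assumes z: "0 \<le> z" and c: "c < 1" "\<And>i. a i * z \<le> c"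
    and t0: "\<And>p. is_part p \<Longrightarrow> t 0 p = delta p"
    and t: "\<And>n p. is_part p \<Longrightarrow> 0 \<le> t n p"
    and step: "\<And>n K. pieri_bound z K (t n) \<Longrightarrow> pieri_bound z (1 / (1 - a n * z) * ((1 + b n * z) * K)) (t (Suc n))"
  shows "pieri_bound z (exp (z / (1 - c) * suminf a + z * suminf b)) (t n)"
proof -
  have "pieri_bound z (exp (z / (1 - c) * (\<Sum>i<n. a i) + z * (\<Sum>i<n. b i))) (t n)"
  proof (induction n)
    case 0
    show ?case by (rule pieri_bound_cong[of delta]) (use t0 pieri_bound_delta[OF z] in auto)
  next
    case (Suc n)
    have "1 / (1 - a n * z) * ((1 + b n * z) * exp (z / (1 - c) * (\<Sum>i<n. a i) + z * (\<Sum>i<n. b i)))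
      \<le> exp (a n * z / (1 - c)) * (exp (b n * z) * exp (z / (1 - c) * (\<Sum>i<n. a i) + z * (\<Sum>i<n. b i)))"
      by (intro mult_mono exp_bound) (use a0 b0 z c in \<open>auto intro!: exp_ge_add_one_self mult_nonneg_nonneg add_nonneg_nonneg\<close>)
    also have "\<dots> = exp (z / (1 - c) * (\<Sum>i<Suc n. a i) + z * (\<Sum>i<Suc n. b i))"
      by (simp add: exp_add[symmetric] algebra_simps)
    finally show ?case by (rule pieri_bound_mono[OF step[OF Suc]]) (rule t)
  qed
  moreover have "exp (z / (1 - c) * (\<Sum>i<n. a i) + z * (\<Sum>i<n. b i)) \<le> exp (z / (1 - c) * suminf a + z * suminf b)"
    by (intro iffD2[OF exp_le_cancel_iff] add_mono mult_left_mono sum_le_suminf sa sb) (use a0 b0 z c in auto)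
  ultimately show ?thesis by (rule pieri_bound_mono) (rule t)
qed

lemma pieri_bound_finite_alphabet: assumes z: "0 \<le> z" and c: "c < 1" "\<And>i. a i * z \<le> c"
  shows "pieri_bound z (exp (z / (1 - c) * suminf a + z * suminf b)) (finite_alphabet a b n)"
proof (rule pieri_bound_finite_alphabet_gen[OF z c])
  fix n K assume "pieri_bound z K (finite_alphabet a b n)"
  then have "pieri_bound z ((1 + b n * z) * K) (add_neg (b n) (finite_alphabet a b n))" by (intro pieri_bound_add_neg b0 z finite_alphabet_nonneg)
  then show "pieri_bound z (1 / (1 - a n * z) * ((1 + b n * z) * K)) (finite_alphabet a b (Suc n))"
    unfolding finite_alphabet.simps
    by (intro pieri_bound_add_pos a0 z add_neg_nonneg b0 finite_alphabet_nonneg) (use c le_less_trans in blast)+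
qed (auto simp: finite_alphabet_nonneg)

lemma pieri_bound_finite_alphabet_conjugate: assumes z: "0 \<le> z" and c: "c < 1" "\<And>i. b i * z \<le> c"
  shows "pieri_bound z (exp (z / (1 - c) * suminf b + z * suminf a)) (\<lambda>p. finite_alphabet a b n (conjugate p))"
proof -
  interpret sw: alphabets b a by standard (rule a0 b0 sa sb)+
  show ?thesis
  proof (rule sw.pieri_bound_finite_alphabet_gen[OF z c])
    fix n K assume pieri_bound: "pieri_bound z K (\<lambda>p. finite_alphabet a b n (conjugate p))"
    let ?s = "\<lambda>p. finite_alphabet a b n (conjugate p)"
    have s0: "is_part p \<Longrightarrow> 0 \<le> ?s p" for p by (rule finite_alphabet_nonneg) (rule conjugate_is_part)
    have b1: "b n * z < 1" using c le_less_trans by blast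
    have "pieri_bound z (1 / (1 - b n * z) * K) (add_pos (b n) ?s)" by (intro pieri_bound_add_pos b0 z b1 s0 pieri_bound)
    then have "pieri_bound z ((1 + a n * z) * (1 / (1 - b n * z) * K)) (add_neg (a n) (add_pos (b n) ?s))"
      by (intro pieri_bound_add_neg a0 z add_pos_nonneg b0 s0)
    then have *: "pieri_bound z (1 / (1 - b n * z) * ((1 + a n * z) * K)) (add_neg (a n) (add_pos (b n) ?s))"
      by (simp add: ac_simps)
    show "pieri_bound z (1 / (1 - b n * z) * ((1 + a n * z) * K)) (\<lambda>p. finite_alphabet a b (Suc n) (conjugate p))"
      by (rule pieri_bound_cong[OF _ *]) (auto simp: add_pos_conjugate add_neg_conjugate intro!: add_neg_cong)
  qed (auto simp: delta_def conjugate_eq_0_iff finite_alphabet_nonneg conjugate_is_part)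
qed

lemma tendsto_power_sums: assumes k: "k \<ge> 1"
  shows "(\<lambda>n. psums a b n k) \<longlonglongrightarrow> of_real ((\<Sum>i. a i ^ k) - (\<Sum>i. (- b i) ^ k))"
proof -
  have sp: "summable (\<lambda>i. c i ^ k)" if c: "summable c" "\<And>i. 0 \<le> c i" for c :: "nat \<Rightarrow> real"
  proof (rule summable_comparison_test_ev[OF _ c(1)])
    have "eventually (\<lambda>i. c i < 1) sequentially"
      using summable_LIMSEQ_zero[OF c(1)] by (rule order_tendstoD) simp
    then show "eventually (\<lambda>i. norm (c i ^ k) \<le> c i) sequentially"
    proof eventually_elim
      case (elim i)
      then show ?case using power_decreasing[of 1 k "c i"] c(2)[of i] k by simp
    qed
  qed
  have 1: "summable (\<lambda>i. a i ^ k)" by (rule sp[OF sa a0])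
  have 2: "summable (\<lambda>i. (- b i) ^ k)"
    using summable_mult[OF sp[OF sb b0], of "(-1)^k"] by (simp flip: power_mult_distrib)
  show ?thesis unfolding psums_def
    by (intro tendsto_of_real tendsto_diff summable_LIMSEQ 1 2)
qed

lemma limit_exists:
  "\<exists>s. specializes (\<lambda>k. of_real ((\<Sum>i. a i ^ k) - (\<Sum>i. (- b i) ^ k))) (\<lambda>la. of_real (s la))
     \<and> (\<forall>la. is_part la \<longrightarrow> (\<lambda>n. finite_alphabet a b n la) \<longlonglongrightarrow> s la)"
proof -
  obtain s where s: "specializes (\<lambda>k. of_real ((\<Sum>i. a i ^ k) - (\<Sum>i. (- b i) ^ k))) s"
    "\<And>la. is_part la \<Longrightarrow> (\<lambda>n. complex_of_real (finite_alphabet a b n la)) \<longlonglongrightarrow> s la"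
    using specializes_limit[OF specializes_finite_alphabet tendsto_power_sums] by blast
  have conv: "(\<lambda>n. finite_alphabet a b n la) \<longlonglongrightarrow> Re (s la)" if "is_part la" for la
    using tendsto_Re[OF s(2)[OF that]] by simp
  have "s la = of_real (Re (s la))" if "is_part la" for la
    using LIMSEQ_unique[OF s(2)[OF that] tendsto_of_real[OF conv[OF that]]] .
  then have "specializes (\<lambda>k. of_real ((\<Sum>i. a i ^ k) - (\<Sum>i. (- b i) ^ k))) (\<lambda>la. of_real (Re (s la)))"
    by (intro specializes_cong[OF s(1)]) auto
  then show ?thesis using conv by (intro exI[of _ "\<lambda>la. Re (s la)"]) auto
qed

text \<open>The Schur values at the infinite alphabet. Only the values at partitions matter.\<close>
definition tail :: "shape \<Rightarrow> real" where
  "tail = (SOME s. specializes (\<lambda>k. of_real ((\<Sum>i. a i ^ k) - (\<Sum>i. (- b i) ^ k))) (\<lambda>la. of_real (s la))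
     \<and> (\<forall>la. is_part la \<longrightarrow> (\<lambda>n. finite_alphabet a b n la) \<longlonglongrightarrow> s la))"

lemma specializes_tail: "specializes (\<lambda>k. of_real ((\<Sum>i. a i ^ k) - (\<Sum>i. (- b i) ^ k))) (\<lambda>la. of_real (tail la))"
  and tail_lim: "is_part la \<Longrightarrow> (\<lambda>n. finite_alphabet a b n la) \<longlonglongrightarrow> tail la"
  using someI_ex[OF limit_exists] unfolding tail_def by auto

lemma tail_nonneg: "is_part la \<Longrightarrow> 0 \<le> tail la"
  by (rule LIMSEQ_le_const[OF tail_lim]) (auto simp: finite_alphabet_nonneg)

lemma tail_at_0: "tail (\<lambda>_. 0) = 1"
  using tail_lim[of "\<lambda>_. 0"] unfolding finite_alphabet_at_0 by (simp add: LIMSEQ_const_iff)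

lemma up_strip_lim: assumes "\<And>p. is_part p \<Longrightarrow> (\<lambda>n. f n p) \<longlonglongrightarrow> s p" "is_part nu"
  shows "(\<lambda>n. up_strip k (f n) nu) \<longlonglongrightarrow> up_strip k s nu"
  unfolding up_strip_def by (intro tendsto_sum assms(1)) (auto dest: hstrip_part_upper[OF _ assms(2)])

lemma harmonic_tail: "harmonic (suminf a + suminf b) tail"
  unfolding harmonic_def
proof (intro allI impI)
  fix nu :: shape assume nu: "is_part nu"
  have "(\<lambda>n. ((\<Sum>i<n. a i) + (\<Sum>i<n. b i)) * finite_alphabet a b n nu) \<longlonglongrightarrow> (suminf a + suminf b) * tail nu"
    by (intro tendsto_mult tendsto_add summable_LIMSEQ sa sb tail_lim nu)
  moreover have "(\<lambda>n. up_strip 1 (finite_alphabet a b n) nu) \<longlonglongrightarrow> up_strip 1 tail nu" by (rule up_strip_lim[OF tail_lim nu])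
  moreover have "up_strip 1 (finite_alphabet a b n) nu = ((\<Sum>i<n. a i) + (\<Sum>i<n. b i)) * finite_alphabet a b n nu" for n
    using harmonic_finite_alphabet nu unfolding harmonic_def by blast
  ultimately show "up_strip 1 tail nu = (suminf a + suminf b) * tail nu" using LIMSEQ_unique by simp
qed

lemma pieri_bound_lim: assumes "\<And>p. is_part p \<Longrightarrow> (\<lambda>n. f n p) \<longlonglongrightarrow> s p" "\<And>n. pieri_bound z K (f n)" shows "pieri_bound z K s"
  unfolding pieri_bound_def
proof (intro allI impI)
  fix nu :: shape and B assume nu: "is_part nu"
  show "(\<Sum>k\<le>B. z ^ k * up_strip k s nu) \<le> K * s nu"
  proof (rule LIMSEQ_le)
    show "(\<lambda>n. \<Sum>k\<le>B. z ^ k * up_strip k (f n) nu) \<longlonglongrightarrow> (\<Sum>k\<le>B. z ^ k * up_strip k s nu)"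
      by (intro tendsto_sum tendsto_mult tendsto_const up_strip_lim assms(1) nu)
    show "(\<lambda>n. K * f n nu) \<longlonglongrightarrow> K * s nu" by (intro tendsto_mult tendsto_const assms(1) nu)
    show "\<exists>N. \<forall>n\<ge>N. (\<Sum>k\<le>B. z ^ k * up_strip k (f n) nu) \<le> K * f n nu" using pbD[OF assms(2) nu] by auto
  qed
qed

lemma pieri_bound_tail: assumes "0 \<le> z" "c < 1" "\<And>i. a i * z \<le> c" shows "\<exists>K\<ge>0. pieri_bound z K tail"
  using pieri_bound_lim[OF tail_lim pieri_bound_finite_alphabet[OF assms]] by (meson exp_ge_zero)

lemma pieri_bound_tail_conjugate: assumes "0 \<le> z" "c < 1" "\<And>i. b i * z \<le> c" shows "\<exists>K\<ge>0. pieri_bound z K (\<lambda>p. tail (conjugate p))"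
  using pieri_bound_lim[of "\<lambda>n p. finite_alphabet a b n (conjugate p)", OF tail_lim[OF conjugate_is_part] pieri_bound_finite_alphabet_conjugate[OF assms]] by (meson exp_ge_zero)

end

section \<open>Rows and columns as letter counts\<close>

lemma cmod_cis_diff: "cmod (cis u - cis v) \<le> \<bar>u - v\<bar>"
proof -
  have "cis u - cis v = cis v * (cis (u - v) - 1)" by (simp add: algebra_simps cis_mult)
  then have "cmod (cis u - cis v) = cmod (cis (u - v) - 1)" by (simp add: norm_mult)
  also have "\<dots> \<le> \<bar>u - v\<bar>" using iexp_approx1[of "u - v" 0] by (simp add: cis_conv_exp)
  finally show ?thesis .
qed

text \<open>The argument of the characteristic function of the first \<open>I\<close> rows and the first \<open>J\<close> columns.\<close>
definition phase :: "nat \<Rightarrow> (nat \<Rightarrow> real) \<Rightarrow> nat \<Rightarrow> (nat \<Rightarrow> real) \<Rightarrow> shape \<Rightarrow> real" where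
  "phase I th J et la = (\<Sum>i<I. th i * real (la i)) + (\<Sum>j<J. et j * real (conjugate la j))"

lemma part_size_diff_ge: assumes mu: "is_part mu" and le: "\<And>i. nu i \<le> mu i"
  shows "part_size nu + (mu i - nu i) \<le> part_size mu"
proof -
  obtain N where N: "\<And>i. i \<ge> N \<Longrightarrow> mu i = 0" using is_part_bound[OF mu] by auto
  have nu0: "nu i = 0" if "i \<ge> N" for i using N[OF that] le[of i] by simp
  let ?M = "max N (Suc i)"
  have 1: "part_size mu = (\<Sum>l<?M. mu l)" by (rule part_size_eq) (use N in auto)
  have 2: "part_size nu = (\<Sum>l<?M. nu l)" by (rule part_size_eq) (use nu0 in auto)
  have "mu i - nu i \<le> (\<Sum>l<?M. mu l - nu l)" by (rule member_le_sum) auto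
  then have "part_size nu + (mu i - nu i) \<le> (\<Sum>l<?M. nu l + (mu l - nu l))" unfolding 2 sum.distrib by simp
  also have "\<dots> = part_size mu" unfolding 1 using le by simp
  finally show ?thesis .
qed

context
  fixes la mu :: shape
  assumes la: "is_part la" and h: "hstrip la mu"
begin

lemma shift_size: "part_size la = la 0 + part_size (\<lambda>i. la (Suc i))"
proof -
  obtain N where N: "\<And>i. i \<ge> N \<Longrightarrow> la i = 0" using is_part_bound[OF la] by auto
  have "part_size la = la 0 + (\<Sum>j<N. la (Suc j))" by (rule part_size_split) (use N in auto)
  also have "(\<Sum>j<N. la (Suc j)) = part_size (\<lambda>i. la (Suc i))" by (rule part_size_eq[symmetric]) (use N in auto)
  finally show ?thesis .
qed

lemma shift_hstrip: "hstrip mu (\<lambda>i. la (Suc i))"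
  unfolding hstrip_def using hstripD[OF h] is_part_Suc[OF la] by (meson order_trans)

lemma shift_le: "part_size (\<lambda>i. la (Suc i)) \<le> part_size mu"
  by (rule hstrip_part_size[OF shift_hstrip hstrip_part_lower[OF h la]])

text \<open>The number of copies of the removed letter is \<open>|\<lambda>| - |\<mu>|\<close>. It falls short of the first row by
  \<open>k = |\<mu>| - |\<lambda> without its first row|\<close>, and the same \<open>k\<close> bounds the change of every later row.\<close>
lemma strip_sizes:
  "part_size mu - part_size (\<lambda>i. la (Suc i)) \<le> la 0"
  "part_size la - part_size mu = la 0 - (part_size mu - part_size (\<lambda>i. la (Suc i)))"
  "mu i - la (Suc i) \<le> part_size mu - part_size (\<lambda>i. la (Suc i))"
proof -
  show 1: "part_size mu - part_size (\<lambda>i. la (Suc i)) \<le> la 0"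
    using hstrip_part_size[OF h la] shift_size by linarith
  show "part_size la - part_size mu = la 0 - (part_size mu - part_size (\<lambda>i. la (Suc i)))"
    using 1 shift_size shift_le by linarith
  have "part_size (\<lambda>i. la (Suc i)) + (mu i - la (Suc i)) \<le> part_size mu"
    by (rule part_size_diff_ge[OF hstrip_part_lower[OF h la]]) (rule hstripD(1)[OF h])
  then show "mu i - la (Suc i) \<le> part_size mu - part_size (\<lambda>i. la (Suc i))" by linarith
qed

text \<open>Each row phase changes by at most \<open>k\<close> times its frequency, and each column phase by at most its frequency.\<close>
lemma phase_diff:
  defines "k \<equiv> part_size mu - part_size (\<lambda>i. la (Suc i))"
  shows "\<bar>phase (Suc I) th J et la - (real (part_size la - part_size mu) * th 0 + phase I (\<lambda>i. th (Suc i)) J et mu)\<bar>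
     \<le> (\<Sum>i<Suc I. \<bar>th i\<bar>) * real k + (\<Sum>j<J. \<bar>et j\<bar>)"
proof -
  have d: "real (la 0) - real (part_size la - part_size mu) = real k"
    using strip_sizes(1,2) unfolding k_def by linarith
  have A: "\<bar>real (la (Suc i)) - real (mu i)\<bar> \<le> real k" for i
    using strip_sizes(3)[of i] hstripD(1)[OF h, of i] unfolding k_def by linarith
  have B: "\<bar>real (conjugate la j) - real (conjugate mu j)\<bar> \<le> 1" for j
    using hstrip_conjugate_bounds[OF la h, of j] by linarith
  have eq: "phase (Suc I) th J et la - (real (part_size la - part_size mu) * th 0 + phase I (\<lambda>i. th (Suc i)) J et mu)
    = th 0 * (real (la 0) - real (part_size la - part_size mu))
      + (\<Sum>i<I. th (Suc i) * (real (la (Suc i)) - real (mu i)))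
      + (\<Sum>j<J. et j * (real (conjugate la j) - real (conjugate mu j)))"
    unfolding phase_def sum.lessThan_Suc_shift by (simp add: algebra_simps sum_subtractf)
  have "\<bar>phase (Suc I) th J et la - (real (part_size la - part_size mu) * th 0 + phase I (\<lambda>i. th (Suc i)) J et mu)\<bar> \<le> \<bar>th 0\<bar> * real k + (\<Sum>i<I. \<bar>th (Suc i)\<bar> * real k) + (\<Sum>j<J. \<bar>et j\<bar> * 1)"
    unfolding eq
  proof (intro order_trans[OF abs_triangle_ineq] add_mono)
    show "\<bar>th 0 * (real (la 0) - real (part_size la - part_size mu))\<bar> \<le> \<bar>th 0\<bar> * real k" unfolding d by (simp add: abs_mult)
    show "\<bar>\<Sum>i<I. th (Suc i) * (real (la (Suc i)) - real (mu i))\<bar> \<le> (\<Sum>i<I. \<bar>th (Suc i)\<bar> * real k)"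
      by (rule order_trans[OF sum_abs]) (intro sum_mono, simp only: abs_mult, intro mult_left_mono A, simp)
    show "\<bar>\<Sum>j<J. et j * (real (conjugate la j) - real (conjugate mu j))\<bar> \<le> (\<Sum>j<J. \<bar>et j\<bar> * 1)"
      by (rule order_trans[OF sum_abs]) (intro sum_mono, simp only: abs_mult, intro mult_left_mono B, simp)
  qed
  also have "\<dots> = (\<Sum>i<Suc I. \<bar>th i\<bar>) * real k + (\<Sum>j<J. \<bar>et j\<bar>)"
    unfolding sum.lessThan_Suc_shift by (simp add: sum_distrib_right distrib_right)
  finally show ?thesis .
qed

end

text \<open>The expectation of the defect \<open>k\<close>, for fixed \<open>\<lambda>\<close>. Since \<open>\<mu>\<close> is reached from \<open>\<lambda>\<close> without its first row by adding a horizontal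
  strip of size \<open>k\<close>, the weighted sum is at most \<open>x ^ \<lambda> 0\<close> times the sum of \<open>k * x ^ - k * h\<^sub>k\<close>; the margin \<open>\<rho> > 1\<close> absorbs
  the factor \<open>k\<close>, as \<open>k * (\<rho> - 1) \<le> \<rho> ^ k\<close>. The term \<open>k = 0\<close> alone shows that the normalization
  \<open>add_pos x s \<lambda>\<close> is not smaller.\<close>
lemma first_row_defect:
  assumes s: "\<And>p. is_part p \<Longrightarrow> 0 \<le> s p" and x: "x > 0" and r: "\<rho> > 1" and K: "K \<ge> 0"
    and pieri_bound: "pieri_bound (\<rho> / x) K s" and la: "is_part la"
  shows "(\<Sum>mu | hstrip la mu. x ^ (part_size la - part_size mu) * (real (part_size mu - part_size (\<lambda>i. la (Suc i))) * s mu))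
    \<le> K / (\<rho> - 1) * add_pos x s la"
proof -
  let ?nu = "\<lambda>i. la (Suc i)"
  let ?k = "\<lambda>mu. part_size mu - part_size ?nu"
  have nu: "is_part ?nu" by (rule hstrip_part_lower[OF hstrip_shift[OF la] la])
  have tm: "x ^ (part_size la - part_size mu) * (real (?k mu) * s mu) \<le> x ^ la 0 / (\<rho> - 1) * ((\<rho> / x) ^ ?k mu * s mu)"
    if mu: "hstrip la mu" for mu
  proof -
    have kl: "?k mu \<le> la 0" by (rule strip_sizes(1)[OF la mu])
    have e: "x ^ (part_size la - part_size mu) = x ^ la 0 / x ^ ?k mu"
      unfolding strip_sizes(2)[OF la mu] using x kl by (simp add: power_diff)
    have "1 + real (?k mu) * (\<rho> - 1) \<le> (1 + (\<rho> - 1)) ^ ?k mu"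
      by (rule Bernoulli_inequality) (use r in simp)
    then have "real (?k mu) * (\<rho> - 1) \<le> \<rho> ^ ?k mu" by simp
    then have "real (?k mu) \<le> \<rho> ^ ?k mu / (\<rho> - 1)" using r by (simp add: field_simps)
    then have "x ^ la 0 / x ^ ?k mu * (real (?k mu) * s mu) \<le> x ^ la 0 / x ^ ?k mu * (\<rho> ^ ?k mu / (\<rho> - 1) * s mu)"
      using x s[OF hstrip_part_lower[OF mu la]] by (intro mult_left_mono mult_right_mono) auto
    then show ?thesis unfolding e by (simp add: power_divide ac_simps)
  qed
  have "(\<Sum>mu | hstrip la mu. x ^ (part_size la - part_size mu) * (real (?k mu) * s mu))
    \<le> (\<Sum>mu | hstrip la mu. x ^ la 0 / (\<rho> - 1) * ((\<rho> / x) ^ ?k mu * s mu))"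
    by (intro sum_mono tm) simp
  also have "\<dots> = x ^ la 0 / (\<rho> - 1) * (\<Sum>mu | hstrip la mu. (\<rho> / x) ^ ?k mu * s mu)"
    by (rule sum_distrib_left[symmetric])
  also have "\<dots> \<le> x ^ la 0 / (\<rho> - 1) * (K * s ?nu)"
  proof (rule mult_left_mono)
    let ?U = "\<lambda>k. {mu. hstrip mu ?nu \<and> part_size mu = part_size ?nu + k}"
    have "(\<Sum>mu | hstrip la mu. (\<rho> / x) ^ ?k mu * s mu) \<le> (\<Sum>mu\<in>(\<Union>k\<le>la 0. ?U k). (\<rho> / x) ^ ?k mu * s mu)"
    proof (rule sum_mono2)
      show "finite (\<Union>k\<le>la 0. ?U k)" using finite_hstrip_upper[OF nu] by auto
      show "{mu. hstrip la mu} \<subseteq> (\<Union>k\<le>la 0. ?U k)"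
      proof
        fix mu assume "mu \<in> {mu. hstrip la mu}"
        then have mu: "hstrip la mu" by simp
        have "part_size mu = part_size ?nu + ?k mu" using shift_le[OF la mu] by simp
        then show "mu \<in> (\<Union>k\<le>la 0. ?U k)" using shift_hstrip[OF la mu] strip_sizes(1)[OF la mu] by blast
      qed
      show "0 \<le> (\<rho> / x) ^ ?k mu * s mu" if "mu \<in> (\<Union>k\<le>la 0. ?U k) - {mu. hstrip la mu}" for mu
        using that s[of mu] hstrip_part_upper[OF _ nu] x r by auto
    qed
    also have "\<dots> = (\<Sum>k\<le>la 0. \<Sum>mu\<in>?U k. (\<rho> / x) ^ ?k mu * s mu)"
      by (rule sum.UNION_disjoint) (auto simp: finite_hstrip_upper[OF nu])
    also have "\<dots> = (\<Sum>k\<le>la 0. (\<rho> / x) ^ k * up_strip k s ?nu)"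
      unfolding up_strip_def sum_distrib_left by (intro sum.cong) auto
    also have "\<dots> \<le> K * s ?nu" by (rule pbD[OF pieri_bound nu])
    finally show "(\<Sum>mu | hstrip la mu. (\<rho> / x) ^ ?k mu * s mu) \<le> K * s ?nu" .
  qed (use x r in auto)
  also have "\<dots> = K / (\<rho> - 1) * (x ^ (part_size la - part_size ?nu) * s ?nu)"
    using shift_size[OF la hstrip_shift[OF la]] by simp
  also have "\<dots> \<le> K / (\<rho> - 1) * add_pos x s la"
  proof (rule mult_left_mono)
    show "x ^ (part_size la - part_size ?nu) * s ?nu \<le> add_pos x s la"
      unfolding add_pos_def
      by (rule member_le_sum[of ?nu]) (use hstrip_shift[OF la] x s hstrip_part_lower[OF _ la] finite_hstrip[OF la] in auto)
  qed (use K r in auto)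
  finally show ?thesis .
qed

text \<open>One step of the comparison: the phase of the first row is traded for a phase carried by the letter \<open>x\<close>, with a
  relative error that does not depend on \<open>\<lambda>\<close>.\<close>
lemma replace_row:
  assumes s: "\<And>p. is_part p \<Longrightarrow> 0 \<le> s p" and x: "x > 0" and r: "\<rho> > 1" and K: "K \<ge> 0"
    and pieri_bound: "pieri_bound (\<rho> / x) K s" and la: "is_part la"
  shows "cmod (of_real (add_pos x s la) * cis (phase (Suc I) th J et la)
      - add_pos (of_real x * cis (th 0)) (\<lambda>mu. of_real (s mu) * cis (phase I (\<lambda>i. th (Suc i)) J et mu)) la)
    \<le> (K / (\<rho> - 1) * (\<Sum>i<Suc I. \<bar>th i\<bar>) + (\<Sum>j<J. \<bar>et j\<bar>)) * add_pos x s la"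
proof -
  let ?T = "\<Sum>i<Suc I. \<bar>th i\<bar>" and ?E = "\<Sum>j<J. \<bar>et j\<bar>"
  let ?k = "\<lambda>mu. part_size mu - part_size (\<lambda>i. la (Suc i))"
  let ?d = "\<lambda>mu. part_size la - part_size mu"
  let ?A = "phase (Suc I) th J et la" and ?B = "\<lambda>mu. real (?d mu) * th 0 + phase I (\<lambda>i. th (Suc i)) J et mu"
  have eq: "of_real (add_pos x s la) * cis ?A - add_pos (of_real x * cis (th 0)) (\<lambda>mu. of_real (s mu) * cis (phase I (\<lambda>i. th (Suc i)) J et mu)) la
    = (\<Sum>mu | hstrip la mu. of_real (x ^ ?d mu * s mu) * (cis ?A - cis (?B mu)))"
  proof -
    have "of_real (add_pos x s la) * cis ?A = (\<Sum>mu | hstrip la mu. of_real (x ^ ?d mu * s mu) * cis ?A)"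
      unfolding add_pos_def of_real_sum sum_distrib_right ..
    moreover have "add_pos (of_real x * cis (th 0)) (\<lambda>mu. of_real (s mu) * cis (phase I (\<lambda>i. th (Suc i)) J et mu)) la
      = (\<Sum>mu | hstrip la mu. of_real (x ^ ?d mu * s mu) * cis (?B mu))"
    proof -
      have B: "cis (?B mu) = cis (th 0) ^ ?d mu * cis (phase I (\<lambda>i. th (Suc i)) J et mu)" for mu
        unfolding Complex.DeMoivre by (rule cis_mult[symmetric])
      show ?thesis unfolding add_pos_def B power_mult_distrib by (intro sum.cong refl) (simp add: ac_simps)
    qed
    ultimately show ?thesis by (simp add: sum_subtractf right_diff_distrib)
  qed
  have "cmod (of_real (add_pos x s la) * cis ?A - add_pos (of_real x * cis (th 0)) (\<lambda>mu. of_real (s mu) * cis (phase I (\<lambda>i. th (Suc i)) J et mu)) la) \<le> (\<Sum>mu | hstrip la mu. x ^ ?d mu * s mu * (?T * real (?k mu) + ?E))"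
    unfolding eq
  proof (rule sum_norm_le)
    fix mu assume "mu \<in> {mu. hstrip la mu}"
    then have mu: "hstrip la mu" by simp
    have nn: "0 \<le> x ^ ?d mu * s mu" using x s[OF hstrip_part_lower[OF mu la]] by simp
    have "cmod (cis ?A - cis (?B mu)) \<le> ?T * real (?k mu) + ?E"
      by (rule order_trans[OF cmod_cis_diff phase_diff[OF la mu]])
    then show "cmod (of_real (x ^ ?d mu * s mu) * (cis ?A - cis (?B mu))) \<le> x ^ ?d mu * s mu * (?T * real (?k mu) + ?E)"
      unfolding norm_mult norm_of_real using nn by (simp only: abs_of_nonneg mult_left_mono)
  qed
  also have "\<dots> = ?T * (\<Sum>mu | hstrip la mu. x ^ ?d mu * (real (?k mu) * s mu)) + ?E * add_pos x s la"
    unfolding add_pos_def by (simp add: sum_distrib_left sum.distrib algebra_simps)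
  also have "\<dots> \<le> ?T * (K / (\<rho> - 1) * add_pos x s la) + ?E * add_pos x s la"
    by (intro add_mono mult_left_mono first_row_defect[OF s x r K pieri_bound la]) (auto intro: sum_nonneg)
  finally show ?thesis by (simp add: algebra_simps)
qed

fun add_pos_letters :: "nat \<Rightarrow> (nat \<Rightarrow> 'a::real_normed_field) \<Rightarrow> (shape \<Rightarrow> 'a) \<Rightarrow> shape \<Rightarrow> 'a" where
  "add_pos_letters 0 a s = s"
| "add_pos_letters (Suc n) a s = add_pos (a 0) (add_pos_letters n (\<lambda>i. a (Suc i)) s)"

fun add_neg_letters :: "nat \<Rightarrow> (nat \<Rightarrow> 'a::real_normed_field) \<Rightarrow> (shape \<Rightarrow> 'a) \<Rightarrow> shape \<Rightarrow> 'a" where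
  "add_neg_letters 0 a s = s"
| "add_neg_letters (Suc n) a s = add_neg (a 0) (add_neg_letters n (\<lambda>i. a (Suc i)) s)"

lemma add_neg_letters_conjugate: "is_part la \<Longrightarrow> add_neg_letters n b s (conjugate la) = add_pos_letters n b (\<lambda>p. s (conjugate p)) la"
proof (induction n arbitrary: b la)
  case (Suc n)
  show ?case unfolding add_neg_letters.simps add_pos_letters.simps add_neg_conjugate[OF Suc.prems]
    by (rule add_pos_cong[OF Suc.IH Suc.prems])
qed simp

lemma add_neg_letters_add_pos_letters: "is_part la \<Longrightarrow> add_neg_letters n b s la = add_pos_letters n b (\<lambda>p. s (conjugate p)) (conjugate la)"
  using add_neg_letters_conjugate[OF conjugate_is_part, of la n b s] by (simp add: conjugate_conjugate)

lemma add_pos_letters_nonneg: "(\<And>i. i < n \<Longrightarrow> 0 \<le> (a i :: real)) \<Longrightarrow> (\<And>p. is_part p \<Longrightarrow> 0 \<le> s p) \<Longrightarrow> is_part la \<Longrightarrow> 0 \<le> add_pos_letters n a s la"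
  by (induction n arbitrary: a la) (auto intro!: add_pos_nonneg)

lemma add_neg_letters_nonneg: "(\<And>i. i < n \<Longrightarrow> 0 \<le> (a i :: real)) \<Longrightarrow> (\<And>p. is_part p \<Longrightarrow> 0 \<le> s p) \<Longrightarrow> is_part la \<Longrightarrow> 0 \<le> add_neg_letters n a s la"
  by (induction n arbitrary: a la) (auto intro!: add_neg_nonneg)

lemma add_pos_letters_at_0: "add_pos_letters n a s (\<lambda>_. 0) = s (\<lambda>_. 0)" by (induction n arbitrary: a) (auto simp: add_pos_at_0)
lemma add_neg_letters_at_0: "add_neg_letters n a s (\<lambda>_. 0) = s (\<lambda>_. 0)" by (induction n arbitrary: a) (auto simp: add_neg_at_0)

lemma harmonic_add_pos_letters: "harmonic c s \<Longrightarrow> harmonic (c + (\<Sum>i<n. a i)) (add_pos_letters n a s)"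
proof (induction n arbitrary: a)
  case (Suc n)
  show ?case using harmonic_add_pos[OF Suc.IH[OF Suc.prems, of "\<lambda>i. a (Suc i)"], of "a 0"]
    unfolding sum.lessThan_Suc_shift by (simp add: algebra_simps)
qed simp

lemma harmonic_add_neg_letters: "harmonic c s \<Longrightarrow> harmonic (c + (\<Sum>i<n. a i)) (add_neg_letters n a s)"
proof (induction n arbitrary: a)
  case (Suc n)
  show ?case using harmonic_add_neg[OF Suc.IH[OF Suc.prems, of "\<lambda>i. a (Suc i)"], of "a 0"]
    unfolding sum.lessThan_Suc_shift by (simp add: algebra_simps)
qed simp

text \<open>Adjoining letters preserves relative errors, because the coefficients of \<open>add_pos\<close> are bounded by those at the
  absolute values of the letters.\<close>
lemma add_pos_letters_diff:
  assumes "\<And>p. is_part p \<Longrightarrow> cmod (f p - g p) \<le> e * S p" "is_part la"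
  shows "cmod (add_pos_letters n u f la - add_pos_letters n u g la) \<le> e * add_pos_letters n (\<lambda>i. cmod (u i)) S la"
  using assms(2)
proof (induction n arbitrary: u la)
  case 0 then show ?case using assms(1) by simp
next
  case (Suc n)
  let ?f = "add_pos_letters n (\<lambda>i. u (Suc i)) f" and ?g = "add_pos_letters n (\<lambda>i. u (Suc i)) g"
  let ?S = "add_pos_letters n (\<lambda>i. cmod (u (Suc i))) S"
  have eq: "add_pos_letters (Suc n) u f la - add_pos_letters (Suc n) u g la = (\<Sum>mu | hstrip la mu. u 0 ^ (part_size la - part_size mu) * (?f mu - ?g mu))"
    unfolding add_pos_letters.simps add_pos_def by (simp add: sum_subtractf algebra_simps)
  have "cmod (add_pos_letters (Suc n) u f la - add_pos_letters (Suc n) u g la) \<le> (\<Sum>mu | hstrip la mu. cmod (u 0) ^ (part_size la - part_size mu) * (e * ?S mu))"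
    unfolding eq
  proof (rule sum_norm_le)
    fix mu assume "mu \<in> {mu. hstrip la mu}"
    then have "is_part mu" using hstrip_part_lower Suc.prems by auto
    from Suc.IH[OF this] show "cmod (u 0 ^ (part_size la - part_size mu) * (?f mu - ?g mu)) \<le> cmod (u 0) ^ (part_size la - part_size mu) * (e * ?S mu)"
      unfolding norm_mult norm_power by (intro mult_left_mono) auto
  qed
  also have "\<dots> = e * add_pos_letters (Suc n) (\<lambda>i. cmod (u i)) S la"
    unfolding add_pos_letters.simps add_pos_def by (simp add: sum_distrib_left ac_simps)
  finally show ?case .
qed

lemma pieri_bound_add_pos_letters:
  assumes "0 \<le> z" "\<And>p. is_part p \<Longrightarrow> 0 \<le> s p" "\<exists>K\<ge>0. pieri_bound z K s"
  shows "(\<And>i. i < n \<Longrightarrow> 0 \<le> a i \<and> a i * z < 1) \<Longrightarrow> \<exists>K\<ge>0. pieri_bound z K (add_pos_letters n a s)"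
proof (induction n arbitrary: a)
  case 0 then show ?case using assms(3) by simp
next
  case (Suc n)
  obtain K where K: "K \<ge> 0" "pieri_bound z K (add_pos_letters n (\<lambda>i. a (Suc i)) s)" using Suc.IH[of "\<lambda>i. a (Suc i)"] Suc.prems by auto
  have "pieri_bound z (1 / (1 - a 0 * z) * K) (add_pos_letters (Suc n) a s)"
    unfolding add_pos_letters.simps by (intro pieri_bound_add_pos K(2) assms(1) add_pos_letters_nonneg assms(2)) (use Suc.prems in auto)
  moreover have "0 \<le> 1 / (1 - a 0 * z) * K" using K(1) Suc.prems[of 0] by simp
  ultimately show ?case by blast
qed

lemma pieri_bound_add_neg_letters:
  assumes "0 \<le> z" "\<And>p. is_part p \<Longrightarrow> 0 \<le> s p" "\<exists>K\<ge>0. pieri_bound z K s"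
  shows "(\<And>i. i < n \<Longrightarrow> 0 \<le> a i) \<Longrightarrow> \<exists>K\<ge>0. pieri_bound z K (add_neg_letters n a s)"
proof (induction n arbitrary: a)
  case 0 then show ?case using assms(3) by simp
next
  case (Suc n)
  obtain K where K: "K \<ge> 0" "pieri_bound z K (add_neg_letters n (\<lambda>i. a (Suc i)) s)" using Suc.IH[of "\<lambda>i. a (Suc i)"] Suc.prems by auto
  have "pieri_bound z ((1 + a 0 * z) * K) (add_neg_letters (Suc n) a s)"
    unfolding add_neg_letters.simps by (intro pieri_bound_add_neg K(2) assms(1) add_neg_letters_nonneg assms(2)) (use Suc.prems in auto)
  moreover have "0 \<le> (1 + a 0 * z) * K" using K(1) Suc.prems[of 0] assms(1) by simp
  ultimately show ?case by blast
qed

text \<open>The letters are positive and decrease geometrically, with room for the margin \<open>\<rho>\<close> of \<open>first_row_defect\<close> against both the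
  later letters and the rest of the alphabet. The last letter of the list is adjoined first.\<close>
definition separated :: "nat \<Rightarrow> (nat \<Rightarrow> real) \<Rightarrow> (shape \<Rightarrow> real) \<Rightarrow> bool" where
  "separated I a s \<longleftrightarrow> (\<forall>i<I. 0 < a i \<and> (\<exists>\<rho>>1. (\<exists>K\<ge>0. pieri_bound (\<rho> / a i) K s) \<and> (\<forall>j<I. i < j \<longrightarrow> \<rho> * a j < a i)))"

text \<open>An error that is pointwise at most \<open>e * s \<mu>\<close> stays at most \<open>e * s \<lambda>\<close> after further letters have been adjoined
  (\<open>add_pos_letters_diff\<close>), so the errors of the single steps add up. The constant depends neither on the
  frequencies nor on the partition.\<close>
lemma replace_rows:
  assumes s: "\<And>p. is_part p \<Longrightarrow> 0 \<le> s p"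
  shows "separated I a s \<Longrightarrow> \<exists>C\<ge>0. \<forall>th J et la. is_part la \<longrightarrow>
    cmod (of_real (add_pos_letters I a s la) * cis (phase I th J et la)
      - add_pos_letters I (\<lambda>i. of_real (a i) * cis (th i)) (\<lambda>mu. of_real (s mu) * cis (phase 0 th J et mu)) la)
    \<le> C * ((\<Sum>i<I. \<bar>th i\<bar>) + (\<Sum>j<J. \<bar>et j\<bar>)) * add_pos_letters I a s la"
proof (induction I arbitrary: a)
  case 0
  show ?case by (intro exI[of _ 0]) simp
next
  case (Suc I)
  let ?a = "\<lambda>i. a (Suc i)"
  have "separated I ?a s" using Suc.prems unfolding separated_def
  proof (intro allI impI, goal_cases)
    case (1 i)
    then have "Suc i < Suc I" by simp
    with 1(1) obtain \<rho> where "0 < a (Suc i)" "\<rho> > 1" "\<exists>K\<ge>0. pieri_bound (\<rho> / a (Suc i)) K s"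
      "\<forall>j<Suc I. Suc i < j \<longrightarrow> \<rho> * a j < a (Suc i)" by blast
    moreover from this have "\<forall>j<I. i < j \<longrightarrow> \<rho> * a (Suc j) < a (Suc i)" by simp
    ultimately show ?case by blast
  qed
  then obtain C where C: "C \<ge> 0" "\<And>th J et la. is_part la \<Longrightarrow>
    cmod (of_real (add_pos_letters I ?a s la) * cis (phase I th J et la)
      - add_pos_letters I (\<lambda>i. of_real (?a i) * cis (th i)) (\<lambda>mu. of_real (s mu) * cis (phase 0 th J et mu)) la)
    \<le> C * ((\<Sum>i<I. \<bar>th i\<bar>) + (\<Sum>j<J. \<bar>et j\<bar>)) * add_pos_letters I ?a s la" using Suc.IH by blast
  obtain \<rho> where rho: "\<rho> > 1" "\<exists>K\<ge>0. pieri_bound (\<rho> / a 0) K s" "\<And>j. j < I \<Longrightarrow> \<rho> * a (Suc j) < a 0"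
    using Suc.prems unfolding separated_def by (metis Suc_less_eq zero_less_Suc)
  have pos: "0 < a i" if "i < Suc I" for i using Suc.prems that unfolding separated_def by blast
  have a0: "0 < a 0" using pos by simp
  let ?R = "add_pos_letters I ?a s"
  have R0: "is_part p \<Longrightarrow> 0 \<le> ?R p" for p by (rule add_pos_letters_nonneg[OF _ s]) (use pos less_imp_le in auto)
  have "\<exists>K\<ge>0. pieri_bound (\<rho> / a 0) K ?R"
  proof (rule pieri_bound_add_pos_letters[OF _ s rho(2)])
    show "0 \<le> ?a i \<and> ?a i * (\<rho> / a 0) < 1" if "i < I" for i
      using pos[of "Suc i"] rho(3)[OF that] that a0 by (simp add: field_simps)
  qed (use rho(1) a0 in auto)
  then obtain K where K: "K \<ge> 0" "pieri_bound (\<rho> / a 0) K ?R" by blast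
  define C' where "C' = max (K / (\<rho> - 1)) 1 + C"
  show ?case
  proof (intro exI[of _ C'] conjI allI impI)
    show "0 \<le> C'" unfolding C'_def using C(1) by simp
    fix th et :: "nat \<Rightarrow> real" and J and la :: "nat \<Rightarrow> nat" assume la: "is_part la"
    let ?T = "\<Sum>i<Suc I. \<bar>th i\<bar>" and ?E = "\<Sum>j<J. \<bar>et j\<bar>"
    let ?th = "\<lambda>i. th (Suc i)"
    let ?u = "of_real (a 0) * cis (th 0)"
    let ?m = "\<lambda>mu. of_real (?R mu) * cis (phase I ?th J et mu)"
    let ?g = "add_pos_letters I (\<lambda>i. of_real (?a i) * cis (?th i)) (\<lambda>mu. of_real (s mu) * cis (phase 0 th J et mu))"
    let ?qt_weight = "add_pos_letters (Suc I) a s la"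
    have full0: "0 \<le> ?qt_weight" by (rule add_pos_letters_nonneg[OF _ s la]) (use pos less_imp_le in blast)
    have TE: "0 \<le> ?T" "0 \<le> ?E" by (auto intro: sum_nonneg)
    have 1: "cmod (of_real ?qt_weight * cis (phase (Suc I) th J et la) - add_pos ?u ?m la) \<le> (K / (\<rho> - 1) * ?T + ?E) * ?qt_weight"
      using replace_row[OF R0 a0 rho(1) K la] by simp
    have p0: "phase 0 ?th J et = phase 0 th J et" unfolding phase_def by simp
    have 2: "cmod (add_pos_letters 1 (\<lambda>_. ?u) ?m la - add_pos_letters 1 (\<lambda>_. ?u) ?g la)
        \<le> C * ((\<Sum>i<I. \<bar>?th i\<bar>) + ?E) * add_pos_letters 1 (\<lambda>i. cmod ?u) ?R la"
      by (rule add_pos_letters_diff[OF _ la]) (use C(2)[of _ ?th J et] in \<open>simp add: p0\<close>)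
    have "(\<Sum>i<I. \<bar>?th i\<bar>) \<le> ?T" unfolding sum.lessThan_Suc_shift by simp
    then have "C * ((\<Sum>i<I. \<bar>?th i\<bar>) + ?E) * ?qt_weight \<le> C * (?T + ?E) * ?qt_weight"
      using C(1) full0 by (intro mult_right_mono mult_left_mono) auto
    moreover have "add_pos_letters 1 (\<lambda>i. cmod ?u) ?R la = ?qt_weight" using a0 by (simp add: norm_mult)
    ultimately have 3: "cmod (add_pos ?u ?m la - add_pos ?u ?g la) \<le> C * (?T + ?E) * ?qt_weight"
      using 2 by simp
    have "(K / (\<rho> - 1) * ?T + ?E) * ?qt_weight \<le> (max (K / (\<rho> - 1)) 1 * ?T + max (K / (\<rho> - 1)) 1 * ?E) * ?qt_weight"
    proof (intro mult_right_mono add_mono)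
      show "?E \<le> max (K / (\<rho> - 1)) 1 * ?E" using mult_right_mono[OF max.cobounded2[of 1 "K / (\<rho> - 1)"] TE(2)] by simp
    qed (use TE full0 in auto)
    then have 4: "cmod (of_real ?qt_weight * cis (phase (Suc I) th J et la) - add_pos ?u ?g la)
      \<le> (max (K / (\<rho> - 1)) 1 * ?T + max (K / (\<rho> - 1)) 1 * ?E) * ?qt_weight + C * (?T + ?E) * ?qt_weight"
      using norm_diff_triangle_le[OF order_trans[OF 1] 3] by blast
    then show "cmod (of_real ?qt_weight * cis (phase (Suc I) th J et la)
        - add_pos_letters (Suc I) (\<lambda>i. of_real (a i) * cis (th i)) (\<lambda>mu. of_real (s mu) * cis (phase 0 th J et mu)) la)
      \<le> C' * (?T + ?E) * ?qt_weight"
      unfolding C'_def add_pos_letters.simps by (simp only: distrib_right distrib_left add.assoc)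
  qed
qed

text \<open>After the positive letters are gone, only column phases remain, and conjugation turns them into row
  phases for the negative letters.\<close>
lemma replace_all:
  assumes s: "\<And>p. is_part p \<Longrightarrow> 0 \<le> s p" and b0: "\<And>j. j < J \<Longrightarrow> 0 \<le> b j"
    and A: "separated I a s" and B: "separated J b (\<lambda>p. s (conjugate p))"
  shows "\<exists>C\<ge>0. \<forall>th et la. is_part la \<longrightarrow>
    cmod (of_real (add_pos_letters I a (add_neg_letters J b s) la) * cis (phase I th J et la)
      - add_pos_letters I (\<lambda>i. of_real (a i) * cis (th i)) (add_neg_letters J (\<lambda>j. of_real (b j) * cis (et j)) (\<lambda>mu. of_real (s mu))) la)
    \<le> C * ((\<Sum>i<I. \<bar>th i\<bar>) + (\<Sum>j<J. \<bar>et j\<bar>)) * add_pos_letters I a (add_neg_letters J b s) la"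
proof -
  let ?S = "add_neg_letters J b s"
  have S0: "is_part p \<Longrightarrow> 0 \<le> ?S p" for p by (rule add_neg_letters_nonneg[OF b0 s])
  have "separated I a ?S" unfolding separated_def
  proof (intro allI impI)
    fix i assume i: "i < I"
    then obtain \<rho> where r: "0 < a i" "\<rho> > 1" "\<exists>K\<ge>0. pieri_bound (\<rho> / a i) K s" "\<forall>j<I. i < j \<longrightarrow> \<rho> * a j < a i"
      using A unfolding separated_def by blast
    have "\<exists>K\<ge>0. pieri_bound (\<rho> / a i) K ?S" by (rule pieri_bound_add_neg_letters[OF _ s r(3) b0]) (use r in auto)
    then show "0 < a i \<and> (\<exists>\<rho>>1. (\<exists>K\<ge>0. pieri_bound (\<rho> / a i) K ?S) \<and> (\<forall>j<I. i < j \<longrightarrow> \<rho> * a j < a i))"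
      using r by blast
  qed
  from replace_rows[of ?S, OF S0 this] obtain C1 where C1: "C1 \<ge> 0" "\<And>th J' et la. is_part la \<Longrightarrow>
    cmod (of_real (add_pos_letters I a ?S la) * cis (phase I th J' et la)
      - add_pos_letters I (\<lambda>i. of_real (a i) * cis (th i)) (\<lambda>mu. of_real (?S mu) * cis (phase 0 th J' et mu)) la)
    \<le> C1 * ((\<Sum>i<I. \<bar>th i\<bar>) + (\<Sum>j<J'. \<bar>et j\<bar>)) * add_pos_letters I a ?S la" by blast
  from replace_rows[of "\<lambda>p. s (conjugate p)", OF s[OF conjugate_is_part] B] obtain C2 where C2: "C2 \<ge> 0" "\<And>th J' et la. is_part la \<Longrightarrow>
    cmod (of_real (add_pos_letters J b (\<lambda>p. s (conjugate p)) la) * cis (phase J th J' et la)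
      - add_pos_letters J (\<lambda>i. of_real (b i) * cis (th i)) (\<lambda>mu. of_real (s (conjugate mu)) * cis (phase 0 th J' et mu)) la)
    \<le> C2 * ((\<Sum>i<J. \<bar>th i\<bar>) + (\<Sum>j<J'. \<bar>et j\<bar>)) * add_pos_letters J b (\<lambda>p. s (conjugate p)) la" by blast
  show ?thesis
  proof (intro exI[of _ "C1 + C2"] conjI allI impI)
    show "0 \<le> C1 + C2" using C1(1) C2(1) by simp
    fix th et :: "nat \<Rightarrow> real" and la :: "nat \<Rightarrow> nat" assume la: "is_part la"
    let ?T = "\<Sum>i<I. \<bar>th i\<bar>" and ?E = "\<Sum>j<J. \<bar>et j\<bar>"
    let ?u = "\<lambda>i. of_real (a i) * cis (th i)" and ?v = "\<lambda>j. of_real (b j) * cis (et j)"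
    let ?qt_weight = "add_pos_letters I a ?S la"
    have apos: "0 \<le> a i" if "i < I" for i using A that unfolding separated_def by (simp add: less_imp_le)
    have full0: "0 \<le> ?qt_weight" by (rule add_pos_letters_nonneg[OF apos S0 la])
    have TE: "0 \<le> ?T" "0 \<le> ?E" by (auto intro: sum_nonneg)
    have "cmod (of_real (?S mu) * cis (phase 0 th J et mu) - add_neg_letters J ?v (\<lambda>mu. of_real (s mu)) mu) \<le> (C2 * ?E) * ?S mu"
      if mu: "is_part mu" for mu
    proof -
      have p: "phase 0 th J et mu = phase J et 0 th (conjugate mu)" "phase 0 et 0 th p = 0" for p unfolding phase_def by simp_all
      show ?thesis unfolding add_neg_letters_add_pos_letters[OF mu] p(1) using C2(2)[OF conjugate_is_part[OF mu], of et 0 th] by (simp add: p(2))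
    qed
    from add_pos_letters_diff[OF this la, where n=I and u="?u"]
    have 2: "cmod (add_pos_letters I ?u (\<lambda>mu. of_real (?S mu) * cis (phase 0 th J et mu)) la - add_pos_letters I ?u (add_neg_letters J ?v (\<lambda>mu. of_real (s mu))) la)
      \<le> (C2 * ?E) * add_pos_letters I (\<lambda>i. cmod (?u i)) ?S la" .
    have abs_add_pos_letters: "add_pos_letters I (\<lambda>i. cmod (of_real (a i) * cis (th i))) f p = add_pos_letters I a f p" if "\<And>i. i < I \<Longrightarrow> 0 \<le> a i"
      for I a th f p using that
    proof (induction I arbitrary: a th p)
      case (Suc I)
      have "add_pos_letters I (\<lambda>i. cmod (of_real (a (Suc i)) * cis (th (Suc i)))) f = add_pos_letters I (\<lambda>i. a (Suc i)) f"
        by (rule ext) (rule Suc.IH[of "\<lambda>i. a (Suc i)" "\<lambda>i. th (Suc i)"], use Suc.prems in auto)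
      then show ?case using Suc.prems[of 0] by (simp add: norm_mult)
    qed simp
    have ar: "add_pos_letters I (\<lambda>i. cmod (?u i)) ?S la = ?qt_weight" by (rule abs_add_pos_letters) (rule apos)
    have "(C2 * ?E) * ?qt_weight \<le> (C2 * (?T + ?E)) * ?qt_weight"
      using C2(1) TE full0 by (intro mult_right_mono mult_left_mono) auto
    then have 3: "cmod (add_pos_letters I ?u (\<lambda>mu. of_real (?S mu) * cis (phase 0 th J et mu)) la - add_pos_letters I ?u (add_neg_letters J ?v (\<lambda>mu. of_real (s mu))) la)
      \<le> (C2 * (?T + ?E)) * ?qt_weight" using 2 unfolding ar by linarith
    show "cmod (of_real ?qt_weight * cis (phase I th J et la) - add_pos_letters I ?u (add_neg_letters J ?v (\<lambda>mu. of_real (s mu))) la)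
      \<le> (C1 + C2) * (?T + ?E) * ?qt_weight"
      using norm_diff_triangle_le[OF C1(2)[OF la, of th J et] 3] by (simp only: distrib_right mult.assoc)
  qed
qed

lemma harmonic_of_real: "harmonic c s \<Longrightarrow> harmonic (of_real c) (\<lambda>p. complex_of_real (s p))"
proof -
  assume h: "harmonic c s"
  have "up_strip 1 (\<lambda>p. complex_of_real (s p)) nu = of_real (up_strip 1 s nu)" for nu unfolding up_strip_def by simp
  then show ?thesis using h unfolding harmonic_def by simp
qed

text \<open>Summed against dimensions, the exact term becomes the \<open>n\<close>-th power of the characteristic function of one letter,
  by \<open>dim_sum_harmonic\<close> with complex letters.\<close>
lemma characteristic_estimate:
  assumes s: "\<And>p. is_part p \<Longrightarrow> 0 \<le> s p" and b0: "\<And>j. j < J \<Longrightarrow> 0 \<le> b j"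
    and A: "separated I a s" and B: "separated J b (\<lambda>p. s (conjugate p))"
    and h: "harmonic r s" and s1: "s (\<lambda>_. 0) = 1" and tot: "(\<Sum>i<I. a i) + (\<Sum>j<J. b j) + r = 1"
  shows "\<exists>C\<ge>0. \<forall>n th et.
    cmod (dim_sum n (\<lambda>la. of_real (add_pos_letters I a (add_neg_letters J b s) la) * cis (phase I th J et la))
      - ((\<Sum>i<I. of_real (a i) * cis (th i)) + (\<Sum>j<J. of_real (b j) * cis (et j)) + of_real r) ^ n)
    \<le> C * ((\<Sum>i<I. \<bar>th i\<bar>) + (\<Sum>j<J. \<bar>et j\<bar>))"
proof -
  let ?qt_weight = "add_pos_letters I a (add_neg_letters J b s)"
  obtain C where C: "C \<ge> 0" "\<And>th et la. is_part la \<Longrightarrow>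
    cmod (of_real (?qt_weight la) * cis (phase I th J et la)
      - add_pos_letters I (\<lambda>i. of_real (a i) * cis (th i)) (add_neg_letters J (\<lambda>j. of_real (b j) * cis (et j)) (\<lambda>mu. of_real (s mu))) la)
    \<le> C * ((\<Sum>i<I. \<bar>th i\<bar>) + (\<Sum>j<J. \<bar>et j\<bar>)) * ?qt_weight la"
    using replace_all[OF s b0 A B] by blast
  show ?thesis
  proof (intro exI[of _ C] conjI allI C(1))
    fix n and th et :: "nat \<Rightarrow> real"
    let ?W = "add_pos_letters I (\<lambda>i. of_real (a i) * cis (th i)) (add_neg_letters J (\<lambda>j. of_real (b j) * cis (et j)) (\<lambda>mu. of_real (s mu)))"
    let ?X = "(\<Sum>i<I. \<bar>th i\<bar>) + (\<Sum>j<J. \<bar>et j\<bar>)"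
    have "harmonic (r + (\<Sum>j<J. b j) + (\<Sum>i<I. a i)) ?qt_weight" by (intro harmonic_add_pos_letters harmonic_add_neg_letters h)
    then have "dim_sum n ?qt_weight = (r + (\<Sum>j<J. b j) + (\<Sum>i<I. a i)) ^ n * ?qt_weight (\<lambda>_. 0)" by (rule dim_sum_harmonic)
    moreover have "r + (\<Sum>j<J. b j) + (\<Sum>i<I. a i) = 1" using tot by simp
    ultimately have Z1: "dim_sum n ?qt_weight = 1" by (simp add: add_pos_letters_at_0 add_neg_letters_at_0 s1)
    have "harmonic (of_real r + (\<Sum>j<J. of_real (b j) * cis (et j)) + (\<Sum>i<I. of_real (a i) * cis (th i))) ?W"
      by (intro harmonic_add_pos_letters harmonic_add_neg_letters harmonic_of_real h)
    then have "dim_sum n ?W = (of_real r + (\<Sum>j<J. of_real (b j) * cis (et j)) + (\<Sum>i<I. of_real (a i) * cis (th i))) ^ n * ?W (\<lambda>_. 0)"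
      by (rule dim_sum_harmonic)
    then have Z2: "dim_sum n ?W = ((\<Sum>i<I. of_real (a i) * cis (th i)) + (\<Sum>j<J. of_real (b j) * cis (et j)) + of_real r) ^ n"
      by (simp add: add_pos_letters_at_0 add_neg_letters_at_0 s1 ac_simps)
    have eq: "dim_sum n (\<lambda>la. of_real (?qt_weight la) * cis (phase I th J et la)) - dim_sum n ?W
      = (\<Sum>la | is_part la \<and> part_size la = n. of_nat (dim_shape n la) * (of_real (?qt_weight la) * cis (phase I th J et la) - ?W la))"
      unfolding dim_sum_def by (simp add: sum_subtractf algebra_simps)
    have "cmod (dim_sum n (\<lambda>la. of_real (?qt_weight la) * cis (phase I th J et la)) - dim_sum n ?W) \<le> (\<Sum>la | is_part la \<and> part_size la = n. real (dim_shape n la) * (C * ?X * ?qt_weight la))"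
      unfolding eq
    proof (rule sum_norm_le)
      fix la assume "la \<in> {la. is_part la \<and> part_size la = n}"
      then show "cmod (of_nat (dim_shape n la) * (of_real (?qt_weight la) * cis (phase I th J et la) - ?W la))
          \<le> real (dim_shape n la) * (C * ?X * ?qt_weight la)"
        unfolding norm_mult norm_of_nat using C(2)[of la th et] by (intro mult_left_mono) auto
    qed
    also have "\<dots> = C * ?X * dim_sum n ?qt_weight" unfolding dim_sum_def by (simp add: sum_distrib_left ac_simps)
    finally show "cmod (dim_sum n (\<lambda>la. of_real (?qt_weight la) * cis (phase I th J et la))
      - ((\<Sum>i<I. of_real (a i) * cis (th i)) + (\<Sum>j<J. of_real (b j) * cis (et j)) + of_real r) ^ n) \<le> C * ?X"
      unfolding Z1 Z2 by simp
  qed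
qed

lemma add_neg_letters_mono: "(\<And>i. i < n \<Longrightarrow> 0 \<le> (a i :: real)) \<Longrightarrow> (\<And>p. is_part p \<Longrightarrow> s p \<le> t p) \<Longrightarrow> is_part la \<Longrightarrow> add_neg_letters n a s la \<le> add_neg_letters n a t la"
  by (induction n arbitrary: a la) (auto intro!: add_neg_mono)

lemma add_pos_letters_mono: "(\<And>i. i < n \<Longrightarrow> 0 \<le> (a i :: real)) \<Longrightarrow> (\<And>p. is_part p \<Longrightarrow> s p \<le> t p) \<Longrightarrow> is_part la \<Longrightarrow> add_pos_letters n a s la \<le> add_pos_letters n a t la"
  by (induction n arbitrary: a la) (auto intro!: add_pos_mono)

lemma add_pos_letters_delta: "is_part la \<Longrightarrow> add_pos_letters n a delta la \<noteq> (0::real) \<Longrightarrow> conjugate la 0 \<le> n"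
proof (induction n arbitrary: a la)
  case 0
  then have "la = (\<lambda>_. 0)" by (simp add: delta_def split: if_splits)
  then show ?case by (simp add: conjugate_0)
next
  case (Suc n)
  then obtain mu where "hstrip la mu" "add_pos_letters n (\<lambda>i. a (Suc i)) delta mu \<noteq> 0"
    by (auto simp: add_pos_def elim!: sum.not_neutral_contains_not_neutral)
  then have "conjugate mu 0 \<le> n" using Suc.IH hstrip_part_lower Suc.prems(1) by blast
  then show ?case using hstrip_conjugate_bounds(2)[OF Suc.prems(1) \<open>hstrip la mu\<close>, of 0] by simp
qed

lemma add_neg_letters_delta: assumes "is_part la" "add_neg_letters n a delta la \<noteq> (0::real)" shows "la 0 \<le> n"
proof -
  have "add_neg_letters n a delta la = add_pos_letters n a (\<lambda>p. delta (conjugate p)) (conjugate la)" by (rule add_neg_letters_add_pos_letters[OF assms(1)])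
  also have "\<dots> = add_pos_letters n a delta (conjugate la)"
  proof -
    have "add_pos_letters n a (\<lambda>p. delta (conjugate p)) q = add_pos_letters n a delta q" if "is_part q" for q using that
    proof (induction n arbitrary: a q)
      case 0 then show ?case by (simp add: delta_def conjugate_eq_0_iff)
    next
      case (Suc n) then show ?case unfolding add_pos_letters.simps by (intro add_pos_cong) auto
    qed
    then show ?thesis using conjugate_is_part[OF assms(1)] by blast
  qed
  finally show ?thesis using add_pos_letters_delta[OF conjugate_is_part[OF assms(1)], of n a] assms by (simp add: conjugate_conjugate)
qed

text \<open>The harmonic function \<open>D \<le> F\<close> collects the words without rare letters, which have probability
  \<open>(1 - r) ^ n \<ge> 1 - n * r\<close>; on the event \<open>Q\<close> it vanishes.\<close>
lemma tail_prob:
  fixes F D :: "shape \<Rightarrow> real"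
  assumes F: "harmonic 1 F" "F (\<lambda>_. 0) = 1" and D: "harmonic (1 - r) D" "D (\<lambda>_. 0) = 1" and r: "0 \<le> r" "r \<le> 1"
    and le: "\<And>p. is_part p \<Longrightarrow> 0 \<le> D p \<and> D p \<le> F p" and Q: "\<And>p. is_part p \<Longrightarrow> Q p \<Longrightarrow> D p = 0"
  shows "(\<Sum>la | is_part la \<and> part_size la = n \<and> Q la. of_nat (dim_shape n la) * F la) \<le> n * r"
proof -
  have "(\<Sum>la | is_part la \<and> part_size la = n \<and> Q la. real (dim_shape n la) * F la)
     = (\<Sum>la | is_part la \<and> part_size la = n \<and> Q la. real (dim_shape n la) * (F la - D la))"
    by (intro sum.cong) (auto simp: Q)
  also have "\<dots> \<le> (\<Sum>la | is_part la \<and> part_size la = n. real (dim_shape n la) * (F la - D la))"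
    by (rule sum_mono2) (use le finite_parts_eq in \<open>auto intro!: mult_nonneg_nonneg\<close>)
  also have "\<dots> = dim_sum n F - dim_sum n D" unfolding dim_sum_def by (simp add: sum_subtractf algebra_simps)
  also have "\<dots> = 1 - (1 - r) ^ n" unfolding dim_sum_harmonic[OF F(1)] dim_sum_harmonic[OF D(1)] F(2) D(2) by simp
  also have "\<dots> \<le> n * r" using Bernoulli_inequality[of "- r" n] r by simp
  finally show ?thesis .
qed

section \<open>A multivariate continuity theorem\<close>

lemma integrable_bounded_rv:
  fixes f :: "'a \<Rightarrow> 'b::{banach, second_countable_topology}"
  assumes "prob_space M" "f \<in> borel_measurable M" "\<And>x. norm (f x) \<le> c"
  shows "integrable M f"
proof -
  interpret prob_space M by fact
  show ?thesis by (rule integrable_const_bound[where B=c]) (use assms in auto)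
qed

text \<open>The law of \<open>Z\<close> under the probability measure with density proportional to \<open>D\<close>.\<close>
definition tilt :: "'a measure \<Rightarrow> ('a \<Rightarrow> real) \<Rightarrow> ('a \<Rightarrow> real) \<Rightarrow> real measure" where
  "tilt M Z D = distr (density M (\<lambda>x. ennreal (D x / (LINT x|M. D x)))) borel Z"

context
  fixes M :: "'a measure" and Z D :: "'a \<Rightarrow> real" and c :: real
  assumes P: "prob_space M" and Zm[measurable]: "Z \<in> borel_measurable M" and Dm[measurable]: "D \<in> borel_measurable M"
    and bD: "\<And>x. 1 \<le> D x \<and> D x \<le> c"
begin

interpretation prob_space M by (rule P)

lemma tilt_integrable: "integrable M D"
proof (rule integrable_bounded_rv[OF P Dm])
  show "norm (D x) \<le> c" for x using bD[of x] by auto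
qed

lemma tilt_mass: "1 \<le> (LINT x|M. D x)"
proof -
  have "(LINT x|M. 1) \<le> (LINT x|M. D x)" by (intro integral_mono tilt_integrable) (use bD in auto)
  then show ?thesis by (simp add: prob_space)
qed

lemma tilt_pos: "0 \<le> D x / (LINT x|M. D x)"
  using tilt_mass bD[of x] by simp

lemma tilt_integral:
  fixes f :: "real \<Rightarrow> 'y::{banach, second_countable_topology}"
  assumes [measurable]: "f \<in> borel_measurable borel"
  shows "(LINT x|tilt M Z D. f x) = (LINT x|M. (D x / (LINT x|M. D x)) *\<^sub>R f (Z x))"
proof -
  have "(LINT x|tilt M Z D. f x) = (LINT x|density M (\<lambda>x. ennreal (D x / (LINT x|M. D x))). f (Z x))"
    unfolding tilt_def by (subst integral_distr) auto
  also have "\<dots> = (LINT x|M. (D x / (LINT x|M. D x)) *\<^sub>R f (Z x))"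
    by (subst integral_density) (auto simp: tilt_pos)
  finally show ?thesis .
qed

lemma tilt_distribution: "real_distribution (tilt M Z D)"
proof -
  have "(\<integral>\<^sup>+x. ennreal (D x / (LINT x|M. D x)) \<partial>M) = ennreal (LINT x|M. D x / (LINT x|M. D x))"
    by (rule nn_integral_eq_integral) (use tilt_integrable tilt_pos in auto)
  also have "(LINT x|M. D x / (LINT x|M. D x)) = 1" using tilt_mass by simp
  finally have "prob_space (density M (\<lambda>x. ennreal (D x / (LINT x|M. D x))))"
    by (intro prob_spaceI) (simp add: emeasure_density cong: nn_integral_cong)
  then show ?thesis unfolding tilt_def real_distribution_def real_distribution_axioms_def
    by (intro conjI prob_space.prob_space_distr) auto
qed

lemma tilt_char:
  "char (tilt M Z D) s = (CLINT x|M. complex_of_real (D x) * iexp (s * Z x)) / complex_of_real (LINT x|M. D x)"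
  unfolding char_def by (subst tilt_integral) (simp_all add: scaleR_conv_of_real)

end

text \<open>The one-dimensional continuity theorem for tilted laws. A density bounded below keeps the total masses away from zero.\<close>
lemma density_convergence:
  fixes M :: "nat \<Rightarrow> 'a measure" and N :: "'b measure"
  assumes M: "\<And>n. prob_space (M n)" and N: "prob_space N"
    and Z: "\<And>n. Z n \<in> borel_measurable (M n)" "W \<in> borel_measurable N"
    and D: "\<And>n. D n \<in> borel_measurable (M n)" "E \<in> borel_measurable N"
    and bD: "\<And>n x. 1 \<le> D n x \<and> D n x \<le> (c::real)" "\<And>x. 1 \<le> E x \<and> E x \<le> c"
    and conv: "\<And>s. (\<lambda>n. CLINT x|M n. complex_of_real (D n x) * iexp (s * Z n x)) \<longlonglongrightarrow> (CLINT x|N. complex_of_real (E x) * iexp (s * W x))"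
    and h: "\<And>x. isCont h x" "\<And>x. \<bar>h x :: real\<bar> \<le> C"
  shows "(\<lambda>n. LINT x|M n. D n x * h (Z n x)) \<longlonglongrightarrow> (LINT x|N. E x * h (W x))"
proof -
  note tM = M Z(1) D(1) bD(1) and tN = N Z(2) D(2) bD(2)
  define m where "m = (\<lambda>n. LINT x|M n. D n x)"
  define m' where "m' = (LINT x|N. E x)"
  have m1: "1 \<le> m n" for n unfolding m_def by (rule tilt_mass[OF tM])
  have m'1: "1 \<le> m'" unfolding m'_def by (rule tilt_mass[OF tN])
  have "(\<lambda>n. complex_of_real (m n)) \<longlonglongrightarrow> complex_of_real m'"
    using conv[of 0] unfolding m_def m'_def by (simp add: integral_complex_of_real)
  from tendsto_Re[OF this] have mc: "m \<longlonglongrightarrow> m'" by simp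
  have "weak_conv_m (\<lambda>n. tilt (M n) (Z n) (D n)) (tilt N W E)"
  proof (rule levy_continuity)
    show "real_distribution (tilt (M n) (Z n) (D n))" for n by (rule tilt_distribution[OF tM])
    show "real_distribution (tilt N W E)" by (rule tilt_distribution[OF tN])
    fix s
    show "(\<lambda>n. char (tilt (M n) (Z n) (D n)) s) \<longlonglongrightarrow> char (tilt N W E) s"
      unfolding tilt_char[OF tM] tilt_char[OF tN]
      by (intro tendsto_divide conv tendsto_of_real mc[unfolded m_def m'_def]) (use m'1 in \<open>simp add: m'_def\<close>)
  qed
  then have "(\<lambda>n. LINT x|tilt (M n) (Z n) (D n). h x) \<longlonglongrightarrow> (LINT x|tilt N W E. h x)"
    by (intro weak_conv_imp_integral_bdd_continuous_conv[where B=C])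
       (use h tilt_distribution[OF tM] tilt_distribution[OF tN] in auto)
  then have lim: "(\<lambda>n. m n * (LINT x|tilt (M n) (Z n) (D n). h x)) \<longlonglongrightarrow> m' * (LINT x|tilt N W E. h x)"
    by (intro tendsto_mult mc)
  have hm: "h \<in> borel_measurable borel"
    by (rule borel_measurable_continuous_onI) (simp add: continuous_at_imp_continuous_on h(1))
  have "m n * (LINT x|tilt (M n) (Z n) (D n). h x) = (LINT x|M n. D n x * h (Z n x))" for n
    using m1[of n] unfolding tilt_integral[OF tM hm] m_def by simp
  moreover have "m' * (LINT x|tilt N W E. h x) = (LINT x|N. E x * h (W x))"
    using m'1 unfolding tilt_integral[OF tN hm] m'_def by simp
  ultimately show ?thesis using lim by simp
qed

text \<open>A factor \<open>g\<close> of arbitrary sign is the difference of the densities \<open>c + 1 + g\<close> and \<open>c + 1\<close>, both at least one.\<close>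
lemma weighted_convergence:
  fixes M :: "nat \<Rightarrow> 'a measure" and N :: "'b measure"
  assumes M: "\<And>n. prob_space (M n)" and N: "prob_space N"
    and Z: "\<And>n. Z n \<in> borel_measurable (M n)" "W \<in> borel_measurable N"
    and g: "\<And>n. g n \<in> borel_measurable (M n)" "g' \<in> borel_measurable N"
    and bg: "\<And>n x. \<bar>g n x :: real\<bar> \<le> c" "\<And>x. \<bar>g' x\<bar> \<le> c"
    and conv: "\<And>s. (\<lambda>n. CLINT x|M n. complex_of_real (g n x) * iexp (s * Z n x)) \<longlonglongrightarrow> (CLINT x|N. complex_of_real (g' x) * iexp (s * W x))"
    and conv1: "\<And>s. (\<lambda>n. CLINT x|M n. iexp (s * Z n x)) \<longlonglongrightarrow> (CLINT x|N. iexp (s * W x))"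
    and h: "\<And>x. isCont h x" "\<And>x. \<bar>h x :: real\<bar> \<le> C"
  shows "(\<lambda>n. LINT x|M n. g n x * h (Z n x)) \<longlonglongrightarrow> (LINT x|N. g' x * h (W x))"
proof -
  have [measurable]: "\<And>n. Z n \<in> borel_measurable (M n)" "W \<in> borel_measurable N"
    "\<And>n. g n \<in> borel_measurable (M n)" "g' \<in> borel_measurable N" using Z g by auto
  have hm[measurable]: "h \<in> borel_measurable borel"
    by (rule borel_measurable_continuous_onI) (simp add: continuous_at_imp_continuous_on h(1))
  have c0: "0 \<le> c" by (rule order_trans[OF abs_ge_zero bg(2)])
  have C0: "0 \<le> C" by (rule order_trans[OF abs_ge_zero h(2)])
  have split: "(CLINT x|M. complex_of_real (c + 1 + g x) * iexp (s * Z x))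
     = complex_of_real (c + 1) * (CLINT x|M. iexp (s * Z x)) + (CLINT x|M. complex_of_real (g x) * iexp (s * Z x))"
    if "prob_space M" and [measurable]: "Z \<in> borel_measurable M" "g \<in> borel_measurable M" and b: "\<And>x. \<bar>g x\<bar> \<le> c"
    for M :: "'z measure" and Z g s
  proof -
    have 1: "integrable M (\<lambda>x. iexp (s * Z x))"
      by (rule integrable_bounded_rv[OF that(1), where c=1]) auto
    have 2: "integrable M (\<lambda>x. complex_of_real (g x) * iexp (s * Z x))"
      by (rule integrable_bounded_rv[OF that(1), where c=c]) (auto simp: norm_mult b)
    have "(\<lambda>x. complex_of_real (c + 1 + g x) * iexp (s * Z x)) = (\<lambda>x. complex_of_real (c + 1) * iexp (s * Z x) + complex_of_real (g x) * iexp (s * Z x))"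
      by (auto simp: fun_eq_iff algebra_simps)
    then show ?thesis using Bochner_Integration.integral_add[OF integrable_mult_right[OF 1, of "complex_of_real (c + 1)"] 2] by simp
  qed
  have split': "(LINT x|M. (c + 1 + g x) * h (Z x)) = (c + 1) * (LINT x|M. 1 * h (Z x)) + (LINT x|M. g x * h (Z x))"
    if "prob_space M" and [measurable]: "Z \<in> borel_measurable M" "g \<in> borel_measurable M" and b: "\<And>x. \<bar>g x\<bar> \<le> c"
    for M :: "'z measure" and Z g
  proof -
    have 1: "integrable M (\<lambda>x. h (Z x))"
      by (rule integrable_bounded_rv[OF that(1), where c=C]) (use h in auto)
    have 2: "integrable M (\<lambda>x. g x * h (Z x))"
      by (rule integrable_bounded_rv[OF that(1), where c="c * C"]) (auto simp: abs_mult intro!: mult_mono b h(2) c0)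
    have "(\<lambda>x. (c + 1 + g x) * h (Z x)) = (\<lambda>x. (c + 1) * h (Z x) + g x * h (Z x))"
      by (auto simp: fun_eq_iff algebra_simps)
    then show ?thesis using Bochner_Integration.integral_add[OF integrable_mult_right[OF 1, of "c + 1"] 2] by simp
  qed
  have A: "(\<lambda>n. LINT x|M n. (c + 1 + g n x) * h (Z n x)) \<longlonglongrightarrow> (LINT x|N. (c + 1 + g' x) * h (W x))"
  proof (rule density_convergence[OF M N Z _ _ _ _ _ h, where c="2 * c + 1"])
    show "1 \<le> c + 1 + g n x \<and> c + 1 + g n x \<le> 2 * c + 1" for n x using bg(1)[of n x] by linarith
    show "1 \<le> c + 1 + g' x \<and> c + 1 + g' x \<le> 2 * c + 1" for x using bg(2)[of x] by linarith
    show "(\<lambda>n. CLINT x|M n. complex_of_real (c + 1 + g n x) * iexp (s * Z n x)) \<longlonglongrightarrow> (CLINT x|N. complex_of_real (c + 1 + g' x) * iexp (s * W x))" for s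
      unfolding split[OF M Z(1) g(1) bg(1)] split[OF N Z(2) g(2) bg(2)]
      by (intro tendsto_add tendsto_mult tendsto_const conv conv1)
  qed auto
  have B: "(\<lambda>n. LINT x|M n. 1 * h (Z n x)) \<longlonglongrightarrow> (LINT x|N. 1 * h (W x))"
    by (rule density_convergence[OF M N Z _ _ _ _ _ h, where c=1]) (use conv1 in auto)
  have "(\<lambda>n. (LINT x|M n. (c + 1 + g n x) * h (Z n x)) - (c + 1) * (LINT x|M n. 1 * h (Z n x)))
      \<longlonglongrightarrow> (LINT x|N. (c + 1 + g' x) * h (W x)) - (c + 1) * (LINT x|N. 1 * h (W x))"
    by (intro tendsto_diff A tendsto_mult tendsto_const B)
  then show ?thesis unfolding split'[OF M Z(1) g(1) bg(1)] split'[OF N Z(2) g(2) bg(2)] by simp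
qed

text \<open>Coordinates outside \<open>K\<close> are set to zero, so that all random vectors take values in one fixed function space and
  stay in a compact cube of it once their coordinates in \<open>K\<close> are bounded.\<close>
locale char_convergence =
  fixes M :: "nat \<Rightarrow> 'a measure" and N :: "'b measure" and K :: "'k::countable set"
    and Z :: "nat \<Rightarrow> 'a \<Rightarrow> 'k \<Rightarrow> real" and W :: "'b \<Rightarrow> 'k \<Rightarrow> real"
  assumes PM: "\<And>n. prob_space (M n)" and PN: "prob_space N" and finK: "finite K"
    and Zm: "\<And>n k. (\<lambda>x. Z n x k) \<in> borel_measurable (M n)" and Wm: "\<And>k. (\<lambda>x. W x k) \<in> borel_measurable N"
    and Z0: "\<And>n x k. k \<notin> K \<Longrightarrow> Z n x k = 0" and W0: "\<And>x k. k \<notin> K \<Longrightarrow> W x k = 0"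
    and conv: "\<And>th. (\<lambda>n. CLINT x|M n. iexp (\<Sum>k\<in>K. th k * Z n x k)) \<longlonglongrightarrow> (CLINT x|N. iexp (\<Sum>k\<in>K. th k * W x k))"
begin

lemma Zm_PiM: "Z n \<in> measurable (M n) borel"
proof -
  have "(\<lambda>x k. Z n x k) \<in> measurable (M n) (Pi\<^sub>M UNIV (\<lambda>_. borel))"
    by (rule measurable_PiM_single') (use Zm in auto)
  then show ?thesis unfolding measurable_cong_sets[OF refl sets_PiM_equal_borel] .
qed

lemma Wm_PiM: "W \<in> measurable N borel"
proof -
  have "(\<lambda>x k. W x k) \<in> measurable N (Pi\<^sub>M UNIV (\<lambda>_. borel))"
    by (rule measurable_PiM_single') (use Wm in auto)
  then show ?thesis unfolding measurable_cong_sets[OF refl sets_PiM_equal_borel] .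
qed

text \<open>The expectations of \<open>G\<close> times any character converge. Asking this for all characters is what makes the class stable under
  multiplication by a function of one coordinate (\<open>char_test_mult\<close>).\<close>
definition char_test :: "(('k \<Rightarrow> real) \<Rightarrow> real) \<Rightarrow> bool" where
  "char_test G \<longleftrightarrow> continuous_on UNIV G \<and> (\<exists>c. \<forall>x. \<bar>G x\<bar> \<le> c) \<and>
    (\<forall>th. (\<lambda>n. CLINT x|M n. complex_of_real (G (Z n x)) * iexp (\<Sum>k\<in>K. th k * Z n x k))
       \<longlonglongrightarrow> (CLINT x|N. complex_of_real (G (W x)) * iexp (\<Sum>k\<in>K. th k * W x k)))"

lemma char_test_1: "char_test (\<lambda>_. 1)" unfolding char_test_def using conv by (auto intro: exI[of _ 1])

lemma cos_sin_iexp: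
  "complex_of_real (g * cos u) * iexp v = (complex_of_real g * iexp (u + v) + complex_of_real g * iexp (v - u)) / 2"
  "complex_of_real (g * sin u) * iexp v = (complex_of_real g * iexp (u + v) - complex_of_real g * iexp (v - u)) / (2 * \<i>)"
  by (simp_all add: complex_eq_iff exp_eq_polar cis.code cos_add sin_add cos_diff sin_diff algebra_simps Re_divide Im_divide power2_eq_square)

text \<open>The product of a cosine or sine of the full phase and a character of coordinate \<open>k\<close> is again a combination of
  characters, so \<open>weighted_convergence\<close> applies in coordinate \<open>k\<close>.\<close>
lemma char_test_mult: assumes G: "char_test G" and k: "k \<in> K" and h: "\<And>x. isCont h x" "\<And>x. \<bar>h x\<bar> \<le> C"
  shows "char_test (\<lambda>x. G x * h (x k))"
proof -
  obtain c where c: "\<And>x. \<bar>G x\<bar> \<le> c" and Gc: "continuous_on UNIV G" using G unfolding char_test_def by auto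
  have c0: "0 \<le> c" by (rule order_trans[OF abs_ge_zero c])
  have Gm[measurable]: "G \<in> borel_measurable borel" by (rule borel_measurable_continuous_onI[OF Gc])
  have hc: "continuous_on UNIV h" by (simp add: continuous_at_imp_continuous_on h(1))
  have hm[measurable]: "h \<in> borel_measurable borel" by (rule borel_measurable_continuous_onI[OF hc])
  note [measurable] = Zm Wm Zm_PiM Wm_PiM
  have Gconv: "(\<lambda>n. CLINT x|M n. complex_of_real (G (Z n x)) * iexp (\<Sum>l\<in>K. th l * Z n x l))
       \<longlonglongrightarrow> (CLINT x|N. complex_of_real (G (W x)) * iexp (\<Sum>l\<in>K. th l * W x l))" for th
    using G unfolding char_test_def by auto
  have upd: "(\<Sum>l\<in>K. (e * th l + (if l = k then s else 0)) * z l) = e * (\<Sum>l\<in>K. th l * z l) + s * z k" for e s th and z :: "'k \<Rightarrow> real"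
    using finK k by (simp add: distrib_right sum.distrib sum_distrib_left mult.assoc if_distrib[of "\<lambda>u. u * _"] cong: if_cong)
  have conv1: "(\<lambda>n. CLINT x|M n. iexp (s * Z n x k)) \<longlonglongrightarrow> (CLINT x|N. iexp (s * W x k))" for s
    using conv[of "\<lambda>l. 0 * 0 + (if l = k then s else 0)"] unfolding upd by simp
  have trig: "(\<lambda>n. LINT x|M n. (G (Z n x) * tr (\<Sum>l\<in>K. th l * Z n x l)) * h (Z n x k))
      \<longlonglongrightarrow> (LINT x|N. (G (W x) * tr (\<Sum>l\<in>K. th l * W x l)) * h (W x k))"
    if tr: "tr = cos \<or> tr = sin" for th and tr :: "real \<Rightarrow> real"
  proof (rule weighted_convergence[OF PM PN _ _ _ _ _ _ _ conv1 h, where c=c])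
    have tr1: "\<bar>tr u\<bar> \<le> 1" for u using tr by auto
    have b: "\<bar>G y * tr u\<bar> \<le> c" for y u
      using mult_mono[OF c[of y] tr1[of u] c0] by (simp add: abs_mult)
    show "\<bar>G (Z n x) * tr (\<Sum>l\<in>K. th l * Z n x l)\<bar> \<le> c" for n x by (rule b)
    show "\<bar>G (W x) * tr (\<Sum>l\<in>K. th l * W x l)\<bar> \<le> c" for x by (rule b)
    show "(\<lambda>x. G (Z n x) * tr (\<Sum>l\<in>K. th l * Z n x l)) \<in> borel_measurable (M n)" for n
      using tr by auto
    show "(\<lambda>x. G (W x) * tr (\<Sum>l\<in>K. th l * W x l)) \<in> borel_measurable N" using tr by auto
    fix s
    have p: "(\<Sum>l\<in>K. th l * z l) + s * z k = (\<Sum>l\<in>K. (1 * th l + (if l = k then s else 0)) * z l)"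
            "s * z k - (\<Sum>l\<in>K. th l * z l) = (\<Sum>l\<in>K. ((- 1) * th l + (if l = k then s else 0)) * z l)" for z :: "'k \<Rightarrow> real"
      unfolding upd by simp_all
    have i: "integrable (M n) (\<lambda>x. complex_of_real (G (Z n x)) * iexp (\<Sum>l\<in>K. th l * Z n x l))" for n th
      by (rule integrable_bounded_rv[OF PM, where c=c]) (auto simp: norm_mult c)
    have i': "integrable N (\<lambda>x. complex_of_real (G (W x)) * iexp (\<Sum>l\<in>K. th l * W x l))" for th
      by (rule integrable_bounded_rv[OF PN, where c=c]) (auto simp: norm_mult c)
    show "(\<lambda>n. CLINT x|M n. complex_of_real (G (Z n x) * tr (\<Sum>l\<in>K. th l * Z n x l)) * iexp (s * Z n x k))
      \<longlonglongrightarrow> (CLINT x|N. complex_of_real (G (W x) * tr (\<Sum>l\<in>K. th l * W x l)) * iexp (s * W x k))"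
    proof (cases "tr = cos")
      case True
      show ?thesis unfolding True cos_sin_iexp(1) p integral_divide_zero
          Bochner_Integration.integral_add[OF i i] Bochner_Integration.integral_add[OF i' i']
        by (intro tendsto_divide tendsto_add Gconv tendsto_const) simp
    next
      case False
      then have t: "tr = sin" using tr by simp
      show ?thesis unfolding t cos_sin_iexp(2) p integral_divide_zero
          Bochner_Integration.integral_diff[OF i i] Bochner_Integration.integral_diff[OF i' i']
        by (intro tendsto_divide tendsto_diff Gconv tendsto_const) simp
    qed
  qed (use Zm Wm in auto)
  have C0: "0 \<le> C" by (rule order_trans[OF abs_ge_zero h(2)])
  have bGh: "\<bar>G x * h y\<bar> \<le> c * C" for x y using mult_mono[OF c h(2) c0] by (simp add: abs_mult)
  show ?thesis unfolding char_test_def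
  proof (intro conjI allI)
    have "continuous_on UNIV (\<lambda>x::'k \<Rightarrow> real. h (x k))"
      by (rule continuous_on_compose2[OF hc]) (auto intro: continuous_on_product_coordinates)
    then show "continuous_on UNIV (\<lambda>x. G x * h (x k))" by (intro continuous_on_mult Gc)
    show "\<exists>c. \<forall>x. \<bar>G x * h (x k)\<bar> \<le> c" using bGh by blast
    fix th
    have dec: "(CLINT x|P. complex_of_real (G (Y x) * h (Y x k)) * iexp (\<Sum>l\<in>K. th l * Y x l))
      = complex_of_real (LINT x|P. (G (Y x) * cos (\<Sum>l\<in>K. th l * Y x l)) * h (Y x k))
        + \<i> * complex_of_real (LINT x|P. (G (Y x) * sin (\<Sum>l\<in>K. th l * Y x l)) * h (Y x k))"
      if P: "prob_space P" and Y: "Y \<in> measurable P borel" "\<And>l. (\<lambda>x. Y x l) \<in> borel_measurable P" for P :: "'z measure" and Y :: "'z \<Rightarrow> 'k \<Rightarrow> real"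
    proof -
      note [measurable] = Y
      have b3: "\<bar>G y * tt * h u\<bar> \<le> c * C" if "\<bar>tt\<bar> \<le> 1" for y tt u
        using mult_mono[OF bGh[of y u] that] c0 C0 by (simp add: abs_mult ac_simps)
      have ic: "integrable P (\<lambda>x. (G (Y x) * cos (\<Sum>l\<in>K. th l * Y x l)) * h (Y x k))"
        by (rule integrable_bounded_rv[OF P, where c="c * C"]) (auto intro!: b3)
      have isn: "integrable P (\<lambda>x. (G (Y x) * sin (\<Sum>l\<in>K. th l * Y x l)) * h (Y x k))"
        by (rule integrable_bounded_rv[OF P, where c="c * C"]) (auto intro!: b3)
      have e: "complex_of_real (G (Y x) * h (Y x k)) * iexp (\<Sum>l\<in>K. th l * Y x l)
        = complex_of_real ((G (Y x) * cos (\<Sum>l\<in>K. th l * Y x l)) * h (Y x k))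
         + \<i> * complex_of_real ((G (Y x) * sin (\<Sum>l\<in>K. th l * Y x l)) * h (Y x k))" for x
        by (simp add: complex_eq_iff exp_eq_polar)
      show ?thesis unfolding e
        unfolding Bochner_Integration.integral_add[OF integrable_of_real[OF ic] integrable_mult_right[OF integrable_of_real[OF isn], of \<i>]]
        by (simp only: integral_mult_right_zero integral_complex_of_real)
    qed
    show "(\<lambda>n. CLINT x|M n. complex_of_real (G (Z n x) * h (Z n x k)) * iexp (\<Sum>l\<in>K. th l * Z n x l))
       \<longlonglongrightarrow> (CLINT x|N. complex_of_real (G (W x) * h (W x k)) * iexp (\<Sum>l\<in>K. th l * W x l))"
      unfolding dec[OF PM Zm_PiM Zm] dec[OF PN Wm_PiM Wm]
      by (intro tendsto_add tendsto_mult tendsto_const tendsto_of_real trig) auto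
  qed
qed

lemma char_test_prod: assumes "finite A" "A \<subseteq> K" "\<And>k x. k \<in> A \<Longrightarrow> isCont (h k) x" "\<And>k. k \<in> A \<Longrightarrow> \<exists>C. \<forall>x. \<bar>h k x\<bar> \<le> C"
  shows "char_test (\<lambda>x. \<Prod>k\<in>A. h k (x k))"
  using assms
proof (induction A)
  case empty then show ?case by (simp add: char_test_1)
next
  case (insert k A)
  obtain C where C: "\<And>x. \<bar>h k x\<bar> \<le> C" using insert.prems by blast
  have "char_test (\<lambda>x. (\<Prod>k\<in>A. h k (x k)) * h k (x k))"
    by (rule char_test_mult[OF insert.IH _ _ C]) (use insert in auto)
  then show ?case using insert.hyps by (simp add: mult.commute)
qed

lemma char_test_integral: assumes "char_test G"
  shows "(\<lambda>n. LINT x|M n. G (Z n x)) \<longlonglongrightarrow> (LINT x|N. G (W x))"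
proof -
  have "(\<lambda>n. complex_of_real (LINT x|M n. G (Z n x))) \<longlonglongrightarrow> complex_of_real (LINT x|N. G (W x))"
    using assms[unfolded char_test_def, THEN conjunct2, THEN conjunct2, THEN spec[of _ "\<lambda>_. 0"]]
    by (simp add: integral_complex_of_real)
  from tendsto_Re[OF this] show ?thesis by simp
qed

text \<open>Polynomials in the coordinates, built by multiplication with single coordinates so that induction can absorb each
  factor into a product of functions of one variable.\<close>
inductive_set polys :: "(('k \<Rightarrow> real) \<Rightarrow> real) set" where
  const: "(\<lambda>_. c) \<in> polys"
| add: "p \<in> polys \<Longrightarrow> q \<in> polys \<Longrightarrow> (\<lambda>x. p x + q x) \<in> polys"
| coord: "k \<in> K \<Longrightarrow> p \<in> polys \<Longrightarrow> (\<lambda>x. x k * p x) \<in> polys"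

lemma polys_mult: "p \<in> polys \<Longrightarrow> q \<in> polys \<Longrightarrow> (\<lambda>x. p x * q x) \<in> polys"
proof (induction p rule: polys.induct)
  case (const c)
  then show ?case
  proof (induction q rule: polys.induct)
    case (const d) then show ?case using polys.const[of "c * d"] by simp
  next
    case (add p q) then show ?case using polys.add[of "\<lambda>x. c * p x" "\<lambda>x. c * q x"] by (simp add: distrib_left)
  next
    case (coord k p) then show ?case using polys.coord[of k "\<lambda>x. c * p x"] by (simp add: mult.left_commute)
  qed
next
  case (add p r) then show ?case using polys.add[of "\<lambda>x. p x * q x" "\<lambda>x. r x * q x"] by (simp add: distrib_right)
next
  case (coord k p) then show ?case using polys.coord[of k "\<lambda>x. p x * q x"] by (simp add: mult.assoc)
qed

lemma polys_continuous: "p \<in> polys \<Longrightarrow> continuous_on S p"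
  by (induction rule: polys.induct)
     (auto intro!: continuous_intros intro: continuous_on_subset[OF continuous_on_product_coordinates])

text \<open>A continuous cut-off: one for \<open>\<bar>u\<bar> \<le> r - 1\<close> and zero for \<open>\<bar>u\<bar> \<ge> r\<close>.\<close>
definition cut :: "real \<Rightarrow> real \<Rightarrow> real" where "cut r u = max 0 (min 1 (r - \<bar>u\<bar>))"

definition cutK :: "real \<Rightarrow> ('k \<Rightarrow> real) \<Rightarrow> real" where "cutK r x = (\<Prod>k\<in>K. cut r (x k))"

lemma cut_bounds: "0 \<le> cut r u" "cut r u \<le> 1" unfolding cut_def by auto
lemma cut_cont: "isCont (cut r) u"
proof -
  have "continuous_on UNIV (cut r)" unfolding cut_def[abs_def] by (intro continuous_intros)
  then show ?thesis by (simp add: continuous_on_eq_continuous_at)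
qed

lemma cutK_bounds: "0 \<le> cutK r x" "cutK r x \<le> 1" unfolding cutK_def
  by (auto intro!: prod_nonneg prod_le_1 simp: cut_bounds)

lemma cutK_nonzero: "cutK r x \<noteq> 0 \<Longrightarrow> k \<in> K \<Longrightarrow> \<bar>x k\<bar> \<le> r"
  unfolding cutK_def cut_def using finK by auto

lemma bounded_of_compact_support:
  fixes f :: "real \<Rightarrow> real"
  assumes f: "\<And>x. isCont f x" "\<And>v. \<bar>v\<bar> > r \<Longrightarrow> f v = 0"
  shows "\<exists>C. \<forall>x. \<bar>f x\<bar> \<le> C"
proof -
  have "compact (f ` {-r..r})"
    by (intro compact_continuous_image continuous_at_imp_continuous_on) (auto simp: f)
  then have "bounded (f ` {-r..r})" by (rule compact_imp_bounded)
  then obtain C where "\<forall>x\<in>{-r..r}. norm (f x) \<le> C" unfolding bounded_iff by auto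
  then have C: "\<And>x. x \<in> {-r..r} \<Longrightarrow> norm (f x) \<le> C" by blast
  have "\<bar>f x\<bar> \<le> max C 0" for x
  proof (cases "\<bar>x\<bar> > r")
    case False then have "x \<in> {-r..r}" by auto
    then show ?thesis using C[of x] by simp
  qed (simp add: f)
  then show ?thesis by blast
qed

text \<open>Multiplying one factor of a product by its own variable gives another product of functions with compact
  support.\<close>
lemma polys_cut:
  assumes "p \<in> polys" "\<And>k x. k \<in> K \<Longrightarrow> isCont (h k) x" "\<And>k u. k \<in> K \<Longrightarrow> \<bar>u\<bar> > r \<Longrightarrow> h k u = 0"
  shows "(\<lambda>n. LINT x|M n. p (Z n x) * (\<Prod>k\<in>K. h k (Z n x k))) \<longlonglongrightarrow> (LINT x|N. p (W x) * (\<Prod>k\<in>K. h k (W x k)))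
    \<and> (\<exists>c. \<forall>x. \<bar>p x * (\<Prod>k\<in>K. h k (x k))\<bar> \<le> c)"
  using assms
proof (induction arbitrary: h rule: polys.induct)
  case (const c)
  have bnd: "\<exists>C. \<forall>x. \<bar>h k x\<bar> \<le> C" if "k \<in> K" for k
    by (rule bounded_of_compact_support[of _ r]) (use const.prems that in auto)
  have g: "char_test (\<lambda>x. \<Prod>k\<in>K. h k (x k))" by (rule char_test_prod[OF finK]) (use const bnd in auto)
  then obtain b where b: "\<And>x. \<bar>\<Prod>k\<in>K. h k (x k)\<bar> \<le> b" unfolding char_test_def by auto
  have "\<bar>c * (\<Prod>k\<in>K. h k (x k))\<bar> \<le> \<bar>c\<bar> * b" for x
    using b[of x] by (simp add: abs_mult mult_left_mono)
  then show ?case using char_test_integral[OF g] by (auto intro: tendsto_mult_left)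
next
  case (add p q)
  have bnd: "\<exists>C. \<forall>x. \<bar>h k x\<bar> \<le> C" if "k \<in> K" for k
    by (rule bounded_of_compact_support[of _ r]) (use add.prems that in auto)
  let ?H = "\<lambda>x. \<Prod>k\<in>K. h k (x k)"
  have ihp: "(\<lambda>n. LINT x|M n. p (Z n x) * ?H (Z n x)) \<longlonglongrightarrow> (LINT x|N. p (W x) * ?H (W x)) \<and> (\<exists>c. \<forall>x. \<bar>p x * ?H x\<bar> \<le> c)"
    by (rule add.IH(1)) (use add.prems in auto)
  have ihq: "(\<lambda>n. LINT x|M n. q (Z n x) * ?H (Z n x)) \<longlonglongrightarrow> (LINT x|N. q (W x) * ?H (W x)) \<and> (\<exists>c. \<forall>x. \<bar>q x * ?H x\<bar> \<le> c)"
    by (rule add.IH(2)) (use add.prems in auto)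
  obtain b c where b: "\<And>x. \<bar>p x * ?H x\<bar> \<le> b" and c: "\<And>x. \<bar>q x * ?H x\<bar> \<le> c"
    using ihp ihq by blast
  have Hc: "continuous_on UNIV ?H"
    using char_test_prod[OF finK subset_refl, of h] add.prems bnd unfolding char_test_def by auto
  have m: "(\<lambda>x. p x * ?H x) \<in> borel_measurable borel" "(\<lambda>x. q x * ?H x) \<in> borel_measurable borel"
    by (intro borel_measurable_continuous_onI continuous_on_mult Hc polys_continuous add.hyps)+
  have i: "integrable (M n) (\<lambda>x. p (Z n x) * ?H (Z n x))" "integrable (M n) (\<lambda>x. q (Z n x) * ?H (Z n x))" for n
    using measurable_compose[OF Zm_PiM m(1)] measurable_compose[OF Zm_PiM m(2)] b c
    by (auto intro!: integrable_bounded_rv[OF PM])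
  have i': "integrable N (\<lambda>x. p (W x) * ?H (W x))" "integrable N (\<lambda>x. q (W x) * ?H (W x))"
    using measurable_compose[OF Wm_PiM m(1)] measurable_compose[OF Wm_PiM m(2)] b c
    by (auto intro!: integrable_bounded_rv[OF PN])
  have "\<bar>(p x + q x) * ?H x\<bar> \<le> b + c" for x
    using b[of x] c[of x] unfolding distrib_right by linarith
  moreover have "(\<lambda>n. LINT x|M n. (p (Z n x) + q (Z n x)) * ?H (Z n x)) \<longlonglongrightarrow> (LINT x|N. (p (W x) + q (W x)) * ?H (W x))"
    unfolding distrib_right Bochner_Integration.integral_add[OF i] Bochner_Integration.integral_add[OF i']
    using ihp ihq by (intro tendsto_add) auto
  ultimately show ?case by blast
next
  case (coord k p)
  define h' where "h' = (\<lambda>l u. if l = k then u * h l u else h l u)"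
  have e: "x k * p x * (\<Prod>l\<in>K. h l (x l)) = p x * (\<Prod>l\<in>K. h' l (x l))" for x
  proof -
    have "(\<Prod>l\<in>K. h' l (x l)) = x k * h k (x k) * (\<Prod>l\<in>K - {k}. h l (x l))"
      by (subst prod.remove[OF finK coord.hyps(1)]) (auto simp: h'_def intro!: prod.cong)
    moreover have "(\<Prod>l\<in>K. h l (x l)) = h k (x k) * (\<Prod>l\<in>K - {k}. h l (x l))"
      by (rule prod.remove[OF finK coord.hyps(1)])
    ultimately show ?thesis by simp
  qed
  have "isCont (h' l) u" if "l \<in> K" for l u
    using coord.prems(1)[OF that] unfolding h'_def by (cases "l = k") auto
  moreover have "h' l u = 0" if "l \<in> K" "\<bar>u\<bar> > r" for l u
    using coord.prems(2)[OF that] unfolding h'_def by (cases "l = k") auto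
  ultimately show ?case using coord.IH[of h'] unfolding e by blast
qed

lemma compact_cube: "compact {x :: 'k \<Rightarrow> real. (\<forall>k\<in>K. \<bar>x k\<bar> \<le> r) \<and> (\<forall>k. k \<notin> K \<longrightarrow> x k = 0)}"
proof -
  have e: "{x :: 'k \<Rightarrow> real. (\<forall>k\<in>K. \<bar>x k\<bar> \<le> r) \<and> (\<forall>k. k \<notin> K \<longrightarrow> x k = 0)} = PiE UNIV (\<lambda>k. if k \<in> K then {-r..r} else {0})"
    by (auto simp: PiE_def Pi_def abs_le_iff split: if_splits)
  have "compactin (product_topology (\<lambda>_. euclideanreal) UNIV) (PiE UNIV (\<lambda>k::'k. if k \<in> K then {-r..r} else {0}))"
    unfolding compactin_PiE by auto
  then show ?thesis unfolding e euclidean_product_topology by simp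
qed

text \<open>On the support of the cut-off, \<open>F\<close> is uniformly close to a polynomial. The mass outside is governed by the
  expectation of the cut-off itself, which also converges; this yields tightness.\<close>
theorem bounded_continuous_convergence:
  fixes F :: "('k \<Rightarrow> real) \<Rightarrow> real"
  assumes F: "continuous_on UNIV F" "\<And>x. \<bar>F x\<bar> \<le> B"
  shows "(\<lambda>n. LINT x|M n. F (Z n x)) \<longlonglongrightarrow> (LINT x|N. F (W x))"
proof (rule LIMSEQ_I)
  fix e0 :: real assume e0: "e0 > 0"
  have B0: "0 \<le> B" by (rule order_trans[OF abs_ge_zero F(2)])
  \<comment> \<open>Five errors occur: the mass outside the cut-off counts \<open>2 * B\<close> before the limit and \<open>B\<close> in the limit, and the
    polynomial approximation and its convergence contribute three more.\<close>
  define e where "e = e0 / (3 * B + 4)"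
  have e: "e > 0" using e0 B0 by (simp add: e_def)
  have Fm[measurable]: "F \<in> borel_measurable borel" by (rule borel_measurable_continuous_onI[OF F(1)])
  have cutc: "char_test (cutK r)" for r
    unfolding cutK_def[abs_def] by (rule char_test_prod[OF finK]) (auto simp: cut_cont abs_of_nonneg[OF cut_bounds(1)] intro!: exI[of _ 1] cut_bounds)
  have cutm[measurable]: "cutK r \<in> borel_measurable borel" for r
    using cutc[of r] unfolding char_test_def by (auto intro: borel_measurable_continuous_onI)
  note [measurable] = Zm_PiM Wm_PiM
  interpret N: prob_space N by (rule PN)
  have "(\<lambda>r. LINT x|N. cutK (real r) (W x)) \<longlonglongrightarrow> (LINT x|N. 1)"
  proof (rule integral_dominated_convergence[where w="\<lambda>_. 1"])
    show "AE x in N. (\<lambda>r. cutK (real r) (W x)) \<longlonglongrightarrow> 1"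
    proof (rule AE_I2)
      fix x
      obtain r0 :: nat where r0: "(\<Sum>k\<in>K. \<bar>W x k\<bar>) + 1 \<le> real r0" using real_arch_simple by blast
      have "cutK (real r) (W x) = 1" if "r \<ge> r0" for r
        unfolding cutK_def
      proof (rule prod.neutral, rule ballI)
        fix k assume k: "k \<in> K"
        have "\<bar>W x k\<bar> \<le> (\<Sum>k\<in>K. \<bar>W x k\<bar>)" by (rule member_le_sum[OF k]) (auto simp: finK)
        moreover have "real r0 \<le> real r" using that by simp
        ultimately have "1 \<le> real r - \<bar>W x k\<bar>" using r0 by linarith
        then show "cut (real r) (W x k) = 1" unfolding cut_def by simp
      qed
      then show "(\<lambda>r. cutK (real r) (W x)) \<longlonglongrightarrow> 1"
        by (intro tendsto_eventually) (auto simp: eventually_sequentially)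
    qed
  qed (auto simp: cutK_bounds abs_of_nonneg)
  then have "(\<lambda>r. LINT x|N. cutK (real r) (W x)) \<longlonglongrightarrow> 1" by (simp add: N.prob_space)
  then have "eventually (\<lambda>r. 1 - e < (LINT x|N. cutK (real r) (W x))) sequentially"
    by (rule order_tendstoD) (use e in simp)
  then obtain r :: real where r: "1 - e < (LINT x|N. cutK r (W x))" by (auto simp: eventually_sequentially)
  let ?S = "{x :: 'k \<Rightarrow> real. (\<forall>k\<in>K. \<bar>x k\<bar> \<le> r) \<and> (\<forall>k. k \<notin> K \<longrightarrow> x k = 0)}"
  have "function_ring_on polys ?S"
  proof
    show "compact ?S" by (rule compact_cube)
    show "continuous_on ?S f" if "f \<in> polys" for f by (rule polys_continuous[OF that])
    fix x y :: "'k \<Rightarrow> real" assume "x \<in> ?S" "y \<in> ?S" "x \<noteq> y"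
    then obtain k where xy: "x k \<noteq> y k" by (auto simp: fun_eq_iff)
    moreover have "k \<in> K"
    proof (rule ccontr)
      assume "k \<notin> K"
      then show False using xy \<open>x \<in> ?S\<close> \<open>y \<in> ?S\<close> by simp
    qed
    ultimately have "k \<in> K" "x k \<noteq> y k" by auto
    then show "\<exists>f\<in>polys. f x \<noteq> f y"
      using polys.coord[OF _ polys.const[of 1], of k] by (intro bexI[of _ "\<lambda>x. x k"]) auto
  qed (auto intro: polys.const polys.add polys_mult)
  from function_ring_on.Stone_Weierstrass_basic[OF this continuous_on_subset[OF F(1)] e]
  obtain p where p: "p \<in> polys" "\<And>x. x \<in> ?S \<Longrightarrow> \<bar>F x - p x\<bar> < e" by auto
  have pc: "(\<lambda>n. LINT x|M n. p (Z n x) * cutK r (Z n x)) \<longlonglongrightarrow> (LINT x|N. p (W x) * cutK r (W x))"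
    and pieri_bound: "\<exists>c. \<forall>x. \<bar>p x * cutK r x\<bar> \<le> c"
    using polys_cut[OF p(1), of "\<lambda>_. cut r" r] cut_cont unfolding cutK_def by (auto simp: cut_def)
  obtain c where c: "\<And>x. \<bar>p x * cutK r x\<bar> \<le> c" using pieri_bound by blast
  have pm[measurable]: "p \<in> borel_measurable borel" by (intro borel_measurable_continuous_onI polys_continuous p)
  have est: "\<bar>(LINT x|P. F (Y x)) - (LINT x|P. p (Y x) * cutK r (Y x))\<bar> \<le> B * (1 - (LINT x|P. cutK r (Y x))) + e"
    if P: "prob_space P" and Y[measurable]: "Y \<in> measurable P borel" and Y0: "\<And>x k. k \<notin> K \<Longrightarrow> Y x k = 0"
    for P :: "'z measure" and Y :: "'z \<Rightarrow> 'k \<Rightarrow> real"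
  proof -
    interpret P: prob_space P by (rule P)
    have i1: "integrable P (\<lambda>x. F (Y x))" by (rule integrable_bounded_rv[OF P, where c=B]) (use F in auto)
    have i2: "integrable P (\<lambda>x. p (Y x) * cutK r (Y x))" by (rule integrable_bounded_rv[OF P, where c=c]) (use c in auto)
    have i3: "integrable P (\<lambda>x. cutK r (Y x))"
      by (rule integrable_bounded_rv[OF P, where c=1]) (auto simp: cutK_bounds abs_of_nonneg)
    have pt: "\<bar>F y - p y * cutK r y\<bar> \<le> B * (1 - cutK r y) + e" if y0: "\<And>k. k \<notin> K \<Longrightarrow> y k = 0" for y
    proof -
      have "\<bar>(F y - p y) * cutK r y\<bar> \<le> e"
      proof (cases "cutK r y = 0")
        case False
        then have "y \<in> ?S" using cutK_nonzero y0 by auto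
        then have "\<bar>F y - p y\<bar> * cutK r y \<le> e * 1"
          using p(2) e cutK_bounds[of r y] by (intro mult_mono) (auto simp: less_imp_le)
        then show ?thesis using cutK_bounds[of r y] by (simp add: abs_mult)
      qed (use e in simp)
      moreover have "\<bar>F y * (1 - cutK r y)\<bar> \<le> B * (1 - cutK r y)"
        using F(2)[of y] cutK_bounds[of r y] by (simp add: abs_mult mult_right_mono)
      moreover have "F y - p y * cutK r y = F y * (1 - cutK r y) + (F y - p y) * cutK r y" by (simp add: algebra_simps)
      ultimately show ?thesis by linarith
    qed
    have "\<bar>(LINT x|P. F (Y x)) - (LINT x|P. p (Y x) * cutK r (Y x))\<bar> = \<bar>LINT x|P. F (Y x) - p (Y x) * cutK r (Y x)\<bar>"
      using i1 i2 by simp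
    also have "\<dots> \<le> (LINT x|P. \<bar>F (Y x) - p (Y x) * cutK r (Y x)\<bar>)" by (rule integral_abs_bound)
    also have "\<dots> \<le> (LINT x|P. B * (1 - cutK r (Y x)) + e)"
      by (rule integral_mono) (use i1 i2 i3 pt Y0 in \<open>auto simp: P.prob_space\<close>)
    also have "\<dots> = B * (1 - (LINT x|P. cutK r (Y x))) + e" using i3 by (simp add: P.prob_space)
    finally show ?thesis .
  qed
  have "\<forall>\<^sub>F n in sequentially. \<bar>(LINT x|M n. cutK r (Z n x)) - (LINT x|N. cutK r (W x))\<bar> < e"
    using tendstoD[OF char_test_integral[OF cutc] e] by (simp add: dist_real_def)
  moreover have "\<forall>\<^sub>F n in sequentially. \<bar>(LINT x|M n. p (Z n x) * cutK r (Z n x)) - (LINT x|N. p (W x) * cutK r (W x))\<bar> < e"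
    using tendstoD[OF pc e] by (simp add: dist_real_def)
  ultimately have "\<forall>\<^sub>F n in sequentially. \<bar>(LINT x|M n. F (Z n x)) - (LINT x|N. F (W x))\<bar> < e0"
  proof eventually_elim
    case (elim n)
    note E1 = est[OF PM Zm_PiM Z0, of n] and E2 = est[OF PN Wm_PiM W0]
    have "B * (1 - (LINT x|M n. cutK r (Z n x))) \<le> B * (2 * e)" by (intro mult_left_mono B0) (use elim r in linarith)
    moreover have "B * (1 - (LINT x|N. cutK r (W x))) \<le> B * e" by (intro mult_left_mono B0) (use r in linarith)
    ultimately have "\<bar>(LINT x|M n. F (Z n x)) - (LINT x|N. F (W x))\<bar> < B * (2 * e) + e + e + (B * e + e)"
      using E1 E2 elim by linarith
    also have "\<dots> \<le> (3 * B + 4) * e" using e by (simp add: algebra_simps)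
    also have "\<dots> = e0" unfolding e_def using B0 by simp
    finally show ?case .
  qed
  then show "\<exists>no. \<forall>n\<ge>no. norm ((LINT x|M n. F (Z n x)) - (LINT x|N. F (W x))) < e0"
    by (auto simp: eventually_sequentially)
qed

end

lemma converges_in_law_fddI:
  fixes M :: "nat \<Rightarrow> 'a measure" and N :: "'b measure" and Z :: "nat \<Rightarrow> 'k::countable \<Rightarrow> 'a \<Rightarrow> real"
  assumes M: "\<And>n. prob_space (M n)" and N: "prob_space N"
    and Z: "\<And>n k. Z n k \<in> borel_measurable (M n)" and W: "\<And>k. W k \<in> borel_measurable N"
    and conv: "\<And>K th. finite K \<Longrightarrow> (\<lambda>n. CLINT x|M n. iexp (\<Sum>k\<in>K. th k * Z n k x)) \<longlonglongrightarrow> (CLINT x|N. iexp (\<Sum>k\<in>K. th k * W k x))"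
  shows "converges_in_law_fdd M Z N W"
  unfolding converges_in_law_fdd_def
proof (intro allI impI, elim conjE)
  fix K :: "'k set" and f
  assume K: "finite K" and f: "continuous_map (product_topology (\<lambda>_. euclideanreal) K) euclideanreal f"
    and b: "bounded (f ` (\<Pi>\<^sub>E k\<in>K. UNIV))"
  obtain B where B: "\<And>y. y \<in> f ` (\<Pi>\<^sub>E k\<in>K. UNIV) \<Longrightarrow> norm y \<le> B" using b unfolding bounded_iff by blast
  define F where "F = (\<lambda>x :: 'k \<Rightarrow> real. f (restrict x K))"
  have "continuous_map (product_topology (\<lambda>_. euclideanreal) UNIV) (product_topology (\<lambda>_. euclideanreal) K) (\<lambda>x :: 'k \<Rightarrow> real. restrict x K)"
    unfolding continuous_map_componentwise
  proof (intro conjI ballI)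
    fix k assume "k \<in> K"
    then have "(\<lambda>x :: 'k \<Rightarrow> real. restrict x K k) = (\<lambda>x. x k)" by auto
    then show "continuous_map (product_topology (\<lambda>_. euclideanreal) UNIV) euclideanreal (\<lambda>x :: 'k \<Rightarrow> real. restrict x K k)"
      using continuous_map_product_projection[of k UNIV "\<lambda>_. euclideanreal"] by simp
  qed auto
  then have "continuous_map euclidean euclideanreal F"
    using continuous_map_compose[OF _ f] unfolding F_def o_def euclidean_product_topology by blast
  then have Fc: "continuous_on UNIV F" by simp
  have Fb: "\<bar>F x\<bar> \<le> B" for x using B[of "F x"] unfolding F_def by auto
  interpret char_convergence M N K "\<lambda>n x k. if k \<in> K then Z n k x else 0" "\<lambda>x k. if k \<in> K then W k x else 0"
  proof (rule char_convergence.intro)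
    show "(\<lambda>n. CLINT x|M n. iexp (\<Sum>k\<in>K. th k * (if k \<in> K then Z n k x else 0))) \<longlonglongrightarrow>
          (CLINT x|N. iexp (\<Sum>k\<in>K. th k * (if k \<in> K then W k x else 0)))" for th
      using conv[OF K, of th] by (simp cong: sum.cong)
    show "(\<lambda>x. if k \<in> K then Z n k x else 0) \<in> borel_measurable (M n)" for n k using Z by (cases "k \<in> K") auto
    show "(\<lambda>x. if k \<in> K then W k x else 0) \<in> borel_measurable N" for k using W by (cases "k \<in> K") auto
  qed (simp_all add: M N K)
  have e: "F (\<lambda>k. if k \<in> K then z k else 0) = f (\<lambda>k\<in>K. z k)" for z
    unfolding F_def by (rule arg_cong[where f=f]) auto
  show "(\<lambda>n. \<integral>\<omega>. f (\<lambda>k\<in>K. Z n k \<omega>) \<partial>M n) \<longlonglongrightarrow> (\<integral>\<omega>. f (\<lambda>k\<in>K. W k \<omega>) \<partial>N)"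
    using bounded_continuous_convergence[OF Fc Fb] unfolding e .
qed

section \<open>Gaussian vectors with multinomial covariance\<close>

definition stdN :: "('k \<Rightarrow> real) measure" where
  "stdN = Pi\<^sub>M UNIV (\<lambda>_. std_normal_distribution)"

lemma product_prob_std: "product_prob_space (\<lambda>_. std_normal_distribution)"
  unfolding product_prob_space_def product_prob_space_axioms_def product_sigma_finite_def
  using real_dist_normal_dist[unfolded real_distribution_def] prob_space_imp_sigma_finite by blast

lemma prob_stdN: "prob_space stdN"
  unfolding stdN_def by (rule prob_space_PiM) (use real_dist_normal_dist real_distribution_def in blast)

lemma stdN_coord: "(\<lambda>\<omega>. \<omega> l) \<in> borel_measurable stdN"
proof -
  have "(\<lambda>\<omega>. \<omega> l) \<in> measurable stdN std_normal_distribution"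
    unfolding stdN_def by (rule measurable_component_singleton) simp
  then show ?thesis by (simp cong: measurable_cong_sets)
qed

lemma stdN_distr: "distr stdN borel (\<lambda>\<omega>. \<omega> l) = std_normal_distribution"
proof -
  interpret product_prob_space "\<lambda>_::'a. std_normal_distribution" UNIV by (rule product_prob_std)
  have "distr stdN borel (\<lambda>\<omega>. \<omega> l) = distr stdN std_normal_distribution (\<lambda>\<omega>. \<omega> l)"
    by (rule distr_cong) auto
  also have "\<dots> = std_normal_distribution" unfolding stdN_def by (rule PiM_component) simp
  finally show ?thesis .
qed

lemma stdN_indep: "prob_space.indep_vars stdN (\<lambda>_. borel) (\<lambda>l \<omega>. \<omega> l) A"
proof -
  interpret prob_space "stdN :: ('a \<Rightarrow> real) measure" by (rule prob_stdN)
  have "indep_vars (\<lambda>_. borel) (\<lambda>l \<omega>. \<omega> l) UNIV"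
  proof (subst indep_vars_iff_distr_eq_PiM)
    have s: "sets (Pi\<^sub>M UNIV (\<lambda>_::'a. borel)) = sets (stdN :: ('a \<Rightarrow> real) measure)"
      unfolding stdN_def by (rule sets_PiM_cong) auto
    have "distr stdN (Pi\<^sub>M UNIV (\<lambda>_. borel)) (\<lambda>x::'a \<Rightarrow> real. x) = stdN" by (rule distr_id2[OF s])
    moreover have "(\<lambda>x. \<lambda>i\<in>UNIV. x i) = (\<lambda>x::'a \<Rightarrow> real. x)" by (simp add: fun_eq_iff)
    ultimately show "distr stdN (Pi\<^sub>M UNIV (\<lambda>_. borel)) (\<lambda>x. \<lambda>i\<in>UNIV. x i) = Pi\<^sub>M UNIV (\<lambda>i::'a. distr stdN borel (\<lambda>\<omega>. \<omega> i))"
      unfolding stdN_distr by (simp only: stdN_def)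
  qed (rule UNIV_not_empty stdN_coord)+
  then show ?thesis by (rule indep_vars_subset) simp
qed

lemma stdN_char: assumes "finite A"
  shows "(CLINT \<omega>|stdN. iexp (\<Sum>l\<in>A. d l * \<omega> l)) = of_real (exp (- (\<Sum>l\<in>A. (d l)\<^sup>2) / 2))"
proof -
  interpret prob_space "stdN :: ('a \<Rightarrow> real) measure" by (rule prob_stdN)
  have iv: "indep_vars (\<lambda>_. borel) (\<lambda>l \<omega>. d l * \<omega> l) A"
    using indep_vars_compose2[OF stdN_indep, of A "\<lambda>l x. d l * x" "\<lambda>_. borel"] by simp
  have m: "(\<lambda>\<omega>. \<Sum>l\<in>A. d l * \<omega> l) \<in> borel_measurable stdN"
    using stdN_coord by (intro borel_measurable_sum borel_measurable_times) auto
  have one: "char (distr stdN borel (\<lambda>\<omega>. d l * \<omega> l)) 1 = of_real (exp (- (d l)\<^sup>2 / 2))" for l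
  proof -
    have "char (distr stdN borel (\<lambda>\<omega>. d l * \<omega> l)) 1 = (CLINT \<omega>|stdN. iexp (d l * \<omega> l))"
      unfolding char_def using stdN_coord[of l] by (subst integral_distr) auto
    also have "\<dots> = char (distr stdN borel (\<lambda>\<omega>. \<omega> l)) (d l)"
      unfolding char_def using stdN_coord[of l] by (subst integral_distr) auto
    finally show ?thesis unfolding stdN_distr char_std_normal_distribution .
  qed
  have "(CLINT \<omega>|stdN. iexp (\<Sum>l\<in>A. d l * \<omega> l)) = char (distr stdN borel (\<lambda>\<omega>. \<Sum>l\<in>A. d l * \<omega> l)) 1"
    unfolding char_def using m by (subst integral_distr) auto
  also have "\<dots> = (\<Prod>l\<in>A. char (distr stdN borel (\<lambda>\<omega>. d l * \<omega> l)) 1)" by (rule char_distr_sum[OF iv])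
  also have "\<dots> = of_real (exp (\<Sum>l\<in>A. - (d l)\<^sup>2 / 2))"
    unfolding one by (simp add: exp_sum assms del: of_real_exp)
  also have "(\<Sum>l\<in>A. - (d l)\<^sup>2 / 2) = - (\<Sum>l\<in>A. (d l)\<^sup>2) / 2" by (simp add: sum_negf sum_divide_distrib)
  finally show ?thesis .
qed

lemma stdN_gaussian: assumes A: "finite A" shows "gaussian_variable stdN (\<lambda>\<omega>. \<Sum>l\<in>A. d l * \<omega> l)"
proof -
  interpret prob_space "stdN :: ('a \<Rightarrow> real) measure" by (rule prob_stdN)
  have m: "(\<lambda>\<omega>. \<Sum>l\<in>A. d l * \<omega> l) \<in> borel_measurable stdN"
    using stdN_coord by (intro borel_measurable_sum borel_measurable_times) auto
  let ?A = "{l \<in> A. d l \<noteq> 0}"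
  have e: "(\<Sum>l\<in>A. d l * \<omega> l) = (\<Sum>l\<in>?A. d l * \<omega> l)" for \<omega> :: "'a \<Rightarrow> real"
    by (rule sum.mono_neutral_right) (use A in auto)
  show ?thesis
  proof (cases "?A = {}")
    case True
    then have "(\<Sum>l\<in>A. d l * \<omega> l) = 0" for \<omega> :: "'a \<Rightarrow> real" unfolding e True by simp
    then show ?thesis unfolding gaussian_variable_def by (auto intro!: exI[of _ 0])
  next
    case False
    have "distributed stdN lborel (\<lambda>\<omega>. \<Sum>l\<in>?A. d l * \<omega> l) (normal_density (\<Sum>l\<in>?A. 0) (sqrt (\<Sum>l\<in>?A. \<bar>d l\<bar>\<^sup>2)))"
    proof (rule sum_indep_normal[OF _ False])
      show "indep_vars (\<lambda>_. borel) (\<lambda>l \<omega>. d l * \<omega> l) ?A"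
        using indep_vars_compose2[OF stdN_indep, of ?A "\<lambda>l x. d l * x" "\<lambda>_. borel"] by simp
      fix l assume l: "l \<in> ?A"
      have "distributed stdN lborel (\<lambda>\<omega>. \<omega> l) (normal_density 0 1)"
        unfolding distributed_def using stdN_distr[of l] stdN_coord[of l]
        by (auto cong: distr_cong)
      from normal_density_affine[OF this, of "d l" 0] l
      show "distributed stdN lborel (\<lambda>\<omega>. d l * \<omega> l) (normal_density 0 \<bar>d l\<bar>)" by simp
    qed (use A in auto)
    moreover have "0 < sqrt (\<Sum>l\<in>?A. \<bar>d l\<bar>\<^sup>2)"
      using False A by (intro real_sqrt_gt_zero sum_pos) auto
    ultimately show ?thesis unfolding gaussian_variable_def using m unfolding e by blast
  qed
qed

lemma stdN_moments:
  "integrable stdN (\<lambda>\<omega>. \<omega> l)" "(LINT \<omega>|stdN. \<omega> l) = 0"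
  "integrable stdN (\<lambda>\<omega>. \<omega> l * \<omega> m)" "(LINT \<omega>|stdN. \<omega> l * \<omega> m) = (if l = m then 1 else 0)"
proof -
  interpret prob_space "stdN :: ('a \<Rightarrow> real) measure" by (rule prob_stdN)
  note c = stdN_coord
  have i: "integrable stdN (\<lambda>\<omega>. (\<omega> l) ^ k)" for l k
    using integrable_std_normal_distribution_moment[of k] c[of l]
    unfolding stdN_distr[of l, symmetric] by (subst (asm) integrable_distr_eq) auto
  have v: "(LINT \<omega>|stdN. (\<omega> l) ^ k) = (LINT x|std_normal_distribution. x ^ k)" for l k
    unfolding stdN_distr[of l, symmetric] using c[of l] by (subst integral_distr) auto
  show i1: "integrable stdN (\<lambda>\<omega>. \<omega> l)" for l :: 'a using i[of l 1] by simp
  show v1: "(LINT \<omega>|stdN. \<omega> l) = 0" for l :: 'a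
    using v[of l 1] integral_std_normal_distribution_moment_odd[of 1] by simp
  have two: "(LINT \<omega>|stdN. \<omega> l * \<omega> l) = 1"
    using v[of l 2] std_normal_distribution_even_moments(1)[of 1] by (simp add: power2_eq_square fact_numeral)
  have iv: "indep_vars (\<lambda>_. borel) (\<lambda>l \<omega>. \<omega> l) {l, m}" by (rule stdN_indep)
  show "integrable stdN (\<lambda>\<omega>. \<omega> l * \<omega> m)"
  proof (cases "l = m")
    case True then show ?thesis using i[of l 2] by (simp add: power2_eq_square)
  next
    case False then show ?thesis using indep_vars_integrable[OF _ iv i1] by simp
  qed
  show "(LINT \<omega>|stdN. \<omega> l * \<omega> m) = (if l = m then 1 else 0)"
  proof (cases "l = m")
    case True then show ?thesis using two by simp
  next
    case False then show ?thesis using indep_vars_lebesgue_integral[OF _ iv i1] v1 by simp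
  qed
qed

lemma stdN_linear: assumes "finite A"
  shows "(LINT \<omega>|stdN. (\<Sum>l\<in>A. d l * \<omega> l)) = 0"
    "(LINT \<omega>|stdN. (\<Sum>l\<in>A. d l * \<omega> l) * (\<Sum>l\<in>A. d' l * \<omega> l)) = (\<Sum>l\<in>A. d l * d' l)"
proof -
  show "(LINT \<omega>|stdN. (\<Sum>l\<in>A. d l * \<omega> l)) = 0"
    by (subst Bochner_Integration.integral_sum) (auto simp: stdN_moments)
  have "(LINT \<omega>|stdN. (\<Sum>l\<in>A. d l * \<omega> l) * (\<Sum>l\<in>A. d' l * \<omega> l))
    = (LINT \<omega>|stdN. (\<Sum>l\<in>A. \<Sum>m\<in>A. d l * d' m * (\<omega> l * \<omega> m)))"
    unfolding sum_product by (simp add: ac_simps)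
  also have "\<dots> = (\<Sum>l\<in>A. \<Sum>m\<in>A. d l * d' m * (if l = m then 1 else 0))"
    by (subst Bochner_Integration.integral_sum; (subst Bochner_Integration.integral_sum)?)
       (auto simp: stdN_moments intro!: Bochner_Integration.integrable_sum)
  also have "\<dots> = (\<Sum>l\<in>A. d l * d' l)" using assms by (simp add: if_distrib cong: if_cong)
  finally show "(LINT \<omega>|stdN. (\<Sum>l\<in>A. d l * \<omega> l) * (\<Sum>l\<in>A. d' l * \<omega> l)) = (\<Sum>l\<in>A. d l * d' l)" .
qed

text \<open>The Cholesky factor of the covariance \<open>\<delta> a\<^sub>j - a\<^sub>j a\<^sub>k\<close>, which is that of the increments of a Brownian bridge over
  consecutive intervals of lengths \<open>a\<^sub>k\<close>. With \<open>T\<^sub>l\<close> the length left after the first \<open>l\<close> intervals, the sum of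
  \<open>a\<^sub>l / (T\<^sub>l * T\<^bsub>l + 1\<^esub>)\<close> telescopes to \<open>1 / T\<^sub>j - 1\<close>. Every row is finite, so infinite sums of normal variables do
  not occur.\<close>
lemma bridge_factor:
  fixes a :: "nat \<Rightarrow> real"
  assumes a0: "\<And>k. 0 \<le> a k" and lt: "\<And>n. (\<Sum>m<n. a m) < 1"
  shows "\<exists>B. (\<forall>k l. k < l \<longrightarrow> B k l = 0) \<and>
    (\<forall>j k n. j < n \<longrightarrow> k < n \<longrightarrow> (\<Sum>l<n. B j l * B k l) = (if j = k then a j else 0) - a j * a k)"
proof -
  define T where "T = (\<lambda>l. 1 - (\<Sum>m<l. a m))"
  have T: "T l > 0" "T (Suc l) = T l - a l" for l using lt[of l] unfolding T_def by auto
  define m where "m = (\<lambda>l. sqrt (a l / (T l * T (Suc l))))"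
  define r where "r = (\<lambda>l. sqrt (a l * T (Suc l) / T l))"
  have mm: "m l * m l = a l / (T l * T (Suc l))" for l unfolding m_def using a0 T(1) by (simp add: less_imp_le)
  have rr: "r l * r l = a l * T (Suc l) / T l" for l unfolding r_def using a0 T(1) by (simp add: less_imp_le)
  have rm: "r l * m l = a l / T l" for l
  proof -
    have "r l * m l = sqrt ((a l * T (Suc l) / T l) * (a l / (T l * T (Suc l))))"
      unfolding r_def m_def by (rule real_sqrt_mult[symmetric])
    also have "(a l * T (Suc l) / T l) * (a l / (T l * T (Suc l))) = (a l / T l)\<^sup>2"
      using T(1)[of l] T(1)[of "Suc l"] by (simp add: field_simps power2_eq_square)
    also have "sqrt ((a l / T l)\<^sup>2) = a l / T l" using a0[of l] T(1)[of l] by simp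
    finally show ?thesis .
  qed
  have tele: "(\<Sum>l<j. m l * m l) = 1 / T j - 1" for j
  proof (induction j)
    case 0 show ?case by (simp add: T_def)
  next
    case (Suc j)
    have "a j / (T j * T (Suc j)) = 1 / T (Suc j) - 1 / T j"
      using T(1)[of j] T(1)[of "Suc j"] T(2)[of j] by (simp add: field_simps)
    then show ?case using Suc by (simp add: mm)
  qed
  define B where "B = (\<lambda>k l. if l < k then - a k * m l else if l = k then r k else 0)"
  have le: "(\<Sum>l<n. B j l * B k l) = (if j = k then a j else 0) - a j * a k" if "j \<le> k" "k < n" for j k n
  proof -
    have "(\<Sum>l<n. B j l * B k l) = (\<Sum>l<Suc j. B j l * B k l)"
      by (rule sum.mono_neutral_right) (use that in \<open>auto simp: B_def\<close>)
    also have "\<dots> = (\<Sum>l<j. a j * a k * (m l * m l)) + r j * B k j"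
      using that by (simp add: B_def ac_simps)
    also have "\<dots> = a j * a k * (1 / T j - 1) + r j * B k j" unfolding tele[symmetric] by (simp add: sum_distrib_left)
    also have "\<dots> = (if j = k then a j else 0) - a j * a k"
    proof (cases "j = k")
      case True
      have "r j * B k j = a j * (T j - a j) / T j" using True rr[of j] T(2)[of j] by (simp add: B_def)
      then show ?thesis using True T(1)[of j] by (simp add: field_simps)
    next
      case False
      then have "r j * B k j = - a k * (r j * m j)" using that by (simp add: B_def)
      also have "\<dots> = - a k * (a j / T j)" unfolding rm ..
      finally show ?thesis using False T(1)[of j] by (simp add: field_simps)
    qed
    finally show ?thesis .
  qed
  have "(\<Sum>l<n. B j l * B k l) = (if j = k then a j else 0) - a j * a k" if "j < n" "k < n" for j k n
  proof (cases "j \<le> k")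
    case True then show ?thesis using le that by blast
  next
    case False
    then have "(\<Sum>l<n. B k l * B j l) = (if k = j then a k else 0) - a k * a j" using le that by simp
    then show ?thesis using False by (simp add: mult.commute)
  qed
  then show ?thesis by (intro exI[of _ B]) (auto simp: B_def)
qed

text \<open>Strict inequality for all finite sums holds when infinitely many weights are positive and the total is one; it
  keeps the remaining lengths in \<open>bridge_factor\<close> positive.\<close>
lemma gaussian_exists:
  fixes w :: "nat + nat \<Rightarrow> real"
  assumes w0: "\<And>k. 0 \<le> w k" and w1: "\<And>K. finite K \<Longrightarrow> (\<Sum>k\<in>K. w k) < 1"
  shows "\<exists>(N :: (nat + nat \<Rightarrow> real) measure) Z. prob_space N \<and> (\<forall>k. Z k \<in> borel_measurable N) \<and>
    gaussian_family N Z \<and> (\<forall>k. mean N (Z k) = 0) \<and>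
    (\<forall>j k. covariance N (Z j) (Z k) = (if j = k then w j else 0) - w j * w k) \<and>
    (\<forall>K th. finite K \<longrightarrow> (CLINT x|N. iexp (\<Sum>k\<in>K. th k * Z k x))
       = of_real (exp (- ((\<Sum>k\<in>K. (th k)\<^sup>2 * w k) - (\<Sum>k\<in>K. th k * w k)\<^sup>2) / 2)))"
proof -
  define a where "a = (\<lambda>l. w (sum_decode l))"
  have inj: "inj_on sum_decode A" for A by (rule inj_sum_decode)
  have "(\<Sum>m<n. a m) < 1" for n
    using w1[of "sum_decode ` {..<n}"] unfolding a_def by (simp add: sum.reindex[OF inj])
  then obtain B where B0: "\<And>k l. k < l \<Longrightarrow> B k l = 0"
    and B: "\<And>j k n. j < n \<Longrightarrow> k < n \<Longrightarrow> (\<Sum>l<n. B j l * B k l) = (if j = k then a j else 0) - a j * a k"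
    using bridge_factor[of a] w0 unfolding a_def by blast
  define D where "D = (\<lambda>n. sum_decode ` {..<n} :: (nat + nat) set)"
  have finD: "finite (D n)" for n unfolding D_def by simp
  define b where "b = (\<lambda>k l. B (sum_encode k) (sum_encode l))"
  define Z where "Z = (\<lambda>k (\<omega> :: nat + nat \<Rightarrow> real). \<Sum>l\<in>D (Suc (sum_encode k)). b k l * \<omega> l)"
  have Zn: "Z k \<omega> = (\<Sum>l\<in>D n. b k l * \<omega> l)" if "sum_encode k < n" for k n \<omega>
    unfolding Z_def
  proof (rule sum.mono_neutral_left[OF finD])
    show "D (Suc (sum_encode k)) \<subseteq> D n" unfolding D_def using that by auto
    show "\<forall>l\<in>D n - D (Suc (sum_encode k)). b k l * \<omega> l = 0"
    proof
      fix l assume l: "l \<in> D n - D (Suc (sum_encode k))"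
      have "l = sum_decode (sum_encode l)" by simp
      then have "\<not> sum_encode l < Suc (sum_encode k)" using l unfolding D_def by (metis DiffD2 image_eqI lessThan_iff)
      then show "b k l * \<omega> l = 0" unfolding b_def by (simp add: B0)
    qed
  qed
  have bb: "(\<Sum>l\<in>D n. b j l * b k l) = (if j = k then w j else 0) - w j * w k"
    if "sum_encode j < n" "sum_encode k < n" for j k n
    using B[OF that] inj_eq[OF inj_sum_encode, of j k] unfolding D_def b_def a_def by (simp add: sum.reindex[OF inj])
  have lin: "\<exists>n. (\<forall>k\<in>K. sum_encode k < n) \<and> (\<forall>c \<omega>. (\<Sum>k\<in>K. c k * Z k \<omega>) = (\<Sum>l\<in>D n. (\<Sum>k\<in>K. c k * b k l) * \<omega> l))"
    if "finite K" for K
  proof -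
    obtain n where n: "\<And>k. k \<in> K \<Longrightarrow> sum_encode k < n"
      using finite_nat_set_iff_bounded[of "sum_encode ` K"] \<open>finite K\<close> by auto
    have "(\<Sum>k\<in>K. c k * Z k \<omega>) = (\<Sum>l\<in>D n. (\<Sum>k\<in>K. c k * b k l) * \<omega> l)" for c \<omega>
    proof -
      have "(\<Sum>k\<in>K. c k * Z k \<omega>) = (\<Sum>k\<in>K. \<Sum>l\<in>D n. c k * b k l * \<omega> l)"
        by (intro sum.cong refl) (simp add: Zn[OF n] sum_distrib_left mult.assoc)
      also have "\<dots> = (\<Sum>l\<in>D n. \<Sum>k\<in>K. c k * b k l * \<omega> l)" by (rule sum.swap)
      finally show ?thesis by (simp add: sum_distrib_right)
    qed
    then show ?thesis using n by blast
  qed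
  have mean0: "mean stdN (Z k) = 0" for k
    unfolding mean_def Z_def by (rule stdN_linear(1)[OF finD])
  show ?thesis
  proof (intro exI[of _ stdN] exI[of _ Z] conjI allI impI)
    show "prob_space stdN" by (rule prob_stdN)
    show "Z k \<in> borel_measurable stdN" for k
      unfolding Z_def using stdN_coord by (intro borel_measurable_sum borel_measurable_times) auto
    show "gaussian_family stdN Z" unfolding gaussian_family_def
    proof (intro allI impI)
      fix K :: "(nat + nat) set" and c :: "nat + nat \<Rightarrow> real" assume "finite K"
      from lin[OF this] obtain n where n: "\<forall>c \<omega>. (\<Sum>k\<in>K. c k * Z k \<omega>) = (\<Sum>l\<in>D n. (\<Sum>k\<in>K. c k * b k l) * \<omega> l)"
        by (elim exE conjE)
      have "(\<Sum>k\<in>K. c k * Z k \<omega>) = (\<Sum>l\<in>D n. (\<Sum>k\<in>K. c k * b k l) * \<omega> l)" for \<omega>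
        by (rule n[rule_format])
      then show "gaussian_variable stdN (\<lambda>\<omega>. \<Sum>k\<in>K. c k * Z k \<omega>)" by (simp only:) (rule stdN_gaussian[OF finD])
    qed
    show "mean stdN (Z k) = 0" for k by (rule mean0)
    fix j k
    let ?n = "Suc (max (sum_encode j) (sum_encode k))"
    have n: "sum_encode j < ?n" "sum_encode k < ?n" by auto
    show "covariance stdN (Z j) (Z k) = (if j = k then w j else 0) - w j * w k"
      unfolding covariance_def mean0 diff_zero Zn[OF n(1)] Zn[OF n(2)] stdN_linear(2)[OF finD] by (rule bb[OF n])
  next
    fix K :: "(nat + nat) set" and th assume K: "finite K"
    from lin[OF K] obtain n where n': "\<forall>k\<in>K. sum_encode k < n"
      and l': "\<forall>c \<omega>. (\<Sum>k\<in>K. c k * Z k \<omega>) = (\<Sum>l\<in>D n. (\<Sum>k\<in>K. c k * b k l) * \<omega> l)"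
      by (elim exE conjE)
    have n: "sum_encode k < n" if "k \<in> K" for k using n' that by blast
    have l: "(\<Sum>k\<in>K. th k * Z k \<omega>) = (\<Sum>l\<in>D n. (\<Sum>k\<in>K. th k * b k l) * \<omega> l)" for \<omega>
      by (rule l'[rule_format])
    have "(\<Sum>l\<in>D n. (\<Sum>k\<in>K. th k * b k l)\<^sup>2) = (\<Sum>l\<in>D n. \<Sum>j\<in>K. \<Sum>k\<in>K. th j * th k * (b j l * b k l))"
      unfolding power2_eq_square sum_product by (simp add: ac_simps)
    also have "\<dots> = (\<Sum>j\<in>K. \<Sum>k\<in>K. th j * th k * (\<Sum>l\<in>D n. b j l * b k l))"
      by (subst sum.swap) (simp add: sum_distrib_left sum.swap[of _ "D n" K])
    also have "\<dots> = (\<Sum>j\<in>K. \<Sum>k\<in>K. th j * th k * ((if j = k then w j else 0) - w j * w k))"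
      by (intro sum.cong refl) (simp add: bb n)
    also have "\<dots> = (\<Sum>j\<in>K. \<Sum>k\<in>K. if j = k then (th j)\<^sup>2 * w j else 0) - (\<Sum>j\<in>K. \<Sum>k\<in>K. (th j * w j) * (th k * w k))"
      unfolding sum_subtractf[symmetric] by (intro sum.cong refl) (simp add: algebra_simps power2_eq_square)
    also have "\<dots> = (\<Sum>k\<in>K. (th k)\<^sup>2 * w k) - (\<Sum>k\<in>K. th k * w k)\<^sup>2"
      using K by (simp add: power2_eq_square sum_product)
    finally show "(CLINT x|stdN. iexp (\<Sum>k\<in>K. th k * Z k x))
       = of_real (exp (- ((\<Sum>k\<in>K. (th k)\<^sup>2 * w k) - (\<Sum>k\<in>K. th k * w k)\<^sup>2) / 2))"
      unfolding l stdN_char[OF finD] by simp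
  qed
qed

section \<open>The central limit theorem for letter counts\<close>

text \<open>After centering, \<open>cis\<close> is expanded to second order; the linear term vanishes, and the \<open>n\<close>-th powers are compared by
  \<open>\<bar>z ^ n - w ^ n\<bar> \<le> n * \<bar>z - w\<bar>\<close> on the unit disc.\<close>
lemma multinomial_limit:
  fixes w y :: "'i \<Rightarrow> real"
  assumes S: "finite S" and w: "\<And>k. k \<in> S \<Longrightarrow> 0 \<le> w k" "(\<Sum>k\<in>S. w k) = 1"
  defines "m \<equiv> (\<Sum>k\<in>S. w k * y k)"
  shows "(\<lambda>n. cis (- (sqrt (real n) * m)) * (\<Sum>k\<in>S. of_real (w k) * cis (y k / sqrt (real n))) ^ n)
    \<longlonglongrightarrow> of_real (exp (- ((\<Sum>k\<in>S. w k * (y k)\<^sup>2) - m\<^sup>2) / 2))"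
proof -
  define v where "v = (\<lambda>k. y k - m)"
  define s2 where "s2 = (\<Sum>k\<in>S. w k * (v k)\<^sup>2)"
  have wv: "(\<Sum>k\<in>S. w k * v k) = 0"
    unfolding v_def right_diff_distrib sum_subtractf sum_distrib_right[symmetric] w(2) m_def by simp
  have s2: "s2 = (\<Sum>k\<in>S. w k * (y k)\<^sup>2) - m\<^sup>2"
  proof -
    have "s2 = (\<Sum>k\<in>S. w k * (y k)\<^sup>2 - 2 * m * (w k * y k) + m\<^sup>2 * w k)"
      unfolding s2_def v_def by (intro sum.cong refl) (simp add: power2_eq_square algebra_simps)
    also have "\<dots> = (\<Sum>k\<in>S. w k * (y k)\<^sup>2) - 2 * m * m + m\<^sup>2 * 1"
      unfolding sum.distrib sum_subtractf sum_distrib_left[symmetric] w(2) m_def[symmetric] by simp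
    finally show ?thesis by (simp add: power2_eq_square)
  qed
  have s20: "0 \<le> s2" unfolding s2_def using w by (intro sum_nonneg) auto
  define C where "C = (\<Sum>k\<in>S. w k * \<bar>v k\<bar> ^ 3 / 6)"
  define p where "p = (\<lambda>n::nat. \<Sum>k\<in>S. of_real (w k) * cis (v k / sqrt (real n)) :: complex)"
  have pn: "cmod (p n) \<le> 1" for n
  proof -
    have "cmod (p n) \<le> (\<Sum>k\<in>S. w k)"
      unfolding p_def by (rule sum_norm_le) (simp add: norm_mult w)
    then show ?thesis using w by simp
  qed
  have approx: "cmod (p n - of_real (1 + (- s2 / 2) / real n)) \<le> C / (real n * sqrt (real n))" if n: "n > 0" for n
  proof -
    define u where "u = (\<lambda>k. v k / sqrt (real n))"
    have usum: "(\<Sum>k\<in>S. w k * (u k)\<^sup>2) = s2 / real n"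
      unfolding u_def s2_def by (simp add: power_divide sum_divide_distrib)
    have "(\<Sum>k\<in>S. w k * u k) = (\<Sum>k\<in>S. w k * v k) / sqrt (real n)" unfolding u_def by (simp add: sum_divide_distrib)
    then have u1: "(\<Sum>k\<in>S. w k * u k) = 0" using wv by simp
    have "(\<Sum>k\<in>S. of_real (w k) * (\<Sum>j\<le>2. (\<i> * of_real (u k)) ^ j / fact j))
       = (\<Sum>k\<in>S. of_real (w k) + \<i> * of_real (w k * u k) - of_real (w k * (u k)\<^sup>2) / 2)"
      by (intro sum.cong refl) (simp add: numeral_2_eq_2 power_mult_distrib algebra_simps)
    also have "\<dots> = of_real (\<Sum>k\<in>S. w k) + \<i> * of_real (\<Sum>k\<in>S. w k * u k) - of_real (\<Sum>k\<in>S. w k * (u k)\<^sup>2) / 2"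
      by (simp add: sum.distrib sum_subtractf sum_distrib_left sum_divide_distrib)
    also have "\<dots> = of_real (1 + (- s2 / 2) / real n)" unfolding w(2) u1 usum by simp
    finally have q: "of_real (1 + (- s2 / 2) / real n) = (\<Sum>k\<in>S. of_real (w k) * (\<Sum>j\<le>2. (\<i> * of_real (u k)) ^ j / fact j))" ..
    have "p n - of_real (1 + (- s2 / 2) / real n) = (\<Sum>k\<in>S. of_real (w k) * (iexp (u k) - (\<Sum>j\<le>2. (\<i> * of_real (u k)) ^ j / fact j)))"
      unfolding q p_def u_def[symmetric] by (simp add: sum_subtractf right_diff_distrib cis_conv_exp u_def)
    then have "cmod (p n - of_real (1 + (- s2 / 2) / real n)) \<le> (\<Sum>k\<in>S. w k * (\<bar>u k\<bar> ^ 3 / 6))"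
    proof (simp only:, intro sum_norm_le)
      fix k assume k: "k \<in> S"
      have "cmod (iexp (u k) - (\<Sum>j\<le>2. (\<i> * of_real (u k)) ^ j / fact j)) \<le> \<bar>u k\<bar> ^ 3 / 6"
        using iexp_approx1[of "u k" 2] by (simp add: fact_numeral numeral_3_eq_3[symmetric])
      then show "cmod (of_real (w k) * (iexp (u k) - (\<Sum>j\<le>2. (\<i> * of_real (u k)) ^ j / fact j))) \<le> w k * (\<bar>u k\<bar> ^ 3 / 6)"
        unfolding norm_mult norm_of_real abs_of_nonneg[OF w(1)[OF k]] using w(1)[OF k] by (rule mult_left_mono)
    qed
    also have "\<dots> = C / (real n * sqrt (real n))"
    proof -
      have "sqrt (real n) ^ 3 = real n * sqrt (real n)" by (simp add: power3_eq_cube)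
      then show ?thesis unfolding u_def C_def by (simp add: power_divide sum_divide_distrib ac_simps)
    qed
    finally show ?thesis .
  qed
  have "(\<lambda>n. of_real ((1 + (- s2 / 2) / real n) ^ n) :: complex) \<longlonglongrightarrow> of_real (exp (- s2 / 2))"
    by (intro tendsto_of_real tendsto_exp_limit_sequentially)
  moreover have "(\<lambda>n. p n ^ n - of_real ((1 + (- s2 / 2) / real n) ^ n)) \<longlonglongrightarrow> 0"
  proof (rule Lim_null_comparison)
    obtain n0 :: nat where n0: "s2 \<le> real n0" using real_arch_simple by blast
    show "\<forall>\<^sub>F n in sequentially. cmod (p n ^ n - of_real ((1 + (- s2 / 2) / real n) ^ n)) \<le> C * inverse (sqrt (real n))"
      using eventually_ge_at_top[of "Suc n0"]
    proof eventually_elim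
      case (elim n)
      then have n: "n > 0" "s2 \<le> real n" using n0 by auto
      have c1: "cmod (of_real (1 + (- s2 / 2) / real n)) \<le> 1"
        unfolding norm_of_real using n s20 by (simp add: abs_le_iff field_simps)
      have "cmod (p n ^ n - of_real (1 + (- s2 / 2) / real n) ^ n) \<le> real n * cmod (p n - of_real (1 + (- s2 / 2) / real n))"
        by (rule norm_power_diff[OF pn c1])
      also have "\<dots> \<le> real n * (C / (real n * sqrt (real n)))" by (intro mult_left_mono approx n(1)) simp
      also have "\<dots> = C * inverse (sqrt (real n))" using n by (simp add: field_simps)
      finally show ?case by simp
    qed
    have "(\<lambda>n. inverse (sqrt (real n))) \<longlonglongrightarrow> 0"
      by (intro tendsto_inverse_0_at_top filterlim_compose[OF sqrt_at_top] filterlim_real_sequentially)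
    then show "(\<lambda>n. C * inverse (sqrt (real n))) \<longlonglongrightarrow> 0" by (rule tendsto_mult_right_zero)
  qed
  ultimately have "(\<lambda>n. p n ^ n) \<longlonglongrightarrow> of_real (exp (- s2 / 2))"
    using tendsto_add by fastforce
  moreover have "cis (- (sqrt (real n) * m)) * (\<Sum>k\<in>S. of_real (w k) * cis (y k / sqrt (real n))) ^ n = p n ^ n" for n
  proof (cases "n = 0")
    case False
    have e: "cis (- (sqrt (real n) * m)) = cis (- m / sqrt (real n)) ^ n"
    proof -
      have "real n * (- m / sqrt (real n)) = - (sqrt (real n) * m)"
        using False by (simp add: field_simps real_sqrt_mult_self)
      then show ?thesis unfolding Complex.DeMoivre by simp
    qed
    have "p n = cis (- m / sqrt (real n)) * (\<Sum>k\<in>S. of_real (w k) * cis (y k / sqrt (real n)))"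
      unfolding p_def sum_distrib_left
      by (intro sum.cong refl) (simp add: v_def cis_mult diff_divide_distrib)
    then show ?thesis unfolding e by (simp add: power_mult_distrib)
  qed simp
  ultimately show ?thesis unfolding s2 by simp
qed

section \<open>The \<open>(q,t)\<close>-Plancherel measure\<close>

lemma specializes_add_pos_letters: "specializes p (\<lambda>la. of_real (s la)) \<Longrightarrow>
  specializes (\<lambda>k. p k + of_real (\<Sum>i<n. a i ^ k)) (\<lambda>la. of_real (add_pos_letters n a s la))"
proof (induction n arbitrary: a)
  case 0 then show ?case by simp
next
  case (Suc n)
  show ?case
  proof (rule specializes_cong[OF specializes_add_pos[OF Suc.IH[OF Suc.prems, of "\<lambda>i. a (Suc i)"], of "of_real (a 0)"]])
    show "p k + of_real (\<Sum>i<n. a (Suc i) ^ k) + of_real (a 0) ^ k = p k + of_real (\<Sum>i<Suc n. a i ^ k)" for k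
      unfolding sum.lessThan_Suc_shift by simp
  qed (simp add: add_pos_of_real)
qed

lemma specializes_add_neg_letters: "specializes p (\<lambda>la. of_real (s la)) \<Longrightarrow>
  specializes (\<lambda>k. p k - of_real (\<Sum>i<n. (- a i) ^ k)) (\<lambda>la. of_real (add_neg_letters n a s la))"
proof (induction n arbitrary: a)
  case 0 then show ?case by simp
next
  case (Suc n)
  show ?case
  proof (rule specializes_cong[OF specializes_add_neg[OF Suc.IH[OF Suc.prems, of "\<lambda>i. a (Suc i)"], of "of_real (a 0)"]])
    show "p k - of_real (\<Sum>i<n. (- a (Suc i)) ^ k) - (- of_real (a 0)) ^ k = p k - of_real (\<Sum>i<Suc n. (- a i) ^ k)" for k
      unfolding sum.lessThan_Suc_shift by simp
  qed (simp add: add_neg_of_real)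
qed

lemma row_part_props:
  assumes "lam \<in> partitions_of n"
  shows "conj_part lam j = conjugate (row_part lam) j" "map (row_part lam) [0..<conjugate (row_part lam) 0] = lam"
proof -
  have z: "0 \<notin> set lam" using assms unfolding partitions_of_def by auto
  have e: "{i. j < row_part lam i} = {i. i < length lam \<and> j < lam ! i}" for j
    unfolding row_part_def by (auto split: if_splits)
  show "conj_part lam j = conjugate (row_part lam) j" unfolding conj_part_def conjugate_def e ..
  have "{i. i < length lam \<and> 0 < lam ! i} = {..<length lam}" using z by (auto simp: in_set_conv_nth gr0_conv_Suc)
  then have "conjugate (row_part lam) 0 = length lam" unfolding conjugate_def e by simp
  then show "map (row_part lam) [0..<conjugate (row_part lam) 0] = lam"
    by (intro nth_equalityI) (auto simp: row_part_def)
qed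

text \<open>The passage between lists of positive parts and functions.\<close>
lemma bij_row_part: "bij_betw row_part (partitions_of n) {p. is_part p \<and> part_size p = n}"
proof (rule bij_betw_byWitness[where f'="\<lambda>p. map p [0..<conjugate p 0]"])
  show "\<forall>lam\<in>partitions_of n. map (row_part lam) [0..<conjugate (row_part lam) 0] = lam"
    using row_part_props(2) by blast
  have inv_eq: "row_part (map p [0..<conjugate p 0]) = p" if "is_part p" for p
  proof
    fix i show "row_part (map p [0..<conjugate p 0]) i = p i"
      using less_conjugate_iff[OF that, of i 0] by (auto simp: row_part_def)
  qed
  then show "\<forall>p\<in>{p. is_part p \<and> part_size p = n}. row_part (map p [0..<conjugate p 0]) = p" by auto
  show "row_part ` partitions_of n \<subseteq> {p. is_part p \<and> part_size p = n}" using dim_kostka_comp(2,3) by auto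
  show "(\<lambda>p. map p [0..<conjugate p 0]) ` {p. is_part p \<and> part_size p = n} \<subseteq> partitions_of n"
  proof safe
    fix p :: shape assume p: "is_part p" "n = part_size p"
    have z: "p i = 0" if "i \<ge> conjugate p 0" for i using less_conjugate_iff[OF p(1), of i 0] that by simp
    show "map p [0..<conjugate p 0] \<in> partitions_of (part_size p)"
      unfolding partitions_of_def
    proof (intro CollectI conjI)
      show "sorted_wrt (\<ge>) (map p [0..<conjugate p 0])"
        by (auto simp: sorted_wrt_iff_nth_less intro: is_part_antimono[OF p(1)])
      show "0 \<notin> set (map p [0..<conjugate p 0])" using less_conjugate_iff[OF p(1), of _ 0] by force
      have "part_size p = (\<Sum>i<conjugate p 0. p i)" by (rule part_size_eq) (rule z)
      then show "sum_list (map p [0..<conjugate p 0]) = part_size p"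
        by (simp add: interv_sum_list_conv_sum_set_nat lessThan_atLeast0)
    qed
  qed
qed

lemma finite_partitions_of: "finite (partitions_of n)"
  using bij_betw_finite[OF bij_row_part] finite_parts_eq by blast

lemma integral_finite_valued:
  fixes g :: "'b \<Rightarrow> complex"
  assumes M: "prob_space M" and L: "L \<in> measurable M (count_space A)" and A: "finite A"
  shows "(CLINT \<omega>|M. g (L \<omega>)) = (\<Sum>a\<in>A. of_real (measure M {\<omega> \<in> space M. L \<omega> = a}) * g a)"
proof -
  interpret prob_space M by (rule M)
  have s: "{\<omega> \<in> space M. L \<omega> = a} \<in> sets M" if "a \<in> A" for a
  proof -
    have "L -` {a} \<inter> space M \<in> sets M" by (rule measurable_sets[OF L]) (use that in auto)
    moreover have "L -` {a} \<inter> space M = {\<omega> \<in> space M. L \<omega> = a}" by auto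
    ultimately show ?thesis by simp
  qed
  have "(CLINT \<omega>|M. g (L \<omega>)) = (CLINT \<omega>|M. (\<Sum>a\<in>A. indicator {\<omega> \<in> space M. L \<omega> = a} \<omega> *\<^sub>R g a))"
  proof (rule Bochner_Integration.integral_cong[OF refl])
    fix \<omega> assume w: "\<omega> \<in> space M"
    have "L \<omega> \<in> A" using measurable_space[OF L w] by simp
    then have "(\<Sum>a\<in>A. if a = L \<omega> then g a else 0) = g (L \<omega>)" using A by simp
    moreover have "(\<Sum>a\<in>A. indicator {\<omega> \<in> space M. L \<omega> = a} \<omega> *\<^sub>R g a) = (\<Sum>a\<in>A. if a = L \<omega> then g a else 0)"
      using w by (intro sum.cong) (auto simp: indicator_def)
    ultimately show "g (L \<omega>) = (\<Sum>a\<in>A. indicator {\<omega> \<in> space M. L \<omega> = a} \<omega> *\<^sub>R g a)" by simp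
  qed
  also have "\<dots> = (\<Sum>a\<in>A. (CLINT \<omega>|M. indicator {\<omega> \<in> space M. L \<omega> = a} \<omega> *\<^sub>R g a))"
    by (rule Bochner_Integration.integral_sum) (auto intro!: integrable_scaleR_left integrable_real_indicator s emeasure_finite simp: less_top[symmetric])
  also have "\<dots> = (\<Sum>a\<in>A. of_real (measure M {\<omega> \<in> space M. L \<omega> = a}) * g a)"
  proof (rule sum.cong[OF refl])
    fix a assume a: "a \<in> A"
    have "(LINT \<omega>|M. indicator {\<omega> \<in> space M. L \<omega> = a} \<omega>) = measure M {\<omega> \<in> space M. L \<omega> = a}"
      using s[OF a] sets.sets_into_space by (simp add: Int_absorb2 inf.absorb1)
    then show "(CLINT \<omega>|M. indicator {\<omega> \<in> space M. L \<omega> = a} \<omega> *\<^sub>R g a) = of_real (measure M {\<omega> \<in> space M. L \<omega> = a}) * g a"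
      by (subst integral_scaleR_left) (use s[OF a] in \<open>auto intro!: integrable_real_indicator simp: scaleR_conv_of_real less_top[symmetric]\<close>)
  qed
  finally show ?thesis .
qed

locale qt =
  fixes q t :: real
  assumes q: "0 < q" "q < 1" and t: "0 \<le> t" "t \<le> 1"
begin

abbreviation al :: "nat \<Rightarrow> real" where "al \<equiv> alpha_qt q t"
abbreviation be :: "nat \<Rightarrow> real" where "be \<equiv> beta_qt q t"

lemma al0: "0 \<le> al i" and be0: "0 \<le> be i"
  unfolding alpha_qt_def beta_qt_def using q t by auto

lemma sums_geo: "(\<lambda>i. c * (1 - q) * q ^ (I + i)) sums (c * q ^ I)"
proof -
  have "(\<lambda>i. (c * (1 - q) * q ^ I) * q ^ i) sums ((c * (1 - q) * q ^ I) * (1 / (1 - q)))"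
    by (intro sums_mult geometric_sums) (use q in simp)
  moreover have "(c * (1 - q) * q ^ I) * (1 / (1 - q)) = c * q ^ I" using q by simp
  ultimately show ?thesis by (simp add: power_add mult.assoc)
qed

lemma al_sums: "(\<lambda>i. al (I + i)) sums (t * q ^ I)" and be_sums: "(\<lambda>i. be (I + i)) sums ((1 - t) * q ^ I)"
  unfolding alpha_qt_def beta_qt_def by (rule sums_geo)+

lemma sum_geo: "(\<Sum>i<I. c * (1 - q) * q ^ i) = c * (1 - q ^ I)"
proof -
  have "(\<Sum>i<I. c * (1 - q) * q ^ i) = c * ((1 - q) * (\<Sum>i<I. q ^ i))"
    by (simp add: sum_distrib_left mult.assoc)
  also have "(1 - q) * (\<Sum>i<I. q ^ i) = 1 - q ^ I" by (rule one_diff_power_eq[symmetric])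
  finally show ?thesis .
qed

lemma al_sum: "(\<Sum>i<I. al i) = t * (1 - q ^ I)" and be_sum: "(\<Sum>i<I. be i) = (1 - t) * (1 - q ^ I)"
  unfolding alpha_qt_def beta_qt_def by (rule sum_geo)+

lemma alph: "alphabets (\<lambda>i. al (I + i)) (\<lambda>j. be (J + j))"
  by standard (use al0 be0 sums_summable[OF al_sums] sums_summable[OF be_sums] in auto)

definition rest_weight :: "nat \<Rightarrow> nat \<Rightarrow> shape \<Rightarrow> real" where
  "rest_weight I J = alphabets.tail (\<lambda>i. al (I + i)) (\<lambda>j. be (J + j))"

text \<open>The Schur values at the \<open>(q,t)\<close>-alphabet, with the first letters of both signs singled out. The values at partitions do
  not depend on \<open>I\<close> and \<open>J\<close> (\<open>qt_weight_unique\<close>), so the letters may be chosen to fit the coordinates in question.\<close>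
definition qt_weight :: "nat \<Rightarrow> nat \<Rightarrow> shape \<Rightarrow> real" where
  "qt_weight I J = add_pos_letters I al (add_neg_letters J be (rest_weight I J))"

lemma rest_weight_nonneg: "is_part p \<Longrightarrow> 0 \<le> rest_weight I J p" unfolding rest_weight_def by (rule alphabets.tail_nonneg[OF alph])
lemma rest_weight_at_0: "rest_weight I J (\<lambda>_. 0) = 1" unfolding rest_weight_def by (rule alphabets.tail_at_0[OF alph])
lemma rest_weight_harmonic: "harmonic (t * q ^ I + (1 - t) * q ^ J) (rest_weight I J)"
  using alphabets.harmonic_tail[OF alph, of I J] unfolding rest_weight_def
  by (simp add: sums_unique[OF al_sums, symmetric] sums_unique[OF be_sums, symmetric])

lemma qt_weight_nonneg: "is_part p \<Longrightarrow> 0 \<le> qt_weight I J p"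
  unfolding qt_weight_def by (intro add_pos_letters_nonneg add_neg_letters_nonneg rest_weight_nonneg al0 be0)
lemma qt_weight_at_0: "qt_weight I J (\<lambda>_. 0) = 1" unfolding qt_weight_def by (simp add: add_pos_letters_at_0 add_neg_letters_at_0 rest_weight_at_0)
lemma qt_weight_harmonic: "harmonic 1 (qt_weight I J)"
proof -
  have "harmonic (t * q ^ I + (1 - t) * q ^ J + (\<Sum>j<J. be j) + (\<Sum>i<I. al i)) (qt_weight I J)"
    unfolding qt_weight_def by (intro harmonic_add_pos_letters harmonic_add_neg_letters rest_weight_harmonic)
  moreover have "t * q ^ I + (1 - t) * q ^ J + (\<Sum>j<J. be j) + (\<Sum>i<I. al i) = 1"
    unfolding al_sum be_sum by (simp add: algebra_simps)
  ultimately show ?thesis by simp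
qed

lemma summable_powers: assumes "k \<ge> 1" shows "summable (\<lambda>i. (c * (1 - q) * q ^ i) ^ k)"
proof -
  have "(c * (1 - q) * q ^ i) ^ k = (c * (1 - q)) ^ k * (q ^ k) ^ i" for i
    by (simp add: power_mult_distrib mult.commute flip: power_mult)
  moreover have "norm (q ^ k) < 1" using q assms by (simp add: power_less_one_iff abs_if)
  ultimately show ?thesis by (simp add: summable_mult summable_geometric)
qed

text \<open>The power sums of the singled-out letters and of the rest add up; for \<open>k = 1\<close> the sum is one, which matches the
  separate convention for \<open>p\<^sub>1\<close>.\<close>
lemma qt_weight_spec: "specializes (\<lambda>k. of_real (thoma_power_sum al be k)) (\<lambda>la. of_real (qt_weight I J la))"
proof (rule specializes_cong)
  let ?A = "\<lambda>k. \<Sum>i. al (I + i) ^ k" and ?B = "\<lambda>k. \<Sum>j. (- be (J + j)) ^ k"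
  show "specializes (\<lambda>k. of_real (?A k - ?B k) - of_real (\<Sum>j<J. (- be j) ^ k) + of_real (\<Sum>i<I. al i ^ k)) (\<lambda>la. of_real (qt_weight I J la))"
    unfolding qt_weight_def rest_weight_def by (intro specializes_add_pos_letters specializes_add_neg_letters alphabets.specializes_tail[OF alph])
  fix k :: nat assume k: "k \<ge> 1"
  have s1: "summable (\<lambda>i. al i ^ k)" unfolding alpha_qt_def by (rule summable_powers[OF k])
  have s2: "summable (\<lambda>j. be j ^ k)" unfolding beta_qt_def by (rule summable_powers[OF k])
  have nb: "(- be j) ^ k = (- 1) ^ k * be j ^ k" for j by (simp flip: power_mult_distrib)
  have s3: "summable (\<lambda>j. (- be j) ^ k)" unfolding nb by (rule summable_mult[OF s2])
  have A: "?A k + (\<Sum>i<I. al i ^ k) = (\<Sum>i. al i ^ k)"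
    using suminf_split_initial_segment[OF s1, of I] by (simp add: add.commute)
  have B: "?B k + (\<Sum>j<J. (- be j) ^ k) = (\<Sum>j. (- be j) ^ k)"
    using suminf_split_initial_segment[OF s3, of J] by (simp add: add.commute)
  have C: "(\<Sum>j. (- be j) ^ k) = (- 1) ^ k * (\<Sum>j. be j ^ k)" unfolding nb by (rule suminf_mult[OF s2])
  have sg: "(- 1) ^ (k - 1) = - ((- 1 :: real) ^ k)" using k by (cases k) auto
  have D: "thoma_power_sum al be k = (\<Sum>i. al i ^ k) - (\<Sum>j. (- be j) ^ k)"
  proof (cases "k = 1")
    case True
    have "(\<Sum>i. al i) = t" "(\<Sum>i. be i) = 1 - t"
      using sums_unique[OF al_sums[of 0]] sums_unique[OF be_sums[of 0]] by simp_all
    then show ?thesis unfolding C using True by (simp add: thoma_power_sum_def)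
  next
    case False then show ?thesis unfolding C thoma_power_sum_def sg by simp
  qed
  have "?A k - ?B k - (\<Sum>j<J. (- be j) ^ k) + (\<Sum>i<I. al i ^ k) = thoma_power_sum al be k"
    unfolding D A[symmetric] B[symmetric] by simp
  then show "of_real (?A k - ?B k) - of_real (\<Sum>j<J. (- be j) ^ k) + of_real (\<Sum>i<I. al i ^ k) = complex_of_real (thoma_power_sum al be k)"
    by (simp only: of_real_diff[symmetric] of_real_add[symmetric])
qed simp

lemma qt_weight_unique: assumes "is_part la" shows "qt_weight I J la = qt_weight I' J' la"
  using specializes_specialization[OF qt_weight_spec assms, of I J] specializes_specialization[OF qt_weight_spec assms, of I' J'] by simp

lemma central_weight_qt_weight: assumes "lam \<in> partitions_of n"
  shows "central_weight al be lam = of_real (real (dim_shape n (row_part lam)) * qt_weight I J (row_part lam))"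
  unfolding central_weight_def schur_at_def schur_schurf dim_kostka_comp(1)[OF assms]
    specializes_specialization[OF qt_weight_spec[of I J] dim_kostka_comp(2)[OF assms]] by simp

lemma expectation_dim_sum:
  assumes "qt_plancherel_random q t n M L"
  shows "(CLINT \<omega>|M. g (row_part (L \<omega>))) = dim_sum n (\<lambda>la. of_real (qt_weight I J la) * g la)"
proof -
  have M: "prob_space M" and L: "L \<in> measurable M (count_space (partitions_of n))"
    and w: "\<And>lam. lam \<in> partitions_of n \<Longrightarrow> of_real (measure M {\<omega> \<in> space M. L \<omega> = lam}) = central_weight al be lam"
    using assms unfolding qt_plancherel_random_def by auto
  have "(CLINT \<omega>|M. g (row_part (L \<omega>))) = (\<Sum>lam\<in>partitions_of n. of_real (measure M {\<omega> \<in> space M. L \<omega> = lam}) * g (row_part lam))"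
    by (rule integral_finite_valued[OF M L finite_partitions_of])
  also have "\<dots> = (\<Sum>lam\<in>partitions_of n. of_nat (dim_shape n (row_part lam)) * (of_real (qt_weight I J (row_part lam)) * g (row_part lam)))"
    by (intro sum.cong refl) (simp add: w central_weight_qt_weight[of _ n I J] mult.assoc)
  also have "\<dots> = dim_sum n (\<lambda>la. of_real (qt_weight I J la) * g la)"
    unfolding dim_sum_def by (rule sum.reindex_bij_betw[OF bij_row_part])
  finally show ?thesis .
qed

text \<open>Any number in the interval from \<open>1\<close> to \<open>1 / q\<close> would do: it must exceed one but not the quotient of
  consecutive letters.\<close>
definition ratio :: real where "ratio = 2 / (1 + q)"

lemma ratio_bounds: "ratio > 1" "0 < ratio * q" "ratio * q < 1" unfolding ratio_def using q by (auto simp: field_simps)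

lemma geo_dec: assumes "0 < c" "i < j" shows "c * (1 - q) * q ^ j \<le> q * (c * (1 - q) * q ^ i)"
proof -
  have "q ^ j \<le> q ^ Suc i" using assms q by (intro power_decreasing) auto
  then have "c * (1 - q) * q ^ j \<le> c * (1 - q) * q ^ Suc i" using assms q by (intro mult_left_mono) auto
  then show ?thesis by (simp add: ac_simps)
qed

lemma separated_al: assumes "0 < t" shows "separated I al (rest_weight I J)"
  unfolding separated_def
proof (intro allI impI)
  fix i assume i: "i < I"
  have pos: "0 < al i" unfolding alpha_qt_def using assms q by simp
  have le: "al j \<le> q * al i" if "i < j" for j
    unfolding alpha_qt_def by (rule geo_dec[OF assms that])
  have le': "al j * (ratio / al i) \<le> ratio * q" if "i < j" for j
    using mult_right_mono[OF le[OF that], of "ratio / al i"] pos ratio_bounds(1) by (simp add: mult.commute)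
  have "\<exists>K\<ge>0. pieri_bound (ratio / al i) K (rest_weight I J)"
    unfolding rest_weight_def
    by (rule alphabets.pieri_bound_tail[OF alph _ ratio_bounds(3)]) (use pos ratio_bounds(1) le' i in auto)
  moreover have "ratio * al j < al i" if "i < j" for j
  proof -
    have "ratio * al j \<le> ratio * q * al i" using mult_left_mono[OF le[OF that], of ratio] ratio_bounds(1) by simp
    also have "\<dots> < 1 * al i" using pos ratio_bounds(3) by (intro mult_strict_right_mono)
    finally show ?thesis by simp
  qed
  ultimately show "0 < al i \<and> (\<exists>ratio>1. (\<exists>K\<ge>0. pieri_bound (ratio / al i) K (rest_weight I J)) \<and> (\<forall>j<I. i < j \<longrightarrow> ratio * al j < al i))"
    using pos ratio_bounds(1) by blast
qed

lemma separated_be: assumes "t < 1" shows "separated J be (\<lambda>p. rest_weight I J (conjugate p))"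
  unfolding separated_def
proof (intro allI impI)
  fix i assume i: "i < J"
  have t1: "0 < 1 - t" using assms by simp
  have pos: "0 < be i" unfolding beta_qt_def using t1 q by simp
  have le: "be j \<le> q * be i" if "i < j" for j
    unfolding beta_qt_def by (rule geo_dec[OF t1 that])
  have le': "be j * (ratio / be i) \<le> ratio * q" if "i < j" for j
    using mult_right_mono[OF le[OF that], of "ratio / be i"] pos ratio_bounds(1) by (simp add: mult.commute)
  have "\<exists>K\<ge>0. pieri_bound (ratio / be i) K (\<lambda>p. rest_weight I J (conjugate p))"
    unfolding rest_weight_def
    by (rule alphabets.pieri_bound_tail_conjugate[OF alph _ ratio_bounds(3)]) (use pos ratio_bounds(1) le' i in auto)
  moreover have "ratio * be j < be i" if "i < j" for j
  proof -
    have "ratio * be j \<le> ratio * q * be i" using mult_left_mono[OF le[OF that], of ratio] ratio_bounds(1) by simp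
    also have "\<dots> < 1 * be i" using pos ratio_bounds(3) by (intro mult_strict_right_mono)
    finally show ?thesis by simp
  qed
  ultimately show "0 < be i \<and> (\<exists>ratio>1. (\<exists>K\<ge>0. pieri_bound (ratio / be i) K (\<lambda>p. rest_weight I J (conjugate p))) \<and> (\<forall>j<J. i < j \<longrightarrow> ratio * be j < be i))"
    using pos ratio_bounds(1) by blast
qed

definition char_fun :: "nat \<Rightarrow> nat \<Rightarrow> (nat \<Rightarrow> real) \<Rightarrow> nat \<Rightarrow> (nat \<Rightarrow> real) \<Rightarrow> complex" where
  "char_fun n I th J et = dim_sum n (\<lambda>la. of_real (qt_weight 0 0 la) * cis (phase I th J et la))"

lemma char_fun_qt_weight: "char_fun n I th J et = dim_sum n (\<lambda>la. of_real (qt_weight I' J' la) * cis (phase I th J et la))"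
  unfolding char_fun_def dim_sum_def by (intro sum.cong refl) (use qt_weight_unique[of _ 0 0 I' J'] in auto)

definition letters :: "nat \<Rightarrow> (nat \<Rightarrow> real) \<Rightarrow> nat \<Rightarrow> (nat \<Rightarrow> real) \<Rightarrow> complex" where
  "letters I th J et = (\<Sum>i<I. of_real (al i) * cis (th i)) + (\<Sum>j<J. of_real (be j) * cis (et j))
     + of_real (t * q ^ I + (1 - t) * q ^ J)"

text \<open>The letters of each sign can be compared with rows or columns only if their weights are positive.\<close>
lemma char_fun_letters_main:
  assumes "I = 0 \<or> 0 < t" "J = 0 \<or> t < 1"
  shows "\<exists>C\<ge>0. \<forall>n th et. cmod (char_fun n I th J et - letters I th J et ^ n) \<le> C * ((\<Sum>i<I. \<bar>th i\<bar>) + (\<Sum>j<J. \<bar>et j\<bar>))"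
proof -
  have A: "separated I al (rest_weight I J)" using assms(1) separated_al by (auto simp: separated_def)
  have B: "separated J be (\<lambda>p. rest_weight I J (conjugate p))" using assms(2) separated_be by (auto simp: separated_def)
  have tot: "(\<Sum>i<I. al i) + (\<Sum>j<J. be j) + (t * q ^ I + (1 - t) * q ^ J) = 1"
    unfolding al_sum be_sum by (simp add: algebra_simps)
  show ?thesis using characteristic_estimate[OF rest_weight_nonneg be0 A B rest_weight_harmonic rest_weight_at_0 tot]
    unfolding char_fun_qt_weight[of _ _ _ _ _ I J] letters_def qt_weight_def by simp
qed

text \<open>Rows (or columns) whose size is rarely larger than \<open>b\<close> may be dropped from the characteristic function.\<close>
lemma neglect:
  assumes P: "\<And>b. (\<Sum>la | is_part la \<and> part_size la = n \<and> b < X la. of_nat (dim_shape n la) * qt_weight 0 0 la) \<le> real n * q ^ b"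
    and A: "\<And>la. is_part la \<Longrightarrow> \<bar>phase I th J et la - phase I' th J' et la\<bar> \<le> c * real (X la)" and c: "0 \<le> c"
  shows "cmod (char_fun n I th J et - char_fun n I' th J' et) \<le> c * real b + 2 * (real n * q ^ b)"
proof -
  let ?f = "\<lambda>la. of_nat (dim_shape n la) * qt_weight 0 0 la"
  let ?P = "{la. is_part la \<and> part_size la = n}"
  have f0: "is_part la \<Longrightarrow> 0 \<le> ?f la" for la using qt_weight_nonneg by simp
  have eq: "char_fun n I th J et - char_fun n I' th J' et = (\<Sum>la\<in>?P. of_real (?f la) * (cis (phase I th J et la) - cis (phase I' th J' et la)))"
    unfolding char_fun_def dim_sum_def by (simp add: sum_subtractf algebra_simps)
  have "cmod (char_fun n I th J et - char_fun n I' th J' et) \<le> (\<Sum>la\<in>?P. ?f la * (c * real b + (if b < X la then 2 else 0)))"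
    unfolding eq
  proof (rule sum_norm_le)
    fix la assume "la \<in> ?P"
    then have la: "is_part la" by simp
    have "cmod (cis (phase I th J et la) - cis (phase I' th J' et la)) \<le> c * real b + (if b < X la then 2 else 0)"
    proof (cases "b < X la")
      case True
      have "cmod (cis (phase I th J et la) - cis (phase I' th J' et la)) \<le> 1 + 1"
        by (rule order_trans[OF norm_triangle_ineq4]) simp
      moreover have "0 \<le> c * real b" using c by simp
      ultimately show ?thesis using True by simp
    next
      case False
      have "cmod (cis (phase I th J et la) - cis (phase I' th J' et la)) \<le> c * real (X la)"
        by (rule order_trans[OF cmod_cis_diff A[OF la]])
      also have "\<dots> \<le> c * real b" using False c by (intro mult_left_mono) auto
      finally show ?thesis using False by simp
    qed
    then show "cmod (of_real (?f la) * (cis (phase I th J et la) - cis (phase I' th J' et la))) \<le> ?f la * (c * real b + (if b < X la then 2 else 0))"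
      unfolding norm_mult norm_of_real abs_of_nonneg[OF f0[OF la]] by (rule mult_left_mono) (rule f0[OF la])
  qed
  also have "\<dots> = c * real b * (\<Sum>la\<in>?P. ?f la) + 2 * (\<Sum>la\<in>?P. if b < X la then ?f la else 0)"
  proof -
    have "?f la * (c * real b + (if b < X la then 2 else 0)) = c * real b * ?f la + 2 * (if b < X la then ?f la else 0)" for la
      by (simp add: algebra_simps)
    then show ?thesis by (simp only: sum.distrib sum_distrib_left)
  qed
  also have "(\<Sum>la\<in>?P. ?f la) = 1"
    using dim_sum_harmonic[OF qt_weight_harmonic, of n 0 0] qt_weight_at_0[of 0 0] unfolding dim_sum_def by simp
  also have "(\<Sum>la\<in>?P. if b < X la then ?f la else 0) = (\<Sum>la | la \<in> ?P \<and> b < X la. ?f la)"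
    by (rule sum.inter_filter[symmetric]) (rule finite_parts_eq)
  also have "{la. la \<in> ?P \<and> b < X la} = {la. is_part la \<and> part_size la = n \<and> b < X la}" by auto
  finally show ?thesis using P[of b] by linarith
qed

text \<open>Without negative letters, a word in the first \<open>b\<close> letters yields at most \<open>b\<close> rows, and the other letters have
  total weight \<open>q ^ b\<close>.\<close>
lemma few_rows:
  assumes "t = 1"
  shows "(\<Sum>la | is_part la \<and> part_size la = n \<and> b < conjugate la 0. of_nat (dim_shape n la) * qt_weight 0 0 la) \<le> real n * q ^ b"
proof -
  have "(\<Sum>la | is_part la \<and> part_size la = n \<and> b < conjugate la 0. of_nat (dim_shape n la) * qt_weight b 0 la) \<le> real n * q ^ b"
  proof (rule tail_prob[where D="add_pos_letters b al delta"])
    have "harmonic (0 + (\<Sum>i<b. al i)) (add_pos_letters b al delta)" by (rule harmonic_add_pos_letters[OF harmonic_delta])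
    moreover have "0 + (\<Sum>i<b. al i) = 1 - q ^ b" using al_sum[of b] assms by simp
    ultimately show "harmonic (1 - q ^ b) (add_pos_letters b al delta)" by (simp only:)
    show "0 \<le> add_pos_letters b al delta p \<and> add_pos_letters b al delta p \<le> qt_weight b 0 p" if "is_part p" for p
      unfolding qt_weight_def add_neg_letters.simps
    proof
      show "0 \<le> add_pos_letters b al delta p" by (rule add_pos_letters_nonneg[OF al0 _ that]) (simp add: delta_def)
      show "add_pos_letters b al delta p \<le> add_pos_letters b al (rest_weight b 0) p"
        by (rule add_pos_letters_mono[OF al0 _ that]) (auto simp: delta_def rest_weight_at_0 rest_weight_nonneg)
    qed
    show "add_pos_letters b al delta p = 0" if "is_part p" "b < conjugate p 0" for p
      using add_pos_letters_delta[OF that(1), of b al] that(2) by force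
  qed (use q in \<open>auto simp: qt_weight_harmonic qt_weight_at_0 add_pos_letters_at_0 delta_def power_le_one\<close>)
  also have "(\<Sum>la | is_part la \<and> part_size la = n \<and> b < conjugate la 0. of_nat (dim_shape n la) * qt_weight b 0 la)
    = (\<Sum>la | is_part la \<and> part_size la = n \<and> b < conjugate la 0. of_nat (dim_shape n la) * qt_weight 0 0 la)"
    by (intro sum.cong refl) (use qt_weight_unique[of _ b 0 0 0] in auto)
  finally show ?thesis .
qed

text \<open>The conjugate of \<open>few_rows\<close>.\<close>
lemma few_cols:
  assumes "t = 0"
  shows "(\<Sum>la | is_part la \<and> part_size la = n \<and> b < la 0. of_nat (dim_shape n la) * qt_weight 0 0 la) \<le> real n * q ^ b"
proof -
  have "(\<Sum>la | is_part la \<and> part_size la = n \<and> b < la 0. of_nat (dim_shape n la) * qt_weight 0 b la) \<le> real n * q ^ b"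
  proof (rule tail_prob[where D="add_neg_letters b be delta"])
    have "harmonic (0 + (\<Sum>i<b. be i)) (add_neg_letters b be delta)" by (rule harmonic_add_neg_letters[OF harmonic_delta])
    moreover have "0 + (\<Sum>i<b. be i) = 1 - q ^ b" using be_sum[of b] assms by simp
    ultimately show "harmonic (1 - q ^ b) (add_neg_letters b be delta)" by (simp only:)
    show "0 \<le> add_neg_letters b be delta p \<and> add_neg_letters b be delta p \<le> qt_weight 0 b p" if "is_part p" for p
      unfolding qt_weight_def add_pos_letters.simps
    proof
      show "0 \<le> add_neg_letters b be delta p" by (rule add_neg_letters_nonneg[OF be0 _ that]) (simp add: delta_def)
      show "add_neg_letters b be delta p \<le> add_neg_letters b be (rest_weight 0 b) p"
        by (rule add_neg_letters_mono[OF be0 _ that]) (auto simp: delta_def rest_weight_at_0 rest_weight_nonneg)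
    qed
    show "add_neg_letters b be delta p = 0" if "is_part p" "b < p 0" for p
      using add_neg_letters_delta[OF that(1), of b be] that(2) by force
  qed (use q in \<open>auto simp: qt_weight_harmonic qt_weight_at_0 add_neg_letters_at_0 delta_def power_le_one\<close>)
  also have "(\<Sum>la | is_part la \<and> part_size la = n \<and> b < la 0. of_nat (dim_shape n la) * qt_weight 0 b la)
    = (\<Sum>la | is_part la \<and> part_size la = n \<and> b < la 0. of_nat (dim_shape n la) * qt_weight 0 0 la)"
    by (intro sum.cong refl) (use qt_weight_unique[of _ 0 b 0 0] in auto)
  finally show ?thesis .
qed

text \<open>Large enough for \<open>n * q ^ b\<close> to vanish, and small compared with the square root of \<open>n\<close>.\<close>
definition cutoff :: "nat \<Rightarrow> nat" where "cutoff n = nat \<lfloor>sqrt (sqrt (real n))\<rfloor>"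

lemma cutoff_limits: "(\<lambda>n. c / sqrt (real n) * real (cutoff n)) \<longlonglongrightarrow> 0" "(\<lambda>n. real n * q ^ cutoff n) \<longlonglongrightarrow> 0"
proof -
  have ub: "real (cutoff n) \<le> sqrt (sqrt (real n))" for n unfolding cutoff_def by simp
  have lb: "sqrt (sqrt (real n)) < real (cutoff n) + 1" for n unfolding cutoff_def by linarith
  have ss: "filterlim (\<lambda>n. sqrt (sqrt (real n))) at_top sequentially"
    by (intro filterlim_compose[OF sqrt_at_top] filterlim_real_sequentially)
  have "(\<lambda>n. inverse (sqrt (sqrt (real n)))) \<longlonglongrightarrow> 0"
    by (rule tendsto_inverse_0_at_top[OF ss])
  then have lim: "(\<lambda>n. \<bar>c\<bar> * inverse (sqrt (sqrt (real n)))) \<longlonglongrightarrow> 0" by (rule tendsto_mult_right_zero)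
  show "(\<lambda>n. c / sqrt (real n) * real (cutoff n)) \<longlonglongrightarrow> 0"
  proof (rule Lim_null_comparison[OF _ lim], rule always_eventually, rule allI)
    fix n
    have "norm (c / sqrt (real n) * real (cutoff n)) \<le> \<bar>c\<bar> / sqrt (real n) * sqrt (sqrt (real n))"
      using ub[of n] by (simp add: abs_mult divide_right_mono mult_left_mono)
    also have "\<dots> = \<bar>c\<bar> * (sqrt (sqrt (real n)) / (sqrt (sqrt (real n)) * sqrt (sqrt (real n))))"
      by simp
    also have "\<dots> = \<bar>c\<bar> * inverse (sqrt (sqrt (real n)))"
      by (cases "n = 0") (simp_all add: field_simps)
    finally show "norm (c / sqrt (real n) * real (cutoff n)) \<le> \<bar>c\<bar> * inverse (sqrt (sqrt (real n)))" .
  qed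
  \<comment> \<open>As \<open>n < (cutoff n + 1) ^ 4\<close>, the fourth root of \<open>q\<close> reduces the claim to \<open>b * x ^ b \<longlonglongrightarrow> 0\<close>.\<close>
  define x where "x = sqrt (sqrt q)"
  have x: "norm x < 1" "x ^ 4 = q"
  proof -
    show "norm x < 1" unfolding x_def using q by simp
    have "x ^ 4 = (x * x) * (x * x)" by (simp add: power4_eq_xxxx mult.assoc)
    then show "x ^ 4 = q" unfolding x_def using q by simp
  qed
  have bt: "filterlim cutoff at_top sequentially"
  proof -
    have "filterlim (\<lambda>n. real (cutoff n) + 1) at_top sequentially"
      by (rule filterlim_at_top_mono[OF ss]) (use lb less_imp_le in \<open>auto intro!: always_eventually\<close>)
    then have "filterlim (\<lambda>n. real (cutoff n)) at_top sequentially"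
      using filterlim_tendsto_add_at_top[OF tendsto_const[of "-1"]] by fastforce
    then show ?thesis by (simp add: filterlim_sequentially_iff_filterlim_real)
  qed
  have "(\<lambda>b. real b * x ^ b + x ^ b) \<longlonglongrightarrow> 0 + 0"
    by (intro tendsto_add powser_times_n_limit_0 LIMSEQ_power_zero x)
  then have "(\<lambda>b. (real b * x ^ b + x ^ b) ^ 4) \<longlonglongrightarrow> (0 + 0) ^ 4" by (rule tendsto_power)
  then have "(\<lambda>n. (real (cutoff n) * x ^ cutoff n + x ^ cutoff n) ^ 4) \<longlonglongrightarrow> 0"
    using filterlim_compose[OF _ bt] by fastforce
  then show "(\<lambda>n. real n * q ^ cutoff n) \<longlonglongrightarrow> 0"
  proof (rule Lim_null_comparison[rotated], intro always_eventually allI)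
    fix n
    have "real n = sqrt (sqrt (real n)) ^ 4"
      by (simp add: power4_eq_xxxx mult.assoc[symmetric]) (simp add: mult.assoc)
    also have "\<dots> \<le> (real (cutoff n) + 1) ^ 4" using lb[of n] by (intro power_mono) auto
    finally have le: "real n * q ^ cutoff n \<le> (real (cutoff n) + 1) ^ 4 * q ^ cutoff n" using q by (intro mult_right_mono) auto
    have "q ^ cutoff n = (x ^ cutoff n) ^ 4" unfolding x(2)[symmetric] by (simp add: mult.commute flip: power_mult)
    then have "(real (cutoff n) + 1) ^ 4 * q ^ cutoff n = (real (cutoff n) * x ^ cutoff n + x ^ cutoff n) ^ 4"
      by (simp only: power_mult_distrib[symmetric] distrib_right mult_1)
    with le have "real n * q ^ cutoff n \<le> (real (cutoff n) * x ^ cutoff n + x ^ cutoff n) ^ 4" by simp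
    then show "norm (real n * q ^ cutoff n) \<le> (real (cutoff n) * x ^ cutoff n + x ^ cutoff n) ^ 4" using q by simp
  qed
qed

text \<open>When \<open>t = 0\<close> there are no positive letters to compare rows with; rows are then negligible, and so is their
  share in \<open>letters\<close>. The case \<open>t = 1\<close> is the same for columns.\<close>
lemma char_fun_letters:
  "(\<lambda>n. char_fun n I (\<lambda>i. th i / sqrt (real n)) J (\<lambda>j. et j / sqrt (real n))
     - letters I (\<lambda>i. th i / sqrt (real n)) J (\<lambda>j. et j / sqrt (real n)) ^ n) \<longlonglongrightarrow> 0"
proof -
  let ?th = "\<lambda>n i. th i / sqrt (real n)" and ?et = "\<lambda>n j. et j / sqrt (real n)"
  have main: "(\<lambda>n. char_fun n I' (?th n) J' (?et n) - letters I' (?th n) J' (?et n) ^ n) \<longlonglongrightarrow> 0"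
    if IJ: "I' = 0 \<or> 0 < t" "J' = 0 \<or> t < 1" for I' J'
  proof -
    obtain C where C: "\<And>n th et. cmod (char_fun n I' th J' et - letters I' th J' et ^ n) \<le> C * ((\<Sum>i<I'. \<bar>th i\<bar>) + (\<Sum>j<J'. \<bar>et j\<bar>))"
      using char_fun_letters_main[OF IJ] by blast
    let ?c = "C * ((\<Sum>i<I'. \<bar>th i\<bar>) + (\<Sum>j<J'. \<bar>et j\<bar>))"
    have "(\<lambda>n. inverse (sqrt (real n))) \<longlonglongrightarrow> 0"
      by (intro tendsto_inverse_0_at_top filterlim_compose[OF sqrt_at_top] filterlim_real_sequentially)
    then have lim: "(\<lambda>n. ?c * inverse (sqrt (real n))) \<longlonglongrightarrow> 0" by (rule tendsto_mult_right_zero)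
    show ?thesis
    proof (rule Lim_null_comparison[OF _ lim], rule always_eventually, rule allI)
      fix n
      have e: "C * ((\<Sum>i<I'. \<bar>?th n i\<bar>) + (\<Sum>j<J'. \<bar>?et n j\<bar>)) = ?c * inverse (sqrt (real n))"
      proof -
        have a: "\<bar>u / sqrt (real n)\<bar> = \<bar>u\<bar> * inverse (sqrt (real n))" for u
          by (simp add: divide_inverse abs_mult)
        show ?thesis unfolding a by (simp only: sum_distrib_right[symmetric] distrib_right[symmetric] mult.assoc)
      qed
      show "norm (char_fun n I' (?th n) J' (?et n) - letters I' (?th n) J' (?et n) ^ n) \<le> ?c * inverse (sqrt (real n))"
        using C[of n "?th n" "?et n"] unfolding e .
    qed
  qed
  have bz: "(\<lambda>n. c / sqrt (real n) * real (cutoff n) + 2 * (real n * q ^ cutoff n)) \<longlonglongrightarrow> 0" for c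
    using tendsto_add[OF cutoff_limits(1)[of c] tendsto_mult_right_zero[OF cutoff_limits(2), of 2]] by simp
  consider "0 < t \<and> t < 1" | "t = 0" | "t = 1" using t by linarith
  then show ?thesis
  proof cases
    case 1 then show ?thesis by (intro main) auto
  next
    case 2
    let ?c = "\<Sum>i<I. \<bar>th i\<bar>"
    have "(\<lambda>n. char_fun n I (?th n) J (?et n) - char_fun n 0 (?th n) J (?et n)) \<longlonglongrightarrow> 0"
    proof (rule Lim_null_comparison[OF _ bz[of ?c]], rule always_eventually, rule allI)
      fix n
      show "norm (char_fun n I (?th n) J (?et n) - char_fun n 0 (?th n) J (?et n)) \<le> ?c / sqrt (real n) * real (cutoff n) + 2 * (real n * q ^ cutoff n)"
      proof (rule neglect[where X="\<lambda>la. la 0"])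
        show "(\<Sum>la | is_part la \<and> part_size la = n \<and> b < la 0. of_nat (dim_shape n la) * qt_weight 0 0 la) \<le> real n * q ^ b" for b
          by (rule few_cols[OF 2])
        fix la :: shape assume la: "is_part la"
        have "\<bar>\<Sum>i<I. ?th n i * real (la i)\<bar> \<le> (\<Sum>i<I. \<bar>?th n i\<bar> * real (la 0))"
          by (rule order_trans[OF sum_abs]) (intro sum_mono, simp add: abs_mult mult_left_mono divide_right_mono is_part_antimono[OF la])
        also have "\<dots> = ?c / sqrt (real n) * real (la 0)" by (simp add: sum_distrib_right sum_divide_distrib)
        finally show "\<bar>phase I (?th n) J (?et n) la - phase 0 (?th n) J (?et n) la\<bar> \<le> ?c / sqrt (real n) * real (la 0)"
          unfolding phase_def by simp
      qed (simp add: sum_nonneg)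
    qed
    moreover have "letters I (?th n) J (?et n) = letters 0 (?th n) J (?et n)" for n
      unfolding letters_def using 2 by (simp add: alpha_qt_def)
    moreover have "(\<lambda>n. char_fun n 0 (?th n) J (?et n) - letters 0 (?th n) J (?et n) ^ n) \<longlonglongrightarrow> 0"
      by (rule main) (use 2 in auto)
    ultimately show ?thesis using tendsto_add by fastforce
  next
    case 3
    let ?c = "\<Sum>j<J. \<bar>et j\<bar>"
    have "(\<lambda>n. char_fun n I (?th n) J (?et n) - char_fun n I (?th n) 0 (?et n)) \<longlonglongrightarrow> 0"
    proof (rule Lim_null_comparison[OF _ bz[of ?c]], rule always_eventually, rule allI)
      fix n
      show "norm (char_fun n I (?th n) J (?et n) - char_fun n I (?th n) 0 (?et n)) \<le> ?c / sqrt (real n) * real (cutoff n) + 2 * (real n * q ^ cutoff n)"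
      proof (rule neglect[where X="\<lambda>la. conjugate la 0"])
        show "(\<Sum>la | is_part la \<and> part_size la = n \<and> b < conjugate la 0. of_nat (dim_shape n la) * qt_weight 0 0 la) \<le> real n * q ^ b" for b
          by (rule few_rows[OF 3])
        fix la :: shape assume la: "is_part la"
        have "\<bar>\<Sum>j<J. ?et n j * real (conjugate la j)\<bar> \<le> (\<Sum>j<J. \<bar>?et n j\<bar> * real (conjugate la 0))"
          by (rule order_trans[OF sum_abs]) (intro sum_mono, simp add: abs_mult mult_left_mono divide_right_mono is_part_antimono[OF conjugate_is_part[OF la]])
        also have "\<dots> = ?c / sqrt (real n) * real (conjugate la 0)" by (simp add: sum_distrib_right sum_divide_distrib)
        finally show "\<bar>phase I (?th n) J (?et n) la - phase I (?th n) 0 (?et n) la\<bar> \<le> ?c / sqrt (real n) * real (conjugate la 0)"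
          unfolding phase_def by simp
      qed (simp add: sum_nonneg)
    qed
    moreover have "letters I (?th n) J (?et n) = letters I (?th n) 0 (?et n)" for n
      unfolding letters_def using 3 by (simp add: beta_qt_def)
    moreover have "(\<lambda>n. char_fun n I (?th n) 0 (?et n) - letters I (?th n) 0 (?et n) ^ n) \<longlonglongrightarrow> 0"
      by (rule main) (use 3 in auto)
    ultimately show ?thesis using tendsto_add by fastforce
  qed
qed

lemma char_fun_limit:
  defines "m \<equiv> \<lambda>I (th :: nat \<Rightarrow> real) J et. (\<Sum>i<I. th i * al i) + (\<Sum>j<J. et j * be j)"
  shows "(\<lambda>n. cis (- (sqrt (real n) * m I th J et)) * char_fun n I (\<lambda>i. th i / sqrt (real n)) J (\<lambda>j. et j / sqrt (real n)))
    \<longlonglongrightarrow> of_real (exp (- ((\<Sum>i<I. (th i)\<^sup>2 * al i) + (\<Sum>j<J. (et j)\<^sup>2 * be j) - (m I th J et)\<^sup>2) / 2))"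
proof -
  let ?th = "\<lambda>n i. th i / sqrt (real n)" and ?et = "\<lambda>n j. et j / sqrt (real n)"
  let ?r = "t * q ^ I + (1 - t) * q ^ J"
  \<comment> \<open>The index \<open>Inr J\<close> stands for all letters that are not singled out; they carry no phase.\<close>
  define w where "w = case_sum al (\<lambda>j. if j < J then be j else ?r)"
  define y where "y = case_sum th (\<lambda>j. if j < J then et j else 0)"
  let ?S = "{..<I} <+> {..<Suc J}"
  have P: "(\<Sum>k\<in>?S. f k) = (\<Sum>i<I. f (Inl i)) + ((\<Sum>j<J. f (Inr j)) + f (Inr J))" for f :: "nat + nat \<Rightarrow> 'z::comm_monoid_add"
    by (subst sum.Plus) (simp_all add: o_def)
  have r0: "0 \<le> ?r" using q t by simp
  have w0: "0 \<le> w k" for k unfolding w_def using al0 be0 r0 by (cases k) auto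
  have w1: "(\<Sum>k\<in>?S. w k) = 1" unfolding P w_def using al_sum[of I] be_sum[of J] by (simp add: algebra_simps)
  have m: "(\<Sum>k\<in>?S. w k * y k) = m I th J et" unfolding P w_def y_def m_def by (simp add: mult.commute)
  have v: "(\<Sum>k\<in>?S. w k * (y k)\<^sup>2) = (\<Sum>i<I. (th i)\<^sup>2 * al i) + (\<Sum>j<J. (et j)\<^sup>2 * be j)"
    unfolding P w_def y_def by (simp add: mult.commute)
  have l: "(\<Sum>k\<in>?S. of_real (w k) * cis (y k / sqrt (real n))) = letters I (?th n) J (?et n)" for n
    unfolding P w_def y_def letters_def by simp
  have "(\<lambda>n. cis (- (sqrt (real n) * m I th J et)) * letters I (?th n) J (?et n) ^ n)
    \<longlonglongrightarrow> of_real (exp (- ((\<Sum>i<I. (th i)\<^sup>2 * al i) + (\<Sum>j<J. (et j)\<^sup>2 * be j) - (m I th J et)\<^sup>2) / 2))"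
    using multinomial_limit[of ?S w y] w0 w1 unfolding m v l by simp
  moreover have "(\<lambda>n. cis (- (sqrt (real n) * m I th J et)) * (char_fun n I (?th n) J (?et n) - letters I (?th n) J (?et n) ^ n)) \<longlonglongrightarrow> 0"
  proof (rule Lim_null_comparison[OF _ tendsto_norm_zero[OF char_fun_letters[of I th J et]]], rule always_eventually, rule allI)
    fix n show "norm (cis (- (sqrt (real n) * m I th J et)) * (char_fun n I (?th n) J (?et n) - letters I (?th n) J (?et n) ^ n))
      \<le> norm (char_fun n I (?th n) J (?et n) - letters I (?th n) J (?et n) ^ n)" by (simp add: norm_mult)
  qed
  ultimately have "(\<lambda>n. cis (- (sqrt (real n) * m I th J et)) * letters I (?th n) J (?et n) ^ n
     + cis (- (sqrt (real n) * m I th J et)) * (char_fun n I (?th n) J (?et n) - letters I (?th n) J (?et n) ^ n))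
    \<longlonglongrightarrow> of_real (exp (- ((\<Sum>i<I. (th i)\<^sup>2 * al i) + (\<Sum>j<J. (et j)\<^sup>2 * be j) - (m I th J et)\<^sup>2) / 2)) + 0"
    by (rule tendsto_add)
  then show ?thesis by (simp add: algebra_simps)
qed

end

theorem proposition34:
  fixes q t :: real
    and M :: "nat \<Rightarrow> 'a measure"
    and L :: "nat \<Rightarrow> 'a \<Rightarrow> nat list"
  assumes "0 < q" "q < 1" "0 \<le> t" "t \<le> 1"
    and "\<And>n. qt_plancherel_random q t n (M n) (L n)"
  shows "\<exists>(N :: (nat + nat \<Rightarrow> real) measure) (X :: nat \<Rightarrow> (nat + nat \<Rightarrow> real) \<Rightarrow> real) Y.
    prob_space N \<and>
    gaussian_family N (case_sum X Y) \<and>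
    (\<forall>i. mean N (X i) = 0) \<and>
    (\<forall>j. mean N (Y j) = 0) \<and>
    (\<forall>i j. covariance N (X i) (X j) =
       (if i = j then t * (1 - q) * q ^ i else 0) - t\<^sup>2 * (1 - q)\<^sup>2 * q ^ (i + j)) \<and>
    (\<forall>i j. covariance N (Y i) (Y j) =
       (if i = j then (1 - t) * (1 - q) * q ^ i else 0) - (1 - t)\<^sup>2 * (1 - q)\<^sup>2 * q ^ (i + j)) \<and>
    (\<forall>i j. covariance N (X i) (Y j) = - t * (1 - t) * (1 - q)\<^sup>2 * q ^ (i + j)) \<and>
    converges_in_law_fdd M
      (\<lambda>n. case_sum
        (\<lambda>i \<omega>. (real (row_part (L n \<omega>) i) - real n * (t * (1 - q) * q ^ i)) / sqrt (real n))
        (\<lambda>j \<omega>. (real (conj_part (L n \<omega>) j) - real n * ((1 - t) * (1 - q) * q ^ j)) / sqrt (real n)))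
      N (case_sum X Y)"
proof -
  interpret qt q t by standard (use assms in auto)
  define w where "w = case_sum al be"
  have w0: "0 \<le> w k" for k unfolding w_def using al0 be0 by (cases k) auto
  have bound: "\<exists>n. K \<subseteq> {..<n} <+> {..<n}" if "finite K" for K :: "(nat + nat) set"
  proof -
    have "finite (Inl -` K)" "finite (Inr -` K)"
      using that by (auto intro!: finite_vimageI)
    then obtain a b where ab: "\<forall>i\<in>Inl -` K. i < a" "\<forall>j\<in>Inr -` K. j < b"
      unfolding finite_nat_set_iff_bounded by blast
    have "K \<subseteq> {..<max a b} <+> {..<max a b}"
    proof
      fix k assume "k \<in> K"
      then show "k \<in> {..<max a b} <+> {..<max a b}" using ab by (cases k) (auto simp: less_max_iff_disj)
    qed
    then show ?thesis by blast
  qed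
  have w1: "(\<Sum>k\<in>K. w k) < 1" if K: "finite K" for K
  proof -
    obtain n where n: "K \<subseteq> {..<n} <+> {..<n}" using bound[OF K] by blast
    have "(\<Sum>k\<in>K. w k) \<le> (\<Sum>k\<in>{..<n} <+> {..<n}. w k)" by (rule sum_mono2[OF _ n]) (use w0 in auto)
    also have "\<dots> = 1 - q ^ n" unfolding w_def by (subst sum.Plus) (simp_all add: o_def al_sum be_sum algebra_simps)
    also have "\<dots> < 1" using q by simp
    finally show ?thesis .
  qed
  obtain N :: "(nat + nat \<Rightarrow> real) measure" and Z where N: "prob_space N" and Zm: "\<And>k. Z k \<in> borel_measurable N"
    and gf: "gaussian_family N Z" and mn: "\<And>k. mean N (Z k) = 0"
    and cv: "\<And>j k. covariance N (Z j) (Z k) = (if j = k then w j else 0) - w j * w k"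
    and ch: "\<And>K th. finite K \<Longrightarrow> (CLINT x|N. iexp (\<Sum>k\<in>K. th k * Z k x))
       = of_real (exp (- ((\<Sum>k\<in>K. (th k)\<^sup>2 * w k) - (\<Sum>k\<in>K. th k * w k)\<^sup>2) / 2))"
    using gaussian_exists[of w] w0 w1 by blast
  have cs: "case_sum (\<lambda>i. Z (Inl i)) (\<lambda>j. Z (Inr j)) = Z" by (auto simp: fun_eq_iff split: sum.splits)
  let ?U = "\<lambda>n. case_sum
        (\<lambda>i \<omega>. (real (row_part (L n \<omega>) i) - real n * (t * (1 - q) * q ^ i)) / sqrt (real n))
        (\<lambda>j \<omega>. (real (conj_part (L n \<omega>) j) - real n * ((1 - t) * (1 - q) * q ^ j)) / sqrt (real n))"
  have PM: "prob_space (M n)" and Lm: "L n \<in> measurable (M n) (count_space (partitions_of n))" for n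
    using assms(5)[of n] unfolding qt_plancherel_random_def by auto
  have conv: "converges_in_law_fdd M ?U N Z"
  proof (rule converges_in_law_fddI[OF PM N _ Zm])
    fix n k
    have "(\<lambda>\<omega>. g (L n \<omega>)) \<in> borel_measurable (M n)" for g :: "nat list \<Rightarrow> real"
      by (rule measurable_compose[OF Lm]) simp
    from this[of "\<lambda>l. case k of Inl i \<Rightarrow> (real (row_part l i) - real n * (t * (1 - q) * q ^ i)) / sqrt (real n)
       | Inr j \<Rightarrow> (real (conj_part l j) - real n * ((1 - t) * (1 - q) * q ^ j)) / sqrt (real n)"]
    show "?U n k \<in> borel_measurable (M n)" by (cases k) simp_all
  next
    fix K :: "(nat + nat) set" and th :: "nat + nat \<Rightarrow> real" assume K: "finite K"
    obtain I where I: "K \<subseteq> {..<I} <+> {..<I}" using bound[OF K] by blast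
    define ta where "ta = (\<lambda>i. if Inl i \<in> K then th (Inl i) else 0)"
    define tb where "tb = (\<lambda>j. if Inr j \<in> K then th (Inr j) else 0)"
    have dec: "(\<Sum>k\<in>K. f k (th k)) = (\<Sum>i<I. f (Inl i) (ta i)) + (\<Sum>j<I. f (Inr j) (tb j))"
      if f: "\<And>k. f k 0 = (0::real)" for f :: "nat + nat \<Rightarrow> real \<Rightarrow> real"
    proof -
      have "(\<Sum>k\<in>K. f k (th k)) = (\<Sum>k\<in>{..<I} <+> {..<I}. f k (if k \<in> K then th k else 0))"
        by (rule sum.mono_neutral_cong_left) (use I f in auto)
      also have "\<dots> = (\<Sum>i<I. f (Inl i) (ta i)) + (\<Sum>j<I. f (Inr j) (tb j))"
        unfolding ta_def tb_def by (subst sum.Plus) (simp_all add: o_def)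
      finally show ?thesis .
    qed
    define m where "m = (\<Sum>i<I. ta i * al i) + (\<Sum>j<I. tb j * be j)"
    have lim: "(\<lambda>n. cis (- (sqrt (real n) * m)) * char_fun n I (\<lambda>i. ta i / sqrt (real n)) I (\<lambda>j. tb j / sqrt (real n)))
      \<longlonglongrightarrow> of_real (exp (- ((\<Sum>i<I. (ta i)\<^sup>2 * al i) + (\<Sum>j<I. (tb j)\<^sup>2 * be j) - m\<^sup>2) / 2))"
      using char_fun_limit[where I=I and th=ta and J=I and et=tb] unfolding m_def .
    have chN: "(CLINT x|N. iexp (\<Sum>k\<in>K. th k * Z k x)) = of_real (exp (- ((\<Sum>i<I. (ta i)\<^sup>2 * al i) + (\<Sum>j<I. (tb j)\<^sup>2 * be j) - m\<^sup>2) / 2))"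
      unfolding ch[OF K] m_def using dec[of "\<lambda>k x. x\<^sup>2 * w k"] dec[of "\<lambda>k x. x * w k"] by (simp add: w_def)
    \<comment> \<open>For \<open>n = 0\<close> the normalization divides by zero, but a single index does not affect the limit.\<close>
    have chM: "(CLINT x|M n. iexp (\<Sum>k\<in>K. th k * ?U n k x))
        = cis (- (sqrt (real n) * m)) * char_fun n I (\<lambda>i. ta i / sqrt (real n)) I (\<lambda>j. tb j / sqrt (real n))" if n: "n > 0" for n
    proof -
      have sq: "real n / sqrt (real n) = sqrt (real n)" by (simp add: real_div_sqrt)
      have e: "(\<Sum>k\<in>K. th k * ?U n k x) = - (sqrt (real n) * m) + phase I (\<lambda>i. ta i / sqrt (real n)) I (\<lambda>j. tb j / sqrt (real n)) (row_part (L n x))"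
        if x: "x \<in> space (M n)" for x
      proof -
        have lam: "L n x \<in> partitions_of n" using measurable_space[OF Lm x] by simp
        have c: "c * ((u - real n * v) / sqrt (real n)) = c / sqrt (real n) * u - sqrt (real n) * (c * v)" for c u v :: real
        proof -
          have "c * ((u - real n * v) / sqrt (real n)) = c / sqrt (real n) * u - real n / sqrt (real n) * (c * v)"
            by (simp add: diff_divide_distrib right_diff_distrib)
          then show ?thesis unfolding sq .
        qed
        have "(\<Sum>k\<in>K. th k * ?U n k x) = (\<Sum>i<I. ta i * ?U n (Inl i) x) + (\<Sum>j<I. tb j * ?U n (Inr j) x)"
          by (rule dec[of "\<lambda>k y. y * ?U n k x"]) simp
        also have "\<dots> = (\<Sum>i<I. ta i / sqrt (real n) * real (row_part (L n x) i) - sqrt (real n) * (ta i * al i))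
           + (\<Sum>j<I. tb j / sqrt (real n) * real (conjugate (row_part (L n x)) j) - sqrt (real n) * (tb j * be j))"
          unfolding sum.case row_part_props(1)[OF lam] c alpha_qt_def beta_qt_def ..
        also have "\<dots> = - (sqrt (real n) * m) + phase I (\<lambda>i. ta i / sqrt (real n)) I (\<lambda>j. tb j / sqrt (real n)) (row_part (L n x))"
          unfolding phase_def m_def sum_subtractf sum_distrib_left[symmetric] by (simp add: distrib_left)
        finally show ?thesis .
      qed
      have "(CLINT x|M n. iexp (\<Sum>k\<in>K. th k * ?U n k x))
        = (CLINT x|M n. cis (- (sqrt (real n) * m)) * cis (phase I (\<lambda>i. ta i / sqrt (real n)) I (\<lambda>j. tb j / sqrt (real n)) (row_part (L n x))))"
        by (rule Bochner_Integration.integral_cong[OF refl]) (simp only: e cis_mult cis_conv_exp[symmetric])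
      also have "\<dots> = cis (- (sqrt (real n) * m)) * (CLINT x|M n. cis (phase I (\<lambda>i. ta i / sqrt (real n)) I (\<lambda>j. tb j / sqrt (real n)) (row_part (L n x))))"
        by simp
      also have "(CLINT x|M n. cis (phase I (\<lambda>i. ta i / sqrt (real n)) I (\<lambda>j. tb j / sqrt (real n)) (row_part (L n x))))
        = char_fun n I (\<lambda>i. ta i / sqrt (real n)) I (\<lambda>j. tb j / sqrt (real n))"
        unfolding char_fun_def by (rule expectation_dim_sum[OF assms(5)])
      finally show ?thesis .
    qed
    show "(\<lambda>n. CLINT x|M n. iexp (\<Sum>k\<in>K. th k * ?U n k x)) \<longlonglongrightarrow> (CLINT x|N. iexp (\<Sum>k\<in>K. th k * Z k x))"
      unfolding chN
    proof (rule Lim_transform_eventually[OF lim])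
      show "\<forall>\<^sub>F n in sequentially. cis (- (sqrt (real n) * m)) * char_fun n I (\<lambda>i. ta i / sqrt (real n)) I (\<lambda>j. tb j / sqrt (real n))
        = (CLINT x|M n. iexp (\<Sum>k\<in>K. th k * ?U n k x))"
        using eventually_gt_at_top[of 0] by (rule eventually_mono) (rule chM[symmetric])
    qed
  qed
  show ?thesis
  proof (rule exI[of _ N], rule exI[of _ "\<lambda>i. Z (Inl i)"], rule exI[of _ "\<lambda>j. Z (Inr j)"], intro conjI allI)
    show "prob_space N" by (rule N)
    show "gaussian_family N (case_sum (\<lambda>i. Z (Inl i)) (\<lambda>j. Z (Inr j)))" unfolding cs by (rule gf)
    show "mean N (Z (Inl i)) = 0" for i by (rule mn)
    show "mean N (Z (Inr j)) = 0" for j by (rule mn)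
    show "covariance N (Z (Inl i)) (Z (Inl j)) = (if i = j then t * (1 - q) * q ^ i else 0) - t\<^sup>2 * (1 - q)\<^sup>2 * q ^ (i + j)" for i j
      unfolding cv w_def alpha_qt_def by (simp add: power_add power2_eq_square ac_simps)
    show "covariance N (Z (Inr i)) (Z (Inr j)) = (if i = j then (1 - t) * (1 - q) * q ^ i else 0) - (1 - t)\<^sup>2 * (1 - q)\<^sup>2 * q ^ (i + j)" for i j
      unfolding cv w_def beta_qt_def by (simp add: power_add power2_eq_square ac_simps)
    show "covariance N (Z (Inl i)) (Z (Inr j)) = - t * (1 - t) * (1 - q)\<^sup>2 * q ^ (i + j)" for i j
      unfolding cv w_def alpha_qt_def beta_qt_def by (simp add: power_add power2_eq_square ac_simps)
    show "converges_in_law_fdd M ?U N (case_sum (\<lambda>i. Z (Inl i)) (\<lambda>j. Z (Inr j)))" unfolding cs by (rule conv)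
  qed
qed

end
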